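(* For all $f,g\in\Lambda^\circ\subset C(\Omega)$, $$-\int_\Omega(A_{z,z'}f)(\omega)g(\omega)\,P_{z,z'}(d\omega)=\int_\Omega\Gamma(f,g)(\omega)\,P_{z,z'}(d\omega),$$ where, viewing $f,g$ as polynomials in the moment coordinates $q_1,q_2,\dots$, $$\Gamma(f,g)(\omega)=\sum_{i,j=1}^\infty\Gamma_{ij}(\omega)\frac{\partial f}{\partial q_i}(\omega)\frac{\partial g}{\partial q_j}(\omega),\qquad\Gamma_{ij}(\omega)=(i+1)(j+1)\big(q_{i+j}(\omega)-q_i(\omega)q_j(\omega)\big)$$ (a finite sum).
   Context: Young diagrams: $\mathbb Y_n$ is the set of Young diagrams with $n$ boxes; $\mu\nearrow\lambda$ means $\mu\subset\lambda$, $|\lambda|=|\mu|+1$; $(z)_\theta=\prod_{(i,j)\in\theta}(z+j-i)$ for a (skew) diagram $\theta$ ($(i,j)$ = row $i$, column $j$), $(z)_n=z(z+1)\cdots(z+n-1)$; $\dim\lambda$ = number of standard Young tableaux of shape $\lambda$. Modified Frobenius coordinates $\lambda=(a_1,\dots,a_d\mid b_1,\dots,b_d)$: $d$ the number of diagonal boxes, $a_i=\lambda_i-i+\frac12$, $b_i=\lambda'_i-i+\frac12$. $(z,z')$ is fixed in the principal series ($z\notin\mathbb R$, $z'=\bar z$) or complementary series ($z,z'\in(N,N+1)$, $N\in\mathbb Z$). z-measure: $M_n(\lambda)=\frac{(z)_\lambda(z')_\lambda}{(zz')_n}\frac{(\dim\lambda)^2}{n!}$. Thoma simplex $\Omega$: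 pairs $\omega=(\alpha,\beta)$ of nonincreasing sequences of nonnegative reals with $\sum_i(\alpha_i+\beta_i)\le1$ (compact); $\iota_n:\mathbb Y_n\to\Omega$, $\alpha_i=a_i/n$, $\beta_i=b_i/n$ ($i\le d$), 0 otherwise. $P_{z,z'}$ (boundary z-measure) is the weak limit of $\iota_n(M_n)$. Moment coordinates $q_k(\omega)=\sum_i\alpha_i^{k+1}+(-1)^k\sum_i\beta_i^{k+1}$, $k\ge1$, algebraically independent; $\Lambda^\circ=\mathbb R[q_1,q_2,\dots]\subset C(\Omega)$, which is also $\Lambda/(p_1-1)$ for the symmetric functions $\Lambda=\mathbb R[p_1,p_2,\dots]$ with $p^\circ_{k+1}=q_k$, $p_1^\circ=1$; $s^\circ_\mu$ denotes the image of the Schur function $s_\mu$. $A_{z,z'}:\Lambda^\circ\to\Lambda^\circ$ is the linear operator $A_{z,z'}s^\circ_\mu=-m(m-1+zz')s^\circ_\mu+\sum_{\mu_\bullet\nearrow\mu}(z)_{\mu/\mu_\bullet}(z')_{\mu/\mu_\bullet}s^\circ_{\mu_\bullet}$, $m=|\mu|$. *)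

theory Defs
  imports "HOL-Probability.Probability" "HOL-Combinatorics.Permutations"
begin

text \<open>A Young diagram is a nonincreasing list of positive row lengths (row 0 first).
  Boxes are 0-indexed pairs (row, column); contents j - i agree with 1-indexing.\<close>

definition young :: "nat list \<Rightarrow> bool" where
  "young l \<longleftrightarrow> sorted_wrt (\<ge>) l \<and> 0 \<notin> set l"

definition boxes :: "nat list \<Rightarrow> (nat \<times> nat) set" where
  "boxes l = {(i, j). i < length l \<and> j < l ! i}"

definition YD :: "nat \<Rightarrow> nat list set" where
  "YD n = {l. young l \<and> sum_list l = n}"

definition colLen :: "nat list \<Rightarrow> nat \<Rightarrow> nat" where
  "colLen l k = length (filter (\<lambda>r. k < r) l)"

definition dimY :: "nat list \<Rightarrow> nat" where
  "dimY l = card {T \<in> boxes l \<rightarrow>\<^sub>E {1..sum_list l}.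
      bij_betw T (boxes l) {1..sum_list l} \<and>
      (\<forall>i j i' j'. (i, j) \<in> boxes l \<and> (i', j') \<in> boxes l \<and> i \<le> i' \<and> j \<le> j'
          \<and> (i, j) \<noteq> (i', j') \<longrightarrow> T (i, j) < T (i', j'))}"

definition pochD :: "complex \<Rightarrow> (nat \<times> nat) set \<Rightarrow> complex" where
  "pochD z \<theta> = (\<Prod>(i, j)\<in>\<theta>. z + of_int (int j - int i))"

text \<open>z-measure (real-valued for (z,z') in the principal/complementary series)\<close>
definition zmeas :: "complex \<Rightarrow> complex \<Rightarrow> nat \<Rightarrow> nat list \<Rightarrow> real" where
  "zmeas z z' n l = Re (pochD z (boxes l) * pochD z' (boxes l) / pochhammer (z * z') n)
      * (real (dimY l))\<^sup>2 / fact n"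

type_synonym thoma = "(nat \<Rightarrow> real) \<times> (nat \<Rightarrow> real)"

definition Omega :: "thoma set" where
  "Omega = {(\<alpha>, \<beta>). (\<forall>i. 0 \<le> \<alpha> i \<and> 0 \<le> \<beta> i) \<and> antimono \<alpha> \<and> antimono \<beta> \<and>
      (\<forall>N. (\<Sum>i<N. \<alpha> i + \<beta> i) \<le> 1)}"

definition ndiag :: "nat list \<Rightarrow> nat" where
  "ndiag l = card {i. i < length l \<and> i < l ! i}"

text \<open>embedding via modified Frobenius coordinates (index i here is i+1 in the paper)\<close>
definition iota :: "nat \<Rightarrow> nat list \<Rightarrow> thoma" where
  "iota n l = ((\<lambda>i. if i < ndiag l then (real (l ! i) - real i - 1/2) / real n else 0),
               (\<lambda>i. if i < ndiag l then (real (colLen l i) - real i - 1/2) / real n else 0))"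

definition qmom :: "nat \<Rightarrow> thoma \<Rightarrow> real" where
  "qmom k \<omega> = (\<Sum>i. (fst \<omega> i) ^ (k + 1)) + (-1) ^ k * (\<Sum>i. (snd \<omega> i) ^ (k + 1))"

text \<open>vector of moment coordinates (entry 0 unused)\<close>
definition qvec :: "thoma \<Rightarrow> nat \<Rightarrow> real" where
  "qvec \<omega> k = (if k = 0 then 0 else qmom k \<omega>)"

section \<open>The algebra \<Lambda>\<degree> as polynomials in the variables x_1, x_2, ... (x_k stands for q_k)\<close>

inductive_set qpoly :: "((nat \<Rightarrow> real) \<Rightarrow> real) set" where
  const: "(\<lambda>x. c) \<in> qpoly"
| var: "k \<ge> 1 \<Longrightarrow> (\<lambda>x. x k) \<in> qpoly"
| add: "F \<in> qpoly \<Longrightarrow> G \<in> qpoly \<Longrightarrow> (\<lambda>x. F x + G x) \<in> qpoly"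
| mult: "F \<in> qpoly \<Longrightarrow> G \<in> qpoly \<Longrightarrow> (\<lambda>x. F x * G x) \<in> qpoly"

text \<open>power sums under p_1 = 1, p_{k+1} = q_k\<close>
definition psum :: "(nat \<Rightarrow> real) \<Rightarrow> nat \<Rightarrow> real" where
  "psum x k = (if k = 1 then 1 else x (k - 1))"

text \<open>complete homogeneous symmetric functions via Newton's identity n h_n = sum_k p_k h_{n-k}\<close>
fun hcomp :: "(nat \<Rightarrow> real) \<Rightarrow> nat \<Rightarrow> real" where
  "hcomp x 0 = 1"
| "hcomp x (Suc n) = (\<Sum>k<Suc n. psum x (Suc k) * hcomp x (n - k)) / real (Suc n)"

definition hint :: "(nat \<Rightarrow> real) \<Rightarrow> int \<Rightarrow> real" where
  "hint x m = (if m < 0 then 0 else hcomp x (nat m))"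

text \<open>image s\<degree>_\<mu> of the Schur function, via Jacobi-Trudi s_\<mu> = det [h_{\<mu>_i - i + j}]\<close>
definition schurq :: "nat list \<Rightarrow> (nat \<Rightarrow> real) \<Rightarrow> real" where
  "schurq \<mu> x = (\<Sum>\<sigma> | \<sigma> permutes {..<length \<mu>}.
      of_int (sign \<sigma>) * (\<Prod>i<length \<mu>. hint x (int (\<mu> ! i) - int i + int (\<sigma> i))))"

definition downY :: "nat list \<Rightarrow> nat list set" where
  "downY \<mu> = {\<nu>. young \<nu> \<and> boxes \<nu> \<subseteq> boxes \<mu> \<and> sum_list \<nu> + 1 = sum_list \<mu>}"

definition A_schur :: "complex \<Rightarrow> complex \<Rightarrow> nat list \<Rightarrow> (nat \<Rightarrow> real) \<Rightarrow> real" where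
  "A_schur z z' \<mu> x =
     - real (sum_list \<mu>) * (real (sum_list \<mu>) - 1 + Re (z * z')) * schurq \<mu> x
     + (\<Sum>\<nu>\<in>downY \<mu>. Re (pochD z (boxes \<mu> - boxes \<nu>) * pochD z' (boxes \<mu> - boxes \<nu>)) * schurq \<nu> x)"

definition fschur :: "(nat list \<Rightarrow> real) \<Rightarrow> (nat \<Rightarrow> real) \<Rightarrow> real" where
  "fschur c x = (\<Sum>\<mu>\<in>{\<mu>. c \<mu> \<noteq> 0}. c \<mu> * schurq \<mu> x)"

definition Aop :: "complex \<Rightarrow> complex \<Rightarrow> (nat list \<Rightarrow> real) \<Rightarrow> (nat \<Rightarrow> real) \<Rightarrow> real" where
  "Aop z z' c x = (\<Sum>\<mu>\<in>{\<mu>. c \<mu> \<noteq> 0}. c \<mu> * A_schur z z' \<mu> x)"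

definition pdq :: "((nat \<Rightarrow> real) \<Rightarrow> real) \<Rightarrow> nat \<Rightarrow> (nat \<Rightarrow> real) \<Rightarrow> real" where
  "pdq F i x = deriv (\<lambda>t. F (x(i := t))) (x i)"

definition GammaQ :: "((nat \<Rightarrow> real) \<Rightarrow> real) \<Rightarrow> ((nat \<Rightarrow> real) \<Rightarrow> real) \<Rightarrow> thoma \<Rightarrow> real" where
  "GammaQ F G \<omega> = (\<Sum>\<^sub>\<infinity>(i, j)\<in>{1..} \<times> {1..}.
      real ((i + 1) * (j + 1)) * (qmom (i + j) \<omega> - qmom i \<omega> * qmom j \<omega>)
      * pdq F i (qvec \<omega>) * pdq G j (qvec \<omega>))"

end

theory Submission
  imports Defs
begin

text \<open>Put $g_\mu(\lambda) = \dim(\mu,\lambda)/\dim\lambda$. Adding a box to $\lambda$ with weight $(z+c)(z'+c)$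
  and removing a box commute up to a scalar. Hence the Gram sum of $g_\mu$ and $g_\nu$ over
  $\mathbb Y_{n+1}$, weighted by $M_{n+1}$, becomes a sum over $\mathbb Y_n$ in which $g_\mu$ is replaced by an affine function of
  $\sum (z)_{\mu/\mu_\bullet}(z')_{\mu/\mu_\bullet}\, g_{\mu_\bullet} - m(m-1+zz')\, g_\mu$. As the Gram sum is symmetric in
  $\mu$ and $\nu$, this operator is symmetric with respect to $M_n$ for every $n$. Since $g_\mu = s^\circ_\mu \circ \iota_n + O(1/n)$
  uniformly on $\mathbb Y_n$, the operator $A$ is symmetric in $L^2(P)$. In the coordinates $q_k$
  it is a second order differential operator without constant term and with principal part $\Gamma$, so that
  $A(fg) = f\,Ag + g\,Af + 2\Gamma(f,g)$; integrating this and using $\int A(fg)\,dP = \int fg\,A1\,dP = 0$ gives the claim.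

  Partitions with at most $N$ rows are encoded by strictly decreasing tuples. Both $s_\mu$ and $\dim(\mu,\lambda)$ (by Aitken's
  formula) are then alternating sums of products, and the identities needed for them hold
  permutation by permutation.\<close>

section \<open>Antisymmetrised functions on integer tuples\<close>

text \<open>The weight is quadratic, (z+c)(z'+c) = c^2 + Bc + A with B = z+z' and A = zz', so the
  box-removal part of the generator needs only three sums over removable boxes, weighted by 1, c and
  c^2. Weight 1 is the derivative in p_1, weight c is of first order and weight c^2 of second order
  in the power sums (\<open>L1_contents\<close>, \<open>L2_contents\<close>). The obstacle is the
  quotient p_1 = 1, where the derivative in p_1 has to disappear: homogeneity expresses it through
  the others, and the term -m(m-1+A) is what makes the result independent of the degree m. The last
  step applies symmetry to the product fg, which is not a Schur function. Multiplication by power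
  sums must therefore stay in the span of the Schur functions, and the Murnaghan--Nakayama rule
  supplies this. All estimates at level n are uniform in the number N of rows, because N has to grow
  with n.\<close>

definition Alt :: "nat \<Rightarrow> ((nat \<Rightarrow> int) \<Rightarrow> real) \<Rightarrow> (nat \<Rightarrow> int) \<Rightarrow> real" where
  "Alt N E b = (\<Sum>\<tau> | \<tau> permutes {..<N}. of_int (sign \<tau>) * E (b \<circ> \<tau>))"

lemma finite_perms [simp]: "finite {\<tau>. \<tau> permutes {..<N::nat}}"
  by (simp add: finite_permutations)

lemma Alt_add: "Alt N (\<lambda>b. E b + F b) b = Alt N E b + Alt N F b"
  by (simp add: Alt_def sum.distrib algebra_simps)

lemma Alt_diff: "Alt N (\<lambda>b. E b - F b) b = Alt N E b - Alt N F b"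
  by (simp add: Alt_def sum_subtractf algebra_simps)

lemma Alt_cmult: "Alt N (\<lambda>b. c * E b) b = c * Alt N E b"
  by (simp add: Alt_def sum_distrib_left algebra_simps)

lemma Alt_sum: "Alt N (\<lambda>b. \<Sum>i\<in>I. E i b) b = (\<Sum>i\<in>I. Alt N (E i) b)"
  unfolding Alt_def by (subst sum.swap) (simp add: sum_distrib_left)

lemma Alt_cong:
  assumes "\<And>\<tau>. \<tau> permutes {..<N} \<Longrightarrow> E (b \<circ> \<tau>) = F (b \<circ> \<tau>)"
  shows "Alt N E b = Alt N F b"
  unfolding Alt_def by (rule sum.cong) (auto simp: assms)

lemma Alt_permute:
  assumes "\<pi> permutes {..<N}"
  shows "Alt N E (b \<circ> \<pi>) = of_int (sign \<pi>) * Alt N E b"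
proof -
  have "Alt N E b = (\<Sum>\<tau> | \<tau> permutes {..<N}. of_int (sign (\<pi> \<circ> \<tau>)) * E (b \<circ> (\<pi> \<circ> \<tau>)))"
    unfolding Alt_def
    by (rule sum.reindex_bij_betw[symmetric], rule bij_betwI[where g="\<lambda>\<tau>. inv \<pi> \<circ> \<tau>"])
       (auto simp: assms permutes_compose permutes_inv o_assoc[symmetric] permutes_inv_o[OF assms]
          simp flip: o_assoc, (simp add: o_assoc permutes_inv_o[OF assms])+)
  also have "\<dots> = of_int (sign \<pi>) * Alt N E (b \<circ> \<pi>)"
    unfolding Alt_def sum_distrib_left
    using assms by (intro sum.cong) (auto simp: sign_compose permutes_imp_permutation[of "{..<N}"] o_assoc)
  finally have "of_int (sign \<pi>) * Alt N E b = (of_int (sign \<pi>) * of_int (sign \<pi>)) * Alt N E (b \<circ> \<pi>)"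
    by simp
  moreover have "(of_int (sign \<pi>) * of_int (sign \<pi>) :: real) = 1"
    by (simp add: sign_def)
  ultimately show ?thesis by simp
qed

text \<open>Here \<pi> permutes the slots of \<open>E\<close>, while in \<open>Alt_permute\<close>
  it permutes the tuple; the summation variable is translated from the right instead of from the
  left.\<close>

lemma Alt_precomp:
  assumes "\<pi> permutes {..<N}"
  shows "Alt N (\<lambda>b. E (b \<circ> \<pi>)) b = of_int (sign \<pi>) * Alt N E b"
proof -
  have "Alt N E b = (\<Sum>\<tau> | \<tau> permutes {..<N}. of_int (sign (\<tau> \<circ> \<pi>)) * E (b \<circ> (\<tau> \<circ> \<pi>)))"
    unfolding Alt_def
    by (rule sum.reindex_bij_betw[symmetric], rule bij_betwI[where g="\<lambda>\<tau>. \<tau> \<circ> inv \<pi>"])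
       (auto simp: assms permutes_compose permutes_inv o_assoc[symmetric] permutes_inv_o[OF assms])
  also have "\<dots> = of_int (sign \<pi>) * Alt N (\<lambda>b. E (b \<circ> \<pi>)) b"
    unfolding Alt_def sum_distrib_left
    using assms by (intro sum.cong) (auto simp: sign_compose permutes_imp_permutation[of "{..<N}"] o_assoc)
  finally have "of_int (sign \<pi>) * Alt N E b = (of_int (sign \<pi>) * of_int (sign \<pi>)) * Alt N (\<lambda>b. E (b \<circ> \<pi>)) b"
    by simp
  moreover have "(of_int (sign \<pi>) * of_int (sign \<pi>) :: real) = 1"
    by (simp add: sign_def)
  ultimately show ?thesis by simp
qed

lemma Alt_swap:
  assumes "x < N" "y < N" "x \<noteq> y"
  shows "Alt N (\<lambda>b. E (b \<circ> Transposition.transpose x y)) b = - Alt N E b"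
  using Alt_precomp[of "Transposition.transpose x y" N E b] assms
  by (simp add: permutes_swap_id sign_swap_id)

lemma Alt_null:
  assumes "x < N" "y < N" "x \<noteq> y" "\<And>b. E (b \<circ> Transposition.transpose x y) = E b"
  shows "Alt N E b = 0"
  using Alt_swap[OF assms(1-3), of E b] assms(4) by simp

lemma Alt_transpose:
  assumes "x < N" "y < N" "x \<noteq> y"
  shows "Alt N E (b \<circ> Transposition.transpose x y) = - Alt N E b"
  using Alt_permute[of "Transposition.transpose x y" N E b] assms
  by (simp add: permutes_swap_id sign_swap_id)

lemma Alt_collision:
  assumes "x < N" "y < N" "x \<noteq> y" "b x = b y"
  shows "Alt N E b = 0"
proof -
  have "b \<circ> Transposition.transpose x y = b" using assms(4) by (auto simp: fun_eq_iff Transposition.transpose_def)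
  thus ?thesis using Alt_transpose[OF assms(1-3), of E b] by simp
qed

text \<open>Row s of the tuple stands in the slot j with \<tau> j = s, and as s runs over all rows,
  j runs over all slots. So an operation summed over all rows can be carried out inside the
  alternating sum, provided its weight depends only on the value of the entry moved. This reduces
  the later identities to statements about a single permutation.\<close>

lemma Alt_sum_shift:
  "(\<Sum>s<N. H (b s) * Alt N E (b(s := b s + a)))
     = Alt N (\<lambda>b. \<Sum>j<N. H (b j) * E (b(j := b j + a))) b"
proof -
  have "(\<Sum>s<N. H (b s) * Alt N E (b(s := b s + a))) =
     (\<Sum>\<tau> | \<tau> permutes {..<N}. \<Sum>s<N. of_int (sign \<tau>) * (H (b s) * E (b(s := b s + a) \<circ> \<tau>)))"
    unfolding Alt_def sum_distrib_left by (subst sum.swap) (simp add: algebra_simps)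
  also have "\<dots> = (\<Sum>\<tau> | \<tau> permutes {..<N}. of_int (sign \<tau>) *
        (\<Sum>j<N. H ((b \<circ> \<tau>) j) * E ((b \<circ> \<tau>)(j := (b \<circ> \<tau>) j + a))))"
  proof (intro sum.cong refl, goal_cases)
    case (1 \<tau>)
    hence p: "\<tau> permutes {..<N}" by simp
    have bij: "bij_betw \<tau> {..<N} {..<N}" using p by (rule permutes_imp_bij)
    have "b(\<tau> j := b (\<tau> j) + a) \<circ> \<tau> = (b \<circ> \<tau>)(j := (b \<circ> \<tau>) j + a)" for j
      using permutes_inj[OF p] by (auto simp: fun_eq_iff inj_eq)
    hence "(\<Sum>s<N. H (b s) * E (b(s := b s + a) \<circ> \<tau>)) =
       (\<Sum>j<N. H ((b \<circ> \<tau>) j) * E ((b \<circ> \<tau>)(j := (b \<circ> \<tau>) j + a)))"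
      by (subst sum.reindex_bij_betw[OF bij, symmetric]) simp
    thus ?case by (simp flip: sum_distrib_left)
  qed
  finally show ?thesis by (simp add: Alt_def)
qed


text \<open>Changing another entry leaves the collision in place. Changing entry x and changing
  entry y give tuples that differ by a transposition, so these two terms cancel.\<close>

lemma Alt_sum_collision:
  assumes "x < N" "y < N" "x \<noteq> y" "b x = b y"
  shows "(\<Sum>r<N. Alt N E (b(r := b r + a))) = 0"
proof -
  have z: "Alt N E (b(r := b r + a)) = 0" if "r \<in> {..<N} - {x, y}" for r
    using that assms by (intro Alt_collision[of x N y]) auto
  have "b(y := b y + a) = b(x := b x + a) \<circ> Transposition.transpose x y"
    using assms by (auto simp: fun_eq_iff Transposition.transpose_def)
  hence "Alt N E (b(y := b y + a)) = - Alt N E (b(x := b x + a))"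
    using Alt_transpose[OF assms(1-3)] by simp
  moreover have "(\<Sum>r<N. Alt N E (b(r := b r + a))) = (\<Sum>r\<in>{x,y}. Alt N E (b(r := b r + a)))"
    using assms z by (intro sum.mono_neutral_right) auto
  ultimately show ?thesis using assms by simp
qed

section \<open>Strictly decreasing tuples and their size\<close>

definition strictly_dec :: "nat \<Rightarrow> (nat \<Rightarrow> int) \<Rightarrow> bool" where
  "strictly_dec N l \<longleftrightarrow> (\<forall>i j. i < j \<longrightarrow> j < N \<longrightarrow> l j < l i)"

definition nonneg :: "nat \<Rightarrow> (nat \<Rightarrow> int) \<Rightarrow> bool" where
  "nonneg N l \<longleftrightarrow> (\<forall>i<N. 0 \<le> l i)"

lemma strictly_dec_inj: "strictly_dec N l \<Longrightarrow> inj_on l {..<N}"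
  unfolding strictly_dec_def inj_on_def by (metis lessThan_iff less_irrefl linorder_neqE_nat)

lemma strictly_dec_exists_permutation:
  assumes "inj_on l {..<N}"
  shows "\<exists>\<pi>. \<pi> permutes {..<N} \<and> strictly_dec N (l \<circ> \<pi>)"
proof -
  obtain h where h: "bij_betw h {..<N} (l ` {..<N})" "strict_mono_on {..<N} h"
  proof
    let ?xs = "sorted_list_of_set (l ` {..<N})"
    have len: "length ?xs = N" using card_image[OF assms] by simp
    show "bij_betw ((!) ?xs) {..<N} (l ` {..<N})"
      using bij_betw_nth[of ?xs "{..<N}" "l ` {..<N}"] len by simp
    show "strict_mono_on {..<N} ((!) ?xs)"
      using strict_sorted_list_of_set[of "l ` {..<N}"] len
      by (auto simp: strict_mono_on_def sorted_wrt_iff_nth_less)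
  qed
  \<comment> \<open>\<open>h\<close> enumerates the values in increasing order; reading it backwards
    gives the decreasing arrangement.\<close>
  define g where "g = (\<lambda>i. inv_into {..<N} l (h (N - 1 - i)))"
  have b1: "bij_betw (inv_into {..<N} l) (l ` {..<N}) {..<N}"
    using assms bij_betw_inv_into[of l "{..<N}"] by (simp add: inj_on_imp_bij_betw)
  have b0: "bij_betw (\<lambda>i. N - 1 - i) {..<N} {..<N}"
    by (rule bij_betwI[where g="\<lambda>i. N - 1 - i"]) auto
  have "bij_betw g {..<N} {..<N}"
    using bij_betw_trans[OF b0 bij_betw_trans[OF h(1) b1]] by (simp add: g_def comp_def)
  then have p: "(\<lambda>i. if i \<in> {..<N} then g i else i) permutes {..<N}"
    by (intro bij_imp_permutes) (use bij_betw_cong[of "{..<N}" "\<lambda>i. if i \<in> {..<N} then g i else i" g] in auto)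
  have lg: "l (g i) = h (N - 1 - i)" if "i < N" for i
  proof -
    have "h (N - 1 - i) \<in> l ` {..<N}" using h(1) that by (auto simp: bij_betw_def)
    thus ?thesis by (simp add: g_def f_inv_into_f)
  qed
  have "strictly_dec N (l \<circ> (\<lambda>i. if i \<in> {..<N} then g i else i))"
    unfolding strictly_dec_def
  proof (intro allI impI)
    fix i j assume "i < j" "j < N"
    hence "h (N - 1 - j) < h (N - 1 - i)"
      by (intro strict_mono_onD[OF h(2)]) auto
    thus "(l \<circ> (\<lambda>i. if i \<in> {..<N} then g i else i)) j < (l \<circ> (\<lambda>i. if i \<in> {..<N} then g i else i)) i"
      using \<open>i < j\<close> \<open>j < N\<close> lg[of i] lg[of j] by simp
  qed
  with p show ?thesis by blast
qed

text \<open>Counted backwards from the last entry, which is nonnegative, every step gains at least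
  1.\<close>

lemma strictly_dec_lower:
  assumes "strictly_dec N l" "nonneg N l" "i < N"
  shows "int N - 1 - int i \<le> l i"
proof -
  have "int d \<le> l i" if "i + d < N" "i + d = N - 1" for d i using that
  proof (induction d arbitrary: i)
    case 0 thus ?case using assms(2) by (simp add: nonneg_def)
  next
    case (Suc d)
    have "int d \<le> l (Suc i)" using Suc by (intro Suc.IH) auto
    moreover have "l (Suc i) < l i" using assms(1) Suc.prems by (simp add: strictly_dec_def)
    ultimately show ?case by simp
  qed
  from this[of i "N - 1 - i"] assms(3) show ?thesis by (simp add: of_nat_diff)
qed

lemma sum_empty_tuple: "(\<Sum>i<N. int N - 1 - int i) = int N * (int N - 1) div 2"
proof (induction N)
  case (Suc N)
  have "(\<Sum>i<Suc N. int (Suc N) - 1 - int i) = (\<Sum>i<N. int N - 1 - int i + 1)"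
    by (simp add: algebra_simps)
  also have "\<dots> = int N * (int N - 1) div 2 + int N" by (simp only: sum.distrib Suc) simp
  also have "\<dots> = int (Suc N) * (int (Suc N) - 1) div 2"
  proof -
    have "int (Suc N) * (int (Suc N) - 1) = int N * (int N - 1) + int N * 2" by (simp add: algebra_simps)
    thus ?thesis by simp
  qed
  finally show ?case .
qed simp

lemma sum_permute:
  assumes "\<pi> permutes {..<N::nat}"
  shows "(\<Sum>i<N. f (\<pi> i)) = (\<Sum>i<N. f i)"
  using sum.permute[OF assms, of f] by (simp add: comp_def)

text \<open>The staircase N-1, ..., 1, 0 is the tuple of the empty partition, so this is the number
  of boxes when \<open>l\<close> encodes a partition.\<close>

definition tuple_size :: "nat \<Rightarrow> (nat \<Rightarrow> int) \<Rightarrow> int" where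
  "tuple_size N l = (\<Sum>i<N. l i - (int N - 1 - int i))"

lemma tuple_size_real: "real_of_int (tuple_size N l) = (\<Sum>i<N. of_int (l i)) - real N * (real N - 1) / 2"
proof -
  have "tuple_size N l = (\<Sum>i<N. l i) - int N * (int N - 1) div 2"
    unfolding tuple_size_def by (subst sum_subtractf) (simp only: sum_empty_tuple)
  moreover have "real_of_int (int N * (int N - 1) div 2) = real N * (real N - 1) / 2"
    by (subst real_of_int_div) auto
  ultimately show ?thesis by simp
qed

lemma tuple_size_permute: "\<pi> permutes {..<N} \<Longrightarrow> tuple_size N (l \<circ> \<pi>) = tuple_size N l"
  unfolding tuple_size_def using sum_permute[of \<pi> N l] by (simp add: sum_subtractf)

lemma tuple_size_upd: "s < N \<Longrightarrow> tuple_size N (l(s := l s + a)) = tuple_size N l + a"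
  unfolding tuple_size_def by (simp add: sum.remove[of _ s] if_distrib sum.If_cases)

lemma tuple_size_nonneg:
  assumes "inj_on l {..<N}" "nonneg N l"
  shows "0 \<le> tuple_size N l"
proof -
  obtain \<pi> where p: "\<pi> permutes {..<N}" "strictly_dec N (l \<circ> \<pi>)"
    using strictly_dec_exists_permutation[OF assms(1)] by blast
  have "nonneg N (l \<circ> \<pi>)"
    using assms(2) permutes_in_image[OF p(1)] by (auto simp: nonneg_def)
  hence "0 \<le> tuple_size N (l \<circ> \<pi>)"
    unfolding tuple_size_def using strictly_dec_lower[OF p(2)] by (intro sum_nonneg) auto
  thus ?thesis using tuple_size_permute[OF p(1)] by simp
qed

lemma Alt_eq_0_not_inj: "\<not> inj_on l {..<N} \<Longrightarrow> Alt N E l = 0"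
  unfolding inj_on_def using Alt_collision[of _ N _ l E] by blast

text \<open>The terms with $r \<noteq> s$ cancel in pairs: with $a = l_s$ and $b = l_r$ they are the values at
  $(t, a+b-t)$ for $0 \<le> t \<le> a+b$, $t \<noteq> a$, of a function that is odd under $t \<mapsto> a+b-t$.\<close>

lemma Alt_euler:
  assumes l: "nonneg N l"
  shows "(\<Sum>s<N. \<Sum>j\<in>{1..nat (l s)}. \<Sum>r<N. Alt N E ((l(s := l s - int j))(r := (l(s := l s - int j)) r + int j)))
     = of_int (tuple_size N l) * Alt N E l"
proof -
  define T where "T s r = (\<Sum>j\<in>{1..nat (l s)}. Alt N E ((l(s := l s - int j))(r := (l(s := l s - int j)) r + int j)))" for s r
  have diag: "T s s = of_int (l s) * Alt N E l" if "s < N" for s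
    using l that by (simp add: T_def nonneg_def)
  have pair: "T s r + T r s = - Alt N E l" if "s < N" "r < N" "s \<noteq> r" for s r
  proof -
    define a b where "a = l s" and "b = l r"
    have ab: "0 \<le> a" "0 \<le> b" using l that by (auto simp: nonneg_def a_def b_def)
    define G where "G t = Alt N E (l(s := t, r := a + b - t))" for t
    have "T s r = (\<Sum>j\<in>{1..nat a}. G (a - int j))"
      unfolding T_def G_def a_def[symmetric] using that
      by (intro sum.cong refl arg_cong[where f="Alt N E"]) (auto simp: a_def b_def fun_eq_iff)
    also have "\<dots> = (\<Sum>t\<in>{0..<a}. G t)"
      by (rule sum.reindex_bij_witness[where i="\<lambda>t. nat (a - t)" and j="\<lambda>j. a - int j"]) (use ab in auto)
    finally have 1: "T s r = (\<Sum>t\<in>{0..<a}. G t)" .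
    have "T r s = (\<Sum>j\<in>{1..nat b}. G (a + int j))"
      unfolding T_def G_def b_def[symmetric] using that
      by (intro sum.cong refl arg_cong[where f="Alt N E"]) (auto simp: a_def b_def fun_eq_iff)
    also have "\<dots> = (\<Sum>t\<in>{a<..a+b}. G t)"
      by (rule sum.reindex_bij_witness[where i="\<lambda>t. nat (t - a)" and j="\<lambda>j. a + int j"]) (use ab in auto)
    finally have 2: "T r s = (\<Sum>t\<in>{a<..a+b}. G t)" .
    have G: "G (a + b - t) = - G t" for t
    proof -
      have "l(s := a + b - t, r := a + b - (a + b - t)) = l(s := t, r := a + b - t) \<circ> Transposition.transpose s r"
        using that by (auto simp: fun_eq_iff Transposition.transpose_def)
      thus ?thesis using Alt_transpose[OF that] by (simp add: G_def)
    qed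
    have "(\<Sum>t\<in>{0..a+b}. G t) = (\<Sum>t\<in>{0..a+b}. G (a + b - t))"
      by (rule sum.reindex_bij_witness[where i="\<lambda>t. a + b - t" and j="\<lambda>t. a + b - t"]) auto
    hence z: "(\<Sum>t\<in>{0..a+b}. G t) = 0" by (simp add: G sum_negf)
    have "{0..a+b} = insert a ({0..<a} \<union> {a<..a+b})" using ab by auto
    hence "(\<Sum>t\<in>{0..a+b}. G t) = G a + ((\<Sum>t\<in>{0..<a}. G t) + (\<Sum>t\<in>{a<..a+b}. G t))"
      by (simp, subst sum.union_disjoint) auto
    moreover have "G a = Alt N E l" by (simp add: G_def a_def b_def)
    ultimately show ?thesis using z 1 2 by simp
  qed
  have "(\<Sum>s<N. \<Sum>r\<in>{..<N} - {s}. T s r) = (\<Sum>s<N. \<Sum>r\<in>{..<N} - {s}. T r s)"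
    using sum.swap[of T "{..<N}" "{..<N}"] by (simp add: sum_diff1 sum_subtractf)
  \<comment> \<open>Averaging over (s, r) and (r, s) makes \<open>pair\<close> applicable. The
    resulting N(N-1)/2 is the sum of the staircase, which turns the sum of the entries into
    \<open>tuple_size\<close>.\<close>
  hence "2 * (\<Sum>s<N. \<Sum>r\<in>{..<N} - {s}. T s r) = (\<Sum>s<N. \<Sum>r\<in>{..<N} - {s}. T s r + T r s)"
    by (simp add: sum.distrib)
  also have "\<dots> = (\<Sum>s<N. \<Sum>r\<in>{..<N} - {s}. - Alt N E l)"
    using pair by (intro sum.cong) auto
  also have "\<dots> = - (real N * (real N - 1)) * Alt N E l"
    by (cases N) (auto simp: algebra_simps)
  finally have off: "(\<Sum>s<N. \<Sum>r\<in>{..<N} - {s}. T s r) = - (real N * (real N - 1) / 2) * Alt N E l"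
    by simp
  have "(\<Sum>s<N. \<Sum>j\<in>{1..nat (l s)}. \<Sum>r<N. Alt N E ((l(s := l s - int j))(r := (l(s := l s - int j)) r + int j)))
     = (\<Sum>s<N. \<Sum>r<N. T s r)"
    unfolding T_def by (intro sum.cong refl sum.swap)
  also have "\<dots> = (\<Sum>s<N. T s s + (\<Sum>r\<in>{..<N} - {s}. T s r))"
    by (intro sum.cong refl) (simp add: sum.remove)
  also have "\<dots> = of_int (\<Sum>s<N. l s) * Alt N E l - (real N * (real N - 1) / 2) * Alt N E l"
    using off by (simp add: sum.distrib diag sum_distrib_right)
  also have "\<dots> = of_int (tuple_size N l) * Alt N E l"
    unfolding tuple_size_real by (simp add: algebra_simps)
  finally show ?thesis .
qed

section \<open>Jacobi--Trudi determinants\<close>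

lemma prod_upd:
  fixes f :: "nat \<Rightarrow> int \<Rightarrow> real"
  assumes "x < N"
  shows "(\<Prod>j<N. f j ((b(x := v)) j)) = f x v * (\<Prod>j\<in>{..<N}-{x}. f j (b j))"
  using assms by (subst prod.remove[of _ x]) (auto intro!: prod.cong)

text \<open>For a product \<open>E\<close> the alternating sum is the determinant with entries
  \<open>f j (b i)\<close>; here two of its columns agree.\<close>

lemma Alt_prod_equal_columns:
  assumes "x < N" "y < N" "x \<noteq> y" "f x = f y"
  shows "Alt N (\<lambda>b. \<Prod>j<N. f j (b j)) b = 0"
proof (rule Alt_null[OF assms(1-3)])
  fix b :: "nat \<Rightarrow> int"
  let ?t = "Transposition.transpose x y"
  have "bij_betw ?t {..<N} {..<N}"
    using assms by (intro permutes_imp_bij permutes_swap_id) auto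
  hence "(\<Prod>j<N. f j ((b \<circ> ?t) j)) = (\<Prod>j<N. f (?t j) ((b \<circ> ?t) (?t j)))"
    by (rule prod.reindex_bij_betw[symmetric])
  also have "\<dots> = (\<Prod>j<N. f j (b j))"
  proof (rule prod.cong[OF refl])
    fix j
    have "f (?t j) = f j" using assms(4) by (cases "j = x"; cases "j = y") auto
    thus "f (?t j) ((b \<circ> ?t) (?t j)) = f j (b j)" by simp
  qed
  finally show "(\<Prod>j<N. f j ((b \<circ> ?t) j)) = (\<Prod>j<N. f j (b j))" .
qed

text \<open>Only two properties of power sums \<open>p\<close> and complete symmetric functions
  \<open>h\<close> enter the determinant identities. Since \<open>h\<close> vanishes at negative
  arguments, every upper limit M with n \<le> M gives the full Newton sum, so one M can serve all
  entries of a tuple.\<close>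

locale newton_pair =
  fixes p :: "nat \<Rightarrow> real" and h :: "int \<Rightarrow> real"
  assumes h_neg: "n < 0 \<Longrightarrow> h n = 0"
    and newton: "n \<le> int M \<Longrightarrow> (\<Sum>i=1..M. p i * h (n - int i)) = of_int n * h n"
begin

text \<open>With v = \<mu>_i + N - 1 - i this is h_{\<mu>_i - i + k}, the Jacobi--Trudi entry in
  column k. The index k is an integer because lowering an entry is the same as moving to an earlier
  column (\<open>col_shift\<close>), possibly outside the matrix.\<close>

definition col :: "nat \<Rightarrow> int \<Rightarrow> int \<Rightarrow> real" where
  "col N k v = h (v + k + 1 - int N)"

definition jt_prod :: "nat \<Rightarrow> (nat \<Rightarrow> int) \<Rightarrow> real" where
  "jt_prod N b = (\<Prod>j<N. col N (int j) (b j))"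

definition S :: "nat \<Rightarrow> (nat \<Rightarrow> int) \<Rightarrow> real" where
  "S N l = Alt N (jt_prod N) l"

definition jt_rest :: "nat \<Rightarrow> (nat \<Rightarrow> int) \<Rightarrow> nat \<Rightarrow> real" where
  "jt_rest N b x = (\<Prod>j\<in>{..<N}-{x}. col N (int j) (b j))"

lemma jt_prod_upd: "x < N \<Longrightarrow> jt_prod N (b(x := v)) = col N (int x) v * jt_rest N b x"
  unfolding jt_prod_def jt_rest_def by (rule prod_upd)

lemma jt_prod_remove: "x < N \<Longrightarrow> jt_prod N b = col N (int x) (b x) * jt_rest N b x"
  using jt_prod_upd[of x N b "b x"] by simp

text \<open>A negative entry v makes a whole row of the determinant vanish: in the columns 0, ...,
  N-1 the argument of \<open>h\<close> is at most v.\<close>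

lemma S_neg:
  assumes "s < N" "l s < 0"
  shows "S N l = 0"
  unfolding S_def Alt_def
proof (intro sum.neutral ballI)
  fix \<tau> assume "\<tau> \<in> {\<tau>. \<tau> permutes {..<N}}"
  hence p: "\<tau> permutes {..<N}" by simp
  have "inv \<tau> s < N" using permutes_in_image[OF permutes_inv[OF p]] assms(1) by auto
  moreover have "col N (int (inv \<tau> s)) ((l \<circ> \<tau>) (inv \<tau> s)) = 0"
  proof -
    have "l s + int (inv \<tau> s) + 1 - int N < 0" using assms calculation by linarith
    thus ?thesis by (simp add: col_def permutes_inverses[OF p] h_neg)
  qed
  ultimately have "jt_prod N (l \<circ> \<tau>) = 0" unfolding jt_prod_def by (intro prod_zero) auto
  thus "of_int (sign \<tau>) * jt_prod N (l \<circ> \<tau>) = 0" by simp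
qed

lemma newton_col:
  assumes "v + k + 1 - int N \<le> int M"
  shows "(\<Sum>i=1..M. p i * col N (k - int i) v) = of_int (v + k + 1 - int N) * col N k v"
proof -
  have "col N (k - int i) v = h (v + k + 1 - int N - int i)" for i
    unfolding col_def by (rule arg_cong[where f=h]) simp
  thus ?thesis using newton[OF assms] by (simp only: col_def)
qed

lemma col_shift: "col N k (v - a) = col N (k - a) v"
  by (simp add: col_def algebra_simps)

text \<open>For k \<ge> 1 this plays the role of k \<partial>/\<partial>p_k: that operator sends h_n
  to h_{n-k}, and by the product rule it lowers one row of the determinant at a time.\<close>

definition lower_sum :: "nat \<Rightarrow> int \<Rightarrow> (nat \<Rightarrow> int) \<Rightarrow> real" where
  "lower_sum N k l = (\<Sum>s<N. S N (l(s := l s - k)))"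

lemma lower_sum_Alt: "lower_sum N k l = Alt N (\<lambda>b. \<Sum>j<N. col N (int j - k) (b j) * jt_rest N b j) l"
proof -
  have "lower_sum N k l = Alt N (\<lambda>b. \<Sum>j<N. jt_prod N (b(j := b j - k))) l"
    using Alt_sum_shift[where N=N and H="\<lambda>_. 1" and b=l and E="jt_prod N" and a="-k"] by (simp add: lower_sum_def S_def)
  also have "(\<lambda>b. \<Sum>j<N. jt_prod N (b(j := b j - k))) = (\<lambda>b. \<Sum>j<N. col N (int j - k) (b j) * jt_rest N b j)"
    by (intro ext sum.cong refl) (simp add: jt_prod_upd col_shift)
  finally show ?thesis .
qed

lemma permuted_le:
  assumes "\<tau> permutes {..<N}" "\<And>s. s < N \<Longrightarrow> l s \<le> int M" "j < N"
  shows "(l \<circ> \<tau>) j \<le> int M"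
  using assms permutes_in_image[OF assms(1)] by auto

text \<open>Euler's identity for a function homogeneous of degree \<open>tuple_size N l\<close>.
  Newton's identity in column x contributes the factor b_x + x + 1 - N, and these factors add up to
  the size, whatever the permutation.\<close>

lemma S_euler:
  assumes M: "\<And>s. s < N \<Longrightarrow> l s \<le> int M"
  shows "(\<Sum>j=1..M. p j * lower_sum N (int j) l) = of_int (tuple_size N l) * S N l"
proof -
  have "(\<Sum>j=1..M. p j * lower_sum N (int j) l)
     = Alt N (\<lambda>b. \<Sum>j=1..M. p j * (\<Sum>x<N. col N (int x - int j) (b x) * jt_rest N b x)) l"
    by (simp add: lower_sum_Alt Alt_sum Alt_cmult)
  also have "\<dots> = Alt N (\<lambda>b. of_int (tuple_size N l) * jt_prod N b) l"
  proof (rule Alt_cong)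
    fix \<tau> assume p: "\<tau> permutes {..<N}"
    let ?b = "l \<circ> \<tau>"
    have "(\<Sum>j=1..M. p j * (\<Sum>x<N. col N (int x - int j) (?b x) * jt_rest N ?b x))
       = (\<Sum>x<N. (\<Sum>j=1..M. p j * col N (int x - int j) (?b x)) * jt_rest N ?b x)"
      by (simp only: sum_distrib_left sum_distrib_right mult.assoc) (rule sum.swap)
    also have "\<dots> = (\<Sum>x<N. of_int (?b x + int x + 1 - int N) * jt_prod N ?b)"
    proof (intro sum.cong refl)
      fix x assume "x \<in> {..<N}"
      hence "x < N" by simp
      have "?b x \<le> int M" by (rule permuted_le[where l=l]) (use p M \<open>x < N\<close> in auto)
      with \<open>x < N\<close>
      have "(\<Sum>j=1..M. p j * col N (int x - int j) (?b x)) = of_int (?b x + int x + 1 - int N) * col N (int x) (?b x)"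
        by (intro newton_col) auto
      thus "(\<Sum>j=1..M. p j * col N (int x - int j) (?b x)) * jt_rest N ?b x = of_int (?b x + int x + 1 - int N) * jt_prod N ?b"
        using jt_prod_remove[OF \<open>x < N\<close>, of ?b] by simp
    qed
    also have "\<dots> = of_int (tuple_size N ?b) * jt_prod N ?b"
      unfolding tuple_size_def of_int_sum sum_distrib_right by (intro sum.cong refl) simp
    finally show "(\<Sum>j=1..M. p j * (\<Sum>x<N. col N (int x - int j) (?b x) * jt_rest N ?b x)) = of_int (tuple_size N l) * jt_prod N ?b"
      using tuple_size_permute[OF p] by simp
  qed
  finally show ?thesis by (simp add: Alt_cmult S_def)
qed

lemma fun_upd_prod:
  "x < N \<Longrightarrow> (\<Prod>j<N. ((\<lambda>j. col N (int j))(x := f)) j (b j)) = f (b x) * jt_rest N b x"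
  unfolding jt_rest_def by (subst prod.remove[of _ x]) (auto intro!: prod.cong)

text \<open>Shifted by one, column x repeats column x - 1. Column 0 has no such neighbour; in the
  applications it is removed by a coefficient divisible by x.\<close>

lemma shifted_column_null:
  assumes "x < N" "0 < x"
  shows "Alt N (\<lambda>b. col N (int x - 1) (b x) * jt_rest N b x) l = 0"
proof -
  have "Alt N (\<lambda>b. \<Prod>j<N. ((\<lambda>j. col N (int j))(x := col N (int x - 1))) j (b j)) l = 0"
    using assms by (intro Alt_prod_equal_columns[of x N "x - 1"]) (auto simp: of_nat_diff)
  thus ?thesis unfolding fun_upd_prod[OF assms(1)] .
qed

lemma weighted_shift: 
  "(\<Sum>s<N. H (l s) * S N (l(s := l s - 1)))
    = Alt N (\<lambda>b. \<Sum>x<N. H (b x) * (col N (int x - 1) (b x) * jt_rest N b x)) l"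
proof -
  have "(\<Sum>s<N. H (l s) * S N (l(s := l s - 1))) = Alt N (\<lambda>b. \<Sum>x<N. H (b x) * jt_prod N (b(x := b x - 1))) l"
    using Alt_sum_shift[where N=N and H=H and b=l and E="jt_prod N" and a="-1"] by (simp add: S_def)
  also have "(\<lambda>b. \<Sum>x<N. H (b x) * jt_prod N (b(x := b x - 1))) = (\<lambda>b. \<Sum>x<N. H (b x) * (col N (int x - 1) (b x) * jt_rest N b x))"
    by (intro ext sum.cong refl) (simp add: jt_prod_upd col_shift)
  finally show ?thesis .
qed

text \<open>Newton's identity turns the left side into the sum with weights $(b_x - N) + x$ in column $x$; the part with
  weight $x$ vanishes since it repeats column $x-1$.\<close>

lemma L1_contents:
  assumes M: "\<And>s. s < N \<Longrightarrow> l s \<le> int M"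
  shows "(\<Sum>i=1..M. p i * lower_sum N (int i + 1) l) = (\<Sum>s<N. of_int (l s - int N) * S N (l(s := l s - 1)))"
proof -
  have "(\<Sum>i=1..M. p i * lower_sum N (int i + 1) l)
     = Alt N (\<lambda>b. \<Sum>i=1..M. p i * (\<Sum>x<N. col N (int x - 1 - int i) (b x) * jt_rest N b x)) l"
    by (simp add: lower_sum_Alt Alt_sum Alt_cmult diff_diff_eq add.commute)
  also have "\<dots> = Alt N (\<lambda>b. (\<Sum>x<N. of_int (b x - int N) * (col N (int x - 1) (b x) * jt_rest N b x))
       + (\<Sum>x<N. real x * (col N (int x - 1) (b x) * jt_rest N b x))) l"
  proof (rule Alt_cong)
    fix \<tau> assume p: "\<tau> permutes {..<N}"
    let ?b = "l \<circ> \<tau>"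
    have "(\<Sum>j=1..M. p j * (\<Sum>x<N. col N (int x - 1 - int j) (?b x) * jt_rest N ?b x))
       = (\<Sum>x<N. (\<Sum>j=1..M. p j * col N (int x - 1 - int j) (?b x)) * jt_rest N ?b x)"
      by (simp only: sum_distrib_left sum_distrib_right mult.assoc) (rule sum.swap)
    also have "\<dots> = (\<Sum>x<N. of_int (?b x + int x - int N) * col N (int x - 1) (?b x) * jt_rest N ?b x)"
    proof (intro sum.cong refl)
      fix x assume "x \<in> {..<N}"
      hence "x < N" by simp
      have "?b x \<le> int M" by (rule permuted_le[where l=l]) (use p M \<open>x < N\<close> in auto)
      with \<open>x < N\<close>
      have "(\<Sum>j=1..M. p j * col N (int x - 1 - int j) (?b x)) = of_int (?b x + (int x - 1) + 1 - int N) * col N (int x - 1) (?b x)"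
        by (intro newton_col) auto
      thus "(\<Sum>j=1..M. p j * col N (int x - 1 - int j) (?b x)) * jt_rest N ?b x = of_int (?b x + int x - int N) * col N (int x - 1) (?b x) * jt_rest N ?b x"
        by simp
    qed
    finally show "(\<Sum>j=1..M. p j * (\<Sum>x<N. col N (int x - 1 - int j) (?b x) * jt_rest N ?b x)) = 
       (\<Sum>x<N. of_int (?b x - int N) * (col N (int x - 1) (?b x) * jt_rest N ?b x))
       + (\<Sum>x<N. real x * (col N (int x - 1) (?b x) * jt_rest N ?b x))"
      unfolding sum.distrib[symmetric] by (simp add: ring_distribs mult.assoc add_diff_eq diff_add_eq)
  qed
  also have "\<dots> = (\<Sum>s<N. of_int (l s - int N) * S N (l(s := l s - 1)))"
  proof -
    have "Alt N (\<lambda>b. \<Sum>x<N. real x * (col N (int x - 1) (b x) * jt_rest N b x)) l = 0"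
      unfolding Alt_sum Alt_cmult using shifted_column_null by (intro sum.neutral) auto
    thus ?thesis using weighted_shift[of "\<lambda>v. of_int (v - int N)" l N] by (simp add: Alt_add)
  qed
  finally show ?thesis .
qed

lemma S_not_inj: "\<not> inj_on l {..<N} \<Longrightarrow> S N l = 0"
  by (simp add: S_def Alt_eq_0_not_inj)

lemma S_collision: "x < N \<Longrightarrow> y < N \<Longrightarrow> x \<noteq> y \<Longrightarrow> l x = l y \<Longrightarrow> S N l = 0"
  by (simp add: S_def Alt_collision)


definition raise_sum :: "nat \<Rightarrow> int \<Rightarrow> (nat \<Rightarrow> int) \<Rightarrow> real" where
  "raise_sum N k l = (\<Sum>r<N. S N (l(r := l r + k)))"

lemma raise_sum_collision:
  assumes "x < N" "y < N" "x \<noteq> y" "l x = l y"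
  shows "raise_sum N k l = 0"
  unfolding raise_sum_def S_def using assms by (rule Alt_sum_collision)

text \<open>Euler's identity is applied to both sides. The surplus on the left comes from rows with $l_s < k$
  that are first lowered and then raised by $k$.\<close>

lemma murnaghan_nakayama:
  assumes "k \<ge> 1" "nonneg N l" "int ` {..<k} \<subseteq> l ` {..<N}"
  shows "raise_sum N (int k) l = p k * S N l"
  using assms(2,3)
\<comment> \<open>For an injective tuple, the hypothesis on the values below k provides k empty
  rows, so that a strip of length k fits. The sum of the entries serves as measure because it stays
  nonnegative even when lowering an entry produces a collision, unlike the size.\<close>
proof (induction "nat (\<Sum>s<N. l s)" arbitrary: l rule: less_induct)
  case less
  show ?case
  proof (cases "inj_on l {..<N}")
    case False
    then obtain x y where "x < N" "y < N" "x \<noteq> y" "l x = l y" by (auto simp: inj_on_def)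
    thus ?thesis using raise_sum_collision[of x N y l] S_collision[of x N y l] by simp
  next
    case inj: True
    have lpos: "0 \<le> l s" if "s < N" for s using less.prems(1) that by (simp add: nonneg_def)
    have gamma_coeff: "\<exists>r<N. l r = w" if "0 \<le> w" "w < int k" for w
    proof -
      have "w \<in> int ` {..<k}" using that by (intro image_eqI[of _ _ "nat w"]) auto
      hence "w \<in> l ` {..<N}" using less.prems(2) by (rule rev_subsetD)
      thus ?thesis by auto
    qed
    define M where "M = nat (\<Sum>s<N. l s) + k"
    have lM: "l s + int k \<le> int M" if "s < N" for s
    proof -
      have "l s \<le> (\<Sum>s<N. l s)" using lpos that by (intro member_le_sum) auto
      thus ?thesis using lpos[OF that] by (simp add: M_def)
    qed
    have kM: "k \<le> M" by (simp add: M_def)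
    have T: "raise_sum N (int k) (l(s := l s - int j)) =
        p k * S N (l(s := l s - int j)) + (if j = k \<and> l s < int k then S N l else 0)"
      if s: "s < N" and j: "1 \<le> j" for s j
    proof (cases "l s < int j")
      case True
      have z: "S N (l(s := l s - int j)) = 0" using s True by (intro S_neg[of s]) auto
      have "S N ((l(s := l s - int j))(r := (l(s := l s - int j)) r + int k)) = 0" if "r \<in> {..<N} - {s}" for r
        using that s True by (intro S_neg[of s]) auto
      hence u: "raise_sum N (int k) (l(s := l s - int j)) = S N (l(s := l s - int j + int k))"
        unfolding raise_sum_def using s by (simp add: sum.remove[of _ s])
      \<comment> \<open>Only raising the same row again is left. For j = k this restores
        \<open>l\<close> and gives the surplus term; otherwise the new value l_s - j + k is
        negative, or it lies below k and is already taken by another row.\<close>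
      show ?thesis
      proof (cases "j = k")
        case True thus ?thesis using u z \<open>l s < int j\<close> by simp
      next
        case False
        have "S N (l(s := l s - int j + int k)) = 0"
        proof (cases "l s - int j + int k < 0")
          case True thus ?thesis using s by (intro S_neg[of s]) auto
        next
          case F2: False
          then obtain s' where s': "s' < N" "l s' = l s - int j + int k"
            using gamma_coeff[of "l s - int j + int k"] \<open>l s < int j\<close> by auto
          have "s' \<noteq> s" using s' False by auto
          thus ?thesis using s s' by (intro S_collision[of s N s']) auto
        qed
        thus ?thesis using u z False by simp
      qed
    next
      case False
      let ?l = "l(s := l s - int j)"
      have nn: "nonneg N ?l" using less.prems(1) False by (auto simp: nonneg_def)
      have e: "raise_sum N (int k) ?l = p k * S N ?l"
      proof (cases "int ` {..<k} \<subseteq> ?l ` {..<N}")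
        case True
        have "(\<Sum>s<N. ?l s) = (\<Sum>s<N. l s) - int j" using s by (simp add: sum.remove[of _ s])
        moreover have "0 \<le> (\<Sum>s<N. ?l s)" using nn by (intro sum_nonneg) (auto simp: nonneg_def)
        ultimately show ?thesis using j by (intro less.hyps nn True) auto
      next
        \<comment> \<open>Only lowering one of the values below k can destroy the hypothesis, and
          then the new value, again below k, is already taken.\<close>
        case F2: False
        then obtain v where v: "v < k" "int v \<notin> ?l ` {..<N}" by auto
        then obtain r where r: "r < N" "l r = int v" using gamma_coeff[of "int v"] by auto
        have "r = s" using v r by (metis fun_upd_other image_eqI lessThan_iff)
        then obtain s' where s': "s' < N" "l s' = l s - int j"
          using gamma_coeff[of "l s - int j"] r v False by auto
        have "s' \<noteq> s" using s' j by auto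
        hence c: "?l s = ?l s'" using s' by simp
        have "raise_sum N (int k) ?l = 0" "S N ?l = 0"
          using s s'(1) \<open>s' \<noteq> s\<close> c by (auto intro!: raise_sum_collision[of s N s'] S_collision[of s N s'])
        thus ?thesis by simp
      qed
      thus ?thesis using False by auto
    qed
    \<comment> \<open>Exactly k rows give a surplus at j = k, together k p_k S. This matches the
      excess k in the size of the raised tuples.\<close>
    have card: "card {s. s < N \<and> l s < int k} = k"
    proof -
      have "l ` {s. s < N \<and> l s < int k} = int ` {..<k}"
      proof
        show "l ` {s. s < N \<and> l s < int k} \<subseteq> int ` {..<k}"
        proof
          fix v assume "v \<in> l ` {s. s < N \<and> l s < int k}"
          hence "0 \<le> v" "v < int k" using lpos by auto
          thus "v \<in> int ` {..<k}" by (intro image_eqI[of _ _ "nat v"]) auto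
        qed
        show "int ` {..<k} \<subseteq> l ` {s. s < N \<and> l s < int k}"
        proof
          fix w assume "w \<in> int ` {..<k}"
          hence w: "0 \<le> w" "w < int k" by auto
          with gamma_coeff[of w] obtain r where "r < N" "l r = w" by auto
          thus "w \<in> l ` {s. s < N \<and> l s < int k}" using w by auto
        qed
      qed
      moreover have "inj_on l {s. s < N \<and> l s < int k}" using inj by (rule inj_on_subset) auto
      ultimately have "card {s. s < N \<and> l s < int k} = card (int ` {..<k})" by (metis card_image)
      thus ?thesis by (simp add: card_image)
    qed
    have comm: "(l(r := l r + int k))(s := (l(r := l r + int k)) s - int j) = (l(s := l s - int j))(r := (l(s := l s - int j)) r + int k)" for r s j
      by (auto simp: fun_eq_iff)
    have "of_int (tuple_size N l + int k) * raise_sum N (int k) l = (\<Sum>r<N. of_int (tuple_size N (l(r := l r + int k))) * S N (l(r := l r + int k)))"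
      unfolding raise_sum_def sum_distrib_left by (intro sum.cong refl) (simp only: tuple_size_upd lessThan_iff)
    also have "\<dots> = (\<Sum>r<N. \<Sum>j=1..M. p j * lower_sum N (int j) (l(r := l r + int k)))"
    proof (intro sum.cong refl)
      fix r assume "r \<in> {..<N}"
      have "(l(r := l r + int k)) s \<le> int M" if "s < N" for s using lM[OF that] by auto
      thus "of_int (tuple_size N (l(r := l r + int k))) * S N (l(r := l r + int k)) = (\<Sum>j=1..M. p j * lower_sum N (int j) (l(r := l r + int k)))"
        by (intro S_euler[symmetric]) auto
    qed
    also have "\<dots> = (\<Sum>j=1..M. p j * (\<Sum>r<N. lower_sum N (int j) (l(r := l r + int k))))"
      unfolding sum_distrib_left by (rule sum.swap)
    also have "\<dots> = (\<Sum>j=1..M. p j * (\<Sum>s<N. raise_sum N (int k) (l(s := l s - int j))))"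
      unfolding lower_sum_def raise_sum_def comm by (subst sum.swap) (rule refl)
    also have "\<dots> = (\<Sum>j=1..M. p j * (\<Sum>s<N. p k * S N (l(s := l s - int j)) + (if j = k \<and> l s < int k then S N l else 0)))"
      using T by (intro sum.cong refl arg_cong2[where f="(*)"]) auto
    also have "\<dots> = p k * (\<Sum>j=1..M. p j * lower_sum N (int j) l) + (\<Sum>j=1..M. if j = k then p k * real k * S N l else 0)"
    proof -
      have "p j * (\<Sum>s<N. p k * S N (l(s := l s - int j)) + (if j = k \<and> l s < int k then S N l else 0))
          = p k * (p j * lower_sum N (int j) l) + (if j = k then p k * real k * S N l else 0)" for j
      proof -
        have "(\<Sum>s<N. if l s < int k then S N l else 0) = real k * S N l"
        proof -
          have "(\<Sum>s<N. if l s < int k then S N l else 0) = (\<Sum>s\<in>{s. s < N \<and> l s < int k}. S N l)"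
            by (intro sum.mono_neutral_cong_right) auto
          thus ?thesis by (simp add: card)
        qed
        thus ?thesis by (auto simp: sum.distrib lower_sum_def sum_distrib_left[symmetric] distrib_left)
      qed
      thus ?thesis by (simp add: sum.distrib sum_distrib_left)
    qed
    also have "\<dots> = p k * (of_int (tuple_size N l) * S N l) + p k * real k * S N l"
    proof -
      have "(\<Sum>j=1..M. p j * lower_sum N (int j) l) = of_int (tuple_size N l) * S N l"
        using lM by (intro S_euler) force
      thus ?thesis using kM assms(1) by simp
    qed
    finally have "of_int (tuple_size N l + int k) * (raise_sum N (int k) l - p k * S N l) = 0"
      by (simp add: algebra_simps)
    moreover have "tuple_size N l + int k > 0" using tuple_size_nonneg[OF inj less.prems(1)] assms(1) by simp
    ultimately show ?thesis by simp
  qed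
qed

section \<open>Lowering two columns at once: the second-order content identity\<close>

definition jt_rest2 :: "nat \<Rightarrow> (nat \<Rightarrow> int) \<Rightarrow> nat \<Rightarrow> nat \<Rightarrow> real" where
  "jt_rest2 N b x y = (\<Prod>j\<in>{..<N}-{x,y}. col N (int j) (b j))"

lemma jt_rest_remove: "x < N \<Longrightarrow> x \<noteq> y \<Longrightarrow> jt_rest N b y = col N (int x) (b x) * jt_rest2 N b x y"
proof -
  assume "x < N" "x \<noteq> y"
  moreover have "{..<N} - {y} - {x} = {..<N} - {x, y}" by auto
  ultimately show ?thesis unfolding jt_rest_def jt_rest2_def by (subst prod.remove[of _ x]) auto
qed

lemma jt_rest2_commute: "jt_rest2 N b x y = jt_rest2 N b y x"
  by (simp add: jt_rest2_def insert_commute)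

lemma fun_upd_prod2:
  assumes "x < N" "y < N" "x \<noteq> y"
  shows "(\<Prod>j<N. ((\<lambda>j. col N (int j))(x := f, y := g)) j (b j)) = f (b x) * g (b y) * jt_rest2 N b x y"
proof -
  have "{..<N} = insert x (insert y ({..<N} - {x,y}))" using assms by auto
  hence "(\<Prod>j<N. ((\<lambda>j. col N (int j))(x := f, y := g)) j (b j)) =
     (\<Prod>j\<in>insert x (insert y ({..<N} - {x,y})). ((\<lambda>j. col N (int j))(x := f, y := g)) j (b j))" by simp
  also have "\<dots> = f (b x) * (g (b y) * (\<Prod>j\<in>{..<N} - {x,y}. ((\<lambda>j. col N (int j))(x := f, y := g)) j (b j)))"
    using assms(3) by (subst prod.insert, simp, simp, subst prod.insert) auto
  also have "(\<Prod>j\<in>{..<N} - {x,y}. ((\<lambda>j. col N (int j))(x := f, y := g)) j (b j)) = jt_rest2 N b x y"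
    unfolding jt_rest2_def by (intro prod.cong) auto
  finally show ?thesis by (simp only: mult.assoc)
qed

lemma jt_rest2_swap: "jt_rest2 N (b \<circ> Transposition.transpose x y) x y = jt_rest2 N b x y"
  unfolding jt_rest2_def by (intro prod.cong refl) (simp add: transpose_apply_other)

lemma Alt_swap2:
  assumes "x < N" "y < N" "x \<noteq> y"
  shows "Alt N (\<lambda>b. F (b x) (b y) * jt_rest2 N b x y) l = - Alt N (\<lambda>b. F (b y) (b x) * jt_rest2 N b x y) l"
  using Alt_swap[OF assms, of "\<lambda>b. F (b y) (b x) * jt_rest2 N b x y" l] by (simp add: jt_rest2_swap)

lemma Alt_null_left:
  assumes "x < N" "y < N" "x \<noteq> y" "u < N" "u \<noteq> x" "u \<noteq> y"
  shows "Alt N (\<lambda>b. col N (int u) (b x) * g (b y) * jt_rest2 N b x y) l = 0"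
  using Alt_prod_equal_columns[of x N u "(\<lambda>j. col N (int j))(x := col N (int u), y := g)" l] assms
  unfolding fun_upd_prod2[OF assms(1-3)] by simp

lemma Alt_null_right:
  assumes "x < N" "y < N" "x \<noteq> y" "v < N" "v \<noteq> x" "v \<noteq> y"
  shows "Alt N (\<lambda>b. f (b x) * col N (int v) (b y) * jt_rest2 N b x y) l = 0"
  using Alt_prod_equal_columns[of y N v "(\<lambda>j. col N (int j))(x := f, y := col N (int v))" l] assms
  unfolding fun_upd_prod2[OF assms(1-3)] by simp

text \<open>The part of a second-order operator that lowers two different columns: a total of i + 1
  units, with coefficient p_i, is split between the columns u and v in all ways with both shares
  positive.\<close>

definition cross :: "nat \<Rightarrow> nat \<Rightarrow> int \<Rightarrow> int \<Rightarrow> int \<Rightarrow> int \<Rightarrow> real" where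
  "cross N M u v a b = (\<Sum>i=1..M. p i * (\<Sum>k=1..i. col N (u - int k) a * col N (v - (int i + 1 - int k)) b))"

lemma cross_commute: "cross N M u v a b = cross N M v u b a"
  unfolding cross_def
proof (rule sum.cong[OF refl])
  fix i
  have "(\<Sum>k=1..i. col N (u - int k) a * col N (v - (int i + 1 - int k)) b)
      = (\<Sum>k=1..i. col N (v - int k) b * col N (u - (int i + 1 - int k)) a)"
    by (rule sum.reindex_bij_witness[where i="\<lambda>k. i + 1 - k" and j="\<lambda>k. i + 1 - k"])
       (auto simp: of_nat_diff mult.commute add.commute)
  thus "p i * (\<Sum>k=1..i. col N (u - int k) a * col N (v - (int i + 1 - int k)) b)
      = p i * (\<Sum>k=1..i. col N (v - int k) b * col N (u - (int i + 1 - int k)) a)" by simp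
qed

text \<open>Moving one unit between the two columns changes only the boundary terms of the inner sum,
  and these are evaluated by Newton's identity.\<close>

lemma cross_step:
  assumes "a + u + 1 - int N \<le> int M" "b + v - int N \<le> int M"
  shows "cross N M (u + 1) (v - 1) a b = cross N M u v a b + of_int (b + v - 1 - a - u) * col N u a * col N (v - 1) b"
proof -
  have inner: "(\<Sum>k=1..i. col N (u + 1 - int k) a * col N (v - 1 - (int i + 1 - int k)) b)
     = (\<Sum>k=1..i. col N (u - int k) a * col N (v - (int i + 1 - int k)) b)
       + col N u a * col N (v - 1 - int i) b - col N (u - int i) a * col N (v - 1) b" if "i \<ge> 1" for i
  proof -
    define f where "f k = col N (u - int k) a * col N (v - (int i + 1 - int k)) b" for k
    have "(\<Sum>k=1..i. col N (u + 1 - int k) a * col N (v - 1 - (int i + 1 - int k)) b) = (\<Sum>k=0..<i. f k)"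
      unfolding f_def
      by (rule sum.reindex_bij_witness[where i="\<lambda>k. k + 1" and j="\<lambda>k. k - 1"]) (auto simp: of_nat_diff algebra_simps)
    moreover have "(\<Sum>k=0..<i. f k) + f i = f 0 + (\<Sum>k=1..i. f k)"
      by (induction i) auto
    ultimately show ?thesis by (simp add: f_def algebra_simps)
  qed
  have "cross N M (u + 1) (v - 1) a b = (\<Sum>i=1..M. p i * ((\<Sum>k=1..i. col N (u - int k) a * col N (v - (int i + 1 - int k)) b)
       + col N u a * col N (v - 1 - int i) b - col N (u - int i) a * col N (v - 1) b))"
    unfolding cross_def by (intro sum.cong refl arg_cong2[where f="(*)"] inner) auto
  also have "\<dots> = cross N M u v a b + col N u a * (\<Sum>i=1..M. p i * col N (v - 1 - int i) b)
       - (\<Sum>i=1..M. p i * col N (u - int i) a) * col N (v - 1) b"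
    unfolding cross_def sum_distrib_left[of "col N u a"] sum_distrib_right
      sum.distrib[symmetric] sum_subtractf[symmetric]
    by (intro sum.cong refl) (simp add: algebra_simps)
  also have "(\<Sum>i=1..M. p i * col N (v - 1 - int i) b) = of_int (b + (v - 1) + 1 - int N) * col N (v - 1) b"
    using assms(2) by (intro newton_col) simp
  also have "(\<Sum>i=1..M. p i * col N (u - int i) a) = of_int (a + u + 1 - int N) * col N u a"
    using assms(1) by (intro newton_col)
  finally show ?thesis by (simp add: algebra_simps)
qed

text \<open>Iterates \<open>cross_step\<close>; the boundary term of step t involves the columns u +
  t and v - 1 - t.\<close>

lemma cross_telescope:
  assumes "a + u + int d - int N \<le> int M" "b + v - int N \<le> int M"
  shows "cross N M u v a b = (\<Sum>t<d. of_int (a - b + u - v + 1 + 2 * int t) * col N (u + int t) a * col N (v - 1 - int t) b)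
     + cross N M (u + int d) (v - int d) a b"
  using assms
proof (induction d)
  case (Suc d)
  have "cross N M (u + int d + 1) (v - int d - 1) a b = cross N M (u + int d) (v - int d) a b
     + of_int (b + (v - int d) - 1 - a - (u + int d)) * col N (u + int d) a * col N (v - int d - 1) b"
    using Suc.prems by (intro cross_step) auto
  moreover have "v - int d - 1 = v - 1 - int d" by simp
  ultimately show ?case using Suc by (simp add: algebra_simps)
qed simp

text \<open>After y - x unit steps the two columns have changed places, and antisymmetry turns the
  interchanged term into minus the original one. Hence twice the left side equals the sum of the
  boundary terms. Almost all of these repeat a column of the matrix; one copy of the right side
  survives at t = y - x - 1 and one at t = 0.\<close>

lemma Alt_cross_pair:
  assumes xy: "x < y" "y < N" and M: "\<And>s. s < N \<Longrightarrow> l s \<le> int M"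
  shows "Alt N (\<lambda>b. cross N M (int x) (int y) (b x) (b y) * jt_rest2 N b x y) l
     = - Alt N (\<lambda>b. of_int (b y) * (col N (int y - 1) (b y) * jt_rest N b y)) l"
proof -
  define d where "d = y - x"
  have d: "d \<ge> 1" "y = x + d" using xy by (auto simp: d_def)
  have xyN: "x < N" "y < N" "x \<noteq> y" using xy by auto
  define A where "A = Alt N (\<lambda>b. cross N M (int x) (int y) (b x) (b y) * jt_rest2 N b x y) l"
  define Z where "Z = Alt N (\<lambda>b. col N (int x) (b x) * (of_int (b y) * col N (int y - 1) (b y)) * jt_rest2 N b x y) l"
  define P1 where "P1 t = Alt N (\<lambda>b. (of_int (b x) * col N (int x + int t) (b x)) * col N (int y - 1 - int t) (b y) * jt_rest2 N b x y) l" for t :: nat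
  define P2 where "P2 t = Alt N (\<lambda>b. col N (int x + int t) (b x) * (of_int (b y) * col N (int y - 1 - int t) (b y)) * jt_rest2 N b x y) l" for t :: nat
  define P3 where "P3 t = Alt N (\<lambda>b. col N (int x + int t) (b x) * col N (int y - 1 - int t) (b y) * jt_rest2 N b x y) l" for t :: nat
  have "A = Alt N (\<lambda>b. (\<Sum>t<d. (of_int (b x) * col N (int x + int t) (b x)) * col N (int y - 1 - int t) (b y) * jt_rest2 N b x y
        - col N (int x + int t) (b x) * (of_int (b y) * col N (int y - 1 - int t) (b y)) * jt_rest2 N b x y
        + of_int (int x - int y + 1 + 2 * int t) * (col N (int x + int t) (b x) * col N (int y - 1 - int t) (b y) * jt_rest2 N b x y))
       + cross N M (int y) (int x) (b x) (b y) * jt_rest2 N b x y) l"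
    unfolding A_def
  proof (rule Alt_cong)
    fix \<tau> assume p: "\<tau> permutes {..<N}"
    let ?b = "l \<circ> \<tau>"
    have "?b x \<le> int M" by (rule permuted_le[where l=l]) (use p M xyN in auto)
    moreover have "?b y \<le> int M" by (rule permuted_le[where l=l]) (use p M xyN in auto)
    ultimately have "cross N M (int x) (int y) (?b x) (?b y) =
      (\<Sum>t<d. of_int (?b x - ?b y + int x - int y + 1 + 2 * int t) * col N (int x + int t) (?b x) * col N (int y - 1 - int t) (?b y))
     + cross N M (int x + int d) (int y - int d) (?b x) (?b y)"
      using d xyN by (intro cross_telescope) auto
    moreover have "int x + int d = int y" "int y - int d = int x" using d by auto
    ultimately have "cross N M (int x) (int y) (?b x) (?b y) =
      (\<Sum>t<d. of_int (?b x - ?b y + int x - int y + 1 + 2 * int t) * col N (int x + int t) (?b x) * col N (int y - 1 - int t) (?b y))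
     + cross N M (int y) (int x) (?b x) (?b y)" by simp
    thus "cross N M (int x) (int y) (?b x) (?b y) * jt_rest2 N ?b x y = (\<Sum>t<d. (of_int (?b x) * col N (int x + int t) (?b x)) * col N (int y - 1 - int t) (?b y) * jt_rest2 N ?b x y
        - col N (int x + int t) (?b x) * (of_int (?b y) * col N (int y - 1 - int t) (?b y)) * jt_rest2 N ?b x y
        + of_int (int x - int y + 1 + 2 * int t) * (col N (int x + int t) (?b x) * col N (int y - 1 - int t) (?b y) * jt_rest2 N ?b x y))
       + cross N M (int y) (int x) (?b x) (?b y) * jt_rest2 N ?b x y"
      by (simp only: distrib_right sum_distrib_right) (intro arg_cong2[where f="(+)"] sum.cong refl, simp add: ring_distribs mult_ac)
  qed
  also have "\<dots> = (\<Sum>t<d. P1 t - P2 t + of_int (int x - int y + 1 + 2 * int t) * P3 t)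
      + Alt N (\<lambda>b. cross N M (int y) (int x) (b x) (b y) * jt_rest2 N b x y) l"
    unfolding Alt_add Alt_sum Alt_diff Alt_cmult P1_def P2_def P3_def ..
  also have "Alt N (\<lambda>b. cross N M (int y) (int x) (b x) (b y) * jt_rest2 N b x y) l = - A"
    unfolding A_def by (subst Alt_swap2[OF xyN]) (simp only: cross_commute[of N M "int y"])
  finally have A2: "2 * A = (\<Sum>t<d. P1 t - P2 t + of_int (int x - int y + 1 + 2 * int t) * P3 t)" by simp
  \<comment> \<open>The column y - 1 - t put into slot y repeats another column unless it equals x.
    At that last step slot x holds column y - 1, and exchanging the slots gives -Z.\<close>
  have P1: "P1 t = (if t = d - 1 then - Z else 0)" if "t < d" for t
  proof (cases "t = d - 1")
    case True
    hence e: "int y - 1 - int t = int x" "int x + int t = int y - 1" using d by auto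
    show ?thesis using True unfolding P1_def Z_def e
      using Alt_swap2[OF xyN, of "\<lambda>v w. of_int v * col N (int y - 1) v * col N (int x) w" l]
      by (simp add: mult_ac)
  next
    case False
    hence e: "int y - 1 - int t = int (y - 1 - t)" "y - 1 - t < N" "y - 1 - t \<noteq> x" "y - 1 - t \<noteq> y"
      using that d xy by auto
    show ?thesis using False unfolding P1_def e(1)
      using Alt_null_right[OF xyN e(2-4), of "\<lambda>v. of_int v * col N (int x + int t) v" l] by simp
  qed
  have left: "Alt N (\<lambda>b. col N (int x + int t) (b x) * g (b y) * jt_rest2 N b x y) l = 0" if "t < d" "t > 0" for t g
  proof -
    have e: "int x + int t = int (x + t)" "x + t < N" "x + t \<noteq> x" "x + t \<noteq> y" using that d xy by auto
    show ?thesis unfolding e(1) using Alt_null_left[OF xyN e(2-4), of g l] .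
  qed
  have P2: "P2 t = (if t = 0 then Z else 0)" if "t < d" for t
    using left[OF that, of "\<lambda>v. of_int v * col N (int y - 1 - int t) v"] by (auto simp: P2_def Z_def)
  \<comment> \<open>The unweighted terms all vanish: for t > 0 by a repeated column in slot x, and
    for t = 0 either by the repeated column y - 1 or, if y = x + 1, because the slots x and y hold
    the same column.\<close>
  have P3: "P3 t = 0" if "t < d" for t
  proof (cases "t = 0")
    case True
    show ?thesis
    proof (cases "d = 1")
      case True
      hence e: "int y - 1 - int t = int x" "int x + int t = int x" using d \<open>t = 0\<close> by auto
      show ?thesis unfolding P3_def e
        using Alt_swap2[OF xyN, of "\<lambda>v w. col N (int x) v * col N (int x) w" l] by (simp add: mult_ac)
    next
      case False
      hence e: "int y - 1 - int t = int (y - 1)" "y - 1 < N" "y - 1 \<noteq> x" "y - 1 \<noteq> y" using d xy True by auto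
      show ?thesis unfolding P3_def e(1)
        using Alt_null_right[OF xyN e(2-4), of "\<lambda>v. col N (int x + int t) v" l] by simp
    qed
  next
    case False
    thus ?thesis unfolding P3_def using left[OF that, of "\<lambda>v. col N (int y - 1 - int t) v"] by simp
  qed
  have "2 * A = (\<Sum>t<d. (if t = d - 1 then - Z else 0) - (if t = 0 then Z else 0))"
    unfolding A2 by (intro sum.cong refl) (simp add: P1 P2 P3)
  also have "\<dots> = - 2 * Z" using d by (simp add: sum_subtractf)
  finally have "A = - Z" by simp
  also have "Z = Alt N (\<lambda>b. of_int (b y) * (col N (int y - 1) (b y) * jt_rest N b y)) l"
    unfolding Z_def using xyN by (intro arg_cong[where f="\<lambda>F. Alt N F l"] ext) (simp add: jt_rest_remove mult_ac)
  finally show ?thesis unfolding A_def .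
qed


text \<open>Two applications of Newton's identity turn the first sum into (b_x + x - N)^2 in column
  x minus \<open>W\<close>; the correction appears because the second application acts on a column
  already shifted by i. In the second sum the two lowerings may hit the same column, which restores
  \<open>W\<close>, or different columns, which \<open>Alt_cross_pair\<close> evaluates. When the
  square is expanded around b_x - N, the mixed term 2 x b_x cancels against the different columns,
  and what remains has no factor b_x and vanishes by \<open>shifted_column_null\<close>.\<close>

lemma L2_contents:
  assumes M: "\<And>s. s < N \<Longrightarrow> l s \<le> int M"
  shows "(\<Sum>i=1..M. \<Sum>j=1..M. p i * p j * lower_sum N (int i + int j + 1) l)
     + (\<Sum>i=1..M. p i * (\<Sum>k=1..i. \<Sum>r<N. lower_sum N (int i + 1 - int k) (l(r := l r - int k))))
     = (\<Sum>s<N. (of_int (l s - int N))\<^sup>2 * S N (l(s := l s - 1)))"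
proof -
  define W where "W b x = (\<Sum>i=1..M. real i * (p i * col N (int x - 1 - int i) (b x)))" for b :: "nat \<Rightarrow> int" and x :: nat
  have first: "(\<Sum>i=1..M. \<Sum>j=1..M. p i * p j * lower_sum N (int i + int j + 1) l)
    = Alt N (\<lambda>b. \<Sum>x<N. (of_int (b x + int x - int N))\<^sup>2 * (col N (int x - 1) (b x) * jt_rest N b x) - W b x * jt_rest N b x) l"
  proof -
    have "(\<Sum>i=1..M. \<Sum>j=1..M. p i * p j * lower_sum N (int i + int j + 1) l)
      = Alt N (\<lambda>b. \<Sum>i=1..M. \<Sum>j=1..M. p i * p j * (\<Sum>x<N. col N (int x - (int i + int j + 1)) (b x) * jt_rest N b x)) l"
      by (simp only: lower_sum_Alt Alt_sum Alt_cmult)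
    also have "\<dots> = Alt N (\<lambda>b. \<Sum>x<N. (of_int (b x + int x - int N))\<^sup>2 * (col N (int x - 1) (b x) * jt_rest N b x) - W b x * jt_rest N b x) l"
    proof (rule Alt_cong)
      fix \<tau> assume pm: "\<tau> permutes {..<N}"
      let ?b = "l \<circ> \<tau>"
      have col2: "(\<Sum>i=1..M. \<Sum>j=1..M. p i * p j * col N (int x - (int i + int j + 1)) (?b x))
         = (of_int (?b x + int x - int N))\<^sup>2 * col N (int x - 1) (?b x) - W ?b x" if "x < N" for x
      proof -
        have bx: "?b x \<le> int M" by (rule permuted_le[where l=l]) (use pm M that in auto)
        define n where "n = ?b x + int x - int N"
        have "(\<Sum>i=1..M. \<Sum>j=1..M. p i * p j * col N (int x - (int i + int j + 1)) (?b x))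
          = (\<Sum>i=1..M. p i * (\<Sum>j=1..M. p j * col N (int x - 1 - int i - int j) (?b x)))"
          unfolding sum_distrib_left by (intro sum.cong refl) (simp add: diff_diff_eq add_ac mult.assoc)
        also have "\<dots> = (\<Sum>i=1..M. p i * (of_int (?b x + (int x - 1 - int i) + 1 - int N) * col N (int x - 1 - int i) (?b x)))"
        proof (rule sum.cong[OF refl])
          fix i
          have "(\<Sum>j=1..M. p j * col N (int x - 1 - int i - int j) (?b x)) = of_int (?b x + (int x - 1 - int i) + 1 - int N) * col N (int x - 1 - int i) (?b x)"
            using bx that by (intro newton_col) auto
          thus "p i * (\<Sum>j=1..M. p j * col N (int x - 1 - int i - int j) (?b x)) = p i * (of_int (?b x + (int x - 1 - int i) + 1 - int N) * col N (int x - 1 - int i) (?b x))"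
            by simp
        qed
        also have "\<dots> = of_int n * (\<Sum>i=1..M. p i * col N (int x - 1 - int i) (?b x)) - W ?b x"
          unfolding sum_distrib_left W_def sum_subtractf[symmetric] n_def
          by (intro sum.cong refl) (simp add: ring_distribs mult_ac)
        also have "(\<Sum>i=1..M. p i * col N (int x - 1 - int i) (?b x)) = of_int (?b x + (int x - 1) + 1 - int N) * col N (int x - 1) (?b x)"
          using bx that by (intro newton_col) auto
        also have "?b x + (int x - 1) + 1 - int N = n" by (simp add: n_def)
        finally show ?thesis unfolding n_def[symmetric] by (simp only: power2_eq_square mult.assoc)
      qed
      have "(\<Sum>i=1..M. \<Sum>j=1..M. p i * p j * (\<Sum>x<N. col N (int x - (int i + int j + 1)) (?b x) * jt_rest N ?b x))
        = (\<Sum>i=1..M. \<Sum>x<N. \<Sum>j=1..M. p i * p j * (col N (int x - (int i + int j + 1)) (?b x) * jt_rest N ?b x))"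
        unfolding sum_distrib_left by (intro sum.cong refl sum.swap)
      also have "\<dots> = (\<Sum>x<N. \<Sum>i=1..M. \<Sum>j=1..M. p i * p j * (col N (int x - (int i + int j + 1)) (?b x) * jt_rest N ?b x))"
        by (rule sum.swap)
      also have "\<dots> = (\<Sum>x<N. (\<Sum>i=1..M. \<Sum>j=1..M. p i * p j * col N (int x - (int i + int j + 1)) (?b x)) * jt_rest N ?b x)"
        by (simp only: sum_distrib_right mult.assoc)
      also have "\<dots> = (\<Sum>x<N. (of_int (?b x + int x - int N))\<^sup>2 * (col N (int x - 1) (?b x) * jt_rest N ?b x) - W ?b x * jt_rest N ?b x)"
        by (rule sum.cong[OF refl]) (subst col2, simp, simp only: left_diff_distrib mult.assoc)
      finally show "(\<Sum>i=1..M. \<Sum>j=1..M. p i * p j * (\<Sum>x<N. col N (int x - (int i + int j + 1)) (?b x) * jt_rest N ?b x))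
         = (\<Sum>x<N. (of_int (?b x + int x - int N))\<^sup>2 * (col N (int x - 1) (?b x) * jt_rest N ?b x) - W ?b x * jt_rest N ?b x)" .
    qed
    finally show ?thesis .
  qed
  define Z where "Z y = Alt N (\<lambda>b. of_int (b y) * (col N (int y - 1) (b y) * jt_rest N b y)) l" for y :: nat
  have second: "(\<Sum>i=1..M. p i * (\<Sum>k=1..i. \<Sum>r<N. lower_sum N (int i + 1 - int k) (l(r := l r - int k))))
    = Alt N (\<lambda>b. \<Sum>x<N. W b x * jt_rest N b x) l - 2 * (\<Sum>y<N. real y * Z y)"
  proof -
    have A2: "(\<Sum>r<N. lower_sum N q (l(r := l r - k))) = Alt N (\<lambda>b. \<Sum>x<N. \<Sum>y<N. jt_prod N ((b(x := b x - k))(y := (b(x := b x - k)) y - q))) l" for q k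
    proof -
      have d: "lower_sum N q l' = Alt N (\<lambda>b. \<Sum>y<N. jt_prod N (b(y := b y - q))) l'" for l'
        using Alt_sum_shift[where N=N and H="\<lambda>_. 1" and b=l' and E="jt_prod N" and a="-q"] by (simp add: lower_sum_def S_def)
      show ?thesis unfolding d
        using Alt_sum_shift[where N=N and H="\<lambda>_. 1" and b=l and E="\<lambda>b. \<Sum>y<N. jt_prod N (b(y := b y - q))" and a="-k"] by simp
    qed
    have jt2: "(\<Sum>y<N. jt_prod N ((b(x := b x - k))(y := (b(x := b x - k)) y - q)))
       = col N (int x - (k + q)) (b x) * jt_rest N b x + (\<Sum>y\<in>{..<N}-{x}. col N (int x - k) (b x) * col N (int y - q) (b y) * jt_rest2 N b x y)"
      if "x < N" for b x k q
    proof -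
      have "jt_prod N ((b(x := b x - k))(y := (b(x := b x - k)) y - q)) = col N (int x - k) (b x) * col N (int y - q) (b y) * jt_rest2 N b x y"
        if "y \<in> {..<N} - {x}" for y
      proof -
        have "jt_rest N (b(x := b x - k)) y = col N (int x) (b x - k) * jt_rest2 N (b(x := b x - k)) x y"
          using \<open>x < N\<close> that jt_rest_remove[of x N y "b(x := b x - k)"] by auto
        moreover have "jt_rest2 N (b(x := b x - k)) x y = jt_rest2 N b x y" unfolding jt_rest2_def by (intro prod.cong) auto
        ultimately show ?thesis using that by (simp add: jt_prod_upd col_shift mult_ac)
      qed
      moreover have "jt_prod N ((b(x := b x - k))(x := (b(x := b x - k)) x - q)) = col N (int x - (k + q)) (b x) * jt_rest N b x"
        using that by (simp add: jt_prod_upd col_shift diff_diff_eq add.commute)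
      ultimately show ?thesis using that by (subst sum.remove[of _ x]) auto
    qed
    have inner: "(\<Sum>i=1..M. p i * (\<Sum>k=1..i. \<Sum>x<N. \<Sum>y<N. jt_prod N ((b(x := b x - int k))(y := (b(x := b x - int k)) y - (int i + 1 - int k)))))
       = (\<Sum>x<N. W b x * jt_rest N b x) + (\<Sum>x<N. \<Sum>y\<in>{..<N}-{x}. cross N M (int x) (int y) (b x) (b y) * jt_rest2 N b x y)" for b
    proof -
      have "(\<Sum>i=1..M. p i * (\<Sum>k=1..i. \<Sum>x<N. \<Sum>y<N. jt_prod N ((b(x := b x - int k))(y := (b(x := b x - int k)) y - (int i + 1 - int k)))))
        = (\<Sum>i=1..M. p i * (\<Sum>k=1..i. \<Sum>x<N. col N (int x - 1 - int i) (b x) * jt_rest N b x + (\<Sum>y\<in>{..<N}-{x}. col N (int x - int k) (b x) * col N (int y - (int i + 1 - int k)) (b y) * jt_rest2 N b x y)))"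
      proof (rule sum.cong[OF refl], rule arg_cong2[where f="(*)", OF refl], intro sum.cong refl)
        fix i k x assume "x \<in> {..<N}"
        moreover have "int x - (int k + (int i + 1 - int k)) = int x - 1 - int i" by simp
        ultimately show "(\<Sum>y<N. jt_prod N ((b(x := b x - int k))(y := (b(x := b x - int k)) y - (int i + 1 - int k)))) =
          col N (int x - 1 - int i) (b x) * jt_rest N b x + (\<Sum>y\<in>{..<N}-{x}. col N (int x - int k) (b x) * col N (int y - (int i + 1 - int k)) (b y) * jt_rest2 N b x y)"
          using jt2[of x b "int k" "int i + 1 - int k"] by (simp only: lessThan_iff)
      qed
      also have "\<dots> = (\<Sum>i=1..M. p i * (\<Sum>k=1..i. \<Sum>x<N. col N (int x - 1 - int i) (b x) * jt_rest N b x))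
         + (\<Sum>i=1..M. p i * (\<Sum>k=1..i. \<Sum>x<N. \<Sum>y\<in>{..<N}-{x}. col N (int x - int k) (b x) * col N (int y - (int i + 1 - int k)) (b y) * jt_rest2 N b x y))"
        by (simp only: sum.distrib distrib_left)
      also have "(\<Sum>i=1..M. p i * (\<Sum>k=1..i. \<Sum>x<N. col N (int x - 1 - int i) (b x) * jt_rest N b x)) = (\<Sum>x<N. W b x * jt_rest N b x)"
      proof -
        have "(\<Sum>i=1..M. p i * (\<Sum>k=1..i. \<Sum>x<N. col N (int x - 1 - int i) (b x) * jt_rest N b x))
           = (\<Sum>i=1..M. \<Sum>x<N. real i * (p i * col N (int x - 1 - int i) (b x)) * jt_rest N b x)"
          by (simp add: sum_distrib_left mult_ac)
        also have "\<dots> = (\<Sum>x<N. W b x * jt_rest N b x)"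
          unfolding W_def sum_distrib_right by (rule sum.swap)
        finally show ?thesis .
      qed
      also have "(\<Sum>i=1..M. p i * (\<Sum>k=1..i. \<Sum>x<N. \<Sum>y\<in>{..<N}-{x}. col N (int x - int k) (b x) * col N (int y - (int i + 1 - int k)) (b y) * jt_rest2 N b x y))
        = (\<Sum>x<N. \<Sum>y\<in>{..<N}-{x}. cross N M (int x) (int y) (b x) (b y) * jt_rest2 N b x y)"
      proof -
        have "(\<Sum>i=1..M. p i * (\<Sum>k=1..i. \<Sum>x<N. \<Sum>y\<in>{..<N}-{x}. col N (int x - int k) (b x) * col N (int y - (int i + 1 - int k)) (b y) * jt_rest2 N b x y))
          = (\<Sum>i=1..M. \<Sum>x<N. \<Sum>k=1..i. \<Sum>y\<in>{..<N}-{x}. p i * (col N (int x - int k) (b x) * col N (int y - (int i + 1 - int k)) (b y) * jt_rest2 N b x y))"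
          unfolding sum_distrib_left by (rule sum.cong[OF refl], rule sum.swap)
        also have "\<dots> = (\<Sum>x<N. \<Sum>i=1..M. \<Sum>k=1..i. \<Sum>y\<in>{..<N}-{x}. p i * (col N (int x - int k) (b x) * col N (int y - (int i + 1 - int k)) (b y) * jt_rest2 N b x y))"
          by (rule sum.swap)
        also have "\<dots> = (\<Sum>x<N. \<Sum>i=1..M. \<Sum>y\<in>{..<N}-{x}. \<Sum>k=1..i. p i * (col N (int x - int k) (b x) * col N (int y - (int i + 1 - int k)) (b y) * jt_rest2 N b x y))"
          by (rule sum.cong[OF refl], rule sum.cong[OF refl], rule sum.swap)
        also have "\<dots> = (\<Sum>x<N. \<Sum>y\<in>{..<N}-{x}. \<Sum>i=1..M. \<Sum>k=1..i. p i * (col N (int x - int k) (b x) * col N (int y - (int i + 1 - int k)) (b y) * jt_rest2 N b x y))"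
          by (rule sum.cong[OF refl], rule sum.swap)
        also have "\<dots> = (\<Sum>x<N. \<Sum>y\<in>{..<N}-{x}. cross N M (int x) (int y) (b x) (b y) * jt_rest2 N b x y)"
          unfolding cross_def sum_distrib_right sum_distrib_left by (simp only: mult.assoc)
        finally show ?thesis .
      qed
      finally show ?thesis .
    qed
    define D where "D x y = Alt N (\<lambda>b. cross N M (int x) (int y) (b x) (b y) * jt_rest2 N b x y) l" for x y :: nat
    have Dsym: "D x y = D y x" for x y
      unfolding D_def by (subst cross_commute, subst jt_rest2_commute) (rule refl)
    have Dlt: "D x y = - Z y" if "x < y" "y < N" for x y
      unfolding D_def Z_def using that M by (rule Alt_cross_pair)
    have "(\<Sum>i=1..M. p i * (\<Sum>k=1..i. \<Sum>r<N. lower_sum N (int i + 1 - int k) (l(r := l r - int k))))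
      = Alt N (\<lambda>b. \<Sum>i=1..M. p i * (\<Sum>k=1..i. \<Sum>x<N. \<Sum>y<N. jt_prod N ((b(x := b x - int k))(y := (b(x := b x - int k)) y - (int i + 1 - int k))))) l"
      by (simp only: A2 Alt_sum Alt_cmult)
    also have "\<dots> = Alt N (\<lambda>b. \<Sum>x<N. W b x * jt_rest N b x) l + (\<Sum>x<N. \<Sum>y\<in>{..<N}-{x}. D x y)"
      unfolding inner Alt_add D_def by (simp only: Alt_sum)
    \<comment> \<open>Column y has y columns to its left, each contributing -Z y, and every pair
      occurs in both orders.\<close>
    also have "(\<Sum>x<N. \<Sum>y\<in>{..<N}-{x}. D x y) = - (2 * (\<Sum>y<N. real y * Z y))"
    proof -
      have "(\<Sum>x<N. \<Sum>y\<in>{..<N}-{x}. D x y) = (\<Sum>x<N. (\<Sum>y<x. D x y) + (\<Sum>y\<in>{x<..<N}. D x y))"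
      proof (rule sum.cong[OF refl])
        fix x assume "x \<in> {..<N}"
        hence split: "{..<N} - {x} = {..<x} \<union> {x<..<N}" by auto
        show "(\<Sum>y\<in>{..<N}-{x}. D x y) = (\<Sum>y<x. D x y) + (\<Sum>y\<in>{x<..<N}. D x y)"
          unfolding split by (rule sum.union_disjoint) auto
      qed
      also have "\<dots> = (\<Sum>x<N. \<Sum>y<x. D x y) + (\<Sum>x<N. \<Sum>y\<in>{x<..<N}. D x y)" by (rule sum.distrib)
      also have "(\<Sum>x<N. \<Sum>y\<in>{x<..<N}. D x y) = (\<Sum>y<N. \<Sum>x<y. D x y)"
        unfolding sum.Sigma[OF finite_lessThan ballI[OF finite_greaterThanLessThan]] sum.Sigma[OF finite_lessThan ballI[OF finite_lessThan]]
        by (rule sum.reindex_bij_witness[where i="\<lambda>(y,x). (x,y)" and j="\<lambda>(x,y). (y,x)"]) auto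
      also have "(\<Sum>x<N. \<Sum>y<x. D x y) = (\<Sum>y<N. \<Sum>x<y. D x y)"
        by (intro sum.cong refl Dsym)
      also have "(\<Sum>y<N. \<Sum>x<y. D x y) = (\<Sum>y<N. - (real y * Z y))"
        by (intro sum.cong refl) (simp add: Dlt)
      finally show ?thesis by (simp add: sum_negf)
    qed
    finally show ?thesis by (simp only: diff_conv_add_uminus)
  qed
  have sq: "Alt N (\<lambda>b. (of_int (b x + int x - int N))\<^sup>2 * (col N (int x - 1) (b x) * jt_rest N b x)) l
    = Alt N (\<lambda>b. (of_int (b x - int N))\<^sup>2 * (col N (int x - 1) (b x) * jt_rest N b x)) l + 2 * (real x * Z x)" if "x < N" for x
  proof -
    have "(\<lambda>b. (of_int (b x + int x - int N))\<^sup>2 * (col N (int x - 1) (b x) * jt_rest N b x))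
      = (\<lambda>b. (of_int (b x - int N))\<^sup>2 * (col N (int x - 1) (b x) * jt_rest N b x)
          + (2 * real x) * (of_int (b x) * (col N (int x - 1) (b x) * jt_rest N b x))
          + ((real x)\<^sup>2 - 2 * real x * real N) * (col N (int x - 1) (b x) * jt_rest N b x))"
      by (intro ext) (simp add: power2_eq_square algebra_simps)
    moreover have "((real x)\<^sup>2 - 2 * real x * real N) * Alt N (\<lambda>b. col N (int x - 1) (b x) * jt_rest N b x) l = 0"
      using shifted_column_null[OF that] by (cases "x = 0") auto
    ultimately show ?thesis by (simp only: Alt_add Alt_cmult Z_def)
  qed
  have "Alt N (\<lambda>b. \<Sum>x<N. (of_int (b x + int x - int N))\<^sup>2 * (col N (int x - 1) (b x) * jt_rest N b x) - W b x * jt_rest N b x) l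
     = (\<Sum>x<N. Alt N (\<lambda>b. (of_int (b x - int N))\<^sup>2 * (col N (int x - 1) (b x) * jt_rest N b x)) l + 2 * (real x * Z x)) - Alt N (\<lambda>b. \<Sum>x<N. W b x * jt_rest N b x) l"
    unfolding sum_subtractf Alt_diff Alt_sum[where b=l and N=N and E="\<lambda>x b. (of_int (b x + int x - int N))\<^sup>2 * (col N (int x - 1) (b x) * jt_rest N b x)"]
    by (rule arg_cong2[where f="(-)", OF _ refl], rule sum.cong[OF refl], rule sq) simp
  also have "\<dots> = (\<Sum>s<N. (of_int (l s - int N))\<^sup>2 * S N (l(s := l s - 1))) + 2 * (\<Sum>y<N. real y * Z y) - Alt N (\<lambda>b. \<Sum>x<N. W b x * jt_rest N b x) l"
    unfolding weighted_shift[of "\<lambda>v. (of_int (v - int N))\<^sup>2"] by (simp only: Alt_sum sum.distrib sum_distrib_left)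
  finally show ?thesis unfolding first second by simp
qed

end

section \<open>Young diagrams as strictly decreasing tuples\<close>

definition rowlen :: "nat list \<Rightarrow> nat \<Rightarrow> nat" where
  "rowlen l i = (if i < length l then l ! i else 0)"

text \<open>These are the beta-numbers of a partition: the last box of row $i$ has content $l_i - N$,
  and a box added to that row has content $l_i - N + 1$.\<close>

definition beta_tuple :: "nat \<Rightarrow> nat list \<Rightarrow> nat \<Rightarrow> int" where
  "beta_tuple N l i = int (rowlen l i) + int N - 1 - int i"

lemma mem_boxes: "(i, j) \<in> boxes l \<longleftrightarrow> j < rowlen l i"
  by (auto simp: boxes_def rowlen_def)

lemma rowlen_antimono: "young l \<Longrightarrow> i \<le> j \<Longrightarrow> rowlen l j \<le> rowlen l i"
  unfolding young_def rowlen_def by (auto simp: sorted_wrt_iff_nth_less le_less)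

lemma rowlen_pos: "young l \<Longrightarrow> 0 < rowlen l i \<longleftrightarrow> i < length l"
  unfolding young_def rowlen_def by (auto simp: in_set_conv_nth)

lemma rowlen_inj:
  assumes "young l" "young m" "rowlen l = rowlen m"
  shows "l = m"
proof -
  have "i < length l \<longleftrightarrow> i < length m" for i
    using rowlen_pos[OF assms(1)] rowlen_pos[OF assms(2)] assms(3) by metis
  hence len: "length l = length m" by (meson linorder_neqE_nat nat_less_le)
  show ?thesis
  proof (rule nth_equalityI[OF len])
    fix i assume "i < length l"
    thus "l ! i = m ! i" using fun_cong[OF assms(3), of i] len by (simp add: rowlen_def)
  qed
qed

lemma sum_rowlen: "length l \<le> N \<Longrightarrow> (\<Sum>i<N. rowlen l i) = sum_list l"
proof -
  assume "length l \<le> N"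
  hence "(\<Sum>i<N. rowlen l i) = (\<Sum>i<length l. rowlen l i)"
    by (intro sum.mono_neutral_right) (auto simp: rowlen_def)
  also have "\<dots> = sum_list l" by (simp add: rowlen_def sum_list_sum_nth atLeast0LessThan)
  finally show ?thesis .
qed

lemma tuple_size_beta_tuple: "length l \<le> N \<Longrightarrow> tuple_size N (beta_tuple N l) = int (sum_list l)"
  unfolding tuple_size_def beta_tuple_def using sum_rowlen[of l N] by (simp flip: of_nat_sum)

lemma length_le_sum_list: "young l \<Longrightarrow> length l \<le> sum_list l"
proof -
  assume y: "young l"
  have "length l = (\<Sum>i<length l. 1)" by simp
  also have "\<dots> \<le> (\<Sum>i<length l. rowlen l i)"
    using rowlen_pos[OF y] by (intro sum_mono) (auto simp: Suc_le_eq)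
  finally show ?thesis by (simp add: sum_rowlen)
qed

lemma strictly_dec_beta_tuple: "young l \<Longrightarrow> strictly_dec N (beta_tuple N l)"
proof -
  assume y: "young l"
  show ?thesis unfolding strictly_dec_def
  proof (intro allI impI)
    fix i j :: nat assume "i < j"
    hence "rowlen l j \<le> rowlen l i" by (intro rowlen_antimono[OF y]) simp
    thus "beta_tuple N l j < beta_tuple N l i" using \<open>i < j\<close> by (simp add: beta_tuple_def)
  qed
qed

lemma nonneg_beta_tuple: "nonneg N (beta_tuple N l)"
  by (auto simp: nonneg_def beta_tuple_def)

definition ylist :: "(nat \<Rightarrow> nat) \<Rightarrow> nat list" where
  "ylist f = map f [0..<(LEAST i. f i = 0)]"

lemma ylist:
  assumes "antimono f" "f N = 0"
  shows "young (ylist f)" "rowlen (ylist f) = f" "length (ylist f) \<le> N"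
proof -
  define k where "k = (LEAST i. f i = 0)"
  have k0: "f k = 0" unfolding k_def by (rule LeastI) (rule assms(2))
  have kl: "f i \<noteq> 0" if "i < k" for i using not_less_Least[of i "\<lambda>i. f i = 0"] that by (simp add: k_def)
  have ge: "f i = 0" if "k \<le> i" for i using antimonoD[OF assms(1) that] k0 by simp
  show "young (ylist f)"
  proof -
    have "sorted_wrt (\<ge>) (map f [0..<k])"
      using antimonoD[OF assms(1)] by (auto simp: sorted_wrt_iff_nth_less)
    moreover have "0 \<notin> set (map f [0..<k])"
      using kl by force
    ultimately show ?thesis unfolding young_def ylist_def k_def by (rule conjI)
  qed
  show "rowlen (ylist f) = f"
    unfolding rowlen_def ylist_def k_def[symmetric] using ge by (auto simp: fun_eq_iff)
  show "length (ylist f) \<le> N"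
    unfolding ylist_def using Least_le[of "\<lambda>i. f i = 0" N] assms(2) by simp
qed

text \<open>Subtracting the staircase turns strict decrease into weak decrease, hence into the row
  lengths of a partition.\<close>

lemma strictly_dec_nonneg_is_beta_tuple:
  assumes "strictly_dec N l" "nonneg N l"
  obtains m where "young m" "length m \<le> N" "\<And>i. i < N \<Longrightarrow> beta_tuple N m i = l i"
proof -
  define f where "f i = (if i < N then nat (l i - (int N - 1 - int i)) else 0)" for i
  have "antimono f"
  proof (rule antimonoI)
    fix i j :: nat assume "i \<le> j"
    show "f j \<le> f i"
    proof (cases "j < N")
      case True
      have "l j - (int N - 1 - int j) \<le> l i - (int N - 1 - int i)" if "i + d = j" for d
        using that True
      proof (induction d arbitrary: j)
        case (Suc d)
        have "l (Suc (i + d)) < l (i + d)" using assms(1) Suc.prems by (auto simp: strictly_dec_def)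
        with Suc.IH[of "i + d"] Suc.prems show ?case by auto
      qed simp
      from this[of "j - i"] \<open>i \<le> j\<close> True show ?thesis by (simp add: f_def)
    qed (simp add: f_def)
  qed
  moreover have "f N = 0" by (simp add: f_def)
  moreover have "beta_tuple N (ylist f) i = l i" if "i < N" for i
  proof -
    have "rowlen (ylist f) i = f i" by (rule fun_cong[OF ylist(2)]) (fact calculation)+
    thus ?thesis using strictly_dec_lower[OF assms that] that by (simp add: beta_tuple_def f_def)
  qed
  ultimately show ?thesis using that[of "ylist f"] ylist by blast
qed

lemma downY_row:
  assumes "young l" "m \<in> downY l"
  obtains s where "s < length l" "rowlen m = (rowlen l)(s := rowlen l s - 1)" "0 < rowlen l s"
proof -
  have m: "young m" "boxes m \<subseteq> boxes l" "sum_list m + 1 = sum_list l" using assms(2) by (auto simp: downY_def)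
  have le: "rowlen m i \<le> rowlen l i" for i
  proof (rule ccontr)
    assume "\<not> rowlen m i \<le> rowlen l i"
    hence "(i, rowlen l i) \<in> boxes m" by (simp add: mem_boxes)
    hence "(i, rowlen l i) \<in> boxes l" using m(2) by blast
    thus False by (simp add: mem_boxes)
  qed
  define N where "N = max (length l) (length m)"
  have "(\<Sum>i<N. rowlen l i) = (\<Sum>i<N. rowlen m i) + 1"
    using m(3) by (simp add: sum_rowlen N_def)
  hence d: "(\<Sum>i<N. rowlen l i - rowlen m i) = 1"
    using le by (subst sum_subtractf_nat) auto
  then obtain s where s: "s < N" "rowlen l s - rowlen m s = 1" "\<And>i. i < N \<Longrightarrow> i \<noteq> s \<Longrightarrow> rowlen l i - rowlen m i = 0"
    by (subst (asm) sum_eq_1_iff) auto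
  have eq: "rowlen m i = rowlen l i" if "i \<noteq> s" for i
  proof (cases "i < N")
    case True thus ?thesis using s(3)[OF True that] le[of i] by simp
  qed (auto simp: rowlen_def N_def)
  have "0 < rowlen l s" using s(2) by simp
  moreover have "s < length l" using calculation rowlen_pos[OF assms(1)] by simp
  moreover have "rowlen m = (rowlen l)(s := rowlen l s - 1)"
    using eq s(2) by (auto simp: fun_eq_iff)
  ultimately show ?thesis using that by blast
qed

lemma downY_I:
  assumes "young l" "young m" "rowlen m = (rowlen l)(s := rowlen l s - 1)" "0 < rowlen l s"
  shows "m \<in> downY l"
proof -
  define N where "N = max (length l) (length m)"
  have s: "s < N" using rowlen_pos[OF assms(1)] assms(4) by (auto simp: N_def)
  have "sum_list m = (\<Sum>i<N. rowlen m i)" by (simp add: sum_rowlen N_def)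
  also have "\<dots> = (rowlen l s - 1) + (\<Sum>i\<in>{..<N}-{s}. rowlen l i)"
    using s assms(3) by (subst sum.remove[of _ s]) (auto intro!: sum.cong)
  also have "\<dots> + 1 = (\<Sum>i<N. rowlen l i)" using s assms(4) by (subst sum.remove[of "{..<N}" s]) auto
  also have "\<dots> = sum_list l" by (simp add: sum_rowlen N_def)
  finally have "sum_list m + 1 = sum_list l" .
  moreover have "boxes m \<subseteq> boxes l"
    using assms(3) by (auto simp: mem_boxes split: if_splits)
  ultimately show ?thesis using assms(2) by (simp add: downY_def)
qed

lemma finite_boxes [simp]: "finite (boxes l)"
proof -
  have "boxes l \<subseteq> Sigma {..<length l} (\<lambda>i. {..<l ! i})" by (auto simp: boxes_def)
  thus ?thesis by (rule finite_subset) auto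
qed

lemma boxes_downY:
  assumes "rowlen m = (rowlen l)(s := rowlen l s - 1)" "0 < rowlen l s"
  shows "boxes l - boxes m = {(s, rowlen l s - 1)}" "boxes m \<subseteq> boxes l"
  using assms by (auto simp: mem_boxes split: if_splits)

lemma beta_tuple_downY: "rowlen m = (rowlen l)(s := rowlen l s - 1) \<Longrightarrow> 0 < rowlen l s \<Longrightarrow> beta_tuple N m = (beta_tuple N l)(s := beta_tuple N l s - 1)"
  by (auto simp: beta_tuple_def fun_eq_iff)

definition corner :: "nat list \<Rightarrow> nat \<Rightarrow> bool" where
  "corner l s \<longleftrightarrow> rowlen l (Suc s) < rowlen l s"

definition dec :: "nat list \<Rightarrow> nat \<Rightarrow> nat list" where
  "dec l s = ylist ((rowlen l)(s := rowlen l s - 1))"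

lemma dec:
  assumes "young l" "corner l s"
  shows "young (dec l s)" "rowlen (dec l s) = (rowlen l)(s := rowlen l s - 1)"
proof -
  have am: "antimono ((rowlen l)(s := rowlen l s - 1))"
  proof (rule antimonoI)
    fix i j :: nat assume ij: "i \<le> j"
    have "rowlen l j \<le> rowlen l i" using rowlen_antimono[OF assms(1) ij] .
    moreover have "rowlen l j \<le> rowlen l s - 1" if "s < j"
      using rowlen_antimono[OF assms(1), of "Suc s" j] that assms(2) by (simp add: corner_def)
    ultimately show "((rowlen l)(s := rowlen l s - 1)) j \<le> ((rowlen l)(s := rowlen l s - 1)) i"
      using ij by (auto simp: le_less)
  qed
  have z: "((rowlen l)(s := rowlen l s - 1)) (length l) = 0"
    using assms(2) by (auto simp: rowlen_def corner_def)
  show "young (dec l s)" "rowlen (dec l s) = (rowlen l)(s := rowlen l s - 1)"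
    unfolding dec_def by (rule ylist[OF am z])+
qed

lemma dec_bij:
  assumes y: "young l"
  shows "bij_betw (dec l) {s. corner l s} (downY l)"
  unfolding bij_betw_def
proof
  show "inj_on (dec l) {s. corner l s}"
  proof (rule inj_onI)
    fix s t assume "s \<in> {s. corner l s}" "t \<in> {s. corner l s}" "dec l s = dec l t"
    hence "(rowlen l)(s := rowlen l s - 1) = (rowlen l)(t := rowlen l t - 1)" and "rowlen l s > 0"
      using dec(2)[OF y] by (metis mem_Collect_eq) (use \<open>s \<in> _\<close> in \<open>auto simp: corner_def\<close>)
    thus "s = t" by (metis diff_less fun_upd_apply less_irrefl zero_less_one)
  qed
  show "dec l ` {s. corner l s} = downY l"
  proof
    show "dec l ` {s. corner l s} \<subseteq> downY l"
    proof safe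
      fix s assume s: "corner l s"
      hence "0 < rowlen l s" by (simp add: corner_def)
      thus "dec l s \<in> downY l" using dec[OF y s] y by (intro downY_I) auto
    qed
    show "downY l \<subseteq> dec l ` {s. corner l s}"
    proof
      fix m assume m: "m \<in> downY l"
      obtain s where s: "rowlen m = (rowlen l)(s := rowlen l s - 1)" "0 < rowlen l s" using downY_row[OF y m] by metis
      have ym: "young m" using m by (simp add: downY_def)
      have "rowlen m (Suc s) \<le> rowlen m s" by (rule rowlen_antimono[OF ym]) simp
      hence c: "corner l s" using s by (simp add: corner_def)
      have "m = dec l s" by (rule rowlen_inj[OF ym dec(1)[OF y c]]) (simp only: dec(2)[OF y c] s)
      thus "m \<in> dec l ` {s. corner l s}" using c by auto
    qed
  qed
qed

lemma finite_downY: "young l \<Longrightarrow> finite (downY l)"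
proof -
  assume y: "young l"
  have "{s. corner l s} \<subseteq> {..<length l}" by (auto simp: corner_def rowlen_def split: if_splits)
  hence "finite {s. corner l s}" by (rule finite_subset) simp
  thus ?thesis using bij_betw_finite[OF dec_bij[OF y]] by simp
qed

text \<open>The right side also runs over rows without a removable box. There the lowered entry
  collides with the next one, or the last row, being empty, acquires the entry -1; \<open>g\<close>
  vanishes in both cases. \<open>W\<close> and \<open>H\<close> allow a weight that depends on the
  content of the removed box.\<close>

lemma sum_downY:
  fixes g :: "(nat \<Rightarrow> int) \<Rightarrow> real"
  assumes y: "young l" and len: "length l \<le> N"
    and coll: "\<And>b x y. x < N \<Longrightarrow> y < N \<Longrightarrow> x \<noteq> y \<Longrightarrow> b x = b y \<Longrightarrow> g b = 0"
    and neg: "\<And>b x. x < N \<Longrightarrow> b x < 0 \<Longrightarrow> g b = 0"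
    and W: "\<And>m s. m \<in> downY l \<Longrightarrow> rowlen m = (rowlen l)(s := rowlen l s - 1) \<Longrightarrow> 0 < rowlen l s \<Longrightarrow>
        W m = H (int (rowlen l s) - 1 - int s)"
  shows "(\<Sum>m\<in>downY l. W m * g (beta_tuple N m)) = (\<Sum>s<N. H (beta_tuple N l s - int N) * g ((beta_tuple N l)(s := beta_tuple N l s - 1)))"
proof -
  have "(\<Sum>m\<in>downY l. W m * g (beta_tuple N m)) = (\<Sum>s\<in>{s. corner l s}. W (dec l s) * g (beta_tuple N (dec l s)))"
    by (rule sum.reindex_bij_betw[OF dec_bij[OF y], symmetric])
  also have "\<dots> = (\<Sum>s\<in>{s. corner l s}. H (beta_tuple N l s - int N) * g ((beta_tuple N l)(s := beta_tuple N l s - 1)))"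
  proof (rule sum.cong[OF refl])
    fix s assume "s \<in> {s. corner l s}"
    hence c: "corner l s" by simp
    hence p: "0 < rowlen l s" by (simp add: corner_def)
    have r: "rowlen (dec l s) = (rowlen l)(s := rowlen l s - 1)" by (rule dec(2)[OF y c])
    have "dec l s \<in> downY l" using dec_bij[OF y] c by (auto simp: bij_betw_def)
    moreover have "beta_tuple N l s - int N = int (rowlen l s) - 1 - int s" by (simp add: beta_tuple_def)
    ultimately show "W (dec l s) * g (beta_tuple N (dec l s)) = H (beta_tuple N l s - int N) * g ((beta_tuple N l)(s := beta_tuple N l s - 1))"
      using W[OF _ r p] beta_tuple_downY[OF r p, of N] by simp
  qed
  also have "\<dots> = (\<Sum>s<N. H (beta_tuple N l s - int N) * g ((beta_tuple N l)(s := beta_tuple N l s - 1)))"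
  proof (rule sum.mono_neutral_left)
    show "{s. corner l s} \<subseteq> {..<N}" using len by (auto simp: corner_def rowlen_def split: if_splits)
    show "\<forall>s\<in>{..<N} - {s. corner l s}. H (beta_tuple N l s - int N) * g ((beta_tuple N l)(s := beta_tuple N l s - 1)) = 0"
    proof
      fix s assume s: "s \<in> {..<N} - {s. corner l s}"
      hence eq: "rowlen l (Suc s) = rowlen l s"
        using rowlen_antimono[OF y, of s "Suc s"] by (auto simp: corner_def)
      have "g ((beta_tuple N l)(s := beta_tuple N l s - 1)) = 0"
      proof (cases "Suc s < N")
        case True
        thus ?thesis using s eq by (intro coll[of s "Suc s"]) (auto simp: beta_tuple_def)
      next
        case False
        hence "Suc s = N" using s by auto
        hence "rowlen l s = 0" using eq len by (auto simp: rowlen_def)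
        thus ?thesis using s \<open>Suc s = N\<close> by (intro neg[of s]) (auto simp: beta_tuple_def)
      qed
      thus "H (beta_tuple N l s - int N) * g ((beta_tuple N l)(s := beta_tuple N l s - 1)) = 0" by simp
    qed
  qed simp
  finally show ?thesis .
qed

section \<open>Adding boxes to Young diagrams\<close>

definition upY :: "nat list \<Rightarrow> nat list set" where
  "upY l = {m. young m \<and> l \<in> downY m}"

definition addable :: "nat list \<Rightarrow> nat \<Rightarrow> bool" where
  "addable l s \<longleftrightarrow> s = 0 \<or> rowlen l s < rowlen l (s - 1)"

definition inc :: "nat list \<Rightarrow> nat \<Rightarrow> nat list" where
  "inc l s = ylist ((rowlen l)(s := rowlen l s + 1))"

lemma inc:
  assumes "young l" "addable l s"
  shows "young (inc l s)" "rowlen (inc l s) = (rowlen l)(s := rowlen l s + 1)"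
proof -
  have am: "antimono ((rowlen l)(s := rowlen l s + 1))"
  proof (rule antimonoI)
    fix i j :: nat assume ij: "i \<le> j"
    have "rowlen l j \<le> rowlen l i" using rowlen_antimono[OF assms(1) ij] .
    moreover have "rowlen l s + 1 \<le> rowlen l i" if "i < s"
    proof -
      have "rowlen l (s - 1) \<le> rowlen l i" using that by (intro rowlen_antimono[OF assms(1)]) auto
      thus ?thesis using that assms(2) by (auto simp: addable_def)
    qed
    ultimately show "((rowlen l)(s := rowlen l s + 1)) j \<le> ((rowlen l)(s := rowlen l s + 1)) i"
      using ij by (auto simp: le_less)
  qed
  have z: "((rowlen l)(s := rowlen l s + 1)) (Suc (max s (length l))) = 0"
    by (auto simp: rowlen_def)
  show "young (inc l s)" "rowlen (inc l s) = (rowlen l)(s := rowlen l s + 1)"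
    unfolding inc_def by (rule ylist[OF am z])+
qed

lemma inc_bij:
  assumes y: "young l"
  shows "bij_betw (inc l) {s. addable l s} (upY l)"
  unfolding bij_betw_def
proof
  show "inj_on (inc l) {s. addable l s}"
  proof (rule inj_onI)
    fix s t assume "s \<in> {s. addable l s}" "t \<in> {s. addable l s}" "inc l s = inc l t"
    hence "(rowlen l)(s := rowlen l s + 1) = (rowlen l)(t := rowlen l t + 1)"
      using inc(2)[OF y] by (metis mem_Collect_eq)
    thus "s = t" by (metis add_cancel_right_right fun_upd_apply zero_neq_one)
  qed
  show "inc l ` {s. addable l s} = upY l"
  proof
    show "inc l ` {s. addable l s} \<subseteq> upY l"
    proof safe
      fix s assume s: "addable l s"
      have "l \<in> downY (inc l s)"
        using inc[OF y s] y by (intro downY_I[of _ _ s]) auto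
      thus "inc l s \<in> upY l" using inc(1)[OF y s] by (simp add: upY_def)
    qed
    show "upY l \<subseteq> inc l ` {s. addable l s}"
    proof
      fix m assume m: "m \<in> upY l"
      hence ym: "young m" and d: "l \<in> downY m" by (auto simp: upY_def)
      obtain s where s: "rowlen l = (rowlen m)(s := rowlen m s - 1)" "0 < rowlen m s" using downY_row[OF ym d] by metis
      have rm: "rowlen m = (rowlen l)(s := rowlen l s + 1)" using s by (auto simp: fun_eq_iff)
      have "rowlen m s \<le> rowlen m (s - 1)" by (rule rowlen_antimono[OF ym]) simp
      hence c: "addable l s" unfolding rm by (auto simp: addable_def split: if_splits)
      have "m = inc l s" by (rule rowlen_inj[OF ym inc(1)[OF y c]]) (simp only: inc(2)[OF y c] rm)
      thus "m \<in> inc l ` {s. addable l s}" using c by auto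
    qed
  qed
qed

text \<open>A row that cannot be lengthened is as long as the row above it, and raising its entry
  collides with that row. The strict bound on the length leaves an empty row for a box that opens a
  new row.\<close>

lemma sum_upY:
  fixes g :: "(nat \<Rightarrow> int) \<Rightarrow> real"
  assumes y: "young l" and len: "length l < N"
    and coll: "\<And>b x y. x < N \<Longrightarrow> y < N \<Longrightarrow> x \<noteq> y \<Longrightarrow> b x = b y \<Longrightarrow> g b = 0"
    and W: "\<And>m s. m \<in> upY l \<Longrightarrow> rowlen m = (rowlen l)(s := rowlen l s + 1) \<Longrightarrow> W m = H (int (rowlen l s) - int s)"
  shows "(\<Sum>m\<in>upY l. W m * g (beta_tuple N m)) = (\<Sum>s<N. H (beta_tuple N l s - int N + 1) * g ((beta_tuple N l)(s := beta_tuple N l s + 1)))"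
proof -
  have "(\<Sum>m\<in>upY l. W m * g (beta_tuple N m)) = (\<Sum>s\<in>{s. addable l s}. W (inc l s) * g (beta_tuple N (inc l s)))"
    by (rule sum.reindex_bij_betw[OF inc_bij[OF y], symmetric])
  also have "\<dots> = (\<Sum>s\<in>{s. addable l s}. H (beta_tuple N l s - int N + 1) * g ((beta_tuple N l)(s := beta_tuple N l s + 1)))"
  proof (rule sum.cong[OF refl])
    fix s assume "s \<in> {s. addable l s}"
    hence c: "addable l s" by simp
    have r: "rowlen (inc l s) = (rowlen l)(s := rowlen l s + 1)" by (rule inc(2)[OF y c])
    have "inc l s \<in> upY l" using inc_bij[OF y] c by (auto simp: bij_betw_def)
    moreover have "beta_tuple N (inc l s) = (beta_tuple N l)(s := beta_tuple N l s + 1)"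
      using r by (auto simp: beta_tuple_def fun_eq_iff)
    moreover have "beta_tuple N l s - int N + 1 = int (rowlen l s) - int s" by (simp add: beta_tuple_def)
    ultimately show "W (inc l s) * g (beta_tuple N (inc l s)) = H (beta_tuple N l s - int N + 1) * g ((beta_tuple N l)(s := beta_tuple N l s + 1))"
      using W[OF _ r] by simp
  qed
  also have "\<dots> = (\<Sum>s<N. H (beta_tuple N l s - int N + 1) * g ((beta_tuple N l)(s := beta_tuple N l s + 1)))"
  proof (rule sum.mono_neutral_left)
    show "{s. addable l s} \<subseteq> {..<N}"
    proof
      fix s assume "s \<in> {s. addable l s}"
      hence "s = 0 \<or> s - 1 < length l" by (auto simp: addable_def rowlen_def split: if_splits)
      thus "s \<in> {..<N}" using len by auto
    qed
    show "\<forall>s\<in>{..<N} - {s. addable l s}. H (beta_tuple N l s - int N + 1) * g ((beta_tuple N l)(s := beta_tuple N l s + 1)) = 0"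
    proof
      fix s assume s: "s \<in> {..<N} - {s. addable l s}"
      hence "s > 0" "rowlen l (s - 1) = rowlen l s"
        using rowlen_antimono[OF y, of "s - 1" s] by (auto simp: addable_def)
      hence "g ((beta_tuple N l)(s := beta_tuple N l s + 1)) = 0"
        using s by (intro coll[of s "s - 1"]) (auto simp: beta_tuple_def of_nat_diff)
      thus "H (beta_tuple N l s - int N + 1) * g ((beta_tuple N l)(s := beta_tuple N l s + 1)) = 0" by simp
    qed
  qed simp
  finally show ?thesis .
qed

lemma YD_young: "l \<in> YD n \<Longrightarrow> young l" "l \<in> YD n \<Longrightarrow> sum_list l = n" "l \<in> YD n \<Longrightarrow> length l \<le> n"
  using length_le_sum_list by (auto simp: YD_def)

lemma finite_YD: "finite (YD n)"
proof -
  have "YD n \<subseteq> {xs. set xs \<subseteq> {..n} \<and> length xs \<le> n}"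
    using YD_young(2,3) by (auto dest: member_le_sum_list)
  thus ?thesis by (rule finite_subset) (simp add: finite_lists_length_le)
qed

lemma sum_YD_swap:
  fixes f :: "nat list \<Rightarrow> nat list \<Rightarrow> real"
  shows "(\<Sum>m\<in>YD (Suc n). \<Sum>l\<in>downY m. f l m) = (\<Sum>l\<in>YD n. \<Sum>m\<in>upY l. f l m)"
proof -
  have fin: "finite (upY l)" if "l \<in> YD n" for l
  proof -
    have "upY l \<subseteq> YD (Suc n)" using that by (auto simp: upY_def YD_def downY_def)
    thus ?thesis using finite_YD finite_subset by blast
  qed
  have "(\<Sum>m\<in>YD (Suc n). \<Sum>l\<in>downY m. f l m) = (\<Sum>(m,l)\<in>Sigma (YD (Suc n)) downY. f l m)"
    by (rule sum.Sigma) (auto simp: finite_YD finite_downY YD_young)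
  also have "\<dots> = (\<Sum>(l,m)\<in>Sigma (YD n) upY. f l m)"
    by (rule sum.reindex_bij_witness[where i="\<lambda>(l,m). (m,l)" and j="\<lambda>(m,l). (l,m)"])
       (auto simp: YD_def upY_def downY_def)
  also have "\<dots> = (\<Sum>l\<in>YD n. \<Sum>m\<in>upY l. f l m)"
    by (rule sum.Sigma[symmetric]) (auto simp: finite_YD fin)
  finally show ?thesis .
qed

section \<open>Standard tableaux\<close>

definition SYT :: "nat list \<Rightarrow> (nat \<times> nat \<Rightarrow> nat) set" where
  "SYT l = {T \<in> boxes l \<rightarrow>\<^sub>E {1..sum_list l}.
      bij_betw T (boxes l) {1..sum_list l} \<and>
      (\<forall>i j i' j'. (i, j) \<in> boxes l \<and> (i', j') \<in> boxes l \<and> i \<le> i' \<and> j \<le> j'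
          \<and> (i, j) \<noteq> (i', j') \<longrightarrow> T (i, j) < T (i', j'))}"

lemma dimY_SYT: "dimY l = card (SYT l)"
  by (simp add: dimY_def SYT_def)

lemma dimY_Nil: "dimY [] = 1"
proof -
  have b: "boxes [] = {}" by (auto simp: boxes_def)
  have "SYT [] = {\<lambda>x. undefined}" unfolding SYT_def b by (auto simp: bij_betw_def)
  thus ?thesis by (simp add: dimY_SYT)
qed

text \<open>Deleting the largest entry and putting it back are inverse bijections between these
  tableaux and those of the smaller diagram.\<close>

lemma SYT_corner_card:
  assumes y: "young l" and c: "corner l s"
  shows "card {T \<in> SYT l. T (s, rowlen l s - 1) = sum_list l} = dimY (dec l s)"
proof -
  define m where "m = dec l s"
  define n where "n = sum_list l"
  define b where "b = (s, rowlen l s - 1)"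
  have pos: "0 < rowlen l s" using c by (simp add: corner_def)
  have r: "rowlen m = (rowlen l)(s := rowlen l s - 1)" unfolding m_def by (rule dec(2)[OF y c])
  have ym: "young m" unfolding m_def by (rule dec(1)[OF y c])
  have "m \<in> downY l" by (rule downY_I[OF y ym r pos])
  hence sm: "sum_list m + 1 = n" by (simp add: downY_def n_def)
  have bx: "boxes l = boxes m \<union> {b}" "b \<notin> boxes m"
    using boxes_downY[OF r pos] by (auto simp: b_def)
  have rng: "{1..n} = {1..sum_list m} \<union> {n}" "n \<notin> {1..sum_list m}" using sm by auto
  have "bij_betw (\<lambda>T. restrict T (boxes m)) {T \<in> SYT l. T b = n} (SYT m)"
  proof (rule bij_betwI[where g="\<lambda>T. T(b := n)"])
    show "(\<lambda>T. restrict T (boxes m)) \<in> {T \<in> SYT l. T b = n} \<rightarrow> SYT m"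
    proof
      fix T assume "T \<in> {T \<in> SYT l. T b = n}"
      hence T: "T \<in> boxes l \<rightarrow>\<^sub>E {1..n}" "bij_betw T (boxes l) {1..n}" "T b = n"
        "\<And>i j i' j'. (i, j) \<in> boxes l \<Longrightarrow> (i', j') \<in> boxes l \<Longrightarrow> i \<le> i' \<Longrightarrow> j \<le> j' \<Longrightarrow> (i, j) \<noteq> (i', j') \<Longrightarrow> T (i, j) < T (i', j')"
        by (auto simp: SYT_def n_def)
      have "bij_betw T (boxes m \<union> {b}) ({1..sum_list m} \<union> {T b})"
        using T(2,3) bx(1) rng(1) by simp
      hence "bij_betw T (boxes m) {1..sum_list m}"
        using notIn_Un_bij_betw3[of b "boxes m" T "{1..sum_list m}"] bx(2) rng(2) T(3) by simp
      hence bj: "bij_betw (restrict T (boxes m)) (boxes m) {1..sum_list m}"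
        by (simp add: bij_betw_restrict_eq)
      have "restrict T (boxes m) \<in> boxes m \<rightarrow>\<^sub>E {1..sum_list m}"
        using bij_betwE[OF bj] by auto
      thus "restrict T (boxes m) \<in> SYT m" unfolding SYT_def using bj T(4) bx(1) by auto
    qed
    show "(\<lambda>T. T(b := n)) \<in> SYT m \<rightarrow> {T \<in> SYT l. T b = n}"
    proof
      fix T assume "T \<in> SYT m"
      hence T: "T \<in> boxes m \<rightarrow>\<^sub>E {1..sum_list m}" "bij_betw T (boxes m) {1..sum_list m}"
        "\<And>i j i' j'. (i, j) \<in> boxes m \<Longrightarrow> (i', j') \<in> boxes m \<Longrightarrow> i \<le> i' \<Longrightarrow> j \<le> j' \<Longrightarrow> (i, j) \<noteq> (i', j') \<Longrightarrow> T (i, j) < T (i', j')"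
        by (auto simp: SYT_def)
      let ?T = "T(b := n)"
      have "bij_betw ?T (boxes m) {1..sum_list m}"
        using T(2) bx(2) by (subst bij_betw_cong[of _ _ T]) auto
      hence bj: "bij_betw ?T (boxes l) {1..n}"
        using notIn_Un_bij_betw3[of b "boxes m" ?T "{1..sum_list m}"] bx rng by simp
      have ext: "?T \<in> boxes l \<rightarrow>\<^sub>E {1..n}"
        using bij_betwE[OF bj] T(1) bx by (auto simp: PiE_def extensional_def)
      have beta_tuple: "T x < n" if "x \<in> boxes m" for x
        using bij_betwE[OF T(2)] that sm by force
      \<comment> \<open>No box of the smaller diagram lies weakly below and to the right of the
        corner, so inserting the maximal entry there breaks no order relation.\<close>
      have nob: "\<not> (s \<le> i \<and> rowlen l s - 1 \<le> j)" if "(i, j) \<in> boxes m" for i j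
      proof
        assume a: "s \<le> i \<and> rowlen l s - 1 \<le> j"
        have j: "j < rowlen m i" using that by (simp add: mem_boxes)
        have "rowlen m i \<le> rowlen m s" by (rule rowlen_antimono[OF ym]) (use a in simp)
        thus False using a j r by simp
      qed
      have mono: "?T (i, j) < ?T (i', j')"
        if "(i, j) \<in> boxes l" "(i', j') \<in> boxes l" "i \<le> i'" "j \<le> j'" "(i, j) \<noteq> (i', j')" for i j i' j'
      proof (cases "(i', j') = b")
        case True
        hence "(i, j) \<in> boxes m" using that bx by auto
        thus ?thesis using beta_tuple bx(2) True by auto
      next
        case False
        hence m': "(i', j') \<in> boxes m" using that bx by auto
        have "(i, j) \<noteq> b" using nob[OF m'] that by (auto simp: b_def)
        hence "(i, j) \<in> boxes m" using that bx by auto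
        thus ?thesis using T(3)[OF _ m' that(3-5)] \<open>(i, j) \<noteq> b\<close> False by simp
      qed
      show "?T \<in> {T \<in> SYT l. T b = n}"
        unfolding SYT_def using ext bj mono by (simp add: n_def)
    qed
    show "(restrict T (boxes m))(b := n) = T" if "T \<in> {T \<in> SYT l. T b = n}" for T
    proof
      fix x
      have "T \<in> boxes l \<rightarrow>\<^sub>E {1..n}" "T b = n" using that by (auto simp: SYT_def n_def)
      thus "((restrict T (boxes m))(b := n)) x = T x" using bx by (cases x) (auto simp: PiE_def extensional_def)
    qed
    show "restrict (T(b := n)) (boxes m) = T" if "T \<in> SYT m" for T
    proof
      fix x
      have "T \<in> boxes m \<rightarrow>\<^sub>E {1..sum_list m}" using that by (auto simp: SYT_def)
      thus "restrict (T(b := n)) (boxes m) x = T x" using bx(2) by (cases x) (auto simp: PiE_def extensional_def restrict_def)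
    qed
  qed
  hence "card {T \<in> SYT l. T b = n} = card (SYT m)" by (rule bij_betw_same_card)
  thus ?thesis by (simp add: dimY_SYT m_def n_def b_def)
qed

lemma finite_SYT: "finite (SYT l)"
proof -
  have "SYT l \<subseteq> boxes l \<rightarrow>\<^sub>E {1..sum_list l}" by (auto simp: SYT_def)
  thus ?thesis by (rule finite_subset) (simp add: finite_PiE)
qed

text \<open>The largest entry has no box to its right or below it, hence sits in a corner; the
  tableaux are sorted by that corner.\<close>

lemma dimY_rec:
  assumes y: "young l" and n: "0 < sum_list l"
  shows "dimY l = (\<Sum>m\<in>downY l. dimY m)"
proof -
  define B where "B s = {T \<in> SYT l. T (s, rowlen l s - 1) = sum_list l}" for s
  have fin: "finite {s. corner l s}" using bij_betw_finite[OF dec_bij[OF y]] finite_downY[OF y] by simp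
  have inb: "(s, rowlen l s - 1) \<in> boxes l" if "corner l s" for s
    using that by (simp add: mem_boxes corner_def)
  have "SYT l = (\<Union>s\<in>{s. corner l s}. B s)"
  proof
    show "(\<Union>s\<in>{s. corner l s}. B s) \<subseteq> SYT l" by (auto simp: B_def)
    show "SYT l \<subseteq> (\<Union>s\<in>{s. corner l s}. B s)"
    proof
      fix T assume TS: "T \<in> SYT l"
      hence T: "bij_betw T (boxes l) {1..sum_list l}"
        "\<And>i j i' j'. (i, j) \<in> boxes l \<Longrightarrow> (i', j') \<in> boxes l \<Longrightarrow> i \<le> i' \<Longrightarrow> j \<le> j' \<Longrightarrow> (i, j) \<noteq> (i', j') \<Longrightarrow> T (i, j) < T (i', j')"
        by (auto simp: SYT_def)
      have "sum_list l \<in> T ` boxes l" using T(1) n by (simp add: bij_betw_def)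
      then obtain i j where ij: "(i, j) \<in> boxes l" "T (i, j) = sum_list l" by auto
      have le: "T x \<le> sum_list l" if "x \<in> boxes l" for x using bij_betwE[OF T(1)] that by auto
      have 1: "\<not> j + 1 < rowlen l i"
        using T(2)[of i j i "j + 1"] ij le[of "(i, j + 1)"] by (auto simp: mem_boxes)
      have 2: "\<not> j < rowlen l (Suc i)"
        using T(2)[of i j "Suc i" j] ij le[of "(Suc i, j)"] by (auto simp: mem_boxes)
      have j: "j < rowlen l i" using ij by (simp add: mem_boxes)
      have "corner l i" "j = rowlen l i - 1" using 1 2 j by (auto simp: corner_def)
      thus "T \<in> (\<Union>s\<in>{s. corner l s}. B s)" using ij(2) TS by (auto simp: B_def)
    qed
  qed
  hence "dimY l = card (\<Union>s\<in>{s. corner l s}. B s)" by (simp add: dimY_SYT)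
  also have "\<dots> = (\<Sum>s\<in>{s. corner l s}. card (B s))"
  proof (rule card_UN_disjoint[OF fin])
    show "\<forall>s\<in>{s. corner l s}. finite (B s)" using finite_SYT by (auto simp: B_def)
    show "\<forall>s\<in>{s. corner l s}. \<forall>t\<in>{s. corner l s}. s \<noteq> t \<longrightarrow> B s \<inter> B t = {}"
    proof (intro ballI impI)
      fix s t assume st: "s \<in> {s. corner l s}" "t \<in> {s. corner l s}" "s \<noteq> t"
      show "B s \<inter> B t = {}"
      proof (rule equals0I)
        fix T assume T: "T \<in> B s \<inter> B t"
        hence "inj_on T (boxes l)" by (auto simp: B_def SYT_def bij_betw_def)
        moreover have "T (s, rowlen l s - 1) = T (t, rowlen l t - 1)" using T by (simp add: B_def)
        ultimately have "(s, rowlen l s - 1) = (t, rowlen l t - 1)" using inb st by (auto dest!: inj_onD)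
        thus False using st by simp
      qed
    qed
  qed
  also have "\<dots> = (\<Sum>s\<in>{s. corner l s}. dimY (dec l s))"
    unfolding B_def using SYT_corner_card[OF y] by (intro sum.cong) auto
  also have "\<dots> = (\<Sum>m\<in>downY l. dimY m)"
    by (rule sum.reindex_bij_betw[OF dec_bij[OF y]])
  finally show ?thesis .
qed

section \<open>Dimensions of skew diagrams\<close>

text \<open>The value 0 at negative arguments is that of 1/\<Gamma>(x+1); with it the recursion in
  \<open>recip_fact_shift\<close> holds for all integers, including x = 0.\<close>

definition recip_fact :: "int \<Rightarrow> real" where
  "recip_fact x = (if x < 0 then 0 else 1 / fact (nat x))"

lemma recip_fact_shift: "recip_fact (x - 1) = of_int x * recip_fact x"
proof (cases "x \<ge> 1")
  case True
  hence "nat x = Suc (nat (x - 1))" by simp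
  hence f: "(fact (nat x) :: real) = of_int x * fact (nat (x - 1))" using True by simp
  show ?thesis using True unfolding recip_fact_def f by simp
qed (auto simp: recip_fact_def)

lemma recip_fact_nonneg: "0 \<le> recip_fact x" by (simp add: recip_fact_def)

text \<open>Aitken's determinant: $\dim(\lambda/\mu)$ is $(|\lambda|-|\mu|)!$ times its value at the tuples of $\lambda$ and $\mu$.\<close>

definition aitken :: "nat \<Rightarrow> (nat \<Rightarrow> int) \<Rightarrow> (nat \<Rightarrow> int) \<Rightarrow> real" where
  "aitken N l k = Alt N (\<lambda>b. \<Prod>j<N. recip_fact (l j - b j)) k"

lemma aitken_collision_right: "x < N \<Longrightarrow> y < N \<Longrightarrow> x \<noteq> y \<Longrightarrow> k x = k y \<Longrightarrow> aitken N l k = 0"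
  unfolding aitken_def by (rule Alt_collision)

lemma aitken_collision_left: "x < N \<Longrightarrow> y < N \<Longrightarrow> x \<noteq> y \<Longrightarrow> l x = l y \<Longrightarrow> aitken N l k = 0"
  unfolding aitken_def using Alt_prod_equal_columns[of x N y "\<lambda>j v. recip_fact (l j - v)" k] by simp

lemma aitken_neg:
  assumes "s < N" "l s < 0" "nonneg N k"
  shows "aitken N l k = 0"
  unfolding aitken_def Alt_def
proof (intro sum.neutral ballI)
  fix \<tau> assume "\<tau> \<in> {\<tau>. \<tau> permutes {..<N}}"
  hence "\<tau> s < N" using permutes_in_image[of \<tau> "{..<N}" s] assms(1) by auto
  hence "recip_fact (l s - (k \<circ> \<tau>) s) = 0" using assms by (auto simp: recip_fact_def nonneg_def add_strict_increasing)
  hence "(\<Prod>j<N. recip_fact (l j - (k \<circ> \<tau>) j)) = 0" using assms(1) by (intro prod_zero) auto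
  thus "of_int (sign \<tau>) * (\<Prod>j<N. recip_fact (l j - (k \<circ> \<tau>) j)) = 0" by simp
qed

lemma tuple_size_diff: "tuple_size N l - tuple_size N k = (\<Sum>i<N. l i - k i)"
  by (simp add: tuple_size_def sum_subtractf)

lemma tuple_size_diff_permute: "\<tau> permutes {..<N} \<Longrightarrow> tuple_size N l - tuple_size N k = (\<Sum>i<N. l i - (k \<circ> \<tau>) i)"
  using tuple_size_diff[of N l "k \<circ> \<tau>"] tuple_size_permute[of \<tau> N k] by simp

lemma recip_fact_prod_shift_right:
  fixes l b :: "nat \<Rightarrow> int"
  assumes "j < N"
  shows "(\<Prod>i<N. recip_fact (l i - (b(j := b j + 1)) i)) = of_int (l j - b j) * (\<Prod>i<N. recip_fact (l i - b i))"
proof -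
  have "(\<Prod>i<N. recip_fact (l i - (b(j := b j + 1)) i)) = recip_fact (l j - b j - 1) * (\<Prod>i\<in>{..<N}-{j}. recip_fact (l i - b i))"
    using prod_upd[OF assms, of "\<lambda>i v. recip_fact (l i - v)" b] by (simp add: algebra_simps)
  also have "\<dots> = of_int (l j - b j) * (\<Prod>i<N. recip_fact (l i - b i))"
    unfolding recip_fact_shift using assms by (simp add: prod.remove[of "{..<N}" j] mult.assoc)
  finally show ?thesis .
qed

lemma recip_fact_prod_shift_left:
  fixes l b :: "nat \<Rightarrow> int"
  assumes "j < N"
  shows "(\<Prod>i<N. recip_fact ((l(j := l j - 1)) i - b i)) = of_int (l j - b j) * (\<Prod>i<N. recip_fact (l i - b i))"
proof -
  have "(\<Prod>i<N. recip_fact ((l(j := l j - 1)) i - b i)) = recip_fact (l j - b j - 1) * (\<Prod>i\<in>{..<N}-{j}. recip_fact (l i - b i))"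
    using prod_upd[OF assms, of "\<lambda>i v. recip_fact (v - b i)" l] by (simp add: algebra_simps)
  also have "\<dots> = of_int (l j - b j) * (\<Prod>i<N. recip_fact (l i - b i))"
    unfolding recip_fact_shift using assms by (simp add: prod.remove[of "{..<N}" j] mult.assoc)
  finally show ?thesis .
qed

text \<open>Shifting the entry in slot j multiplies the product by l_j - b_j, and the sum of these
  factors is the difference of the sizes for every permutation. \<open>aitken_harmonic_left\<close>
  is the same computation in the other argument.\<close>

lemma aitken_harmonic_right:
  "(\<Sum>s<N. aitken N l (k(s := k s + 1))) = of_int (tuple_size N l - tuple_size N k) * aitken N l k"
proof -
  have "(\<Sum>s<N. aitken N l (k(s := k s + 1))) = Alt N (\<lambda>b. \<Sum>j<N. \<Prod>i<N. recip_fact (l i - (b(j := b j + 1)) i)) k"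
    using Alt_sum_shift[where N=N and H="\<lambda>_. 1" and b=k and E="\<lambda>b. \<Prod>j<N. recip_fact (l j - b j)" and a=1]
    by (simp add: aitken_def)
  also have "\<dots> = Alt N (\<lambda>b. of_int (tuple_size N l - tuple_size N k) * (\<Prod>i<N. recip_fact (l i - b i))) k"
  proof (rule Alt_cong)
    fix \<tau> assume p: "\<tau> permutes {..<N}"
    let ?b = "k \<circ> \<tau>"
    have "(\<Sum>j<N. \<Prod>i<N. recip_fact (l i - (?b(j := ?b j + 1)) i)) = (\<Sum>j<N. of_int (l j - ?b j) * (\<Prod>i<N. recip_fact (l i - ?b i)))"
      by (intro sum.cong refl recip_fact_prod_shift_right) simp
    thus "(\<Sum>j<N. \<Prod>i<N. recip_fact (l i - (?b(j := ?b j + 1)) i)) = of_int (tuple_size N l - tuple_size N k) * (\<Prod>i<N. recip_fact (l i - ?b i))"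
      unfolding tuple_size_diff_permute[OF p] of_int_sum sum_distrib_right .
  qed
  finally show ?thesis by (simp add: Alt_cmult aitken_def)
qed

lemma aitken_harmonic_left:
  "(\<Sum>s<N. aitken N (l(s := l s - 1)) k) = of_int (tuple_size N l - tuple_size N k) * aitken N l k"
proof -
  have "(\<Sum>s<N. aitken N (l(s := l s - 1)) k) = Alt N (\<lambda>b. \<Sum>j<N. \<Prod>i<N. recip_fact ((l(j := l j - 1)) i - b i)) k"
    by (simp only: aitken_def Alt_sum)
  also have "\<dots> = Alt N (\<lambda>b. of_int (tuple_size N l - tuple_size N k) * (\<Prod>i<N. recip_fact (l i - b i))) k"
  proof (rule Alt_cong)
    fix \<tau> assume p: "\<tau> permutes {..<N}"
    let ?b = "k \<circ> \<tau>"
    have "(\<Sum>j<N. \<Prod>i<N. recip_fact ((l(j := l j - 1)) i - ?b i)) = (\<Sum>j<N. of_int (l j - ?b j) * (\<Prod>i<N. recip_fact (l i - ?b i)))"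
      by (intro sum.cong refl recip_fact_prod_shift_left) simp
    thus "(\<Sum>j<N. \<Prod>i<N. recip_fact ((l(j := l j - 1)) i - ?b i)) = of_int (tuple_size N l - tuple_size N k) * (\<Prod>i<N. recip_fact (l i - ?b i))"
      unfolding tuple_size_diff_permute[OF p] of_int_sum sum_distrib_right .
  qed
  finally show ?thesis by (simp add: Alt_cmult aitken_def)
qed

text \<open>The difference w(l_j - N + 1) - w(b_j - N) is divisible by l_j - b_j + 1, and this
  divisor reduces 1/(l_j - b_j + 1)! to 1/(l_j - b_j)!. Since w is quadratic, the quotient is linear
  in l_j + b_j, so its sum over j depends only on the two sizes and not on the permutation.\<close>

lemma aitken_commutation:
  fixes A B :: real
  defines "w \<equiv> \<lambda>c::int. (of_int c)\<^sup>2 + B * of_int c + A"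
  shows "(\<Sum>r<N. w (l r - int N + 1) * aitken N (l(r := l r + 1)) k)
       - (\<Sum>s<N. w (k s - int N) * aitken N l (k(s := k s - 1)))
     = (of_int (tuple_size N l + tuple_size N k) - (real N)\<^sup>2 + real N * B) * aitken N l k"
proof -
  let ?R = "\<lambda>b j. \<Prod>i\<in>{..<N}-{j}. recip_fact (l i - b i)"
  have 1: "(\<Sum>r<N. w (l r - int N + 1) * aitken N (l(r := l r + 1)) k) = Alt N (\<lambda>b. \<Sum>j<N. w (l j - int N + 1) * (recip_fact (l j - b j + 1) * ?R b j)) k"
  proof -
    have e: "(\<Prod>i<N. recip_fact ((l(j := l j + 1)) i - b i)) = recip_fact (l j - b j + 1) * ?R b j" if "j < N" for j and b :: "nat \<Rightarrow> int"
      using prod_upd[OF that, of "\<lambda>i v. recip_fact (v - b i)" l] by (simp add: algebra_simps)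
    have "(\<Sum>r<N. w (l r - int N + 1) * aitken N (l(r := l r + 1)) k) = Alt N (\<lambda>b. \<Sum>j<N. w (l j - int N + 1) * (\<Prod>i<N. recip_fact ((l(j := l j + 1)) i - b i))) k"
      by (simp only: aitken_def Alt_sum Alt_cmult)
    also have "(\<lambda>b. \<Sum>j<N. w (l j - int N + 1) * (\<Prod>i<N. recip_fact ((l(j := l j + 1)) i - b i))) = (\<lambda>b. \<Sum>j<N. w (l j - int N + 1) * (recip_fact (l j - b j + 1) * ?R b j))"
      by (intro ext sum.cong refl) (simp only: e lessThan_iff)
    finally show ?thesis .
  qed
  have 2: "(\<Sum>s<N. w (k s - int N) * aitken N l (k(s := k s - 1))) = Alt N (\<lambda>b. \<Sum>j<N. w (b j - int N) * (recip_fact (l j - b j + 1) * ?R b j)) k"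
  proof -
    have e: "(\<Prod>i<N. recip_fact (l i - (b(j := b j - 1)) i)) = recip_fact (l j - b j + 1) * ?R b j" if "j < N" for j and b :: "nat \<Rightarrow> int"
      using prod_upd[OF that, of "\<lambda>i v. recip_fact (l i - v)" b] by (simp add: algebra_simps)
    have "(\<Sum>s<N. w (k s - int N) * aitken N l (k(s := k s - 1))) = Alt N (\<lambda>b. \<Sum>j<N. w (b j - int N) * (\<Prod>i<N. recip_fact (l i - (b(j := b j - 1)) i))) k"
      using Alt_sum_shift[where N=N and H="\<lambda>v. w (v - int N)" and b=k and E="\<lambda>b. \<Prod>j<N. recip_fact (l j - b j)" and a="-1"]
      by (simp add: aitken_def)
    also have "(\<lambda>b. \<Sum>j<N. w (b j - int N) * (\<Prod>i<N. recip_fact (l i - (b(j := b j - 1)) i))) = (\<lambda>b. \<Sum>j<N. w (b j - int N) * (recip_fact (l j - b j + 1) * ?R b j))"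
      by (intro ext sum.cong refl) (simp only: e lessThan_iff)
    finally show ?thesis .
  qed
  have "Alt N (\<lambda>b. (\<Sum>j<N. w (l j - int N + 1) * (recip_fact (l j - b j + 1) * ?R b j)) - (\<Sum>j<N. w (b j - int N) * (recip_fact (l j - b j + 1) * ?R b j))) k
     = Alt N (\<lambda>b. (of_int (tuple_size N l + tuple_size N k) - (real N)\<^sup>2 + real N * B) * (\<Prod>i<N. recip_fact (l i - b i))) k"
  proof (rule Alt_cong)
    fix \<tau> assume p: "\<tau> permutes {..<N}"
    let ?b = "k \<circ> \<tau>"
    have "(\<Sum>j<N. w (l j - int N + 1) * (recip_fact (l j - ?b j + 1) * ?R ?b j)) - (\<Sum>j<N. w (?b j - int N) * (recip_fact (l j - ?b j + 1) * ?R ?b j))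
       = (\<Sum>j<N. (of_int (l j + ?b j) - 2 * real N + 1 + B) * (\<Prod>i<N. recip_fact (l i - ?b i)))"
      unfolding sum_subtractf[symmetric]
    proof (rule sum.cong[OF refl])
      fix j assume "j \<in> {..<N}"
      hence P: "(\<Prod>i<N. recip_fact (l i - ?b i)) = recip_fact (l j - ?b j) * ?R ?b j" by (subst prod.remove[of _ j]) auto
      have s: "recip_fact (l j - ?b j) = of_int (l j - ?b j + 1) * recip_fact (l j - ?b j + 1)"
        using recip_fact_shift[of "l j - ?b j + 1"] by simp
      show "w (l j - int N + 1) * (recip_fact (l j - ?b j + 1) * ?R ?b j) - w (?b j - int N) * (recip_fact (l j - ?b j + 1) * ?R ?b j)
         = (of_int (l j + ?b j) - 2 * real N + 1 + B) * (\<Prod>i<N. recip_fact (l i - ?b i))"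
        unfolding P s w_def by (simp add: power2_eq_square algebra_simps)
    qed
    also have "\<dots> = ((\<Sum>j<N. of_int (l j + ?b j)) - 2 * real N * real N + real N + real N * B) * (\<Prod>i<N. recip_fact (l i - ?b i))"
      unfolding sum_distrib_right[symmetric] by (simp add: sum.distrib sum_subtractf algebra_simps)
    also have "(\<Sum>j<N. real_of_int (l j + ?b j)) = of_int (tuple_size N l) + of_int (tuple_size N k) + real N * (real N - 1)"
      using tuple_size_real[of N l] tuple_size_real[of N ?b] tuple_size_permute[OF p, of k] by (simp add: sum.distrib)
    finally show "(\<Sum>j<N. w (l j - int N + 1) * (recip_fact (l j - ?b j + 1) * ?R ?b j)) - (\<Sum>j<N. w (?b j - int N) * (recip_fact (l j - ?b j + 1) * ?R ?b j))
       = (of_int (tuple_size N l + tuple_size N k) - (real N)\<^sup>2 + real N * B) * (\<Prod>i<N. recip_fact (l i - ?b i))"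
      by (simp add: power2_eq_square algebra_simps)
  qed
  thus ?thesis unfolding 1 2 by (simp only: Alt_diff Alt_cmult aitken_def)
qed

text \<open>Supplies the removal from an empty last row, which the tuple identity
  \<open>aitken_commutation\<close> counts although no such box exists.\<close>

lemma aitken_last_row:
  assumes "l N = 0" "k N = 0" "nonneg (Suc N) k" "\<And>s. s < N \<Longrightarrow> 0 < k s"
  shows "aitken (Suc N) l (k(N := k N - 1)) = aitken (Suc N) l k"
  unfolding aitken_def Alt_def
proof (rule sum.cong[OF refl])
  fix \<tau> assume "\<tau> \<in> {\<tau>. \<tau> permutes {..<Suc N}}"
  hence p: "\<tau> permutes {..<Suc N}" by simp
  let ?b = "k(N := k N - 1)"
  have "(\<Prod>j<Suc N. recip_fact (l j - (?b \<circ> \<tau>) j)) = (\<Prod>j<Suc N. recip_fact (l j - (k \<circ> \<tau>) j))"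
  proof (cases "\<tau> N = N")
    case True
    have "\<tau> j \<noteq> N" if "j < N" for j using permutes_inj[OF p] True that by (metis injD less_irrefl)
    hence "(\<Prod>j<N. recip_fact (l j - (?b \<circ> \<tau>) j)) = (\<Prod>j<N. recip_fact (l j - (k \<circ> \<tau>) j))" by (intro prod.cong) auto
    thus ?thesis using True assms by (simp add: recip_fact_def)
  next
    case False
    have "\<tau> N < Suc N" using permutes_in_image[OF p, of N] by simp
    hence "0 < k (\<tau> N)" using False assms(4)[of "\<tau> N"] by simp
    thus ?thesis using False assms by (simp add: recip_fact_def)
  qed
  thus "of_int (sign \<tau>) * (\<Prod>j<Suc N. recip_fact (l j - (?b \<circ> \<tau>) j)) = of_int (sign \<tau>) * (\<Prod>j<Suc N. recip_fact (l j - (k \<circ> \<tau>) j))"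
    by simp
qed

text \<open>Strict monotonicity gives i \<le> \<tau> i, and both sides have the same sum over i <
  N.\<close>

lemma strict_mono_permutation_id:
  assumes p: "\<tau> permutes {..<N::nat}" and m: "\<And>i j. i < j \<Longrightarrow> j < N \<Longrightarrow> \<tau> i < \<tau> j"
  shows "\<tau> = id"
proof -
  have ge: "i \<le> \<tau> i" if "i < N" for i using that
  proof (induction i)
    case (Suc i) thus ?case using m[of i "Suc i"] by simp
  qed simp
  have "(\<Sum>i<N. \<tau> i - i) = (\<Sum>i<N. \<tau> i) - (\<Sum>i<N. i)" using ge by (intro sum_subtractf_nat) auto
  also have "\<dots> = 0" using sum_permute[OF p, of "\<lambda>i. i"] by simp
  finally have z: "(\<Sum>i<N. \<tau> i - i) = 0" .
  have "\<tau> i = i" if "i < N" for i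
  proof -
    have "\<tau> i - i = 0" using z that by (simp only: sum_eq_0_iff finite_lessThan) auto
    thus ?thesis using ge[OF that] by simp
  qed
  moreover have "\<tau> i = i" if "\<not> i < N" for i using permutes_not_in[OF p] that by simp
  ultimately show ?thesis by (auto simp: fun_eq_iff)
qed

text \<open>A nonzero product needs every l_j - k_{\<tau> j} to be nonnegative, while their sum is
  at most 0. So all of them are 0, and two strictly decreasing tuples with the same values agree
  entry by entry.\<close>

lemma aitken_support:
  assumes "tuple_size N l \<le> tuple_size N k" "strictly_dec N l" "strictly_dec N k" "\<tau> permutes {..<N}" "(\<Prod>j<N. recip_fact (l j - (k \<circ> \<tau>) j)) \<noteq> 0"
  shows "\<tau> = id" "\<And>j. j < N \<Longrightarrow> l j = k j"
proof -
  have ge: "0 \<le> l j - (k \<circ> \<tau>) j" if "j < N" for j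
  proof (rule ccontr)
    assume "\<not> 0 \<le> l j - (k \<circ> \<tau>) j"
    hence "recip_fact (l j - (k \<circ> \<tau>) j) = 0" by (simp add: recip_fact_def)
    hence "(\<Prod>j<N. recip_fact (l j - (k \<circ> \<tau>) j)) = 0" using that by (intro prod_zero) auto
    thus False using assms(5) by simp
  qed
  have s: "(\<Sum>j<N. l j - (k \<circ> \<tau>) j) \<le> 0" using tuple_size_diff_permute[OF assms(4), of l k] assms(1) by simp
  have "0 \<le> (\<Sum>j<N. l j - (k \<circ> \<tau>) j)" by (intro sum_nonneg ge) simp
  with s have "(\<Sum>j<N. l j - (k \<circ> \<tau>) j) = 0" by simp
  hence "\<forall>j\<in>{..<N}. l j - (k \<circ> \<tau>) j = 0" by (subst (asm) sum_nonneg_eq_0_iff) (use ge in auto)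
  hence eq: "l j = k (\<tau> j)" if "j < N" for j using that by simp
  show id: "\<tau> = id"
  proof (rule strict_mono_permutation_id[OF assms(4)])
    fix i j :: nat assume ij: "i < j" "j < N"
    have "l j < l i" using assms(2) ij by (simp add: strictly_dec_def)
    hence "k (\<tau> j) < k (\<tau> i)" using eq[of i] eq[of j] ij by simp
    moreover have "\<tau> i < N" "\<tau> j < N" using permutes_in_image[OF assms(4)] ij by auto
    ultimately show "\<tau> i < \<tau> j" using assms(3) unfolding strictly_dec_def by (metis linorder_neqE_nat not_less_iff_gr_or_eq)
  qed
  show "l j = k j" if "j < N" for j using eq[OF that] id by simp
qed

lemma aitken_base_nonneg:
  assumes "tuple_size N l \<le> tuple_size N k" "strictly_dec N l" "strictly_dec N k"
  shows "0 \<le> aitken N l k"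
  unfolding aitken_def Alt_def
proof (rule sum_nonneg)
  fix \<tau> assume "\<tau> \<in> {\<tau>. \<tau> permutes {..<N}}"
  hence p: "\<tau> permutes {..<N}" by simp
  show "0 \<le> of_int (sign \<tau>) * (\<Prod>j<N. recip_fact (l j - (k \<circ> \<tau>) j))"
  proof (cases "(\<Prod>j<N. recip_fact (l j - (k \<circ> \<tau>) j)) = 0")
    case False
    from aitken_support(1)[OF assms p this] show ?thesis by (simp add: prod_nonneg recip_fact_nonneg)
  next
    case True
    show ?thesis unfolding True by simp
  qed
qed

lemma aitken_refl:
  assumes "strictly_dec N k" shows "aitken N k k = 1"
proof -
  have "aitken N k k = (\<Sum>\<tau>\<in>{id}. of_int (sign \<tau>) * (\<Prod>j<N. recip_fact (k j - (k \<circ> \<tau>) j)))"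
    unfolding aitken_def Alt_def
  proof (rule sum.mono_neutral_right)
    show "\<forall>\<tau>\<in>{\<tau>. \<tau> permutes {..<N}} - {id}. of_int (sign \<tau>) * (\<Prod>j<N. recip_fact (k j - (k \<circ> \<tau>) j)) = 0"
      using aitken_support(1)[OF order.refl assms assms] by auto
  qed (auto simp: permutes_id)
  thus ?thesis by (simp add: recip_fact_def)
qed

lemma strictly_dec_down_cases:
  assumes "strictly_dec N l" "s < N"
  shows "strictly_dec N (l(s := l s - 1)) \<or> (Suc s < N \<and> l (Suc s) = l s - 1)"
proof (cases "Suc s < N \<and> l (Suc s) = l s - 1")
  case False
  have "strictly_dec N (l(s := l s - 1))" unfolding strictly_dec_def
  proof (intro allI impI)
    fix i j assume ij: "i < j" "j < N"
    have "l j < l i" using assms(1) ij by (simp add: strictly_dec_def)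
    moreover have "l j < l s - 1" if "i = s"
    proof (cases "j = Suc s")
      case True
      have "l (Suc s) < l s" using assms(1) True ij by (simp add: strictly_dec_def)
      thus ?thesis using False True ij by auto
    next
      case F: False
      hence "l j < l (Suc s)" "l (Suc s) < l s" using assms(1) ij that by (auto simp: strictly_dec_def)
      thus ?thesis by simp
    qed
    ultimately show "(l(s := l s - 1)) j < (l(s := l s - 1)) i" using ij by auto
  qed
  thus ?thesis ..
qed simp

lemma strictly_dec_up_cases:
  assumes "strictly_dec N l" "s < N"
  shows "strictly_dec N (l(s := l s + 1)) \<or> (0 < s \<and> l (s - 1) = l s + 1)"
proof (cases "0 < s \<and> l (s - 1) = l s + 1")
  case False
  have "strictly_dec N (l(s := l s + 1))" unfolding strictly_dec_def
  proof (intro allI impI)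
    fix i j assume ij: "i < j" "j < N"
    have "l j < l i" using assms(1) ij by (simp add: strictly_dec_def)
    moreover have "l s + 1 < l i" if "j = s"
    proof (cases "i = s - 1")
      case True
      thus ?thesis using False \<open>l j < l i\<close> ij that by auto
    next
      case F: False
      hence "l (s - 1) < l i" "l s < l (s - 1)" using assms(1) ij that by (auto simp: strictly_dec_def)
      thus ?thesis by simp
    qed
    ultimately show "(l(s := l s + 1)) j < (l(s := l s + 1)) i" using ij by auto
  qed
  thus ?thesis ..
qed simp

text \<open>The sign is not visible in the determinant. It follows by induction on the difference of
  sizes from \<open>aitken_harmonic_left\<close>, where every lowered tuple is strictly decreasing
  again or has a collision and contributes 0.\<close>

lemma aitken_nonneg:
  assumes "strictly_dec N l" "strictly_dec N k" "nonneg N k"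
  shows "0 \<le> aitken N l k"
  using assms(1)
proof (induction "nat (tuple_size N l - tuple_size N k)" arbitrary: l rule: less_induct)
  case less
  show ?case
  proof (cases "tuple_size N l \<le> tuple_size N k")
    case True thus ?thesis using less.prems assms by (intro aitken_base_nonneg) auto
  next
    case False
    have "0 \<le> (\<Sum>s<N. aitken N (l(s := l s - 1)) k)"
    proof (rule sum_nonneg)
      fix s assume "s \<in> {..<N}"
      hence s: "s < N" by simp
      from strictly_dec_down_cases[OF less.prems s]
      show "0 \<le> aitken N (l(s := l s - 1)) k"
      proof
        assume "strictly_dec N (l(s := l s - 1))"
        thus ?thesis using False s tuple_size_upd[OF s, of l "-1"] by (intro less.hyps) auto
      next
        assume "Suc s < N \<and> l (Suc s) = l s - 1"
        thus ?thesis using aitken_collision_left[of s N "Suc s" "l(s := l s - 1)" k] s by simp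
      qed
    qed
    hence "0 \<le> of_int (tuple_size N l - tuple_size N k) * aitken N l k" by (simp only: aitken_harmonic_left)
    moreover have "real_of_int (tuple_size N l - tuple_size N k) > 0" using False by simp
    ultimately show ?thesis by (simp only: zero_le_mult_iff) auto
  qed
qed

text \<open>The truncation by \<open>nat\<close> does no harm: when \<open>l\<close> is smaller than
  \<open>k\<close> in size, \<open>aitken\<close> is 0 by
  \<open>aitken_eq_0_of_size_less\<close>.\<close>

definition skew_dim :: "nat \<Rightarrow> (nat \<Rightarrow> int) \<Rightarrow> (nat \<Rightarrow> int) \<Rightarrow> real" where
  "skew_dim N l k = fact (nat (tuple_size N l - tuple_size N k)) * aitken N l k"

lemma fact_nat_pred: "0 < x \<Longrightarrow> (fact (nat x) :: real) = of_int x * fact (nat (x - 1))"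
proof -
  assume "0 < x"
  hence "nat x = Suc (nat (x - 1))" by simp
  thus ?thesis using \<open>0 < x\<close> by simp
qed

lemma skew_dim_harmonic_left:
  assumes "tuple_size N k < tuple_size N l"
  shows "(\<Sum>s<N. skew_dim N (l(s := l s - 1)) k) = skew_dim N l k"
proof -
  have "(\<Sum>s<N. skew_dim N (l(s := l s - 1)) k) = fact (nat (tuple_size N l - tuple_size N k - 1)) * (\<Sum>s<N. aitken N (l(s := l s - 1)) k)"
    unfolding skew_dim_def sum_distrib_left
  proof (rule sum.cong[OF refl])
    fix s assume "s \<in> {..<N}"
    hence "tuple_size N (l(s := l s - 1)) - tuple_size N k = tuple_size N l - tuple_size N k - 1" using tuple_size_upd[of s N l "-1"] by simp
    thus "fact (nat (tuple_size N (l(s := l s - 1)) - tuple_size N k)) * aitken N (l(s := l s - 1)) k = fact (nat (tuple_size N l - tuple_size N k - 1)) * aitken N (l(s := l s - 1)) k"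
      by (simp only:)
  qed
  thus ?thesis using assms fact_nat_pred[of "tuple_size N l - tuple_size N k"] by (simp add: aitken_harmonic_left skew_dim_def)
qed

lemma skew_dim_harmonic_right:
  assumes "tuple_size N k < tuple_size N l"
  shows "(\<Sum>s<N. skew_dim N l (k(s := k s + 1))) = skew_dim N l k"
proof -
  have "(\<Sum>s<N. skew_dim N l (k(s := k s + 1))) = fact (nat (tuple_size N l - tuple_size N k - 1)) * (\<Sum>s<N. aitken N l (k(s := k s + 1)))"
    unfolding skew_dim_def sum_distrib_left
  proof (rule sum.cong[OF refl])
    fix s assume "s \<in> {..<N}"
    hence "tuple_size N l - tuple_size N (k(s := k s + 1)) = tuple_size N l - tuple_size N k - 1" using tuple_size_upd[of s N k 1] by simp
    thus "fact (nat (tuple_size N l - tuple_size N (k(s := k s + 1)))) * aitken N l (k(s := k s + 1)) = fact (nat (tuple_size N l - tuple_size N k - 1)) * aitken N l (k(s := k s + 1))"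
      by (simp only:)
  qed
  thus ?thesis using assms fact_nat_pred[of "tuple_size N l - tuple_size N k"] by (simp add: aitken_harmonic_right skew_dim_def)
qed

lemma length_dec_le:
  assumes y: "young l" and c: "corner l s"
  shows "length (dec l s) \<le> length l"
proof (rule ccontr)
  assume "\<not> length (dec l s) \<le> length l"
  hence "0 < rowlen (dec l s) (length l)" using rowlen_pos[OF dec(1)[OF y c]] by simp
  thus False using dec(2)[OF y c] by (auto simp: rowlen_def split: if_splits)
qed

lemma length_downY: "young l \<Longrightarrow> m \<in> downY l \<Longrightarrow> length m \<le> length l"
proof -
  assume y: "young l" and "m \<in> downY l"
  hence "m \<in> dec l ` {s. corner l s}" using dec_bij[OF y] by (simp add: bij_betw_def)
  thus ?thesis using length_dec_le[OF y] by auto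
qed

lemma last_corner:
  assumes "young l" "l \<noteq> []"
  shows "corner l (length l - 1)"
  using rowlen_pos[OF assms(1), of "length l - 1"] assms(2) by (auto simp: corner_def rowlen_def)

text \<open>Both sides satisfy the recursion over the removal of a box and equal 1 at the empty
  diagram.\<close>

lemma dimY_eq_skew_dim:
  assumes "young l" "length l \<le> N"
  shows "real (dimY l) = skew_dim N (beta_tuple N l) (beta_tuple N [])"
  using assms
proof (induction "sum_list l" arbitrary: l rule: less_induct)
  case less
  have k0: "tuple_size N (beta_tuple N []) = 0" "nonneg N (beta_tuple N [])" "strictly_dec N (beta_tuple N [])"
    using tuple_size_beta_tuple[of "[]" N] nonneg_beta_tuple strictly_dec_beta_tuple[of "[]"] by (auto simp: young_def)
  show ?case
  proof (cases "l = []")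
    case True
    thus ?thesis using aitken_refl[OF k0(3)] by (simp add: dimY_Nil skew_dim_def)
  next
    case False
    have pos: "0 < sum_list l" using length_le_sum_list[OF less.prems(1)] False by (cases l) auto
    have "real (dimY l) = (\<Sum>m\<in>downY l. 1 * skew_dim N (beta_tuple N m) (beta_tuple N []))"
      unfolding dimY_rec[OF less.prems(1) pos] of_nat_sum
    proof (rule sum.cong[OF refl])
      fix m assume m: "m \<in> downY l"
      hence "young m" "sum_list m < sum_list l" by (auto simp: downY_def)
      moreover have "length m \<le> N" using length_downY[OF less.prems(1) m] less.prems(2) by simp
      ultimately show "real (dimY m) = 1 * skew_dim N (beta_tuple N m) (beta_tuple N [])" using less.hyps by simp
    qed
    also have "\<dots> = (\<Sum>s<N. 1 * skew_dim N ((beta_tuple N l)(s := beta_tuple N l s - 1)) (beta_tuple N []))"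
    proof (rule sum_downY[OF less.prems, where g="\<lambda>b. skew_dim N b (beta_tuple N [])" and H="\<lambda>_. 1" and W="\<lambda>_. 1"])
      show "skew_dim N b (beta_tuple N []) = 0" if "x < N" "y < N" "x \<noteq> y" "b x = b y" for b x y
        using aitken_collision_left[OF that] by (simp add: skew_dim_def)
      show "skew_dim N b (beta_tuple N []) = 0" if "x < N" "b x < 0" for b x
        using aitken_neg[of x N b "beta_tuple N []"] that k0(2) by (simp add: skew_dim_def)
    qed simp
    also have "\<dots> = skew_dim N (beta_tuple N l) (beta_tuple N [])"
      using skew_dim_harmonic_left[of N "beta_tuple N []" "beta_tuple N l"] k0(1) tuple_size_beta_tuple[OF less.prems(2)] pos by simp
    finally show ?thesis .
  qed
qed

lemma dimY_pos: "young l \<Longrightarrow> 0 < dimY l"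
proof (induction "sum_list l" arbitrary: l rule: less_induct)
  case less
  show ?case
  proof (cases "l = []")
    case False
    have pos: "0 < sum_list l" using length_le_sum_list[OF less.prems(1)] False by (cases l) auto
    let ?m = "dec l (length l - 1)"
    have m: "?m \<in> downY l" using dec_bij[OF less.prems] last_corner[OF less.prems False] by (auto simp: bij_betw_def)
    hence "0 < dimY ?m" by (intro less.hyps) (auto simp: downY_def)
    also have "\<dots> \<le> (\<Sum>m\<in>downY l. dimY m)" using finite_downY[OF less.prems] m by (intro member_le_sum) auto
    finally show ?thesis using dimY_rec[OF less.prems pos] by simp
  qed (simp add: dimY_Nil)
qed

lemma skew_dim_nonneg: "strictly_dec N l \<Longrightarrow> strictly_dec N k \<Longrightarrow> nonneg N k \<Longrightarrow> 0 \<le> skew_dim N l k"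
  unfolding skew_dim_def using aitken_nonneg by simp

lemma aitken_eq_0_of_size_less:
  assumes "tuple_size N l < tuple_size N k"
  shows "aitken N l k = 0"
  unfolding aitken_def Alt_def
proof (intro sum.neutral ballI)
  fix \<tau> assume "\<tau> \<in> {\<tau>. \<tau> permutes {..<N}}"
  hence p: "\<tau> permutes {..<N}" by simp
  have "\<exists>j<N. l j - (k \<circ> \<tau>) j < 0"
  proof (rule ccontr)
    assume "\<not> ?thesis"
    hence "0 \<le> l j - (k \<circ> \<tau>) j" if "j < N" for j using that by (meson not_less)
    hence "0 \<le> (\<Sum>j<N. l j - (k \<circ> \<tau>) j)" by (intro sum_nonneg) simp
    thus False using tuple_size_diff_permute[OF p, of l k] assms by simp
  qed
  then obtain j where "j < N" "recip_fact (l j - (k \<circ> \<tau>) j) = 0" by (auto simp: recip_fact_def)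
  hence "(\<Prod>j<N. recip_fact (l j - (k \<circ> \<tau>) j)) = 0" by (intro prod_zero) auto
  thus "of_int (sign \<tau>) * (\<Prod>j<N. recip_fact (l j - (k \<circ> \<tau>) j)) = 0" by simp
qed

text \<open>Enlarging the inner diagram by a box can only decrease the dimension, because by
  \<open>skew_dim_harmonic_right\<close> the old value is a sum of nonnegative terms that contains
  the new one. Removing the boxes of \<open>m\<close> one by one leads to the empty diagram.\<close>

lemma skew_dim_le_dimY:
  assumes "strictly_dec N l" "young m" "length m \<le> N"
  shows "skew_dim N l (beta_tuple N m) \<le> skew_dim N l (beta_tuple N [])"
  using assms(2,3)
proof (induction "sum_list m" arbitrary: m rule: less_induct)
  case less
  show ?case
  proof (cases "m = []")
    case False
    define s where "s = length m - 1"
    have c: "corner m s" unfolding s_def by (rule last_corner[OF less.prems(1) False])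
    define k where "k = beta_tuple N (dec m s)"
    have r: "rowlen (dec m s) = (rowlen m)(s := rowlen m s - 1)" by (rule dec(2)[OF less.prems(1) c])
    have p: "0 < rowlen m s" using c by (simp add: corner_def)
    have km: "beta_tuple N m = k(s := k s + 1)" using beta_tuple_downY[OF r p, of N] by (auto simp: k_def fun_eq_iff)
    have sN: "s < N" using False less.prems(2) by (cases m) (auto simp: s_def)
    have d: "dec m s \<in> downY m" using dec_bij[OF less.prems(1)] c by (auto simp: bij_betw_def)
    have yd: "young (dec m s)" and ld: "length (dec m s) \<le> N"
      using dec(1)[OF less.prems(1) c] length_downY[OF less.prems(1) d] less.prems(2) by auto
    have sk: "strictly_dec N k" "nonneg N k" unfolding k_def using strictly_dec_beta_tuple[OF yd] nonneg_beta_tuple by auto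
    have nn: "0 \<le> skew_dim N l (k(r := k r + 1))" if "r < N" for r
      using strictly_dec_up_cases[OF sk(1) that]
    proof
      assume "strictly_dec N (k(r := k r + 1))"
      moreover have "nonneg N (k(r := k r + 1))" using sk(2) by (auto simp: nonneg_def)
      ultimately show ?thesis using assms(1) by (intro skew_dim_nonneg)
    next
      assume "0 < r \<and> k (r - 1) = k r + 1"
      hence "aitken N l (k(r := k r + 1)) = 0" using that by (intro aitken_collision_right[of r N "r - 1"]) auto
      thus ?thesis by (simp add: skew_dim_def)
    qed
    have "skew_dim N l (beta_tuple N m) \<le> skew_dim N l k"
    proof (cases "tuple_size N k < tuple_size N l")
      case True
      have "skew_dim N l (beta_tuple N m) \<le> (\<Sum>r<N. skew_dim N l (k(r := k r + 1)))"
        unfolding km using nn sN by (intro member_le_sum[of s "{..<N}" "\<lambda>r. skew_dim N l (k(r := k r + 1))"]) auto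
      thus ?thesis using skew_dim_harmonic_right[OF True] by simp
    next
      case F: False
      have "tuple_size N (beta_tuple N m) = tuple_size N k + 1" unfolding km by (rule tuple_size_upd[OF sN])
      hence "skew_dim N l (beta_tuple N m) = 0" using F aitken_eq_0_of_size_less[of N l "beta_tuple N m"] by (simp add: skew_dim_def)
      thus ?thesis using skew_dim_nonneg[OF assms(1) sk] by simp
    qed
    also have "\<dots> \<le> skew_dim N l (beta_tuple N [])" unfolding k_def
      using d yd ld by (intro less.hyps) (auto simp: downY_def)
    finally show ?thesis .
  qed simp
qed

section \<open>Contents and Frobenius coordinates\<close>

definition falling :: "int \<Rightarrow> nat \<Rightarrow> real" where
  "falling y j = (\<Prod>t<j. of_int y - real t)"

lemma falling_0 [simp]: "falling y 0 = 1" by (simp add: falling_def)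

lemma falling_Suc: "falling y (Suc j) = falling y j * (of_int y - real j)" by (simp add: falling_def)

lemma falling_pochhammer: "falling y j = (-1) ^ j * pochhammer (- of_int y) j"
  by (induction j) (auto simp: falling_Suc pochhammer_Suc algebra_simps)

lemma falling_vandermonde: "falling (x + y) n = (\<Sum>i\<le>n. real (n choose i) * falling x i * falling y (n - i))"
proof -
  have "falling (x + y) n = (-1) ^ n * pochhammer (- of_int x + - of_int y) n" by (simp add: falling_pochhammer)
  also have "\<dots> = (\<Sum>i\<le>n. (-1) ^ n * (of_nat (n choose i) * pochhammer (- of_int x) i * pochhammer (- of_int y) (n - i)))"
    unfolding pochhammer_binomial_sum sum_distrib_left ..
  also have "\<dots> = (\<Sum>i\<le>n. real (n choose i) * falling x i * falling y (n - i))"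
  proof (rule sum.cong[OF refl])
    fix i assume "i \<in> {..n}"
    hence "(-1::real) ^ n = (-1) ^ i * (-1) ^ (n - i)" by (simp flip: power_add)
    thus "(-1) ^ n * (of_nat (n choose i) * pochhammer (- of_int x) i * pochhammer (- of_int y) (n - i)) = real (n choose i) * falling x i * falling y (n - i)"
      by (simp add: falling_pochhammer mult_ac)
  qed
  finally show ?thesis .
qed

lemma falling_diff: "falling (y + 1) (Suc j) - falling y (Suc j) = real (Suc j) * falling y j"
proof -
  have "falling (y + 1) (Suc j) = (of_int y + 1) * falling y j"
    unfolding falling_def by (subst prod.lessThan_Suc_shift) simp
  thus ?thesis by (simp add: falling_Suc algebra_simps)
qed

lemma recip_fact_falling: "falling x i * recip_fact x = recip_fact (x - int i)"
proof (induction i)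
  case (Suc i)
  have "falling x (Suc i) * recip_fact x = of_int (x - int i) * recip_fact (x - int i)" using Suc by (simp add: falling_Suc mult_ac)
  also have "\<dots> = recip_fact (x - int i - 1)" by (rule recip_fact_shift[symmetric])
  finally show ?case by (simp add: algebra_simps)
qed simp

text \<open>At the tuple of \<lambda> the argument is \<lambda>_r - r. Empty rows contribute as
  well, so only differences from the value at \<open>beta_tuple N []\<close> are free of N.\<close>

definition content_psum :: "nat \<Rightarrow> nat \<Rightarrow> (nat \<Rightarrow> int) \<Rightarrow> real" where
  "content_psum N j l = (\<Sum>r<N. falling (l r - int N + 1) j)"

text \<open>Vandermonde's convolution in every factor, together with $x(x-1)\cdots(x-i+1)/x! = 1/(x-i)!$.\<close>

lemma aitken_content:
  "(content_psum N j l - content_psum N j k) * aitken N l k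
     = (\<Sum>i=1..j. real (j choose i) * (\<Sum>s<N. falling (k s - int N + 1) (j - i) * aitken N l (k(s := k s + int i))))"
proof -
  let ?R = "\<lambda>b j. \<Prod>i\<in>{..<N}-{j}. recip_fact (l i - b i)"
  have e: "(\<Prod>t<N. recip_fact (l t - (b(x := b x + int i)) t)) = falling (l x - b x) i * (\<Prod>t<N. recip_fact (l t - b t))" if "x < N" for x i and b :: "nat \<Rightarrow> int"
  proof -
    have "(\<Prod>t<N. recip_fact (l t - (b(x := b x + int i)) t)) = recip_fact (l x - b x - int i) * ?R b x"
      using prod_upd[OF that, of "\<lambda>i v. recip_fact (l i - v)" b] by (simp add: algebra_simps)
    thus ?thesis using that by (simp add: recip_fact_falling[symmetric] prod.remove[of "{..<N}" x] mult.assoc)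
  qed
  have "(\<Sum>i=1..j. real (j choose i) * (\<Sum>s<N. falling (k s - int N + 1) (j - i) * aitken N l (k(s := k s + int i))))
     = Alt N (\<lambda>b. \<Sum>i=1..j. real (j choose i) * (\<Sum>x<N. falling (b x - int N + 1) (j - i) * (\<Prod>t<N. recip_fact (l t - (b(x := b x + int i)) t)))) k"
    unfolding aitken_def Alt_sum_shift[where H="\<lambda>v. falling (v - int N + 1) q" for q] by (simp only: Alt_sum Alt_cmult)
  also have "\<dots> = Alt N (\<lambda>b. (content_psum N j l - content_psum N j k) * (\<Prod>t<N. recip_fact (l t - b t))) k"
  proof (rule Alt_cong)
    fix \<tau> assume p: "\<tau> permutes {..<N}"
    let ?b = "k \<circ> \<tau>"
    have "(\<Sum>i=1..j. real (j choose i) * (\<Sum>x<N. falling (?b x - int N + 1) (j - i) * (\<Prod>t<N. recip_fact (l t - (?b(x := ?b x + int i)) t))))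
       = (\<Sum>i=1..j. \<Sum>x<N. real (j choose i) * falling (l x - ?b x) i * falling (?b x - int N + 1) (j - i) * (\<Prod>t<N. recip_fact (l t - ?b t)))"
      unfolding sum_distrib_left by (intro sum.cong refl) (simp only: e lessThan_iff mult_ac)
    also have "\<dots> = (\<Sum>x<N. (\<Sum>i=1..j. real (j choose i) * falling (l x - ?b x) i * falling (?b x - int N + 1) (j - i)) * (\<Prod>t<N. recip_fact (l t - ?b t)))"
      unfolding sum_distrib_right by (rule sum.swap)
    also have "\<dots> = (\<Sum>x<N. (falling (l x - int N + 1) j - falling (?b x - int N + 1) j) * (\<Prod>t<N. recip_fact (l t - ?b t)))"
    proof (rule sum.cong[OF refl])
      fix x
      have "falling (l x - int N + 1) j = falling ((l x - ?b x) + (?b x - int N + 1)) j" by (simp add: algebra_simps)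
      also have "\<dots> = (\<Sum>i\<in>insert 0 {1..j}. real (j choose i) * falling (l x - ?b x) i * falling (?b x - int N + 1) (j - i))"
        unfolding falling_vandermonde by (intro sum.cong) auto
      finally have "(\<Sum>i=1..j. real (j choose i) * falling (l x - ?b x) i * falling (?b x - int N + 1) (j - i)) = falling (l x - int N + 1) j - falling (?b x - int N + 1) j"
        by simp
      thus "(\<Sum>i=1..j. real (j choose i) * falling (l x - ?b x) i * falling (?b x - int N + 1) (j - i)) * (\<Prod>t<N. recip_fact (l t - ?b t)) = (falling (l x - int N + 1) j - falling (?b x - int N + 1) j) * (\<Prod>t<N. recip_fact (l t - ?b t))"
        by (simp only:)
    qed
    also have "\<dots> = (content_psum N j l - content_psum N j ?b) * (\<Prod>t<N. recip_fact (l t - ?b t))"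
      unfolding content_psum_def sum_subtractf[symmetric] sum_distrib_right ..
    also have "content_psum N j ?b = content_psum N j k"
      unfolding content_psum_def using sum_permute[OF p, of "\<lambda>i. falling (k i - int N + 1) j"] by simp
    finally show "(\<Sum>i=1..j. real (j choose i) * (\<Sum>x<N. falling (?b x - int N + 1) (j - i) * (\<Prod>t<N. recip_fact (l t - (?b(x := ?b x + int i)) t))))
       = (content_psum N j l - content_psum N j k) * (\<Prod>t<N. recip_fact (l t - ?b t))" .
  qed
  finally show ?thesis by (simp only: Alt_cmult aitken_def)
qed

section \<open>Power sums of Frobenius coordinates as sums over boxes\<close>

definition content :: "nat \<times> nat \<Rightarrow> int" where
  "content x = int (snd x) - int (fst x)"

lemma sum_boxes: "length l \<le> N \<Longrightarrow> (\<Sum>x\<in>boxes l. f x) = (\<Sum>i<N. \<Sum>j<rowlen l i. f (i, j))"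
proof -
  assume "length l \<le> N"
  hence "boxes l = Sigma {..<N} (\<lambda>i. {..<rowlen l i})"
    by (auto simp: boxes_def rowlen_def split: if_splits)
  thus ?thesis by (simp add: sum.Sigma)
qed

lemma card_boxes: "card (boxes l) = sum_list l"
  using sum_boxes[of l "length l" "\<lambda>_. 1::nat"] sum_rowlen[of l "length l"] by simp

text \<open>Telescoping along each row: the increment of a falling factorial from one content to the
  next is given by \<open>falling_diff\<close>.\<close>

lemma content_psum_boxes:
  assumes "length l \<le> N"
  shows "content_psum N (Suc j) (beta_tuple N l) - content_psum N (Suc j) (beta_tuple N []) = (\<Sum>x\<in>boxes l. real (Suc j) * falling (content x) j)"
proof -
  have "content_psum N (Suc j) (beta_tuple N l) - content_psum N (Suc j) (beta_tuple N []) = (\<Sum>i<N. falling (int (rowlen l i) - int i) (Suc j) - falling (- int i) (Suc j))"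
    unfolding content_psum_def sum_subtractf[symmetric] by (intro sum.cong refl) (simp add: beta_tuple_def rowlen_def)
  also have "\<dots> = (\<Sum>i<N. \<Sum>c<rowlen l i. real (Suc j) * falling (int c - int i) j)"
  proof (rule sum.cong[OF refl])
    fix i
    have "falling (int m - int i) (Suc j) - falling (- int i) (Suc j) = (\<Sum>c<m. real (Suc j) * falling (int c - int i) j)" for m
    proof (induction m)
      case (Suc m)
      show ?case using falling_diff[of "int m - int i" j] Suc by (simp add: algebra_simps)
    qed simp
    thus "falling (int (rowlen l i) - int i) (Suc j) - falling (- int i) (Suc j) = (\<Sum>c<rowlen l i. real (Suc j) * falling (int c - int i) j)" .
  qed
  finally show ?thesis by (simp add: sum_boxes[OF assms] content_def)
qed

text \<open>The j-th power sum of the modified Frobenius coordinates, \<Sum>(a_i^j - (-b_i)^j),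
  written as a sum over boxes so that it can be compared with content sums box by box.\<close>

definition frob_psum :: "nat \<Rightarrow> nat list \<Rightarrow> real" where
  "frob_psum j l = (\<Sum>x\<in>boxes l. (of_int (content x) + 1/2) ^ j - (of_int (content x) - 1/2) ^ j)"

text \<open>The rows longer than i form an initial segment, which is determined by its cardinality;
  \<open>less_ndiag\<close> uses the same argument for the diagonal.\<close>

lemma less_colLen:
  assumes y: "young l"
  shows "r < colLen l i \<longleftrightarrow> i < rowlen l r"
proof -
  have "colLen l i = card {r. r < length l \<and> i < l ! r}"
    by (simp add: colLen_def length_filter_conv_card)
  also have "{r. r < length l \<and> i < l ! r} = {r. i < rowlen l r}" by (auto simp: rowlen_def)
  finally have c: "colLen l i = card {r. i < rowlen l r}" .
  have fin: "finite {r. i < rowlen l r}"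
    by (rule finite_subset[of _ "{..<length l}"]) (auto simp: rowlen_def split: if_splits)
  show ?thesis
  proof
    assume "i < rowlen l r"
    hence "{..r} \<subseteq> {r. i < rowlen l r}" using rowlen_antimono[OF y] by (auto intro: less_le_trans)
    from card_mono[OF fin this] show "r < colLen l i" using c by simp
  next
    assume r: "r < colLen l i"
    show "i < rowlen l r"
    proof (rule ccontr)
      assume "\<not> i < rowlen l r"
      hence "{r. i < rowlen l r} \<subseteq> {..<r}" using rowlen_antimono[OF y] by (auto simp: not_less) (meson leI le_trans not_less)
      from card_mono[OF _ this] show False using r c by simp
    qed
  qed
qed

lemma less_ndiag:
  assumes y: "young l"
  shows "i < ndiag l \<longleftrightarrow> i < rowlen l i"
proof -
  have c: "ndiag l = card {i. i < rowlen l i}"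
    unfolding ndiag_def by (rule arg_cong[where f=card]) (auto simp: rowlen_def)
  have fin: "finite {i. i < rowlen l i}"
    by (rule finite_subset[of _ "{..<length l}"]) (auto simp: rowlen_def split: if_splits)
  have mono: "i < rowlen l i" if "i \<le> j" "j < rowlen l j" for i j
    using rowlen_antimono[OF y that(1)] that by simp
  show ?thesis
  proof
    assume "i < rowlen l i"
    hence "{..i} \<subseteq> {i. i < rowlen l i}" using mono by auto
    from card_mono[OF fin this] show "i < ndiag l" using c by simp
  next
    assume i: "i < ndiag l"
    show "i < rowlen l i"
    proof (rule ccontr)
      assume "\<not> i < rowlen l i"
      hence "{i. i < rowlen l i} \<subseteq> {..<i}" using mono by (auto simp: not_less) (meson not_le_imp_less not_less)
      from card_mono[OF _ this] show False using i c by simp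
    qed
  qed
qed

text \<open>The diagram is cut into its diagonal hooks. Along the arm, diagonal box included, the
  increments telescope to a_i^j - (-1/2)^j, along the leg to (-1/2)^j - (-b_i)^j. The half shifts in
  the coordinates make the middle terms cancel.\<close>

lemma frob_psum_frobenius:
  assumes y: "young l"
  shows "frob_psum j l = (\<Sum>i<ndiag l. (real (l ! i) - real i - 1/2) ^ j - (- (real (colLen l i) - real i - 1/2)) ^ j)"
proof -
  define g where "g c = (of_int c + 1/2) ^ j - (of_int c - 1/2 :: real) ^ j" for c :: int
  define arm where "arm i = (\<lambda>c. (i, c)) ` {i..<rowlen l i}" for i
  define leg where "leg i = (\<lambda>r. (r, i)) ` {Suc i..<colLen l i}" for i
  have mem: "(r, c) \<in> arm i \<longleftrightarrow> i = r \<and> r \<le> c \<and> c < rowlen l r"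
    "(r, c) \<in> leg i \<longleftrightarrow> i = c \<and> c < r \<and> r < colLen l c" for r c i
    by (auto simp: arm_def leg_def)
  have bx: "boxes l = (\<Union>i<ndiag l. arm i) \<union> (\<Union>i<ndiag l. leg i)"
  proof (rule set_eqI)
    fix x :: "nat \<times> nat"
    obtain r c where x: "x = (r, c)" by (cases x)
    show "x \<in> boxes l \<longleftrightarrow> x \<in> (\<Union>i<ndiag l. arm i) \<union> (\<Union>i<ndiag l. leg i)"
    proof (cases "r \<le> c")
      case True
      have "(r, c) \<in> (\<Union>i<ndiag l. arm i) \<union> (\<Union>i<ndiag l. leg i) \<longleftrightarrow> r < ndiag l \<and> c < rowlen l r"
        using True by (auto simp: mem)
      thus ?thesis unfolding x mem_boxes using less_ndiag[OF y, of r] True by auto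
    next
      case False
      have "c < ndiag l" if "c < rowlen l r"
        using that rowlen_antimono[OF y, of c r] False less_ndiag[OF y, of c] by simp
      moreover have "(r, c) \<in> (\<Union>i<ndiag l. arm i) \<union> (\<Union>i<ndiag l. leg i) \<longleftrightarrow> c < ndiag l \<and> r < colLen l c"
        using False by (auto simp: mem)
      ultimately show ?thesis unfolding x mem_boxes using False less_colLen[OF y, of r c] by auto
    qed
  qed
  have "frob_psum j l = (\<Sum>x\<in>boxes l. g (content x))" by (simp add: frob_psum_def g_def)
  also have "\<dots> = (\<Sum>x\<in>(\<Union>i<ndiag l. arm i). g (content x)) + (\<Sum>x\<in>(\<Union>i<ndiag l. leg i). g (content x))"
    unfolding bx by (rule sum.union_disjoint) (auto simp: arm_def leg_def)
  also have "(\<Sum>x\<in>(\<Union>i<ndiag l. arm i). g (content x)) = (\<Sum>i<ndiag l. \<Sum>x\<in>arm i. g (content x))"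
    by (rule sum.UNION_disjoint) (auto simp: arm_def)
  also have "(\<Sum>x\<in>(\<Union>i<ndiag l. leg i). g (content x)) = (\<Sum>i<ndiag l. \<Sum>x\<in>leg i. g (content x))"
    by (rule sum.UNION_disjoint) (auto simp: leg_def)
  also have "(\<Sum>i<ndiag l. \<Sum>x\<in>arm i. g (content x)) + (\<Sum>i<ndiag l. \<Sum>x\<in>leg i. g (content x)) = (\<Sum>i<ndiag l. (\<Sum>x\<in>arm i. g (content x)) + (\<Sum>x\<in>leg i. g (content x)))"
    by (rule sum.distrib[symmetric])
  also have "\<dots> = (\<Sum>i<ndiag l. (real (l ! i) - real i - 1/2) ^ j - (- (real (colLen l i) - real i - 1/2)) ^ j)"
  proof (rule sum.cong[OF refl])
    fix i assume "i \<in> {..<ndiag l}"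
    hence i: "i < rowlen l i" using less_ndiag[OF y] by simp
    have c: "i < colLen l i" using less_colLen[OF y] i by simp
    have "(\<Sum>x\<in>arm i. g (content x)) = (\<Sum>c\<in>{i..<rowlen l i}. g (int c - int i))"
      unfolding arm_def by (subst sum.reindex) (auto simp: inj_on_def content_def)
    also have "\<dots> = (real (rowlen l i) - real i - 1/2) ^ j - (-1/2) ^ j"
    proof -
      have "(\<Sum>c\<in>{i..<i+d}. g (int c - int i)) = (real d - 1/2) ^ j - (-1/2) ^ j" for d
        by (induction d) (auto simp: g_def add.commute)
      from this[of "rowlen l i - i"] i show ?thesis by (simp add: of_nat_diff)
    qed
    finally have 1: "(\<Sum>x\<in>arm i. g (content x)) = (real (rowlen l i) - real i - 1/2) ^ j - (-1/2) ^ j" .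
    have "(\<Sum>x\<in>leg i. g (content x)) = (\<Sum>r\<in>{Suc i..<colLen l i}. g (int i - int r))"
      unfolding leg_def by (subst sum.reindex) (auto simp: inj_on_def content_def)
    also have "\<dots> = (-1/2) ^ j - (- (real (colLen l i) - real i - 1/2)) ^ j"
    proof -
      have "(\<Sum>r\<in>{Suc i..<Suc i+d}. g (int i - int r)) = (-1/2) ^ j - (- (real (Suc d) - 1/2)) ^ j" for d
      proof (induction d)
        case (Suc d)
        have "(\<Sum>r\<in>{Suc i..<Suc i+Suc d}. g (int i - int r)) = (\<Sum>r\<in>{Suc i..<Suc i+d}. g (int i - int r)) + g (int i - int (Suc i + d))"
          by simp
        also have "g (int i - int (Suc i + d)) = (- (real (Suc d) - 1/2)) ^ j - (- (real (Suc (Suc d)) - 1/2)) ^ j"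
        proof -
          have "of_int (int i - int (Suc i + d)) + 1/2 = - (real (Suc d) - 1/2)"
            "of_int (int i - int (Suc i + d)) - 1/2 = - (real (Suc (Suc d)) - 1/2)" by simp_all
          thus ?thesis unfolding g_def by (simp only:)
        qed
        finally show ?case using Suc by simp
      qed simp
      from this[of "colLen l i - Suc i"] c show ?thesis by (simp add: of_nat_diff algebra_simps)
    qed
    finally have 2: "(\<Sum>x\<in>leg i. g (content x)) = (-1/2) ^ j - (- (real (colLen l i) - real i - 1/2)) ^ j" .
    have "rowlen l i = l ! i" using i by (auto simp: rowlen_def split: if_splits)
    thus "(\<Sum>x\<in>arm i. g (content x)) + (\<Sum>x\<in>leg i. g (content x)) = (real (l ! i) - real i - 1/2) ^ j - (- (real (colLen l i) - real i - 1/2)) ^ j"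
      unfolding 1 2 by simp
  qed
  finally show ?thesis .
qed

lemma qmom_iota:
  assumes y: "young l"
  shows "qmom k (iota n l) = frob_psum (k + 1) l / real n ^ (k + 1)"
proof -
  define a where "a i = real (l ! i) - real i - 1/2" for i
  define b where "b i = real (colLen l i) - real i - 1/2" for i
  have 1: "(\<Sum>i. (fst (iota n l) i) ^ (k + 1)) = (\<Sum>i<ndiag l. (a i / real n) ^ (k + 1))"
    by (subst suminf_finite[of "{..<ndiag l}"]) (auto simp: iota_def a_def)
  have 2: "(\<Sum>i. (snd (iota n l) i) ^ (k + 1)) = (\<Sum>i<ndiag l. (b i / real n) ^ (k + 1))"
    by (subst suminf_finite[of "{..<ndiag l}"]) (auto simp: iota_def b_def)
  have "frob_psum (k + 1) l = (\<Sum>i<ndiag l. (a i) ^ (k + 1) - (- b i) ^ (k + 1))"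
    unfolding frob_psum_frobenius[OF y] a_def b_def ..
  also have "\<dots> = (\<Sum>i<ndiag l. (a i) ^ (k + 1)) + (-1) ^ k * (\<Sum>i<ndiag l. (b i) ^ (k + 1))"
    unfolding sum_distrib_left sum.distrib[symmetric] by (intro sum.cong refl) (subst power_minus, simp)
  finally show ?thesis unfolding qmom_def 1 2
    by (simp only: power_divide sum_divide_distrib[symmetric] add_divide_distrib times_divide_eq_right)
qed

lemma frob_psum_1: "frob_psum 1 l = real (sum_list l)"
  by (simp add: frob_psum_def card_boxes)

text \<open>The convention p_1 = 1 is exact on the image of \<open>iota\<close>, since the modified
  Frobenius coordinates of a diagram with n boxes add up to n.\<close>

lemma psum_iota:
  assumes "l \<in> YD n" "1 \<le> n" "1 \<le> j"
  shows "psum (qvec (iota n l)) j = frob_psum j l / real n ^ j"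
proof (cases "j = 1")
  case True
  thus ?thesis using frob_psum_1[of l] YD_young(2)[OF assms(1)] assms(2) by (simp add: psum_def)
next
  case False
  thus ?thesis using qmom_iota[OF YD_young(1)[OF assms(1)], of "j - 1" n] assms(3) by (simp add: psum_def qvec_def)
qed

text \<open>f(c) equals c^a up to lower order, uniformly for |c| \<le> n. The factor n on the left
  replaces an exponent a - 1 on the right, which would be truncated at a = 0.\<close>

definition monic :: "nat \<Rightarrow> (real \<Rightarrow> real) \<Rightarrow> bool" where
  "monic a f \<longleftrightarrow> (\<exists>C\<ge>0. \<forall>n c. 1 \<le> n \<longrightarrow> \<bar>c\<bar> \<le> n \<longrightarrow> \<bar>f c - c ^ a\<bar> * n \<le> C * n ^ a)"

lemma monic_0: "monic 0 (\<lambda>c. 1)"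
  unfolding monic_def by (intro exI[of _ 0]) auto

lemma monic_1: "monic 1 (\<lambda>c. c + t)"
  unfolding monic_def by (intro exI[of _ "\<bar>t\<bar>"]) auto

lemma monic_mult:
  assumes "monic a f" "monic b g"
  shows "monic (a + b) (\<lambda>c. f c * g c)"
proof -
  obtain C where C: "C \<ge> 0" "\<And>n c. 1 \<le> n \<Longrightarrow> \<bar>c\<bar> \<le> n \<Longrightarrow> \<bar>f c - c ^ a\<bar> * n \<le> C * n ^ a"
    using assms(1) unfolding monic_def by blast
  obtain D where D: "D \<ge> 0" "\<And>n c. 1 \<le> n \<Longrightarrow> \<bar>c\<bar> \<le> n \<Longrightarrow> \<bar>g c - c ^ b\<bar> * n \<le> D * n ^ b"
    using assms(2) unfolding monic_def by blast
  show ?thesis unfolding monic_def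
  proof (intro exI[of _ "C * (1 + D) + D"] conjI allI impI)
    show "0 \<le> C * (1 + D) + D" using C D by simp
    fix n c :: real assume n: "1 \<le> n" "\<bar>c\<bar> \<le> n"
    have cp: "\<bar>c ^ q\<bar> \<le> n ^ q" for q unfolding power_abs using n by (intro power_mono) auto
    have "\<bar>g c - c ^ b\<bar> * 1 \<le> \<bar>g c - c ^ b\<bar> * n" using n by (intro mult_left_mono) auto
    hence "\<bar>g c - c ^ b\<bar> \<le> D * n ^ b" using D(2)[OF n] by simp
    hence g: "\<bar>g c\<bar> \<le> (1 + D) * n ^ b" using cp[of b] by (simp add: algebra_simps)
    have "f c * g c - c ^ (a + b) = (f c - c ^ a) * g c + c ^ a * (g c - c ^ b)" by (simp add: power_add algebra_simps)
    hence "\<bar>f c * g c - c ^ (a + b)\<bar> \<le> \<bar>f c - c ^ a\<bar> * \<bar>g c\<bar> + \<bar>c ^ a\<bar> * \<bar>g c - c ^ b\<bar>"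
      by (simp add: abs_mult[symmetric] abs_triangle_ineq)
    hence "\<bar>f c * g c - c ^ (a + b)\<bar> * n \<le> (\<bar>f c - c ^ a\<bar> * \<bar>g c\<bar> + \<bar>c ^ a\<bar> * \<bar>g c - c ^ b\<bar>) * n"
      using n by (intro mult_right_mono) auto
    also have "\<dots> = (\<bar>f c - c ^ a\<bar> * n) * \<bar>g c\<bar> + \<bar>c ^ a\<bar> * (\<bar>g c - c ^ b\<bar> * n)" by (simp add: algebra_simps)
    also have "\<dots> \<le> (C * n ^ a) * ((1 + D) * n ^ b) + n ^ a * (D * n ^ b)"
    proof (rule add_mono)
      show "\<bar>f c - c ^ a\<bar> * n * \<bar>g c\<bar> \<le> C * n ^ a * ((1 + D) * n ^ b)"
        by (rule mult_mono[OF C(2)[OF n] g]) (use C n in auto)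
      show "\<bar>c ^ a\<bar> * (\<bar>g c - c ^ b\<bar> * n) \<le> n ^ a * (D * n ^ b)"
        by (rule mult_mono[OF cp D(2)[OF n]]) (use n in auto)
    qed
    also have "\<dots> = (C * (1 + D) + D) * n ^ (a + b)" by (simp add: power_add algebra_simps)
    finally show "\<bar>f c * g c - c ^ (a + b)\<bar> * n \<le> (C * (1 + D) + D) * n ^ (a + b)" .
  qed
qed

lemma monic_power: "monic a (\<lambda>c. (c + t) ^ a)"
proof (induction a)
  case (Suc a)
  from monic_mult[OF monic_1[of t] this] show ?case by simp
qed (simp add: monic_0)

lemma monic_falling: "monic a (\<lambda>c. \<Prod>t<a. c - real t)"
proof (induction a)
  case (Suc a)
  from monic_mult[OF this monic_1[of "- real a"]] show ?case by simp
qed (simp add: monic_0)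

text \<open>Both expressions have leading term (j+1) c^j: the first is j + 1 times a product of j
  linear factors, the second a sum of j + 1 products of powers of c + 1/2 and c - 1/2.\<close>

lemma content_poly_bound:
  "\<exists>C\<ge>0. \<forall>n c. 1 \<le> n \<longrightarrow> \<bar>of_int c\<bar> \<le> n \<longrightarrow>
     \<bar>real (Suc j) * falling c j - ((of_int c + 1/2) ^ Suc j - (of_int c - 1/2) ^ Suc j)\<bar> * n \<le> C * n ^ j"
proof -
  define h where "h t = (\<lambda>c::real. (c + 1/2) ^ t * (c + -1/2) ^ (j - t))" for t
  have mh: "monic j (h t)" if "t \<le> j" for t
    using monic_mult[OF monic_power[of t "1/2"] monic_power[of "j - t" "-1/2"]] that by (simp add: h_def)
  obtain C where C: "C \<ge> 0" "\<And>n c. 1 \<le> n \<Longrightarrow> \<bar>c\<bar> \<le> n \<Longrightarrow> \<bar>(\<Prod>t<j. c - real t) - c ^ j\<bar> * n \<le> C * n ^ j"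
    using monic_falling[of j] unfolding monic_def by blast
  have "\<forall>t\<in>{..j}. \<exists>D\<ge>0. \<forall>n c. 1 \<le> n \<longrightarrow> \<bar>c\<bar> \<le> n \<longrightarrow> \<bar>h t c - c ^ j\<bar> * n \<le> D * n ^ j"
    using mh unfolding monic_def by simp
  then obtain D where D: "\<And>t. t \<le> j \<Longrightarrow> 0 \<le> D t"
    "\<And>t n c. t \<le> j \<Longrightarrow> 1 \<le> n \<Longrightarrow> \<bar>c\<bar> \<le> n \<Longrightarrow> \<bar>h t c - c ^ j\<bar> * n \<le> D t * n ^ j"
    by (metis atMost_iff)
  show ?thesis
  proof (intro exI[of _ "real (Suc j) * C + (\<Sum>t\<le>j. D t)"] conjI allI impI)
    show "0 \<le> real (Suc j) * C + (\<Sum>t\<le>j. D t)"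
      using C(1) D(1) by (intro add_nonneg_nonneg mult_nonneg_nonneg sum_nonneg) auto
    fix n :: real and c :: int assume n: "1 \<le> n" "\<bar>of_int c\<bar> \<le> n"
    let ?c = "of_int c :: real"
    have "(?c + 1/2) ^ Suc j - (?c + -1/2) ^ Suc j = (\<Sum>t\<le>j. h t ?c)"
      unfolding h_def by (subst power_diff_sumr2) (simp add: lessThan_Suc_atMost mult_ac)
    hence "\<bar>real (Suc j) * falling c j - ((?c + 1/2) ^ Suc j - (?c - 1/2) ^ Suc j)\<bar> = \<bar>real (Suc j) * (falling c j - ?c ^ j) - (\<Sum>t\<le>j. h t ?c - ?c ^ j)\<bar>"
      by (simp add: sum_subtractf algebra_simps)
    also have "\<dots> \<le> \<bar>real (Suc j) * (falling c j - ?c ^ j)\<bar> + \<bar>\<Sum>t\<le>j. h t ?c - ?c ^ j\<bar>"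
      by (rule abs_triangle_ineq4)
    also have "\<dots> \<le> real (Suc j) * \<bar>falling c j - ?c ^ j\<bar> + (\<Sum>t\<le>j. \<bar>h t ?c - ?c ^ j\<bar>)"
      by (intro add_mono sum_abs) (simp add: abs_mult)
    finally have "\<bar>real (Suc j) * falling c j - ((?c + 1/2) ^ Suc j - (?c - 1/2) ^ Suc j)\<bar> \<le> real (Suc j) * \<bar>falling c j - ?c ^ j\<bar> + (\<Sum>t\<le>j. \<bar>h t ?c - ?c ^ j\<bar>)" .
    hence "\<bar>real (Suc j) * falling c j - ((?c + 1/2) ^ Suc j - (?c - 1/2) ^ Suc j)\<bar> * n \<le> (real (Suc j) * \<bar>falling c j - ?c ^ j\<bar> + (\<Sum>t\<le>j. \<bar>h t ?c - ?c ^ j\<bar>)) * n"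
      using n by (intro mult_right_mono) auto
    also have "\<dots> = real (Suc j) * (\<bar>falling c j - ?c ^ j\<bar> * n) + (\<Sum>t\<le>j. \<bar>h t ?c - ?c ^ j\<bar> * n)"
      by (simp only: distrib_right sum_distrib_right mult.assoc)
    also have "\<dots> \<le> real (Suc j) * (C * n ^ j) + (\<Sum>t\<le>j. D t * n ^ j)"
      using C(2)[OF n] D(2) n by (intro add_mono mult_left_mono sum_mono) (auto simp: falling_def)
    also have "\<dots> = (real (Suc j) * C + (\<Sum>t\<le>j. D t)) * n ^ j" by (simp only: distrib_right sum_distrib_right mult.assoc)
    finally show "\<bar>real (Suc j) * falling c j - ((?c + 1/2) ^ Suc j - (?c - 1/2) ^ Suc j)\<bar> * n \<le> (real (Suc j) * C + (\<Sum>t\<le>j. D t)) * n ^ j" .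
  qed
qed

lemma content_bound:
  assumes "l \<in> YD n" "x \<in> boxes l"
  shows "\<bar>real_of_int (content x)\<bar> \<le> real n"
proof -
  obtain i c where x: "x = (i, c)" by (cases x)
  have c: "c < rowlen l i" using assms(2) x by (simp add: mem_boxes)
  hence i: "i < length l" by (auto simp: rowlen_def split: if_splits)
  hence "rowlen l i \<le> n" using YD_young(2)[OF assms(1)] member_le_sum_list[of "l ! i" l] by (simp add: rowlen_def)
  thus ?thesis using i c YD_young(3)[OF assms(1)] by (simp add: x content_def)
qed

text \<open>Each of the n boxes contributes an error O(n^(j-2)), as its content is at most n in
  absolute value; together this is O(n^(j-1)).\<close>

lemma frob_psum_approx:
  assumes "1 \<le> j"
  shows "\<exists>C\<ge>0. \<forall>n l N. 1 \<le> n \<longrightarrow> l \<in> YD n \<longrightarrow> length l \<le> N \<longrightarrow>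
     \<bar>(content_psum N j (beta_tuple N l) - content_psum N j (beta_tuple N [])) / real n ^ j - frob_psum j l / real n ^ j\<bar> \<le> C / real n"
proof -
  obtain i where j: "j = Suc i" using assms by (cases j) auto
  obtain C where C: "C \<ge> 0" "\<And>n c. 1 \<le> n \<Longrightarrow> \<bar>of_int c\<bar> \<le> n \<Longrightarrow>
     \<bar>real (Suc i) * falling c i - ((of_int c + 1/2) ^ Suc i - (of_int c - 1/2) ^ Suc i)\<bar> * n \<le> C * n ^ i"
    using content_poly_bound[of i] by blast
  show ?thesis
  proof (intro exI[of _ C] conjI allI impI C(1))
    fix n l N assume a: "1 \<le> n" "l \<in> YD n" "length l \<le> N"
    have n: "1 \<le> real n" using a by simp
    have "\<bar>(content_psum N j (beta_tuple N l) - content_psum N j (beta_tuple N [])) - frob_psum j l\<bar> * real n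
      \<le> (\<Sum>x\<in>boxes l. \<bar>real (Suc i) * falling (content x) i - ((of_int (content x) + 1/2) ^ Suc i - (of_int (content x) - 1/2) ^ Suc i)\<bar>) * real n"
      unfolding j content_psum_boxes[OF a(3)] frob_psum_def sum_subtractf[symmetric] by (intro mult_right_mono sum_abs) simp
    also have "\<dots> \<le> (\<Sum>x\<in>boxes l. C * real n ^ i)"
      unfolding sum_distrib_right using C(2)[OF n] content_bound[OF a(2)] by (intro sum_mono) auto
    also have "\<dots> = C * real n ^ j" using card_boxes[of l] YD_young(2)[OF a(2)] by (simp add: j)
    finally have "\<bar>(content_psum N j (beta_tuple N l) - content_psum N j (beta_tuple N [])) - frob_psum j l\<bar> * real n \<le> C * real n ^ j" .
    moreover have "\<bar>(content_psum N j (beta_tuple N l) - content_psum N j (beta_tuple N [])) / real n ^ j - frob_psum j l / real n ^ j\<bar> = \<bar>(content_psum N j (beta_tuple N l) - content_psum N j (beta_tuple N [])) - frob_psum j l\<bar> / real n ^ j"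
      using n by (simp add: abs_divide flip: diff_divide_distrib)
    ultimately show "\<bar>(content_psum N j (beta_tuple N l) - content_psum N j (beta_tuple N [])) / real n ^ j - frob_psum j l / real n ^ j\<bar> \<le> C / real n"
      using n by (simp add: field_simps)
  qed
qed

lemma frob_psum_bounded:
  assumes "1 \<le> j"
  shows "\<exists>C\<ge>0. \<forall>n l. 1 \<le> n \<longrightarrow> l \<in> YD n \<longrightarrow> \<bar>frob_psum j l / real n ^ j\<bar> \<le> C"
\<comment> \<open>A box contributes u^j - v^j with u - v = 1 and |u|, |v| \<le> 2n, hence at most j
  (2n)^(j-1), and there are n boxes.\<close>
proof (intro exI[of _ "real j * 2 ^ (j - 1)"] conjI allI impI)
  fix n l assume a: "1 \<le> n" "l \<in> YD n"
  obtain i where j: "j = Suc i" using assms by (cases j) auto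
  have n: "1 \<le> real n" using a by simp
  have b: "\<bar>(of_int (content x) + 1/2) ^ j - (of_int (content x) - 1/2) ^ j\<bar> \<le> real j * (2 * real n) ^ i" if "x \<in> boxes l" for x
  proof -
    let ?u = "real_of_int (content x) + 1/2" and ?v = "real_of_int (content x) - 1/2"
    have uv: "\<bar>?u\<bar> \<le> 2 * real n" "\<bar>?v\<bar> \<le> 2 * real n" using content_bound[OF a(2) that] n by auto
    have "?u ^ j - ?v ^ j = (\<Sum>t<Suc i. ?v ^ (i - t) * ?u ^ t)" unfolding j by (subst power_diff_sumr2) simp
    also have "\<bar>\<dots>\<bar> \<le> (\<Sum>t<Suc i. \<bar>?v ^ (i - t) * ?u ^ t\<bar>)" by (rule sum_abs)
    also have "\<dots> \<le> (\<Sum>t<Suc i. (2 * real n) ^ (i - t) * (2 * real n) ^ t)"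
      unfolding abs_mult power_abs using uv by (intro sum_mono mult_mono power_mono) auto
    also have "\<dots> = (\<Sum>t<Suc i. (2 * real n) ^ i)"
      by (intro sum.cong refl) (simp only: power_add[symmetric] lessThan_iff less_Suc_eq_le le_add_diff_inverse2)
    finally show ?thesis by (simp add: j)
  qed
  have "\<bar>frob_psum j l\<bar> \<le> (\<Sum>x\<in>boxes l. real j * (2 * real n) ^ i)"
    unfolding frob_psum_def using b by (intro order.trans[OF sum_abs] sum_mono) auto
  also have "\<dots> = real j * 2 ^ i * real n ^ j"
    using card_boxes[of l] YD_young(2)[OF a(2)] by (simp add: j power_mult_distrib)
  finally have "\<bar>frob_psum j l\<bar> / real n ^ j \<le> real j * 2 ^ i" using n by (simp add: field_simps)
  thus "\<bar>frob_psum j l / real n ^ j\<bar> \<le> real j * 2 ^ (j - 1)" by (simp add: j abs_divide)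
qed simp

section \<open>Schur functions in the moment coordinates\<close>

lemma hint_of_nat_diff: "b \<le> a \<Longrightarrow> hint x (int a - int b) = hcomp x (a - b)"
  by (simp add: hint_def nat_diff_distrib')

lemma hint_newton:
  assumes "n \<le> int M"
  shows "(\<Sum>i=1..M. psum x i * hint x (n - int i)) = of_int n * hint x n"
proof (cases "n \<le> 0")
  case True
  have "(\<Sum>i=1..M. psum x i * hint x (n - int i)) = 0"
    using True by (intro sum.neutral) (auto simp: hint_def)
  thus ?thesis using True by (auto simp: hint_def)
next
  case False
  define m where "m = nat (n - 1)"
  have n: "n = int (Suc m)" using False by (simp add: m_def)
  have "(\<Sum>i=1..M. psum x i * hint x (n - int i)) = (\<Sum>i=1..Suc m. psum x i * hint x (n - int i))"
    using assms n by (intro sum.mono_neutral_right) (auto simp: hint_def)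
  also have "\<dots> = (\<Sum>k=1..Suc m. psum x k * hcomp x (Suc m - k))"
    unfolding n by (intro sum.cong refl) (simp only: hint_of_nat_diff atLeastAtMost_iff)
  also have "\<dots> = (\<Sum>k<Suc m. psum x (Suc k) * hcomp x (m - k))"
    by (rule sum.reindex_bij_witness[where i=Suc and j="\<lambda>i. i - 1"]) auto
  also have "\<dots> = of_int n * hint x n"
  proof -
    have "hint x n = hcomp x (Suc m)" by (simp add: n hint_def del: of_nat_Suc hcomp.simps)
    thus ?thesis by (simp add: n)
  qed
  finally show ?thesis .
qed

interpretation NP: newton_pair "psum x" "hint x" for x
  by standard (simp add: hint_def, rule hint_newton)

definition schur_tuple :: "(nat \<Rightarrow> real) \<Rightarrow> nat \<Rightarrow> (nat \<Rightarrow> int) \<Rightarrow> real" where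
  "schur_tuple x N l = NP.S x N l"

text \<open>The formula \<partial>h_n/\<partial>p_k = h_{n-k}/k for k = i + 1, as the variable x_i
  stands for p_{i+1}. Differentiating Newton's recursion gives h_{n-k} once from p_k itself and, by
  induction and Newton's identity at degree n - k, another (n-k)/k times. Together this is n/k
  times, and the recursion divides by n.\<close>

lemma hcomp_deriv:
  assumes "i \<ge> 1"
  shows "((\<lambda>t. hcomp (x(i := t)) n) has_real_derivative (hint (x(i := t)) (int n - (int i + 1)) / real (i + 1))) (at t)"
proof (induction n rule: less_induct)
  case (less n)
  show ?case
  proof (cases n)
    case 0
    thus ?thesis by (simp add: hint_def)
  next
    case (Suc m)
    let ?x = "\<lambda>t. x(i := t)"
    have p: "((\<lambda>t. psum (?x t) (Suc k)) has_real_derivative (if k = i then 1 else 0)) (at t)" for k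
      using assms by (cases "k = i"; cases "k = 0") (auto simp: psum_def intro!: derivative_eq_intros)
    have IH: "((\<lambda>t. hcomp (?x t) (m - k)) has_real_derivative (hint (?x t) (int (m - k) - (int i + 1)) / real (i + 1))) (at t)" for k
      by (rule less.IH) (use Suc in simp)
    have "((\<lambda>t. (\<Sum>k<Suc m. psum (?x t) (Suc k) * hcomp (?x t) (m - k)) / real (Suc m)) has_real_derivative
       (\<Sum>k<Suc m. (if k = i then 1 else 0) * hcomp (?x t) (m - k)
           + (hint (?x t) (int (m - k) - (int i + 1)) / real (i + 1)) * psum (?x t) (Suc k)) / real (Suc m)) (at t)"
      by (intro DERIV_cdivide DERIV_sum DERIV_mult p IH)
    moreover have "(\<Sum>k<Suc m. (if k = i then 1 else 0) * hcomp (?x t) (m - k)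
           + (hint (?x t) (int (m - k) - (int i + 1)) / real (i + 1)) * psum (?x t) (Suc k)) / real (Suc m)
        = hint (?x t) (int n - (int i + 1)) / real (i + 1)"
    proof -
      define q where "q = hint (?x t) (int m - int i)"
      have 1: "(\<Sum>k<Suc m. (if k = i then 1 else 0) * hcomp (?x t) (m - k)) = q"
      proof -
        have "(\<Sum>k<Suc m. (if k = i then 1 else 0) * hcomp (?x t) (m - k)) = (\<Sum>k<Suc m. if k = i then hcomp (?x t) (m - k) else 0)"
          by (intro sum.cong) auto
        thus ?thesis by (auto simp: q_def hint_def nat_diff_distrib')
      qed
      have "(\<Sum>k<Suc m. hint (?x t) (int (m - k) - (int i + 1)) * psum (?x t) (Suc k)) = (\<Sum>j=1..Suc m. psum (?x t) j * hint (?x t) (int m - int i - int j))"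
        by (rule sum.reindex_bij_witness[where i="\<lambda>i. i - 1" and j=Suc]) (auto simp: of_nat_diff algebra_simps)
      also have "\<dots> = of_int (int m - int i) * q"
        unfolding q_def by (rule hint_newton) simp
      finally have 2: "(\<Sum>k<Suc m. (hint (?x t) (int (m - k) - (int i + 1)) / real (i + 1)) * psum (?x t) (Suc k)) = (real m - real i) * q / real (i + 1)"
        by (simp add: sum_divide_distrib[symmetric])
      have f1: "q + (real m - real i) * q / real (i + 1) = real (Suc m) * q / real (i + 1)"
        by (simp add: field_simps)
      have f2: "hint (?x t) (int n - (int i + 1)) = q" using Suc by (simp add: q_def)
      show ?thesis unfolding sum.distrib 1 2 f1 f2 by simp
    qed
    ultimately show ?thesis by (simp only: Suc hcomp.simps)
  qed
qed

lemma hint_deriv: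
  assumes "i \<ge> 1"
  shows "((\<lambda>t. hint (x(i := t)) m) has_real_derivative (hint (x(i := t)) (m - (int i + 1)) / real (i + 1))) (at t)"
proof (cases "m < 0")
  case True thus ?thesis by (simp add: hint_def)
next
  case False thus ?thesis using hcomp_deriv[OF assms, of x "nat m" t] by (simp add: hint_def)
qed

lemma schur_tuple_deriv:
  assumes "i \<ge> 1"
  shows "((\<lambda>t. schur_tuple (x(i := t)) N l) has_real_derivative (NP.lower_sum (x(i := t)) N (int i + 1) l / real (i + 1))) (at t)"
proof -
  let ?x = "\<lambda>t. x(i := t)"
  have "((\<lambda>t. \<Sum>\<tau> | \<tau> permutes {..<N}. of_int (sign \<tau>) * (\<Prod>j<N. hint (?x t) ((l \<circ> \<tau>) j + int j + 1 - int N))) has_real_derivative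
     (\<Sum>\<tau> | \<tau> permutes {..<N}. of_int (sign \<tau>) * (\<Sum>j<N. (hint (?x t) ((l \<circ> \<tau>) j + int j + 1 - int N - (int i + 1)) / real (i + 1))
       * (\<Prod>k\<in>{..<N}-{j}. hint (?x t) ((l \<circ> \<tau>) k + int k + 1 - int N))))) (at t)"
    by (intro DERIV_sum DERIV_cmult has_field_derivative_prod hint_deriv assms)
  moreover have "(\<lambda>t. schur_tuple (?x t) N l) = (\<lambda>t. \<Sum>\<tau> | \<tau> permutes {..<N}. of_int (sign \<tau>) * (\<Prod>j<N. hint (?x t) ((l \<circ> \<tau>) j + int j + 1 - int N)))"
    by (simp add: schur_tuple_def NP.S_def Alt_def NP.jt_prod_def NP.col_def)
  moreover have "NP.lower_sum (?x t) N (int i + 1) l / real (i + 1) = (\<Sum>\<tau> | \<tau> permutes {..<N}. of_int (sign \<tau>) * (\<Sum>j<N. (hint (?x t) ((l \<circ> \<tau>) j + int j + 1 - int N - (int i + 1)) / real (i + 1))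
       * (\<Prod>k\<in>{..<N}-{j}. hint (?x t) ((l \<circ> \<tau>) k + int k + 1 - int N))))"
    unfolding NP.lower_sum_Alt Alt_def NP.col_def NP.jt_rest_def sum_divide_distrib sum_distrib_left
    by (intro sum.cong refl) (simp add: algebra_simps)
  ultimately show ?thesis by simp
qed

text \<open>In \<open>schurq\<close> the permutation sends rows to columns, in \<open>Alt\<close>
  columns to rows, so the two sums correspond under inversion.\<close>

lemma schurq_eq_S: "schurq \<mu> x = schur_tuple x (length \<mu>) (beta_tuple (length \<mu>) \<mu>)"
proof -
  let ?N = "length \<mu>"
  have "schur_tuple x ?N (beta_tuple ?N \<mu>) = (\<Sum>\<tau> | \<tau> permutes {..<?N}. of_int (sign \<tau>) * (\<Prod>j<?N. hint x ((beta_tuple ?N \<mu> \<circ> \<tau>) j + int j + 1 - int ?N)))"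
    by (simp add: schur_tuple_def NP.S_def Alt_def NP.jt_prod_def NP.col_def)
  also have "\<dots> = (\<Sum>\<tau> | \<tau> permutes {..<?N}. of_int (sign (inv \<tau>)) * (\<Prod>j<?N. hint x ((beta_tuple ?N \<mu> \<circ> inv \<tau>) j + int j + 1 - int ?N)))"
    by (rule sum_permutations_inverse)
  also have "\<dots> = schurq \<mu> x"
    unfolding schurq_def
  proof (rule sum.cong[OF refl])
    fix \<tau> assume "\<tau> \<in> {\<tau>. \<tau> permutes {..<?N}}"
    hence p: "\<tau> permutes {..<?N}" by simp
    have "(\<Prod>j<?N. hint x ((beta_tuple ?N \<mu> \<circ> inv \<tau>) j + int j + 1 - int ?N)) = (\<Prod>i<?N. hint x ((beta_tuple ?N \<mu> \<circ> inv \<tau>) (\<tau> i) + int (\<tau> i) + 1 - int ?N))"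
      by (rule prod.reindex_bij_betw[OF permutes_imp_bij[OF p], symmetric])
    also have "\<dots> = (\<Prod>i<?N. hint x (int (\<mu> ! i) - int i + int (\<tau> i)))"
      by (intro prod.cong refl arg_cong[where f="hint x"]) (simp add: permutes_inverses[OF p] beta_tuple_def rowlen_def)
    finally show "of_int (sign (inv \<tau>)) * (\<Prod>j<?N. hint x ((beta_tuple ?N \<mu> \<circ> inv \<tau>) j + int j + 1 - int ?N))
      = of_int (sign \<tau>) * (\<Prod>i<?N. hint x (int (\<mu> ! i) - int i + int (\<tau> i)))"
      using sign_inverse[OF permutes_imp_permutation[OF _ p]] by simp
  qed
  finally show ?thesis by simp
qed

text \<open>The row with entry 0 consists of h_{j-N} for j = 0, ..., N, which is 0 except for a 1 in
  the last column; the determinant is expanded along it. This is what allows \<open>schurq_S\<close>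
  to use any sufficiently large number of rows.\<close>

lemma schur_tuple_pad:
  assumes "l N = 0"
  shows "schur_tuple x (Suc N) l = schur_tuple x N (\<lambda>i. l i - 1)"
proof -
  let ?P = "\<lambda>\<tau>. \<Prod>j<Suc N. hint x ((l \<circ> \<tau>) j + int j + 1 - int (Suc N))"
  have "schur_tuple x (Suc N) l = (\<Sum>\<tau> | \<tau> permutes {..<Suc N}. of_int (sign \<tau>) * ?P \<tau>)"
    by (simp add: schur_tuple_def NP.S_def Alt_def NP.jt_prod_def NP.col_def)
  also have "\<dots> = (\<Sum>\<tau> | \<tau> permutes {..<N}. of_int (sign \<tau>) * ?P \<tau>)"
  proof (rule sum.mono_neutral_right)
    show "finite {\<tau>. \<tau> permutes {..<Suc N}}" by (rule finite_perms)
    show "{\<tau>. \<tau> permutes {..<N}} \<subseteq> {\<tau>. \<tau> permutes {..<Suc N}}"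
      by (auto intro: permutes_subset)
    show "\<forall>\<tau>\<in>{\<tau>. \<tau> permutes {..<Suc N}} - {\<tau>. \<tau> permutes {..<N}}. of_int (sign \<tau>) * ?P \<tau> = 0"
    proof
      fix \<tau> assume "\<tau> \<in> {\<tau>. \<tau> permutes {..<Suc N}} - {\<tau>. \<tau> permutes {..<N}}"
      hence p: "\<tau> permutes {..<Suc N}" and np: "\<not> \<tau> permutes {..<N}" by auto
      define j where "j = inv \<tau> N"
      have tj: "\<tau> j = N" by (simp add: j_def permutes_inverses[OF p])
      have "j < Suc N" using permutes_in_image[OF permutes_inv[OF p], of N] by (simp add: j_def)
      moreover have "j \<noteq> N"
      proof
        assume "j = N"
        hence "\<tau> permutes {..<N}" using tj by (intro permutes_superset[OF p]) auto
        thus False using np by simp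
      qed
      ultimately have "hint x ((l \<circ> \<tau>) j + int j + 1 - int (Suc N)) = 0" using tj assms by (simp add: hint_def)
      hence "?P \<tau> = 0" using \<open>j < Suc N\<close> by (intro prod_zero) auto
      thus "of_int (sign \<tau>) * ?P \<tau> = 0" by simp
    qed
  qed
  also have "\<dots> = schur_tuple x N (\<lambda>i. l i - 1)"
    unfolding schur_tuple_def NP.S_def Alt_def NP.jt_prod_def NP.col_def
  proof (rule sum.cong[OF refl])
    fix \<tau> assume "\<tau> \<in> {\<tau>. \<tau> permutes {..<N}}"
    hence "\<tau> N = N" by (auto simp: permutes_def)
    hence "?P \<tau> = (\<Prod>j<N. hint x ((l \<circ> \<tau>) j + int j + 1 - int (Suc N)))"
      using assms by (simp add: hint_def)
    also have "\<dots> = (\<Prod>j<N. hint x (((\<lambda>i. l i - 1) \<circ> \<tau>) j + int j + 1 - int N))"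
      by (intro prod.cong refl arg_cong[where f="hint x"]) simp
    finally show "of_int (sign \<tau>) * ?P \<tau> = of_int (sign \<tau>) * (\<Prod>j<N. hint x (((\<lambda>i. l i - 1) \<circ> \<tau>) j + int j + 1 - int N))"
      by simp
  qed
  finally show ?thesis .
qed

lemma schurq_S: "length \<mu> \<le> N \<Longrightarrow> schurq \<mu> x = schur_tuple x N (beta_tuple N \<mu>)"
proof (induction N rule: dec_induct)
  case base show ?case by (rule schurq_eq_S)
next
  case (step n)
  have "beta_tuple (Suc n) \<mu> n = 0" using step by (simp add: beta_tuple_def rowlen_def)
  moreover have "(\<lambda>i. beta_tuple (Suc n) \<mu> i - 1) = beta_tuple n \<mu>" by (auto simp: beta_tuple_def)
  ultimately show ?case using schur_tuple_pad[of "beta_tuple (Suc n) \<mu>" n x] step by simp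
qed

lemma schur_tuple_cong: "(\<And>i. i < N \<Longrightarrow> l i = l' i) \<Longrightarrow> schur_tuple x N l = schur_tuple x N l'"
  unfolding schur_tuple_def NP.S_def
proof -
  assume e: "\<And>i. i < N \<Longrightarrow> l i = l' i"
  show "Alt N (NP.jt_prod x N) l = Alt N (NP.jt_prod x N) l'"
    unfolding Alt_def
  proof (rule sum.cong[OF refl])
    fix \<tau> assume "\<tau> \<in> {\<tau>. \<tau> permutes {..<N}}"
    hence p: "\<tau> permutes {..<N}" by simp
    have "NP.jt_prod x N (l \<circ> \<tau>) = NP.jt_prod x N (l' \<circ> \<tau>)"
      unfolding NP.jt_prod_def using e permutes_in_image[OF p] by (intro prod.cong) auto
    thus "of_int (sign \<tau>) * NP.jt_prod x N (l \<circ> \<tau>) = of_int (sign \<tau>) * NP.jt_prod x N (l' \<circ> \<tau>)" by simp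
  qed
qed

lemma schurq_Nil: "schurq [] x = 1"
  by (simp add: schurq_def)

lemma schur_tuple_permute: "\<pi> permutes {..<N} \<Longrightarrow> schur_tuple x N (l \<circ> \<pi>) = of_int (sign \<pi>) * schur_tuple x N l"
  unfolding schur_tuple_def NP.S_def by (rule Alt_permute)

lemma schur_tuple_not_inj: "\<not> inj_on l {..<N} \<Longrightarrow> schur_tuple x N l = 0"
  unfolding schur_tuple_def by (rule NP.S_not_inj)

lemma schur_tuple_neg: "s < N \<Longrightarrow> l s < 0 \<Longrightarrow> schur_tuple x N l = 0"
  unfolding schur_tuple_def by (rule NP.S_neg)

section \<open>Asymptotics of relative dimensions\<close>

lemma schur_tuple_euler:
  assumes "\<And>s. s < N \<Longrightarrow> l s \<le> int M"
  shows "(\<Sum>j=1..M. psum x j * (\<Sum>s<N. schur_tuple x N (l(s := l s - int j)))) = of_int (tuple_size N l) * schur_tuple x N l"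
  using NP.S_euler[where N=N and l=l and M=M and x=x, OF assms] by (simp add: NP.lower_sum_def schur_tuple_def)

lemma aitken_cong: "(\<And>i. i < N \<Longrightarrow> k i = k' i) \<Longrightarrow> aitken N l k = aitken N l k'"
proof -
  assume e: "\<And>i. i < N \<Longrightarrow> k i = k' i"
  show ?thesis unfolding aitken_def Alt_def
  proof (rule sum.cong[OF refl])
    fix \<tau> assume "\<tau> \<in> {\<tau>. \<tau> permutes {..<N}}"
    hence p: "\<tau> permutes {..<N}" by simp
    have "(\<Prod>j<N. recip_fact (l j - (k \<circ> \<tau>) j)) = (\<Prod>j<N. recip_fact (l j - (k' \<circ> \<tau>) j))"
      using e permutes_in_image[OF p] by (intro prod.cong) auto
    thus "of_int (sign \<tau>) * (\<Prod>j<N. recip_fact (l j - (k \<circ> \<tau>) j)) = of_int (sign \<tau>) * (\<Prod>j<N. recip_fact (l j - (k' \<circ> \<tau>) j))" by simp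
  qed
qed

lemma tuple_size_cong: "(\<And>i. i < N \<Longrightarrow> k i = k' i) \<Longrightarrow> tuple_size N k = tuple_size N k'"
  unfolding tuple_size_def by (intro sum.cong) auto

lemma sorted_partition:
  assumes "inj_on k {..<N}" "nonneg N k"
  obtains \<pi> m where "\<pi> permutes {..<N}" "young m" "length m \<le> N" "\<And>i. i < N \<Longrightarrow> (k \<circ> \<pi>) i = beta_tuple N m i"
    "int (sum_list m) = tuple_size N k"
proof -
  obtain \<pi> where p: "\<pi> permutes {..<N}" "strictly_dec N (k \<circ> \<pi>)"
    using strictly_dec_exists_permutation[OF assms(1)] by blast
  have "nonneg N (k \<circ> \<pi>)"
    using assms(2) permutes_in_image[OF p(1)] by (auto simp: nonneg_def)
  then obtain m where m: "young m" "length m \<le> N" "\<And>i. i < N \<Longrightarrow> beta_tuple N m i = (k \<circ> \<pi>) i"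
    using strictly_dec_nonneg_is_beta_tuple[OF p(2)] by metis
  have "tuple_size N k = tuple_size N (k \<circ> \<pi>)" by (simp only: tuple_size_permute[OF p(1)])
  also have "\<dots> = tuple_size N (beta_tuple N m)" by (rule tuple_size_cong) (simp only: m(3))
  finally have "int (sum_list m) = tuple_size N k" by (simp add: tuple_size_beta_tuple[OF m(2)])
  thus ?thesis using p(1) m by (intro that[of \<pi> m]) auto
qed

text \<open>This is $n(n-1)\cdots(n-m+1)\, n^{-m} \dim(\mu,\lambda)/\dim\lambda$ for $|\mu| = m$, extended
  antisymmetrically to all tuples.\<close>

definition rel_dim :: "nat \<Rightarrow> nat \<Rightarrow> nat list \<Rightarrow> (nat \<Rightarrow> int) \<Rightarrow> real" where
  "rel_dim n N la k = aitken N (beta_tuple N la) k / (aitken N (beta_tuple N la) (beta_tuple N []) * real n ^ nat (tuple_size N k))"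

lemma tuple_size_beta_tuple_Nil: "tuple_size N (beta_tuple N []) = 0"
  using tuple_size_beta_tuple[of "[]" N] by simp

lemma aitken_empty_pos:
  assumes "la \<in> YD n" "length la \<le> N"
  shows "0 < aitken N (beta_tuple N la) (beta_tuple N [])"
proof -
  have "0 < skew_dim N (beta_tuple N la) (beta_tuple N [])"
    using dimY_eq_skew_dim[OF YD_young(1)[OF assms(1)] assms(2)] dimY_pos[OF YD_young(1)[OF assms(1)]] by simp
  thus ?thesis by (simp add: skew_dim_def zero_less_mult_iff)
qed

lemma rel_dim_permute: "\<pi> permutes {..<N} \<Longrightarrow> rel_dim n N la (k \<circ> \<pi>) = of_int (sign \<pi>) * rel_dim n N la k"
  by (simp add: rel_dim_def tuple_size_permute aitken_def Alt_permute)

lemma rel_dim_cong: "(\<And>i. i < N \<Longrightarrow> k i = k' i) \<Longrightarrow> rel_dim n N la k = rel_dim n N la k'"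
  unfolding rel_dim_def using aitken_cong[of N k k'] tuple_size_cong[of N k k'] by simp

lemma abs_sign: "\<bar>real_of_int (sign \<pi>)\<bar> = 1"
  by (simp add: sign_def)

lemma rel_dim_collision: "x < N \<Longrightarrow> y < N \<Longrightarrow> x \<noteq> y \<Longrightarrow> k x = k y \<Longrightarrow> rel_dim n N la k = 0"
  by (simp add: rel_dim_def aitken_collision_right)

lemma rel_dim_not_inj: "\<not> inj_on k {..<N} \<Longrightarrow> rel_dim n N la k = 0"
  by (simp add: rel_dim_def aitken_def Alt_eq_0_not_inj)

text \<open>After sorting, the bound combines \<open>skew_dim_le_dimY\<close> with n!/(n-m)! \<le>
  n^m. If the size of \<open>k\<close> exceeds n, the quotient is 0.\<close>

lemma rel_dim_le_1:
  assumes "la \<in> YD n" "length la \<le> N" "1 \<le> n" "nonneg N k"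
  shows "\<bar>rel_dim n N la k\<bar> \<le> 1"
proof (cases "inj_on k {..<N}")
  case False thus ?thesis by (simp add: rel_dim_not_inj)
next
  case True
  obtain \<pi> m where m: "\<pi> permutes {..<N}" "young m" "length m \<le> N" "\<And>i. i < N \<Longrightarrow> (k \<circ> \<pi>) i = beta_tuple N m i"
    "int (sum_list m) = tuple_size N k" using sorted_partition[OF True assms(4)] by metis
  let ?l = "beta_tuple N la"
  have y: "young la" by (rule YD_young(1)[OF assms(1)])
  have wl: "tuple_size N ?l = int n" using tuple_size_beta_tuple[OF assms(2)] YD_young(2)[OF assms(1)] by simp
  have wm: "tuple_size N (beta_tuple N m) = int (sum_list m)" by (rule tuple_size_beta_tuple[OF m(3)])
  have D0: "0 < aitken N ?l (beta_tuple N [])" by (rule aitken_empty_pos[OF assms(1,2)])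
  have Dm: "0 \<le> aitken N ?l (beta_tuple N m)" by (rule aitken_nonneg[OF strictly_dec_beta_tuple[OF y] strictly_dec_beta_tuple[OF m(2)] nonneg_beta_tuple])
  have "\<bar>rel_dim n N la k\<bar> = \<bar>rel_dim n N la (k \<circ> \<pi>)\<bar>" by (simp only: rel_dim_permute[OF m(1)] abs_mult abs_sign mult_1)
  also have "rel_dim n N la (k \<circ> \<pi>) = rel_dim n N la (beta_tuple N m)" by (rule rel_dim_cong) (rule m(4))
  also have "\<bar>rel_dim n N la (beta_tuple N m)\<bar> \<le> 1"
  proof (cases "sum_list m \<le> n")
    case False
    hence "aitken N ?l (beta_tuple N m) = 0" using wl wm by (intro aitken_eq_0_of_size_less) simp
    thus ?thesis by (simp add: rel_dim_def)
  next
    case le: True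
    let ?m = "sum_list m"
    have "skew_dim N ?l (beta_tuple N m) \<le> skew_dim N ?l (beta_tuple N [])" by (rule skew_dim_le_dimY[OF strictly_dec_beta_tuple[OF y] m(2,3)])
    hence 1: "fact (n - ?m) * aitken N ?l (beta_tuple N m) \<le> fact n * aitken N ?l (beta_tuple N [])"
      using wl wm by (simp add: skew_dim_def tuple_size_beta_tuple_Nil nat_diff_distrib')
    have "fact n = fact (n - ?m) * (fact n div fact (n - ?m) :: nat)" by (simp add: fact_dvd)
    also have "\<dots> \<le> fact (n - ?m) * n ^ ?m" using fact_div_fact_le_pow[OF le] by (intro mult_left_mono) auto
    finally have "real (fact n) \<le> real (fact (n - ?m) * n ^ ?m)" by (simp only: of_nat_le_iff)
    hence 2: "(fact n :: real) \<le> fact (n - ?m) * real n ^ ?m" by simp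
    have "fact (n - ?m) * aitken N ?l (beta_tuple N m) \<le> fact (n - ?m) * (real n ^ ?m * aitken N ?l (beta_tuple N []))"
    proof -
      have "fact n * aitken N ?l (beta_tuple N []) \<le> (fact (n - ?m) * real n ^ ?m) * aitken N ?l (beta_tuple N [])"
        by (rule mult_right_mono[OF 2]) (use D0 in simp)
      with 1 show ?thesis by (simp only: mult.assoc)
    qed
    hence "aitken N ?l (beta_tuple N m) \<le> real n ^ ?m * aitken N ?l (beta_tuple N [])" by simp
    thus ?thesis using Dm D0 assms(3) by (simp add: rel_dim_def wm field_simps)
  qed
  finally show ?thesis .
qed

text \<open>Sums over rows have N terms, and N is going to grow with n. Only boundedly many rows of
  a fixed diagram contribute, which keeps the constants independent of N.\<close>

lemma few_terms_bound:
  fixes f :: "nat \<Rightarrow> real"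
  assumes "\<And>s. s < N \<Longrightarrow> s < q \<Longrightarrow> \<bar>f s\<bar> \<le> B" "\<And>s. s < N \<Longrightarrow> q \<le> s \<Longrightarrow> f s = 0" "0 \<le> B"
  shows "\<bar>\<Sum>s<N. f s\<bar> \<le> real q * B"
proof -
  have "(\<Sum>s<N. f s) = (\<Sum>s\<in>{..<N} \<inter> {..<q}. f s)"
    using assms(2) by (intro sum.mono_neutral_right) (auto, meson not_less)
  hence "\<bar>\<Sum>s<N. f s\<bar> \<le> (\<Sum>s\<in>{..<N} \<inter> {..<q}. \<bar>f s\<bar>)" by simp
  also have "\<dots> \<le> (\<Sum>s\<in>{..<N} \<inter> {..<q}. B)" using assms(1) by (intro sum_mono) auto
  also have "\<dots> = real (card ({..<N} \<inter> {..<q})) * B" by simp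
  also have "\<dots> \<le> real q * B"
    using card_mono[of "{..<q}" "{..<N} \<inter> {..<q}"] assms(3) by (intro mult_right_mono) auto
  finally show ?thesis .
qed

lemma falling_bound:
  assumes "\<bar>real_of_int y\<bar> \<le> a" "i \<le> j" "1 \<le> j" "0 \<le> a"
  shows "\<bar>falling y i\<bar> \<le> (a + real j) ^ j"
proof -
  have "\<bar>falling y i\<bar> = (\<Prod>t<i. \<bar>of_int y - real t\<bar>)" unfolding falling_def by (rule abs_prod)
  also have "\<dots> \<le> (\<Prod>t<i. a + real j)" using assms by (intro prod_mono) auto
  also have "\<dots> = (a + real j) ^ i" by simp
  also have "\<dots> \<le> (a + real j) ^ j" using assms by (intro power_increasing) auto
  finally show ?thesis .
qed

lemma rowlen_le_sum: "rowlen m s \<le> sum_list m"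
  by (auto simp: rowlen_def intro: member_le_sum_list)

lemma rowlen_eq_0: "young m \<Longrightarrow> sum_list m \<le> s \<Longrightarrow> rowlen m s = 0"
  using length_le_sum_list[of m] by (simp add: rowlen_def)

text \<open>This is \<open>aitken_content\<close> divided by the normalisation: its i-th term
  carries the factor n^i, so i = j is the main term and the terms with i < j are smaller by a factor
  1/n at least. \<open>B\<close> bounds the falling factorials of numbers of absolute value at most
  m + j, and at most m + j rows contribute.\<close>

lemma rel_dim_shift_sum_sorted:
  assumes j: "1 \<le> j" and n: "1 \<le> n" and la: "la \<in> YD n" "length la \<le> N"
    and \<mu>: "young \<mu>" "length \<mu> \<le> N" "sum_list \<mu> = m"
  defines "B \<equiv> (real (m + j) + real j) ^ j"
  shows "\<bar>(\<Sum>r<N. rel_dim n N la ((beta_tuple N \<mu>)(r := beta_tuple N \<mu> r + int j)))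
      - (content_psum N j (beta_tuple N la) - content_psum N j (beta_tuple N [])) / real n ^ j * rel_dim n N la (beta_tuple N \<mu>)\<bar>
    \<le> (real m * (2 * B) + (\<Sum>i=1..<j. real (j choose i) * (real (m + j) * B))) / real n"
proof -
  let ?l = "beta_tuple N la" and ?k = "beta_tuple N \<mu>"
  define u where "u i s = rel_dim n N la (?k(s := ?k s + int i))" for i s
  have D0: "0 < aitken N ?l (beta_tuple N [])" by (rule aitken_empty_pos[OF la])
  have n0: "1 \<le> real n" using n by simp
  have B0: "0 \<le> B" by (simp add: B_def)
  have wk: "tuple_size N ?k = int m" using tuple_size_beta_tuple[OF \<mu>(2)] \<mu>(3) by simp
  have ks: "?k s - int N + 1 = int (rowlen \<mu> s) - int s" for s by (simp add: beta_tuple_def)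
  have DDu: "aitken N ?l (?k(s := ?k s + int i)) = u i s * (aitken N ?l (beta_tuple N []) * real n ^ (m + i))" if "s < N" for s i
    using D0 n wk tuple_size_upd[OF that, of ?k "int i"] by (simp add: u_def rel_dim_def nat_add_distrib)
  have DDk: "aitken N ?l ?k = rel_dim n N la ?k * (aitken N ?l (beta_tuple N []) * real n ^ m)"
    using D0 n wk by (simp add: rel_dim_def)
  define R where "R i = real (j choose i) * (\<Sum>s<N. falling (?k s - int N + 1) (j - i) * u i s)" for i
  have "(content_psum N j ?l - content_psum N j ?k) * (rel_dim n N la ?k * (aitken N ?l (beta_tuple N []) * real n ^ m))
     = (\<Sum>i=1..j. real (j choose i) * (\<Sum>s<N. falling (?k s - int N + 1) (j - i) * (u i s * (aitken N ?l (beta_tuple N []) * real n ^ (m + i)))))"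
    unfolding DDk[symmetric] aitken_content
    by (intro sum.cong refl arg_cong2[where f="(*)"]) (simp_all only: DDu lessThan_iff)
  also have "\<dots> = (\<Sum>i=1..j. R i * real n ^ i) * (aitken N ?l (beta_tuple N []) * real n ^ m)"
    unfolding R_def sum_distrib_right sum_distrib_left
    by (intro sum.cong refl) (simp add: power_add mult_ac)
  finally have "((content_psum N j ?l - content_psum N j ?k) * rel_dim n N la ?k) * (aitken N ?l (beta_tuple N []) * real n ^ m) = (\<Sum>i=1..j. R i * real n ^ i) * (aitken N ?l (beta_tuple N []) * real n ^ m)"
    by (simp only: mult.assoc)
  hence "(content_psum N j ?l - content_psum N j ?k) * rel_dim n N la ?k = (\<Sum>i=1..j. R i * real n ^ i)"
    using D0 n by simp
  also have "\<dots> = (\<Sum>i=1..<j. R i * real n ^ i) + R j * real n ^ j"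
    using j by (cases j) (auto simp: atLeastLessThanSuc_atLeastAtMost)
  also have "R j = (\<Sum>r<N. u j r)" by (simp add: R_def)
  finally have main: "(\<Sum>r<N. u j r) * real n ^ j - (content_psum N j ?l - content_psum N j (beta_tuple N [])) * rel_dim n N la ?k
     = - (content_psum N j ?k - content_psum N j (beta_tuple N [])) * rel_dim n N la ?k - (\<Sum>i=1..<j. R i * real n ^ i)"
    by (simp add: algebra_simps)
  have u1: "\<bar>rel_dim n N la ?k\<bar> \<le> 1" by (rule rel_dim_le_1[OF la n nonneg_beta_tuple])
  have nk: "nonneg N (?k(s := ?k s + int i))" for s i using nonneg_beta_tuple[of N \<mu>] by (auto simp: nonneg_def)
  \<comment> \<open>\<open>aitken_content\<close> compares with the power sum of the tuple of \<mu>,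
    which differs from that of the empty tuple by an amount bounded independently of n and
    N.\<close>
  have CFk: "\<bar>content_psum N j ?k - content_psum N j (beta_tuple N [])\<bar> \<le> real m * (2 * B)"
    unfolding content_psum_def sum_subtractf[symmetric]
  proof (rule few_terms_bound)
    fix s assume s: "s < N" "s < m"
    have "\<bar>real_of_int (?k s - int N + 1)\<bar> \<le> real (m + j)" unfolding ks using rowlen_le_sum[of \<mu> s] \<mu>(3) s by simp
    hence 1: "\<bar>falling (?k s - int N + 1) j\<bar> \<le> B" unfolding B_def using j by (intro falling_bound) auto
    have "\<bar>real_of_int (beta_tuple N [] s - int N + 1)\<bar> \<le> real (m + j)" using s by (simp add: beta_tuple_def rowlen_def)
    hence 2: "\<bar>falling (beta_tuple N [] s - int N + 1) j\<bar> \<le> B" unfolding B_def using j by (intro falling_bound) auto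
    show "\<bar>falling (?k s - int N + 1) j - falling (beta_tuple N [] s - int N + 1) j\<bar> \<le> 2 * B" using 1 2 by linarith
  next
    fix s assume "s < N" "m \<le> s"
    thus "falling (?k s - int N + 1) j - falling (beta_tuple N [] s - int N + 1) j = 0"
      using rowlen_eq_0[OF \<mu>(1), of s] \<mu>(3) by (simp add: beta_tuple_def rowlen_def)
  qed (use B0 in simp)
  have R: "\<bar>R i\<bar> \<le> real (j choose i) * (real (m + j) * B)" if i: "1 \<le> i" "i < j" for i
  proof -
    have "\<bar>\<Sum>s<N. falling (?k s - int N + 1) (j - i) * u i s\<bar> \<le> real (m + j) * B"
    proof (rule few_terms_bound)
      fix s assume s: "s < N" "s < m + j"
      have "\<bar>real_of_int (?k s - int N + 1)\<bar> \<le> real (m + j)" unfolding ks using rowlen_le_sum[of \<mu> s] \<mu>(3) s by simp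
      hence 1: "\<bar>falling (?k s - int N + 1) (j - i)\<bar> \<le> B" unfolding B_def using j by (intro falling_bound) auto
      have 2: "\<bar>u i s\<bar> \<le> 1" unfolding u_def by (rule rel_dim_le_1[OF la n nk])
      show "\<bar>falling (?k s - int N + 1) (j - i) * u i s\<bar> \<le> B"
        unfolding abs_mult using mult_mono[OF 1 2 B0] by simp
    next
      fix s assume s: "s < N" "m + j \<le> s"
      \<comment> \<open>Such a row and the one i places above it are both empty, so raising it by i
        creates a collision.\<close>
      have "rowlen \<mu> s = 0" "rowlen \<mu> (s - i) = 0" using s i \<mu> by (auto intro!: rowlen_eq_0)
      hence "u i s = 0" unfolding u_def using s i by (intro rel_dim_collision[of s N "s - i"]) (auto simp: beta_tuple_def of_nat_diff)
      thus "falling (?k s - int N + 1) (j - i) * u i s = 0" by simp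
    qed (rule B0)
    thus ?thesis unfolding R_def abs_mult by (intro mult_mono) auto
  qed
  define E where "E = (\<Sum>r<N. u j r) - (content_psum N j ?l - content_psum N j (beta_tuple N [])) / real n ^ j * rel_dim n N la ?k"
  have "\<bar>E\<bar> * real n ^ j = \<bar>E * real n ^ j\<bar>" by (simp add: abs_mult)
  also have "E * real n ^ j = - (content_psum N j ?k - content_psum N j (beta_tuple N [])) * rel_dim n N la ?k - (\<Sum>i=1..<j. R i * real n ^ i)"
    unfolding main[symmetric] E_def using n by (simp add: field_simps)
  also have "\<bar>\<dots>\<bar> \<le> \<bar>- (content_psum N j ?k - content_psum N j (beta_tuple N [])) * rel_dim n N la ?k\<bar> + \<bar>\<Sum>i=1..<j. R i * real n ^ i\<bar>"
    by (rule abs_triangle_ineq4)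
  also have "\<dots> \<le> real m * (2 * B) * real n ^ (j - 1) + (\<Sum>i=1..<j. real (j choose i) * (real (m + j) * B)) * real n ^ (j - 1)"
  proof (rule add_mono)
    have "\<bar>- (content_psum N j ?k - content_psum N j (beta_tuple N [])) * rel_dim n N la ?k\<bar> \<le> (real m * (2 * B)) * 1"
      unfolding abs_mult abs_minus using CFk u1 B0 by (intro mult_mono) auto
    also have "\<dots> \<le> (real m * (2 * B)) * real n ^ (j - 1)"
      using B0 n0 by (intro mult_left_mono one_le_power) auto
    finally show "\<bar>- (content_psum N j ?k - content_psum N j (beta_tuple N [])) * rel_dim n N la ?k\<bar> \<le> real m * (2 * B) * real n ^ (j - 1)" .
    have "\<bar>\<Sum>i=1..<j. R i * real n ^ i\<bar> \<le> (\<Sum>i=1..<j. \<bar>R i * real n ^ i\<bar>)" by (rule sum_abs)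
    also have "\<dots> \<le> (\<Sum>i=1..<j. real (j choose i) * (real (m + j) * B) * real n ^ (j - 1))"
    proof (rule sum_mono)
      fix i assume i: "i \<in> {1..<j}"
      have "real n ^ i \<le> real n ^ (j - 1)" using i n0 by (intro power_increasing) auto
      thus "\<bar>R i * real n ^ i\<bar> \<le> real (j choose i) * (real (m + j) * B) * real n ^ (j - 1)"
        unfolding abs_mult using R[of i] i by (intro mult_mono) auto
    qed
    finally show "\<bar>\<Sum>i=1..<j. R i * real n ^ i\<bar> \<le> (\<Sum>i=1..<j. real (j choose i) * (real (m + j) * B)) * real n ^ (j - 1)"
      by (simp only: sum_distrib_right)
  qed
  also have "\<dots> = (real m * (2 * B) + (\<Sum>i=1..<j. real (j choose i) * (real (m + j) * B))) * real n ^ (j - 1)"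
    by (simp only: distrib_right)
  finally have "\<bar>E\<bar> * real n ^ j \<le> (real m * (2 * B) + (\<Sum>i=1..<j. real (j choose i) * (real (m + j) * B))) * real n ^ (j - 1)" .
  moreover have "real n ^ j = real n * real n ^ (j - 1)" using j by (cases j) auto
  ultimately have "(\<bar>E\<bar> * real n) * real n ^ (j - 1) \<le> (real m * (2 * B) + (\<Sum>i=1..<j. real (j choose i) * (real (m + j) * B))) * real n ^ (j - 1)"
    by (simp only: mult.assoc)
  hence "\<bar>E\<bar> * real n \<le> real m * (2 * B) + (\<Sum>i=1..<j. real (j choose i) * (real (m + j) * B))"
    using n by (subst (asm) mult_le_cancel_right) auto
  thus ?thesis unfolding E_def u_def using n by (simp add: pos_le_divide_eq)
qed

lemma rel_dim_shift_sum:
  assumes j: "1 \<le> j"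
  shows "\<exists>C\<ge>0. \<forall>n N la k. 1 \<le> n \<longrightarrow> la \<in> YD n \<longrightarrow> length la \<le> N \<longrightarrow> nonneg N k \<longrightarrow> inj_on k {..<N} \<longrightarrow> tuple_size N k = int m \<longrightarrow>
     \<bar>(\<Sum>r<N. rel_dim n N la (k(r := k r + int j))) - (content_psum N j (beta_tuple N la) - content_psum N j (beta_tuple N [])) / real n ^ j * rel_dim n N la k\<bar> \<le> C / real n"
proof -
  define B where "B = (real (m + j) + real j) ^ j"
  define C where "C = real m * (2 * B) + (\<Sum>i=1..<j. real (j choose i) * (real (m + j) * B))"
  show ?thesis
  proof (intro exI[of _ C] conjI allI impI)
    show "0 \<le> C" unfolding C_def B_def by (intro add_nonneg_nonneg sum_nonneg mult_nonneg_nonneg) auto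
    fix n N la k assume n: "1 \<le> n" and la: "la \<in> YD n" "length la \<le> N" and k: "nonneg N k" "inj_on k {..<N}" "tuple_size N k = int m"
    obtain \<pi> \<mu> where m: "\<pi> permutes {..<N}" "young \<mu>" "length \<mu> \<le> N" "\<And>i. i < N \<Longrightarrow> (k \<circ> \<pi>) i = beta_tuple N \<mu> i"
      "int (sum_list \<mu>) = tuple_size N k" using sorted_partition[OF k(2,1)] by metis
    have sm: "sum_list \<mu> = m" using m(5) k(3) by simp
    define c where "c = (content_psum N j (beta_tuple N la) - content_psum N j (beta_tuple N [])) / real n ^ j"
    define T where "T k = (\<Sum>r<N. rel_dim n N la (k(r := k r + int j)))" for k
    \<comment> \<open>Written through \<open>Alt\<close>, the sum over r is antisymmetric in
      \<open>k\<close>, which reduces the estimate to sorted tuples.\<close>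
    have Talt: "T k = Alt N (\<lambda>b. \<Sum>x<N. 1 * (\<Prod>i<N. recip_fact (beta_tuple N la i - (b(x := b x + int j)) i))) k / (aitken N (beta_tuple N la) (beta_tuple N []) * real n ^ nat (tuple_size N k + int j))" for k
    proof -
      have "T k = (\<Sum>r<N. 1 * Alt N (\<lambda>b. \<Prod>i<N. recip_fact (beta_tuple N la i - b i)) (k(r := k r + int j)) / (aitken N (beta_tuple N la) (beta_tuple N []) * real n ^ nat (tuple_size N k + int j)))"
        unfolding T_def rel_dim_def by (intro sum.cong refl) (simp only: tuple_size_upd lessThan_iff aitken_def mult_1)
      thus ?thesis
        unfolding sum_divide_distrib[symmetric]
        by (simp only: Alt_sum_shift[where H="\<lambda>_. 1" and a="int j"])
    qed
    have 1: "T (k \<circ> \<pi>) = of_int (sign \<pi>) * T k"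
      unfolding Talt tuple_size_permute[OF m(1)] Alt_permute[OF m(1)] by simp
    have 2: "T (k \<circ> \<pi>) = T (beta_tuple N \<mu>)"
      unfolding T_def using m(4) by (intro sum.cong refl rel_dim_cong) auto
    have 3: "rel_dim n N la (beta_tuple N \<mu>) = of_int (sign \<pi>) * rel_dim n N la k"
      unfolding rel_dim_permute[OF m(1), symmetric] using m(4) by (intro rel_dim_cong) simp
    have "T (beta_tuple N \<mu>) - c * rel_dim n N la (beta_tuple N \<mu>) = of_int (sign \<pi>) * (T k - c * rel_dim n N la k)"
      using 1 2 3 by (simp add: algebra_simps)
    hence "\<bar>T (beta_tuple N \<mu>) - c * rel_dim n N la (beta_tuple N \<mu>)\<bar> = \<bar>T k - c * rel_dim n N la k\<bar>" by (simp only: abs_mult abs_sign mult_1)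
    moreover have "\<bar>T (beta_tuple N \<mu>) - c * rel_dim n N la (beta_tuple N \<mu>)\<bar> \<le> C / real n"
      unfolding T_def c_def C_def B_def by (rule rel_dim_shift_sum_sorted[OF j n la m(2,3) sm])
    ultimately show "\<bar>(\<Sum>r<N. rel_dim n N la (k(r := k r + int j))) - (content_psum N j (beta_tuple N la) - content_psum N j (beta_tuple N [])) / real n ^ j * rel_dim n N la k\<bar> \<le> C / real n"
      unfolding T_def c_def by simp
  qed
qed


lemma psum_bounds:
  assumes "1 \<le> j"
  shows "\<exists>C\<ge>0. \<forall>n N la. 1 \<le> n \<longrightarrow> la \<in> YD n \<longrightarrow> length la \<le> N \<longrightarrow>
     \<bar>(content_psum N j (beta_tuple N la) - content_psum N j (beta_tuple N [])) / real n ^ j - psum (qvec (iota n la)) j\<bar> \<le> C / real n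
     \<and> \<bar>psum (qvec (iota n la)) j\<bar> \<le> C"
proof -
  obtain C where C: "C \<ge> 0" "\<And>n l N. 1 \<le> n \<Longrightarrow> l \<in> YD n \<Longrightarrow> length l \<le> N \<Longrightarrow>
     \<bar>(content_psum N j (beta_tuple N l) - content_psum N j (beta_tuple N [])) / real n ^ j - frob_psum j l / real n ^ j\<bar> \<le> C / real n"
    using frob_psum_approx[OF assms] by blast
  obtain D where D: "D \<ge> 0" "\<And>n l. 1 \<le> n \<Longrightarrow> l \<in> YD n \<Longrightarrow> \<bar>frob_psum j l / real n ^ j\<bar> \<le> D"
    using frob_psum_bounded[OF assms] by blast
  show ?thesis
  proof (intro exI[of _ "C + D"] conjI allI impI)
    show "0 \<le> C + D" using C D by simp
    fix n N la assume a: "1 \<le> n" "la \<in> YD n" "length la \<le> N"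
    have e: "psum (qvec (iota n la)) j = frob_psum j la / real n ^ j" by (rule psum_iota[OF a(2,1) assms])
    have "C / real n \<le> (C + D) / real n" using D(1) by (intro divide_right_mono) auto
    thus "\<bar>(content_psum N j (beta_tuple N la) - content_psum N j (beta_tuple N [])) / real n ^ j - psum (qvec (iota n la)) j\<bar> \<le> (C + D) / real n"
      unfolding e using C(2)[OF a] by linarith
    show "\<bar>psum (qvec (iota n la)) j\<bar> \<le> C + D"
      unfolding e using D(2)[OF a(1,2)] C(1) by linarith
  qed
qed

lemma rel_dim_collision_sum:
  assumes "\<not> inj_on k {..<N}"
  shows "(\<Sum>r<N. rel_dim n N la (k(r := k r + int j))) = 0"
proof -
  obtain x y where xy: "x < N" "y < N" "x \<noteq> y" "k x = k y" using assms by (auto simp: inj_on_def)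
  have "(\<Sum>r<N. rel_dim n N la (k(r := k r + int j))) = (\<Sum>r<N. Alt N (\<lambda>b. \<Prod>i<N. recip_fact (beta_tuple N la i - b i)) (k(r := k r + int j))) / (aitken N (beta_tuple N la) (beta_tuple N []) * real n ^ nat (tuple_size N k + int j))"
    unfolding rel_dim_def sum_divide_distrib by (intro sum.cong refl) (simp only: tuple_size_upd lessThan_iff aitken_def)
  thus ?thesis by (simp only: Alt_sum_collision[OF xy] div_0)
qed

text \<open>Both terms satisfy an Euler identity: the first by \<open>Alt_euler\<close>, with the
  inner sum over r in the place of the factor p_j, the second by Newton's identity. Both are
  expanded over the same lowered tuples, so that they can be compared term by term.\<close>

lemma rel_dim_euler:
  assumes k: "nonneg N k" and M: "\<And>s. s < N \<Longrightarrow> k s \<le> int M"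
  shows "of_int (tuple_size N k) * (rel_dim n N la k - schur_tuple x N k) =
    (\<Sum>s<N. \<Sum>j\<in>{1..nat (k s)}. (\<Sum>r<N. rel_dim n N la ((k(s := k s - int j))(r := (k(s := k s - int j)) r + int j))) - psum x j * schur_tuple x N (k(s := k s - int j)))"
proof -
  have 1: "of_int (tuple_size N k) * rel_dim n N la k = (\<Sum>s<N. \<Sum>j\<in>{1..nat (k s)}. \<Sum>r<N. rel_dim n N la ((k(s := k s - int j))(r := (k(s := k s - int j)) r + int j)))"
  proof -
    have w: "tuple_size N ((k(s := k s - int j))(r := (k(s := k s - int j)) r + int j)) = tuple_size N k" if "s < N" "r < N" for s r j
      using tuple_size_upd[OF that(2), of "k(s := k s - int j)" "int j"] tuple_size_upd[OF that(1), of k "- int j"] by simp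
    have "(\<Sum>s<N. \<Sum>j\<in>{1..nat (k s)}. \<Sum>r<N. rel_dim n N la ((k(s := k s - int j))(r := (k(s := k s - int j)) r + int j)))
       = (\<Sum>s<N. \<Sum>j\<in>{1..nat (k s)}. \<Sum>r<N. aitken N (beta_tuple N la) ((k(s := k s - int j))(r := (k(s := k s - int j)) r + int j))) / (aitken N (beta_tuple N la) (beta_tuple N []) * real n ^ nat (tuple_size N k))"
      unfolding rel_dim_def sum_divide_distrib by (intro sum.cong refl) (simp only: w lessThan_iff)
    thus ?thesis unfolding aitken_def Alt_euler[OF k] by (simp add: rel_dim_def aitken_def)
  qed
  have 2: "of_int (tuple_size N k) * schur_tuple x N k = (\<Sum>s<N. \<Sum>j\<in>{1..nat (k s)}. psum x j * schur_tuple x N (k(s := k s - int j)))"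
  proof -
    have "of_int (tuple_size N k) * schur_tuple x N k = (\<Sum>j=1..M. psum x j * (\<Sum>s<N. schur_tuple x N (k(s := k s - int j))))"
      using schur_tuple_euler[OF M] by simp
    also have "\<dots> = (\<Sum>s<N. \<Sum>j=1..M. psum x j * schur_tuple x N (k(s := k s - int j)))"
      unfolding sum_distrib_left by (rule sum.swap)
    also have "\<dots> = (\<Sum>s<N. \<Sum>j\<in>{1..nat (k s)}. psum x j * schur_tuple x N (k(s := k s - int j)))"
    proof (rule sum.cong[OF refl])
      fix s assume s: "s \<in> {..<N}"
      show "(\<Sum>j=1..M. psum x j * schur_tuple x N (k(s := k s - int j))) = (\<Sum>j\<in>{1..nat (k s)}. psum x j * schur_tuple x N (k(s := k s - int j)))"
      proof (rule sum.mono_neutral_right)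
        show "{1..nat (k s)} \<subseteq> {1..M}" using M[of s] s by auto
        show "\<forall>j\<in>{1..M} - {1..nat (k s)}. psum x j * schur_tuple x N (k(s := k s - int j)) = 0"
          using schur_tuple_neg[of s N _ x] s by auto
      qed simp
    qed
    finally show ?thesis .
  qed
  show ?thesis unfolding right_diff_distrib 1 2 by (simp only: sum_subtractf)
qed

text \<open>Induction on the degree: Euler's identity holds for the relative dimensions up to $O(1/n)$ with
  the content power sums in place of the $p_j$.\<close>

lemma rel_dim_asymptotic:
  "\<exists>C\<ge>0. \<forall>n N la k. 1 \<le> n \<longrightarrow> la \<in> YD n \<longrightarrow> length la \<le> N \<longrightarrow> nonneg N k \<longrightarrow> inj_on k {..<N} \<longrightarrow> tuple_size N k = int m \<longrightarrow>
     \<bar>rel_dim n N la k - schur_tuple (qvec (iota n la)) N k\<bar> \<le> C / real n"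
proof (induction m rule: less_induct)
  case (less m)
  \<comment> \<open>Both terms are antisymmetric in \<open>k\<close>, so it suffices to treat
    partitions.\<close>
  have reduce: "\<bar>rel_dim n N la k - schur_tuple (qvec (iota n la)) N k\<bar> \<le> D"
    if sorted: "\<And>mu. young mu \<Longrightarrow> length mu \<le> N \<Longrightarrow> sum_list mu = m \<Longrightarrow> \<bar>rel_dim n N la (beta_tuple N mu) - schur_tuple (qvec (iota n la)) N (beta_tuple N mu)\<bar> \<le> D"
      and k: "nonneg N k" "inj_on k {..<N}" "tuple_size N k = int m" for n N la k D
  proof -
    obtain \<pi> mu where mu: "\<pi> permutes {..<N}" "young mu" "length mu \<le> N" "\<And>i. i < N \<Longrightarrow> (k \<circ> \<pi>) i = beta_tuple N mu i"
      "int (sum_list mu) = tuple_size N k" using sorted_partition[OF k(2,1)] by metis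
    let ?x = "qvec (iota n la)"
    have "rel_dim n N la (beta_tuple N mu) - schur_tuple ?x N (beta_tuple N mu) = rel_dim n N la (k \<circ> \<pi>) - schur_tuple ?x N (k \<circ> \<pi>)"
      using rel_dim_cong[of N "k \<circ> \<pi>" "beta_tuple N mu"] schur_tuple_cong[of N "k \<circ> \<pi>" "beta_tuple N mu"] mu(4) by simp
    also have "\<dots> = of_int (sign \<pi>) * (rel_dim n N la k - schur_tuple ?x N k)"
      by (simp only: rel_dim_permute[OF mu(1)] schur_tuple_permute[OF mu(1)] right_diff_distrib)
    finally have "\<bar>rel_dim n N la (beta_tuple N mu) - schur_tuple ?x N (beta_tuple N mu)\<bar> = \<bar>rel_dim n N la k - schur_tuple ?x N k\<bar>"
      by (simp only: abs_mult abs_sign mult_1)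
    thus ?thesis using sorted[OF mu(2,3)] mu(5) k(3) by simp
  qed
  show ?case
  proof (cases "m = 0")
    case True
    show ?thesis
    proof (intro exI[of _ 0] conjI allI impI)
      fix n N la k assume n: "1 \<le> n" and la: "la \<in> YD n" "length la \<le> N" and k: "nonneg N k" "inj_on k {..<N}" "tuple_size N k = int m"
      show "\<bar>rel_dim n N la k - schur_tuple (qvec (iota n la)) N k\<bar> \<le> 0 / real n"
      proof (rule reduce[OF _ k])
        fix mu assume mu: "young mu" "length mu \<le> N" "sum_list mu = m"
        have "mu = []" using length_le_sum_list[OF mu(1)] mu(3) True by simp
        moreover have "schur_tuple (qvec (iota n la)) N (beta_tuple N []) = 1" using schurq_S[of "[]" N] by (simp add: schurq_Nil)
        moreover have "rel_dim n N la (beta_tuple N []) = 1" using aitken_empty_pos[OF la] by (simp add: rel_dim_def tuple_size_beta_tuple_Nil)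
        ultimately show "\<bar>rel_dim n N la (beta_tuple N mu) - schur_tuple (qvec (iota n la)) N (beta_tuple N mu)\<bar> \<le> 0 / real n" by simp
      qed
    qed simp
  next
    case False
    define P1 where "P1 j C \<longleftrightarrow> C \<ge> 0 \<and> (\<forall>n N la k. 1 \<le> n \<longrightarrow> la \<in> YD n \<longrightarrow> length la \<le> N \<longrightarrow> nonneg N k \<longrightarrow> inj_on k {..<N} \<longrightarrow> tuple_size N k = int (m - j) \<longrightarrow>
      \<bar>rel_dim n N la k - schur_tuple (qvec (iota n la)) N k\<bar> \<le> C / real n)" for j C
    have "\<exists>C. P1 j C" if "j \<in> {1..m}" for j
      unfolding P1_def using less.IH[of "m - j"] that by simp
    then obtain C1 where P1: "\<And>j. j \<in> {1..m} \<Longrightarrow> P1 j (C1 j)" by metis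
    have C1: "j \<in> {1..m} \<Longrightarrow> C1 j \<ge> 0" "j \<in> {1..m} \<Longrightarrow> 1 \<le> n \<Longrightarrow> la \<in> YD n \<Longrightarrow> length la \<le> N \<Longrightarrow> nonneg N k \<Longrightarrow> inj_on k {..<N} \<Longrightarrow> tuple_size N k = int (m - j) \<Longrightarrow>
      \<bar>rel_dim n N la k - schur_tuple (qvec (iota n la)) N k\<bar> \<le> C1 j / real n" for j n N la k
      using P1[of j] unfolding P1_def by blast+
    define P2 where "P2 j C \<longleftrightarrow> C \<ge> 0 \<and> (\<forall>n N la k. 1 \<le> n \<longrightarrow> la \<in> YD n \<longrightarrow> length la \<le> N \<longrightarrow> nonneg N k \<longrightarrow> inj_on k {..<N} \<longrightarrow> tuple_size N k = int (m - j) \<longrightarrow>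
      \<bar>(\<Sum>r<N. rel_dim n N la (k(r := k r + int j))) - (content_psum N j (beta_tuple N la) - content_psum N j (beta_tuple N [])) / real n ^ j * rel_dim n N la k\<bar> \<le> C / real n)" for j C
    have "\<exists>C. P2 j C" if "j \<in> {1..m}" for j
      unfolding P2_def using rel_dim_shift_sum[of j "m - j"] that by simp
    then obtain C2 where P2: "\<And>j. j \<in> {1..m} \<Longrightarrow> P2 j (C2 j)" by metis
    have C2: "j \<in> {1..m} \<Longrightarrow> C2 j \<ge> 0" "j \<in> {1..m} \<Longrightarrow> 1 \<le> n \<Longrightarrow> la \<in> YD n \<Longrightarrow> length la \<le> N \<Longrightarrow> nonneg N k \<Longrightarrow> inj_on k {..<N} \<Longrightarrow> tuple_size N k = int (m - j) \<Longrightarrow>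
      \<bar>(\<Sum>r<N. rel_dim n N la (k(r := k r + int j))) - (content_psum N j (beta_tuple N la) - content_psum N j (beta_tuple N [])) / real n ^ j * rel_dim n N la k\<bar> \<le> C2 j / real n" for j n N la k
      using P2[of j] unfolding P2_def by blast+
    define P3 where "P3 j C \<longleftrightarrow> C \<ge> 0 \<and> (\<forall>n N la. 1 \<le> n \<longrightarrow> la \<in> YD n \<longrightarrow> length la \<le> N \<longrightarrow>
      \<bar>(content_psum N j (beta_tuple N la) - content_psum N j (beta_tuple N [])) / real n ^ j - psum (qvec (iota n la)) j\<bar> \<le> C / real n
     \<and> \<bar>psum (qvec (iota n la)) j\<bar> \<le> C)" for j C
    have "\<exists>C. P3 j C" if "j \<in> {1..m}" for j
      unfolding P3_def using psum_bounds[of j] that by simp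
    then obtain C3 where P3: "\<And>j. j \<in> {1..m} \<Longrightarrow> P3 j (C3 j)" by metis
    have C3: "j \<in> {1..m} \<Longrightarrow> C3 j \<ge> 0" "j \<in> {1..m} \<Longrightarrow> 1 \<le> n \<Longrightarrow> la \<in> YD n \<Longrightarrow> length la \<le> N \<Longrightarrow>
      \<bar>(content_psum N j (beta_tuple N la) - content_psum N j (beta_tuple N [])) / real n ^ j - psum (qvec (iota n la)) j\<bar> \<le> C3 j / real n
     \<and> \<bar>psum (qvec (iota n la)) j\<bar> \<le> C3 j" for j n N la
      using P3[of j] unfolding P3_def by blast+
    \<comment> \<open>For one lowered tuple the error splits into the defect of the shift sum
      (\<open>C2\<close>), the difference between content and Frobenius power sums
      (\<open>C3\<close>), and the induction hypothesis (\<open>C1\<close>) multiplied by the bound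
      on p_j.\<close>
    define D where "D j = C2 j + C3 j + C3 j * C1 j" for j
    define C where "C = (\<Sum>j\<in>{1..m}. D j)"
    have D0: "0 \<le> D j" if "j \<in> {1..m}" for j using C1(1) C2(1) C3(1) that by (simp add: D_def)
    have C0: "0 \<le> C" unfolding C_def using D0 by (rule sum_nonneg)
    have DC: "D j \<le> C" if "j \<in> {1..m}" for j unfolding C_def using that D0 by (intro member_le_sum) auto
    show ?thesis
    \<comment> \<open>At most m rows and at most m values of j give a nonzero term.\<close>
    proof (intro exI[of _ "real m * (real m * C)"] conjI allI impI)
      show "0 \<le> real m * (real m * C)" using C0 by simp
      fix n N la k assume n: "1 \<le> n" and la: "la \<in> YD n" "length la \<le> N" and k: "nonneg N k" "inj_on k {..<N}" "tuple_size N k = int m"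
      let ?x = "qvec (iota n la)"
      have n0: "0 < real n" using n by simp
      show "\<bar>rel_dim n N la k - schur_tuple ?x N k\<bar> \<le> real m * (real m * C) / real n"
      proof (rule reduce[OF _ k])
        fix mu assume mu: "young mu" "length mu \<le> N" "sum_list mu = m"
        let ?k = "beta_tuple N mu"
        define X where "X s j = (\<Sum>r<N. rel_dim n N la ((?k(s := ?k s - int j))(r := (?k(s := ?k s - int j)) r + int j))) - psum ?x j * schur_tuple ?x N (?k(s := ?k s - int j))" for s j
        have wk: "tuple_size N ?k = int m" using tuple_size_beta_tuple[OF mu(2)] mu(3) by simp
        have X0: "X s j = 0" if "\<not> inj_on (?k(s := ?k s - int j)) {..<N}" for s j
          unfolding X_def rel_dim_collision_sum[OF that] schur_tuple_not_inj[OF that] by simp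
        have Xb: "\<bar>X s j\<bar> \<le> C / real n \<and> j \<le> m \<and> s < m" if s: "s < N" and j: "1 \<le> j" "int j \<le> ?k s" and inj: "inj_on (?k(s := ?k s - int j)) {..<N}" for s j
        proof -
          let ?q = "?k(s := ?k s - int j)"
          have nn: "nonneg N ?q" using nonneg_beta_tuple[of N mu] j by (auto simp: nonneg_def)
          have wq: "tuple_size N ?q = int m - int j" using tuple_size_upd[OF s, of ?k "- int j"] wk by simp
          hence jm: "j \<le> m" using tuple_size_nonneg[OF inj nn] by simp
          have jJ: "j \<in> {1..m}" using jm j by simp
          have wq': "tuple_size N ?q = int (m - j)" using wq jm by (simp add: of_nat_diff)
          \<comment> \<open>From row m on the diagram is empty; lowering the entry there by j would
            make it collide with row s + j.\<close>
          have sm: "s < m"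
          proof (rule ccontr)
            assume "\<not> s < m"
            hence z: "rowlen mu s = 0" "rowlen mu (s + j) = 0" using mu by (auto intro!: rowlen_eq_0)
            have "s + j < N" using j z s by (simp add: beta_tuple_def)
            moreover have "?q s = ?q (s + j)" using z j by (simp add: beta_tuple_def)
            ultimately show False using inj s j unfolding inj_on_def by (metis add_cancel_right_right lessThan_iff not_one_le_zero)
          qed
          define u v p c where "u = rel_dim n N la ?q" and "v = schur_tuple ?x N ?q" and "p = psum ?x j" and "c = (content_psum N j (beta_tuple N la) - content_psum N j (beta_tuple N [])) / real n ^ j"
          have b1: "\<bar>u - v\<bar> \<le> C1 j / real n" unfolding u_def v_def by (rule C1(2)[OF jJ n la nn inj wq'])
          have b2: "\<bar>(\<Sum>r<N. rel_dim n N la (?q(r := ?q r + int j))) - c * u\<bar> \<le> C2 j / real n"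
            unfolding u_def c_def by (rule C2(2)[OF jJ n la nn inj wq'])
          have b3: "\<bar>c - p\<bar> \<le> C3 j / real n" "\<bar>p\<bar> \<le> C3 j" unfolding p_def c_def using C3(2)[OF jJ n la] by auto
          have b4: "\<bar>u\<bar> \<le> 1" unfolding u_def by (rule rel_dim_le_1[OF la n nn])
          have Xe: "X s j = ((\<Sum>r<N. rel_dim n N la (?q(r := ?q r + int j))) - c * u) + ((c - p) * u + p * (u - v))"
            by (simp add: X_def v_def p_def algebra_simps)
          hence "\<bar>X s j\<bar> \<le> C2 j / real n + (C3 j / real n * 1 + C3 j * (C1 j / real n))"
          proof -
            have "\<bar>(c - p) * u\<bar> \<le> C3 j / real n * 1" unfolding abs_mult by (intro mult_mono b3 b4) (use C3(1)[OF jJ] in auto)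
            moreover have "\<bar>p * (u - v)\<bar> \<le> C3 j * (C1 j / real n)" unfolding abs_mult by (intro mult_mono b3 b1) (use C3(1)[OF jJ] in auto)
            ultimately show ?thesis unfolding Xe using b2 by linarith
          qed
          also have "\<dots> = D j / real n" by (simp add: D_def add_divide_distrib)
          also have "\<dots> \<le> C / real n" using DC[OF jJ] by (intro divide_right_mono) auto
          finally show ?thesis using jm sm by simp
        qed
        define M where "M = m + N"
        have M: "?k s \<le> int M" if "s < N" for s using rowlen_le_sum[of mu s] mu(3) by (simp add: beta_tuple_def M_def)
        have "real m * (rel_dim n N la ?k - schur_tuple ?x N ?k) = (\<Sum>s<N. \<Sum>j\<in>{1..nat (?k s)}. X s j)"
          using rel_dim_euler[OF nonneg_beta_tuple M, of n la ?x] wk unfolding X_def by simp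
        also have "\<bar>\<dots>\<bar> \<le> real m * (real m * (C / real n))"
        proof (rule few_terms_bound)
          fix s assume s: "s < N" "s < m"
          have "\<bar>\<Sum>j\<in>{1..nat (?k s)}. X s j\<bar> = \<bar>\<Sum>j\<in>{1..nat (?k s)} \<inter> {1..m}. X s j\<bar>"
          proof (intro arg_cong[where f=abs] sum.mono_neutral_right ballI)
            fix j assume "j \<in> {1..nat (?k s)} - {1..nat (?k s)} \<inter> {1..m}"
            hence "1 \<le> j" "int j \<le> ?k s" "\<not> j \<le> m" by auto
            thus "X s j = 0" using Xb[OF s(1), of j] X0[of s j] by blast
          qed auto
          also have "\<dots> \<le> (\<Sum>j\<in>{1..nat (?k s)} \<inter> {1..m}. \<bar>X s j\<bar>)" by (rule sum_abs)
          also have "\<dots> \<le> (\<Sum>j\<in>{1..nat (?k s)} \<inter> {1..m}. C / real n)"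
          proof (rule sum_mono)
            fix j assume "j \<in> {1..nat (?k s)} \<inter> {1..m}"
            hence "1 \<le> j" "int j \<le> ?k s" by auto
            thus "\<bar>X s j\<bar> \<le> C / real n" using Xb[OF s(1), of j] X0[of s j] C0 by (cases "inj_on (?k(s := ?k s - int j)) {..<N}") auto
          qed
          also have "\<dots> = real (card ({1..nat (?k s)} \<inter> {1..m})) * (C / real n)" by simp
          also have "\<dots> \<le> real m * (C / real n)"
            using card_mono[of "{1..m}" "{1..nat (?k s)} \<inter> {1..m}"] C0 by (intro mult_right_mono) auto
          finally show "\<bar>\<Sum>j\<in>{1..nat (?k s)}. X s j\<bar> \<le> real m * (C / real n)" .
        next
          fix s assume s: "s < N" "m \<le> s"
          show "(\<Sum>j\<in>{1..nat (?k s)}. X s j) = 0"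
          proof (rule sum.neutral, rule ballI)
            fix j assume "j \<in> {1..nat (?k s)}"
            hence "1 \<le> j" "int j \<le> ?k s" by auto
            thus "X s j = 0" using Xb[OF s(1), of j] X0[of s j] s(2) by (meson not_less)
          qed
        qed (use C0 in simp)
        finally have "\<bar>real m * (rel_dim n N la ?k - schur_tuple ?x N ?k)\<bar> \<le> real m * (real m * (C / real n))" .
        hence "real m * \<bar>rel_dim n N la ?k - schur_tuple ?x N ?k\<bar> \<le> real m * (real m * (C / real n))" by (simp only: abs_mult abs_of_nat)
        hence "\<bar>rel_dim n N la ?k - schur_tuple ?x N ?k\<bar> \<le> real m * (C / real n)" using False by (subst (asm) mult_le_cancel_left) auto
        also have "\<dots> \<le> real m * (real m * C) / real n"
        proof -
          have "1 * (real m * C) \<le> real m * (real m * C)" using False C0 by (intro mult_right_mono) auto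
          thus ?thesis using n0 by (simp add: divide_right_mono)
        qed
        finally show "\<bar>rel_dim n N la ?k - schur_tuple ?x N ?k\<bar> \<le> real m * (real m * C) / real n" .
      qed
    qed
  qed
qed

text \<open>Here r is the product of the factors 1 - i/n over i < m; it measures how far
  n(n-1)...(n-m+1) is from n^m.\<close>

lemma fact_ratio_bounds:
  assumes "m \<le> n" "1 \<le> n"
  shows "\<exists>r. fact n = fact (n - m) * real n ^ m * r \<and> r \<le> 1 \<and> 0 < r \<and> 1 - (real m)\<^sup>2 / real n \<le> r"
  using assms(1)
proof (induction m)
  case 0 thus ?case by (intro exI[of _ 1]) simp
next
  case (Suc m)
  then obtain r where r: "fact n = fact (n - m) * real n ^ m * r" "r \<le> 1" "0 < r" "1 - (real m)\<^sup>2 / real n \<le> r" by auto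
  have n0: "0 < real n" using assms(2) by simp
  have "n - m = Suc (n - Suc m)" using Suc.prems by simp
  hence f: "(fact (n - m) :: real) = (real n - real m) * fact (n - Suc m)" using Suc.prems by (simp add: of_nat_diff)
  have q: "0 < 1 - real m / real n" using Suc.prems n0 by simp
  show ?case
  proof (intro exI[of _ "r * (1 - real m / real n)"] conjI)
    have "fact (n - Suc m) * real n ^ Suc m * (r * (1 - real m / real n)) = fact (n - Suc m) * real n ^ m * r * (real n * (1 - real m / real n))"
      by (simp add: mult_ac)
    also have "real n * (1 - real m / real n) = real n - real m" using n0 by (simp add: right_diff_distrib)
    also have "fact (n - Suc m) * real n ^ m * r * (real n - real m) = fact n" using r(1) f by (simp add: mult_ac)
    finally show "fact n = fact (n - Suc m) * real n ^ Suc m * (r * (1 - real m / real n))" by simp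
    show "r * (1 - real m / real n) \<le> 1" using mult_mono[OF r(2), of "1 - real m / real n" 1] q by simp
    show "0 < r * (1 - real m / real n)" using r(3) q by simp
    have "r * (real m / real n) \<le> 1 * (real m / real n)" using r(2) by (intro mult_right_mono) auto
    hence "r * (1 - real m / real n) \<ge> r - real m / real n" by (simp add: right_diff_distrib)
    moreover have "(real (Suc m))\<^sup>2 / real n = (real m)\<^sup>2 / real n + 2 * (real m / real n) + 1 / real n"
      by (simp add: power2_eq_square add_divide_distrib[symmetric] algebra_simps)
    moreover have "0 \<le> real m / real n" "0 \<le> 1 / real n" using n0 by auto
    ultimately show "1 - (real (Suc m))\<^sup>2 / real n \<le> r * (1 - real m / real n)" using r(4) by linarith
  qed
qed

definition dim_ratio :: "nat \<Rightarrow> nat list \<Rightarrow> nat list \<Rightarrow> real" where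
  "dim_ratio N mu la = skew_dim N (beta_tuple N la) (beta_tuple N mu) / skew_dim N (beta_tuple N la) (beta_tuple N [])"

text \<open>\<open>dim_ratio\<close> is the quotient g_\<mu> of the overview. Here
  \<open>rel_dim\<close> is r times \<open>dim_ratio\<close> with r from
  \<open>fact_ratio_bounds\<close>, and both vanish when \<mu> has more than n boxes.\<close>

lemma dim_ratio_asymptotic:
  assumes mu: "young mu"
  shows "\<exists>C\<ge>0. \<forall>n N la. 1 \<le> n \<longrightarrow> la \<in> YD n \<longrightarrow> length la \<le> N \<longrightarrow> length mu \<le> N \<longrightarrow>
     \<bar>dim_ratio N mu la - schurq mu (qvec (iota n la))\<bar> \<le> C / real n \<and> \<bar>dim_ratio N mu la\<bar> \<le> 1"
proof -
  let ?m = "sum_list mu"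
  obtain C where C: "C \<ge> 0" "\<And>n N la k. 1 \<le> n \<Longrightarrow> la \<in> YD n \<Longrightarrow> length la \<le> N \<Longrightarrow> nonneg N k \<Longrightarrow> inj_on k {..<N} \<Longrightarrow> tuple_size N k = int ?m \<Longrightarrow>
     \<bar>rel_dim n N la k - schur_tuple (qvec (iota n la)) N k\<bar> \<le> C / real n" using rel_dim_asymptotic[of ?m] by blast
  show ?thesis
  proof (intro exI[of _ "C + (real ?m)\<^sup>2"] allI impI conjI)
    show "0 \<le> C + (real ?m)\<^sup>2" using C by simp
    fix n N la assume n: "1 \<le> n" and la: "la \<in> YD n" "length la \<le> N" and l: "length mu \<le> N"
    have n0: "0 < real n" using n by simp
    have D0: "0 < aitken N (beta_tuple N la) (beta_tuple N [])" by (rule aitken_empty_pos[OF la])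
    have wl: "tuple_size N (beta_tuple N la) = int n" using tuple_size_beta_tuple[OF la(2)] YD_young(2)[OF la(1)] by simp
    have wm: "tuple_size N (beta_tuple N mu) = int ?m" by (rule tuple_size_beta_tuple[OF l])
    have y: "young la" by (rule YD_young(1)[OF la(1)])
    have dd0: "0 < skew_dim N (beta_tuple N la) (beta_tuple N [])" using D0 by (simp add: skew_dim_def)
    have nn: "0 \<le> skew_dim N (beta_tuple N la) (beta_tuple N mu)" by (rule skew_dim_nonneg[OF strictly_dec_beta_tuple[OF y] strictly_dec_beta_tuple[OF mu] nonneg_beta_tuple])
    have le: "skew_dim N (beta_tuple N la) (beta_tuple N mu) \<le> skew_dim N (beta_tuple N la) (beta_tuple N [])" by (rule skew_dim_le_dimY[OF strictly_dec_beta_tuple[OF y] mu l])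
    have g01: "0 \<le> dim_ratio N mu la" "dim_ratio N mu la \<le> 1" using nn le dd0 by (auto simp: dim_ratio_def)
    thus "\<bar>dim_ratio N mu la\<bar> \<le> 1" by simp
    have u: "\<bar>rel_dim n N la (beta_tuple N mu) - schur_tuple (qvec (iota n la)) N (beta_tuple N mu)\<bar> \<le> C / real n"
      by (rule C(2)[OF n la nonneg_beta_tuple strictly_dec_inj[OF strictly_dec_beta_tuple[OF mu]] wm])
    have "\<bar>dim_ratio N mu la - rel_dim n N la (beta_tuple N mu)\<bar> \<le> (real ?m)\<^sup>2 / real n"
    proof (cases "?m \<le> n")
      case False
      hence "aitken N (beta_tuple N la) (beta_tuple N mu) = 0" using wl wm by (intro aitken_eq_0_of_size_less) simp
      thus ?thesis by (simp add: dim_ratio_def rel_dim_def skew_dim_def)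
    next
      case True
      obtain r where r: "fact n = fact (n - ?m) * real n ^ ?m * r" "r \<le> 1" "0 < r" "1 - (real ?m)\<^sup>2 / real n \<le> r"
        using fact_ratio_bounds[OF True n] by blast
      have "rel_dim n N la (beta_tuple N mu) = r * dim_ratio N mu la"
        using wl wm D0 n r(3) True by (simp add: rel_dim_def dim_ratio_def skew_dim_def tuple_size_beta_tuple_Nil r(1) nat_diff_distrib' field_simps)
      hence "dim_ratio N mu la - rel_dim n N la (beta_tuple N mu) = (1 - r) * dim_ratio N mu la" by (simp add: algebra_simps)
      moreover have "0 \<le> (1 - r) * dim_ratio N mu la" using r g01 by simp
      moreover have "(1 - r) * dim_ratio N mu la \<le> (1 - r) * 1" using r g01 by (intro mult_left_mono) auto
      ultimately show ?thesis using r(4) by simp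
    qed
    with u show "\<bar>dim_ratio N mu la - schurq mu (qvec (iota n la))\<bar> \<le> (C + (real ?m)\<^sup>2) / real n"
      unfolding schurq_S[OF l] add_divide_distrib by linarith
  qed
qed

section \<open>Symmetry of the generator before the limit\<close>

definition content_weight :: "real \<Rightarrow> real \<Rightarrow> int \<Rightarrow> real" where
  "content_weight A B c = (of_int c)\<^sup>2 + B * of_int c + A"

definition z_weight :: "real \<Rightarrow> real \<Rightarrow> nat \<Rightarrow> nat list \<Rightarrow> real" where
  "z_weight A B n l = (\<Prod>x\<in>boxes l. content_weight A B (content x)) / pochhammer A n * (real (dimY l))\<^sup>2 / fact n"

text \<open>In the complementary series z + c and z' + c lie in the same open interval between
  consecutive integers, so they have the same sign. In the principal series the product is |z + c|^2
  with z + c nonzero.\<close>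

lemma series_weights:
  fixes z z' :: complex
  assumes "(z \<notin> \<real> \<and> z' = cnj z) \<or>
      (\<exists>N::int. z \<in> \<real> \<and> z' \<in> \<real> \<and> of_int N < Re z \<and> Re z < of_int N + 1
                 \<and> of_int N < Re z' \<and> Re z' < of_int N + 1)"
  shows "(z + of_int c) * (z' + of_int c) = of_real (content_weight (Re (z * z')) (Re (z + z')) c)"
    "0 < content_weight (Re (z * z')) (Re (z + z')) c"
proof -
  have re: "Re ((z + of_int c) * (z' + of_int c)) = content_weight (Re (z * z')) (Re (z + z')) c"
    by (simp add: content_weight_def power2_eq_square algebra_simps)
  have "Im ((z + of_int c) * (z' + of_int c)) = 0 \<and> 0 < Re ((z + of_int c) * (z' + of_int c))"
    using assms
  proof
    assume h: "z \<notin> \<real> \<and> z' = cnj z"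
    hence "Im z \<noteq> 0" by (auto simp: complex_is_Real_iff)
    hence "0 < (Re z + of_int c)\<^sup>2 + (Im z)\<^sup>2" by (simp add: add_nonneg_pos)
    thus ?thesis using h by (simp add: power2_eq_square algebra_simps)
  next
    assume "\<exists>N::int. z \<in> \<real> \<and> z' \<in> \<real> \<and> of_int N < Re z \<and> Re z < of_int N + 1
                 \<and> of_int N < Re z' \<and> Re z' < of_int N + 1"
    then obtain N :: int where N: "Im z = 0" "Im z' = 0" "of_int N < Re z" "Re z < of_int N + 1"
      "of_int N < Re z'" "Re z' < of_int N + 1" by (auto simp: complex_is_Real_iff)
    have "0 < (Re z + of_int c) * (Re z' + of_int c)"
    proof (cases "0 \<le> N + c")
      case True
      hence "0 \<le> real_of_int N + real_of_int c" by (metis of_int_0_le_iff of_int_add)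
      thus ?thesis using N by (intro mult_pos_pos) linarith+
    next
      case False
      hence "N + c + 1 \<le> 0" by simp
      hence "real_of_int N + real_of_int c + 1 \<le> 0" by (metis of_int_1 of_int_add of_int_le_0_iff)
      thus ?thesis using N by (intro mult_neg_neg) linarith+
    qed
    thus ?thesis using N by simp
  qed
  thus "(z + of_int c) * (z' + of_int c) = of_real (content_weight (Re (z * z')) (Re (z + z')) c)"
    "0 < content_weight (Re (z * z')) (Re (z + z')) c"
    unfolding re[symmetric] by (auto simp: complex_eq_iff)
qed

lemma pochD_mult:
  assumes "\<And>c::int. (z + of_int c) * (z' + of_int c) = complex_of_real (w c)"
  shows "pochD z th * pochD z' th = of_real (\<Prod>x\<in>th. w (content x))"
proof -
  have "pochD z th * pochD z' th = (\<Prod>x\<in>th. (z + of_int (content x)) * (z' + of_int (content x)))"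
    unfolding pochD_def prod.distrib[symmetric] by (intro prod.cong) (auto simp: content_def)
  thus ?thesis by (simp add: assms)
qed

lemma zmeas_z_weight:
  assumes w: "\<And>c::int. (z + of_int c) * (z' + of_int c) = complex_of_real (content_weight A B c)"
  shows "zmeas z z' n l = z_weight A B n l"
proof -
  have "z * z' = of_real A" using w[of 0] by (simp add: content_weight_def)
  hence "pochhammer (z * z') n = of_real (pochhammer A n)" by (simp add: pochhammer_of_real)
  thus ?thesis unfolding zmeas_def z_weight_def pochD_mult[OF w] by (simp del: of_real_prod flip: of_real_divide)
qed

lemma z_weight_nonneg:
  assumes "\<And>c. 0 < content_weight A B c"
  shows "0 \<le> z_weight A B n l"
proof -
  have "0 < A" using assms[of 0] by (simp add: content_weight_def)
  hence "0 < pochhammer A n" by (rule pochhammer_pos)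
  moreover have "0 \<le> (\<Prod>x\<in>boxes l. content_weight A B (content x))" using assms by (intro prod_nonneg) (auto intro: less_imp_le)
  ultimately show ?thesis by (simp add: z_weight_def)
qed

lemma boxes_downY_content:
  assumes "rowlen m = (rowlen l)(s := rowlen l s - 1)" "0 < rowlen l s"
  shows "(\<Prod>x\<in>boxes l - boxes m. f (content x)) = f (int (rowlen l s) - 1 - int s)"
  unfolding boxes_downY(1)[OF assms] using assms(2) by (simp add: content_def of_nat_diff)

definition box_weight :: "real \<Rightarrow> real \<Rightarrow> nat list \<Rightarrow> nat list \<Rightarrow> real" where
  "box_weight A B l m = (\<Prod>x\<in>boxes l - boxes m. content_weight A B (content x))"

text \<open>A detailed balance: the weight of \<open>m\<close> times the probability of descending
  to \<open>l\<close> is rewritten as the weight of \<open>l\<close> times a rate of ascending to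
  \<open>m\<close>. The factors A + n and n + 1 are the quotients of consecutive Pochhammer symbols
  and factorials.\<close>

lemma z_weight_step:
  assumes "0 < A" "m \<in> YD (Suc n)" "l \<in> downY m"
  shows "z_weight A B (Suc n) m * real (dimY l) / real (dimY m)
    = z_weight A B n l * (box_weight A B m l * real (dimY m)) / ((A + real n) * real (Suc n) * real (dimY l))"
proof -
  have ym: "young m" by (rule YD_young(1)[OF assms(2)])
  have yl: "young l" using assms(3) by (simp add: downY_def)
  have sub: "boxes l \<subseteq> boxes m" using assms(3) by (simp add: downY_def)
  have P: "(\<Prod>x\<in>boxes m. content_weight A B (content x)) = box_weight A B m l * (\<Prod>x\<in>boxes l. content_weight A B (content x))"
    unfolding box_weight_def using sub by (intro prod.subset_diff) auto
  have d: "0 < real (dimY l)" "0 < real (dimY m)" using dimY_pos[OF yl] dimY_pos[OF ym] by auto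
  have p: "0 < pochhammer A n" "pochhammer A (Suc n) = pochhammer A n * (A + real n)"
    using pochhammer_pos[OF assms(1)] by (auto simp: pochhammer_Suc)
  have a: "0 < A + real n" using assms(1) by simp
  have f: "(fact (Suc n) :: real) = real (Suc n) * fact n" by simp
  have cancel: "c * X / (p * q) * b\<^sup>2 / (s * t) * a / b = X / p * a\<^sup>2 / t * (c * b) / (q * s * a)"
    if "a \<noteq> 0" "b \<noteq> 0" for c X p q b s t a :: real
    using that by (simp add: power2_eq_square mult_ac)
  show ?thesis unfolding z_weight_def P p(2) f by (rule cancel) (use d in auto)
qed

lemma skew_dim_down_sum:
  assumes "young m" "length m \<le> N" "nonneg N k" "tuple_size N k < int (sum_list m)"
  shows "(\<Sum>l\<in>downY m. skew_dim N (beta_tuple N l) k) = skew_dim N (beta_tuple N m) k"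
proof -
  have "(\<Sum>l\<in>downY m. 1 * skew_dim N (beta_tuple N l) k) = (\<Sum>s<N. 1 * skew_dim N ((beta_tuple N m)(s := beta_tuple N m s - 1)) k)"
  proof (rule sum_downY[OF assms(1,2), where g="\<lambda>b. skew_dim N b k" and H="\<lambda>_. 1" and W="\<lambda>_. 1"])
    show "skew_dim N b k = 0" if "x < N" "y < N" "x \<noteq> y" "b x = b y" for b x y
      using aitken_collision_left[OF that] by (simp add: skew_dim_def)
    show "skew_dim N b k = 0" if "x < N" "b x < 0" for b x
      using aitken_neg[of x N b k] that assms(3) by (simp add: skew_dim_def)
  qed simp
  thus ?thesis using skew_dim_harmonic_left[of N k "beta_tuple N m"] assms(4) tuple_size_beta_tuple[OF assms(2)] by simp
qed

text \<open>This is \<open>aitken_commutation\<close> for tuples of length N = n + 1. Both diagrams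
  then have an empty last row; lowering the last entry of \<mu> removes no box, and by
  \<open>aitken_last_row\<close> it contributes w(-N) times the determinant. Moving this to the
  right gives, with m the size of \<mu>, the constant n + m - N^2 + N B + w(-N) = n + m + A, while n
  + 1 - m is the quotient of the two factorials.\<close>

lemma skew_dim_up_sum:
  assumes l: "young l" "sum_list l = n" and mu: "young mu" "sum_list mu \<le> n"
  defines "N \<equiv> Suc n"
  shows "(\<Sum>m\<in>upY l. box_weight A B m l * skew_dim N (beta_tuple N m) (beta_tuple N mu))
     = (\<Sum>ka\<in>downY mu. box_weight A B mu ka * skew_dim N (beta_tuple N l) (beta_tuple N ka))
       + (real (Suc n) - real (sum_list mu)) * (real n + real (sum_list mu) + A) * skew_dim N (beta_tuple N l) (beta_tuple N mu)"
proof -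
  let ?l = "beta_tuple N l" and ?k = "beta_tuple N mu" and ?m = "sum_list mu"
  have len: "length l < N" "length mu < N" "length l \<le> N" "length mu \<le> N"
    using length_le_sum_list[OF l(1)] length_le_sum_list[OF mu(1)] l(2) mu(2) by (auto simp: N_def)
  have wl: "tuple_size N ?l = int n" using tuple_size_beta_tuple[OF len(3)] l(2) by simp
  have wk: "tuple_size N ?k = int ?m" by (rule tuple_size_beta_tuple[OF len(4)])
  define F where "F = (fact (Suc n - ?m) :: real)"
  have F: "F = (real (Suc n) - real ?m) * fact (n - ?m)" using mu(2) by (simp add: F_def Suc_diff_le of_nat_diff)
  have raise_sum: "(\<Sum>m\<in>upY l. box_weight A B m l * skew_dim N (beta_tuple N m) ?k) = (\<Sum>r<N. content_weight A B (?l r - int N + 1) * skew_dim N (?l(r := ?l r + 1)) ?k)"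
  proof (rule sum_upY[OF l(1) len(1), where g="\<lambda>b. skew_dim N b ?k" and H="content_weight A B"])
    show "skew_dim N b ?k = 0" if "x < N" "y < N" "x \<noteq> y" "b x = b y" for b x y
      using aitken_collision_left[OF that] by (simp add: skew_dim_def)
    show "box_weight A B m l = content_weight A B (int (rowlen l s) - int s)" if "m \<in> upY l" "rowlen m = (rowlen l)(s := rowlen l s + 1)" for m s
    proof -
      have r: "rowlen l = (rowlen m)(s := rowlen m s - 1)" "0 < rowlen m s" using that(2) by auto
      show ?thesis unfolding box_weight_def boxes_downY_content[OF r, of "content_weight A B"] using that(2) by simp
    qed
  qed
  have up2: "\<dots> = F * (\<Sum>r<N. content_weight A B (?l r - int N + 1) * aitken N (?l(r := ?l r + 1)) ?k)"
    unfolding sum_distrib_left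
  proof (rule sum.cong[OF refl])
    fix r assume "r \<in> {..<N}"
    hence "tuple_size N (?l(r := ?l r + 1)) = int n + 1" using tuple_size_upd[of r N ?l 1] wl by simp
    hence "nat (tuple_size N (?l(r := ?l r + 1)) - tuple_size N ?k) = Suc n - ?m" using wk by simp
    thus "content_weight A B (?l r - int N + 1) * skew_dim N (?l(r := ?l r + 1)) ?k = F * (content_weight A B (?l r - int N + 1) * aitken N (?l(r := ?l r + 1)) ?k)"
      by (simp only: skew_dim_def F_def mult_ac)
  qed
  \<comment> \<open>\<open>sum_downY\<close> requires a function that vanishes on tuples with a
    negative entry, which \<open>skew_dim\<close> does not guarantee in its second argument; hence
    the explicit value 0.\<close>
  define g where "g b = (if \<exists>x<N. b x < 0 then 0 else skew_dim N ?l b)" for b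
  have down: "(\<Sum>ka\<in>downY mu. box_weight A B mu ka * skew_dim N ?l (beta_tuple N ka)) = (\<Sum>s<N. content_weight A B (?k s - int N) * g (?k(s := ?k s - 1)))"
  proof -
    have "(\<Sum>ka\<in>downY mu. box_weight A B mu ka * skew_dim N ?l (beta_tuple N ka)) = (\<Sum>ka\<in>downY mu. box_weight A B mu ka * g (beta_tuple N ka))"
    proof (rule sum.cong[OF refl])
      fix ka
      have "\<not> (\<exists>x<N. beta_tuple N ka x < 0)" using nonneg_beta_tuple[of N ka] by (auto simp: nonneg_def not_less)
      thus "box_weight A B mu ka * skew_dim N ?l (beta_tuple N ka) = box_weight A B mu ka * g (beta_tuple N ka)" by (simp only: g_def if_False)
    qed
    also have "\<dots> = (\<Sum>s<N. content_weight A B (?k s - int N) * g (?k(s := ?k s - 1)))"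
    proof (rule sum_downY[OF mu(1) len(4), where g=g and H="content_weight A B"])
      show "g b = 0" if "x < N" "y < N" "x \<noteq> y" "b x = b y" for b x y
        using aitken_collision_right[OF that] by (simp add: skew_dim_def g_def)
      show "g b = 0" if "x < N" "b x < 0" for b x using that by (auto simp: g_def)
      show "box_weight A B mu ka = content_weight A B (int (rowlen mu s) - 1 - int s)" if "rowlen ka = (rowlen mu)(s := rowlen mu s - 1)" "0 < rowlen mu s" for ka s
        unfolding box_weight_def by (rule boxes_downY_content[OF that])
    qed
    finally show ?thesis .
  qed
  have kn: "?k n = 0" "?l n = 0" using len by (auto simp: beta_tuple_def rowlen_def N_def)
  have kpos: "0 < ?k s" if "s < n" for s using that by (simp add: beta_tuple_def N_def)
  have down2: "(\<Sum>s<N. content_weight A B (?k s - int N) * g (?k(s := ?k s - 1))) = F * (\<Sum>s<n. content_weight A B (?k s - int N) * aitken N ?l (?k(s := ?k s - 1)))"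
  proof -
    have "g (?k(n := ?k n - 1)) = 0" using kn by (auto simp: g_def N_def)
    hence "(\<Sum>s<N. content_weight A B (?k s - int N) * g (?k(s := ?k s - 1))) = (\<Sum>s<n. content_weight A B (?k s - int N) * g (?k(s := ?k s - 1)))"
      by (simp add: N_def)
    also have "\<dots> = F * (\<Sum>s<n. content_weight A B (?k s - int N) * aitken N ?l (?k(s := ?k s - 1)))"
      unfolding sum_distrib_left
    proof (rule sum.cong[OF refl])
      fix s assume "s \<in> {..<n}"
      hence s: "s < n" by simp
      have "\<not> (\<exists>x<N. (?k(s := ?k s - 1)) x < 0)" using kpos[OF s] nonneg_beta_tuple[of N mu] by (auto simp: nonneg_def not_less)
      hence "g (?k(s := ?k s - 1)) = skew_dim N ?l (?k(s := ?k s - 1))" by (simp only: g_def if_False)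
      moreover have "tuple_size N (?k(s := ?k s - 1)) = int ?m - 1" using tuple_size_upd[of s N ?k "-1"] wk s by (simp add: N_def)
      hence "nat (tuple_size N ?l - tuple_size N (?k(s := ?k s - 1))) = Suc n - ?m" using wl by simp
      ultimately show "content_weight A B (?k s - int N) * g (?k(s := ?k s - 1)) = F * (content_weight A B (?k s - int N) * aitken N ?l (?k(s := ?k s - 1)))"
        by (simp only: skew_dim_def F_def mult_ac)
    qed
    finally show ?thesis .
  qed
  have last: "aitken N ?l (?k(n := ?k n - 1)) = aitken N ?l ?k"
    unfolding N_def by (rule aitken_last_row) (use kn kpos nonneg_beta_tuple[of N mu] in \<open>auto simp: N_def\<close>)
  have comm: "(\<Sum>r<N. content_weight A B (?l r - int N + 1) * aitken N (?l(r := ?l r + 1)) ?k) - (\<Sum>s<N. content_weight A B (?k s - int N) * aitken N ?l (?k(s := ?k s - 1)))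
     = (of_int (tuple_size N ?l + tuple_size N ?k) - (real N)\<^sup>2 + real N * B) * aitken N ?l ?k"
    using aitken_commutation[where A=A and B=B and l="?l" and N=N and k="?k"] unfolding content_weight_def .
  have "(\<Sum>s<N. content_weight A B (?k s - int N) * aitken N ?l (?k(s := ?k s - 1))) = (\<Sum>s<n. content_weight A B (?k s - int N) * aitken N ?l (?k(s := ?k s - 1))) + content_weight A B (- int N) * aitken N ?l ?k"
    using last kn by (simp add: N_def)
  hence "(\<Sum>r<N. content_weight A B (?l r - int N + 1) * aitken N (?l(r := ?l r + 1)) ?k) = (\<Sum>s<n. content_weight A B (?k s - int N) * aitken N ?l (?k(s := ?k s - 1)))
     + (real n + real ?m + A) * aitken N ?l ?k"
    using comm wl wk by (simp add: content_weight_def algebra_simps)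
  hence "F * (\<Sum>r<N. content_weight A B (?l r - int N + 1) * aitken N (?l(r := ?l r + 1)) ?k) = F * (\<Sum>s<n. content_weight A B (?k s - int N) * aitken N ?l (?k(s := ?k s - 1)))
     + F * ((real n + real ?m + A) * aitken N ?l ?k)"
    by (simp only: distrib_left)
  moreover have "F * ((real n + real ?m + A) * aitken N ?l ?k) = (real (Suc n) - real ?m) * (real n + real ?m + A) * skew_dim N ?l ?k"
    using wl wk mu(2) by (simp add: F skew_dim_def nat_diff_distrib')
  ultimately show ?thesis unfolding raise_sum up2 down down2 by simp
qed

text \<open>The formula for the generator on Schur functions, with the s_\<nu> replaced by the
  quotients g_\<nu>.\<close>

definition dim_ratio_gen :: "real \<Rightarrow> real \<Rightarrow> nat \<Rightarrow> nat list \<Rightarrow> nat list \<Rightarrow> real" where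
  "dim_ratio_gen A B N mu l = (\<Sum>ka\<in>downY mu. box_weight A B mu ka * dim_ratio N ka l) - real (sum_list mu) * (real (sum_list mu) - 1 + A) * dim_ratio N mu l"

text \<open>The function g_\<nu> at level n + 1 is an average of its values at level n
  (\<open>s1\<close>). Exchanging the order of summation with the balance
  \<open>z_weight_step\<close> leaves a sum over larger diagrams, which acts on g_\<mu> by
  \<open>skew_dim_up_sum\<close>. With N = n + 1 rows all diagrams of both levels fit.\<close>

lemma gram_shift:
  assumes A: "0 < A" and mu: "young mu" "sum_list mu \<le> n" and nu: "young nu" "sum_list nu \<le> n"
  defines "N \<equiv> Suc n"
  shows "(\<Sum>m\<in>YD (Suc n). z_weight A B (Suc n) m * dim_ratio N mu m * dim_ratio N nu m) * ((A + real n) * real (Suc n))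
    = (\<Sum>l\<in>YD n. z_weight A B n l * dim_ratio N nu l * (dim_ratio_gen A B N mu l + (A + real n) * real (Suc n) * dim_ratio N mu l))"
proof -
  let ?c = "(A + real n) * real (Suc n)"
  have c: "?c \<noteq> 0" using A by simp
  have lnu: "length nu \<le> N" using length_le_sum_list[OF nu(1)] nu(2) by (simp add: N_def)
  have dim: "real (dimY l) = skew_dim N (beta_tuple N l) (beta_tuple N [])" "0 < real (dimY l)" if "young l" "length l \<le> N" for l
    using dimY_eq_skew_dim[OF that] dimY_pos[OF that(1)] by auto
  have g: "dim_ratio N mu' l = skew_dim N (beta_tuple N l) (beta_tuple N mu') / real (dimY l)" if "young l" "length l \<le> N" for mu' l
    unfolding dim_ratio_def dim(1)[OF that] ..
  have s1: "dim_ratio N nu m = (\<Sum>l\<in>downY m. real (dimY l) / real (dimY m) * dim_ratio N nu l)" if m: "m \<in> YD (Suc n)" for m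
  proof -
    have ym: "young m" "length m \<le> N" "sum_list m = Suc n" using YD_young[OF m] by (auto simp: N_def)
    have "(\<Sum>l\<in>downY m. real (dimY l) / real (dimY m) * dim_ratio N nu l) = (\<Sum>l\<in>downY m. skew_dim N (beta_tuple N l) (beta_tuple N nu) / real (dimY m))"
    proof (rule sum.cong[OF refl])
      fix l assume l: "l \<in> downY m"
      have "young l" "length l \<le> N" using l length_downY[OF ym(1) l] ym(2) by (auto simp: downY_def)
      thus "real (dimY l) / real (dimY m) * dim_ratio N nu l = skew_dim N (beta_tuple N l) (beta_tuple N nu) / real (dimY m)"
        using g[of l nu] dim(2)[of l] by simp
    qed
    also have "\<dots> = skew_dim N (beta_tuple N m) (beta_tuple N nu) / real (dimY m)"
      unfolding sum_divide_distrib[symmetric]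
      using skew_dim_down_sum[OF ym(1,2) nonneg_beta_tuple, of nu] tuple_size_beta_tuple[OF lnu] ym(3) nu(2) by simp
    finally show ?thesis using g[OF ym(1,2)] by simp
  qed
  have "(\<Sum>m\<in>YD (Suc n). z_weight A B (Suc n) m * dim_ratio N mu m * dim_ratio N nu m)
     = (\<Sum>m\<in>YD (Suc n). \<Sum>l\<in>downY m. z_weight A B (Suc n) m * dim_ratio N mu m * (real (dimY l) / real (dimY m) * dim_ratio N nu l))"
    by (intro sum.cong refl) (subst s1, simp_all only: sum_distrib_left)
  also have "\<dots> = (\<Sum>m\<in>YD (Suc n). \<Sum>l\<in>downY m. (z_weight A B n l * dim_ratio N nu l / (?c * real (dimY l))) * (box_weight A B m l * skew_dim N (beta_tuple N m) (beta_tuple N mu)))"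
  proof (intro sum.cong refl)
    fix m l assume m: "m \<in> YD (Suc n)" and l: "l \<in> downY m"
    have ym: "young m" "length m \<le> N" using YD_young[OF m] by (auto simp: N_def)
    have e: "z_weight A B (Suc n) m * real (dimY l) / real (dimY m) = z_weight A B n l * (box_weight A B m l * real (dimY m)) / (?c * real (dimY l))"
      by (rule z_weight_step[OF A m l])
    have "z_weight A B (Suc n) m * dim_ratio N mu m * (real (dimY l) / real (dimY m) * dim_ratio N nu l) = (z_weight A B (Suc n) m * real (dimY l) / real (dimY m)) * (dim_ratio N mu m * dim_ratio N nu l)"
      by simp
    also have "\<dots> = (z_weight A B n l * dim_ratio N nu l / (?c * real (dimY l))) * (box_weight A B m l * (real (dimY m) * dim_ratio N mu m))"
      unfolding e by simp
    also have "real (dimY m) * dim_ratio N mu m = skew_dim N (beta_tuple N m) (beta_tuple N mu)" using g[OF ym] dim(2)[OF ym] by simp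
    finally show "z_weight A B (Suc n) m * dim_ratio N mu m * (real (dimY l) / real (dimY m) * dim_ratio N nu l) = (z_weight A B n l * dim_ratio N nu l / (?c * real (dimY l))) * (box_weight A B m l * skew_dim N (beta_tuple N m) (beta_tuple N mu))" .
  qed
  also have "\<dots> = (\<Sum>l\<in>YD n. \<Sum>m\<in>upY l. (z_weight A B n l * dim_ratio N nu l / (?c * real (dimY l))) * (box_weight A B m l * skew_dim N (beta_tuple N m) (beta_tuple N mu)))"
    by (rule sum_YD_swap)
  also have "\<dots> = (\<Sum>l\<in>YD n. z_weight A B n l * dim_ratio N nu l * (dim_ratio_gen A B N mu l + ?c * dim_ratio N mu l) / ?c)"
  proof (rule sum.cong[OF refl])
    fix l assume l: "l \<in> YD n"
    have yl: "young l" "sum_list l = n" "length l \<le> N" using YD_young[OF l] by (auto simp: N_def)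
    have d: "0 < real (dimY l)" by (rule dim(2)[OF yl(1,3)])
    have "(\<Sum>m\<in>upY l. box_weight A B m l * skew_dim N (beta_tuple N m) (beta_tuple N mu))
       = (\<Sum>ka\<in>downY mu. box_weight A B mu ka * skew_dim N (beta_tuple N l) (beta_tuple N ka)) + (real (Suc n) - real (sum_list mu)) * (real n + real (sum_list mu) + A) * skew_dim N (beta_tuple N l) (beta_tuple N mu)"
      unfolding N_def by (rule skew_dim_up_sum[OF yl(1,2) mu])
    also have "\<dots> = real (dimY l) * ((\<Sum>ka\<in>downY mu. box_weight A B mu ka * dim_ratio N ka l) + (real (Suc n) - real (sum_list mu)) * (real n + real (sum_list mu) + A) * dim_ratio N mu l)"
      unfolding g[OF yl(1,3)] distrib_left sum_distrib_left using d by (simp add: mult.left_commute)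
    \<comment> \<open>This is the identity (n+1-m)(n+m+A) = (n+1)(n+A) - m(m-1+A) with m the size of
      \<mu>; it is the origin of the diagonal term of the generator.\<close>
    also have "(\<Sum>ka\<in>downY mu. box_weight A B mu ka * dim_ratio N ka l) + (real (Suc n) - real (sum_list mu)) * (real n + real (sum_list mu) + A) * dim_ratio N mu l
       = dim_ratio_gen A B N mu l + ?c * dim_ratio N mu l" unfolding dim_ratio_gen_def by (simp add: algebra_simps)
    finally show "(\<Sum>m\<in>upY l. (z_weight A B n l * dim_ratio N nu l / (?c * real (dimY l))) * (box_weight A B m l * skew_dim N (beta_tuple N m) (beta_tuple N mu)))
      = z_weight A B n l * dim_ratio N nu l * (dim_ratio_gen A B N mu l + ?c * dim_ratio N mu l) / ?c"
      unfolding sum_distrib_left[symmetric] using d c by simp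
  qed
  finally show ?thesis using c by (simp add: sum_divide_distrib[symmetric])
qed

lemma discrete_symmetry:
  assumes A: "0 < A" and mu: "young mu" "sum_list mu \<le> n" and nu: "young nu" "sum_list nu \<le> n"
  shows "(\<Sum>l\<in>YD n. z_weight A B n l * (dim_ratio_gen A B (Suc n) mu l * dim_ratio (Suc n) nu l - dim_ratio (Suc n) mu l * dim_ratio_gen A B (Suc n) nu l)) = 0"
proof -
  let ?c = "(A + real n) * real (Suc n)"
  have "(\<Sum>l\<in>YD n. z_weight A B n l * dim_ratio (Suc n) nu l * (dim_ratio_gen A B (Suc n) mu l + ?c * dim_ratio (Suc n) mu l))
     = (\<Sum>l\<in>YD n. z_weight A B n l * dim_ratio (Suc n) mu l * (dim_ratio_gen A B (Suc n) nu l + ?c * dim_ratio (Suc n) nu l))"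
    unfolding gram_shift[OF A mu nu, symmetric] gram_shift[OF A nu mu, symmetric] by (simp only: mult_ac)
  hence "(\<Sum>l\<in>YD n. z_weight A B n l * dim_ratio (Suc n) nu l * (dim_ratio_gen A B (Suc n) mu l + ?c * dim_ratio (Suc n) mu l)
     - z_weight A B n l * dim_ratio (Suc n) mu l * (dim_ratio_gen A B (Suc n) nu l + ?c * dim_ratio (Suc n) nu l)) = 0"
    by (simp only: sum_subtractf diff_self)
  moreover have "z_weight A B n l * dim_ratio (Suc n) nu l * (dim_ratio_gen A B (Suc n) mu l + ?c * dim_ratio (Suc n) mu l)
     - z_weight A B n l * dim_ratio (Suc n) mu l * (dim_ratio_gen A B (Suc n) nu l + ?c * dim_ratio (Suc n) nu l)
    = z_weight A B n l * (dim_ratio_gen A B (Suc n) mu l * dim_ratio (Suc n) nu l - dim_ratio (Suc n) mu l * dim_ratio_gen A B (Suc n) nu l)" for l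
    by (simp add: ring_distribs mult_ac)
  ultimately show ?thesis by simp
qed

lemma A_schur_eq:
  assumes w: "\<And>c::int. (z + of_int c) * (z' + of_int c) = complex_of_real (content_weight (Re (z * z')) B c)"
  shows "A_schur z z' mu x = (\<Sum>ka\<in>downY mu. box_weight (Re (z * z')) B mu ka * schurq ka x) - real (sum_list mu) * (real (sum_list mu) - 1 + Re (z * z')) * schurq mu x"
  unfolding A_schur_def pochD_mult[OF w] box_weight_def by (simp del: of_real_prod times_complex.sel)

section \<open>Polynomials in the moment coordinates\<close>

lemma qpoly_deriv:
  assumes "F \<in> qpoly"
  shows "\<exists>F'\<in>qpoly. \<forall>x t. ((\<lambda>t. F (x(i := t))) has_real_derivative F' (x(i := t))) (at t)"
  using assms
proof induction
  case (const c)
  show ?case by (intro bexI[of _ "\<lambda>_. 0"] qpoly.const) auto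
next
  case (var k)
  show ?case
    by (intro bexI[of _ "\<lambda>_. if k = i then 1 else 0"] qpoly.const) (auto intro!: derivative_eq_intros)
next
  case (add F G)
  then obtain F' G' where "F' \<in> qpoly" "G' \<in> qpoly"
    "\<And>x t. ((\<lambda>t. F (x(i := t))) has_real_derivative F' (x(i := t))) (at t)"
    "\<And>x t. ((\<lambda>t. G (x(i := t))) has_real_derivative G' (x(i := t))) (at t)" by blast
  thus ?case by (intro bexI[of _ "\<lambda>x. F' x + G' x"] qpoly.add allI DERIV_add)
next
  case (mult F G)
  then obtain F' G' where "F' \<in> qpoly" "G' \<in> qpoly"
    "\<And>x t. ((\<lambda>t. F (x(i := t))) has_real_derivative F' (x(i := t))) (at t)"
    "\<And>x t. ((\<lambda>t. G (x(i := t))) has_real_derivative G' (x(i := t))) (at t)" by blast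
  thus ?case using mult.hyps
    by (intro bexI[of _ "\<lambda>x. F' x * G x + G' x * F x"] qpoly.add qpoly.mult allI DERIV_mult)
qed

lemma pdq_eqI:
  assumes "\<And>x t. ((\<lambda>t. F (x(i := t))) has_real_derivative F' (x(i := t))) (at t)"
  shows "pdq F i = F'"
proof
  fix x show "pdq F i x = F' x"
    unfolding pdq_def using DERIV_imp_deriv[OF assms[of x "x i"]] by simp
qed

text \<open>\<open>deriv\<close> is total, so differentiability has to be recorded before the rules
  of calculus apply to \<open>pdq\<close>.\<close>

lemma pdq_deriv:
  assumes "F \<in> qpoly"
  shows "((\<lambda>t. F (x(i := t))) has_real_derivative pdq F i (x(i := t))) (at t)" "pdq F i \<in> qpoly"
proof -
  obtain F' where F': "F' \<in> qpoly" "\<And>x t. ((\<lambda>t. F (x(i := t))) has_real_derivative F' (x(i := t))) (at t)"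
    using qpoly_deriv[OF assms] by blast
  have "pdq F i = F'" by (rule pdq_eqI) (rule F'(2))
  thus "((\<lambda>t. F (x(i := t))) has_real_derivative pdq F i (x(i := t))) (at t)" "pdq F i \<in> qpoly"
    using F' by auto
qed

lemma pdq_const: "pdq (\<lambda>x. c) i = (\<lambda>x. 0)"
  by (rule pdq_eqI) auto

lemma pdq_add:
  assumes "F \<in> qpoly" "G \<in> qpoly"
  shows "pdq (\<lambda>x. F x + G x) i = (\<lambda>x. pdq F i x + pdq G i x)"
  by (rule pdq_eqI) (intro DERIV_add pdq_deriv assms)

lemma pdq_mult:
  assumes "F \<in> qpoly" "G \<in> qpoly"
  shows "pdq (\<lambda>x. F x * G x) i = (\<lambda>x. pdq F i x * G x + pdq G i x * F x)"
  by (rule pdq_eqI) (intro DERIV_mult pdq_deriv assms)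

lemma pdq_cmult:
  assumes "F \<in> qpoly"
  shows "pdq (\<lambda>x. c * F x) i = (\<lambda>x. c * pdq F i x)"
  by (rule pdq_eqI) (intro DERIV_cmult pdq_deriv assms)

lemma qpoly_cmult: "F \<in> qpoly \<Longrightarrow> (\<lambda>x. c * F x) \<in> qpoly"
  by (intro qpoly.mult qpoly.const)

lemma qpoly_sum: "(\<And>i. i \<in> I \<Longrightarrow> F i \<in> qpoly) \<Longrightarrow> (\<lambda>x. \<Sum>i\<in>I. F i x) \<in> qpoly"
proof (induction I rule: infinite_finite_induct)
  case (insert a I)
  have "(\<lambda>x. F a x + (\<Sum>i\<in>I. F i x)) \<in> qpoly" using insert by (intro qpoly.add) auto
  thus ?case using insert by simp
qed (auto intro: qpoly.const)

lemma qpoly_prod: "(\<And>i. i \<in> I \<Longrightarrow> F i \<in> qpoly) \<Longrightarrow> (\<lambda>x. \<Prod>i\<in>I. F i x) \<in> qpoly"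
proof (induction I rule: infinite_finite_induct)
  case (insert a I)
  have "(\<lambda>x. F a x * (\<Prod>i\<in>I. F i x)) \<in> qpoly" using insert by (intro qpoly.mult) auto
  thus ?case using insert by simp
qed (auto intro: qpoly.const)

lemma pdq_sum:
  assumes "\<And>i. i \<in> I \<Longrightarrow> F i \<in> qpoly"
  shows "pdq (\<lambda>x. \<Sum>i\<in>I. F i x) k = (\<lambda>x. \<Sum>i\<in>I. pdq (F i) k x)"
  by (rule pdq_eqI) (intro DERIV_sum pdq_deriv assms)

lemma qpoly_diff: "F \<in> qpoly \<Longrightarrow> G \<in> qpoly \<Longrightarrow> (\<lambda>x. F x - G x) \<in> qpoly"
  using qpoly.add[of F "\<lambda>x. (-1) * G x"] qpoly_cmult[of G "-1"] by simp

lemma pdq_eventually_zero: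
  assumes "F \<in> qpoly"
  shows "\<exists>K. \<forall>i>K. pdq F i = (\<lambda>x. 0)"
  using assms
proof induction
  case (const c) show ?case by (simp add: pdq_const)
next
  case (var k)
  have "pdq (\<lambda>x. x k) i = (\<lambda>x. 0)" if "i > k" for i
    using that by (intro pdq_eqI) auto
  thus ?case by blast
next
  case (add F G)
  then obtain K L where "\<forall>i>K. pdq F i = (\<lambda>x. 0)" "\<forall>i>L. pdq G i = (\<lambda>x. 0)" by blast
  thus ?case using add.hyps by (intro exI[of _ "max K L"]) (simp add: pdq_add)
next
  case (mult F G)
  then obtain K L where "\<forall>i>K. pdq F i = (\<lambda>x. 0)" "\<forall>i>L. pdq G i = (\<lambda>x. 0)" by blast
  thus ?case using mult.hyps by (intro exI[of _ "max K L"]) (simp add: pdq_mult)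
qed

lemma psum_qpoly: "k \<ge> 1 \<Longrightarrow> (\<lambda>x. psum x k) \<in> qpoly"
  unfolding psum_def by (cases "k = 1") (auto intro: qpoly.const qpoly.var)

lemma hcomp_qpoly: "(\<lambda>x. hcomp x n) \<in> qpoly"
proof (induction n rule: less_induct)
  case (less n)
  show ?case
  proof (cases n)
    case 0 thus ?thesis by (simp add: qpoly.const)
  next
    case (Suc m)
    have "(\<lambda>x. (1 / real (Suc m)) * (\<Sum>k<Suc m. psum x (Suc k) * hcomp x (m - k))) \<in> qpoly"
      using Suc by (intro qpoly_cmult qpoly_sum qpoly.mult psum_qpoly less.IH) auto
    thus ?thesis unfolding Suc hcomp.simps by simp
  qed
qed

lemma hint_qpoly: "(\<lambda>x. hint x m) \<in> qpoly"
  unfolding hint_def by (cases "m < 0") (auto intro: qpoly.const hcomp_qpoly)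

lemma schur_tuple_qpoly: "(\<lambda>x. schur_tuple x N l) \<in> qpoly"
  unfolding schur_tuple_def NP.S_def Alt_def NP.jt_prod_def NP.col_def
  by (intro qpoly_sum qpoly_cmult qpoly_prod hint_qpoly)

lemma schurq_qpoly: "schurq mu \<in> qpoly"
proof -
  have "schurq mu = (\<lambda>x. schur_tuple x (length mu) (beta_tuple (length mu) mu))" by (rule ext) (rule schurq_eq_S)
  thus ?thesis by (simp only: schur_tuple_qpoly)
qed

text \<open>Plays the role of k \<partial>/\<partial>p_k on \<open>schur_tuple\<close>, also for k =
  1, where p_1 = 1 leaves no variable to differentiate by.\<close>

definition schur_down :: "(nat \<Rightarrow> real) \<Rightarrow> nat \<Rightarrow> nat \<Rightarrow> (nat \<Rightarrow> int) \<Rightarrow> real" where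
  "schur_down x N k l = (\<Sum>s<N. schur_tuple x N (l(s := l s - int k)))"

lemma pdq_schur_tuple:
  assumes "i \<ge> 1"
  shows "pdq (\<lambda>x. schur_tuple x N l) i = (\<lambda>x. schur_down x N (i + 1) l / real (i + 1))"
proof (rule pdq_eqI)
  fix x t
  show "((\<lambda>t. schur_tuple (x(i := t)) N l) has_real_derivative schur_down (x(i := t)) N (i + 1) l / real (i + 1)) (at t)"
    using schur_tuple_deriv[OF assms, of x N l t] by (simp add: schur_down_def NP.lower_sum_def schur_tuple_def add.commute)
qed

lemma pdq_pdq_schur_tuple:
  assumes "i \<ge> 1" "j \<ge> 1"
  shows "pdq (pdq (\<lambda>x. schur_tuple x N l) i) j = (\<lambda>x. (\<Sum>s<N. schur_down x N (j + 1) (l(s := l s - int (i + 1)))) / (real (i + 1) * real (j + 1)))"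
proof -
  have "pdq (\<lambda>x. schur_tuple x N l) i = (\<lambda>x. (1 / real (i + 1)) * (\<Sum>s<N. schur_tuple x N (l(s := l s - int (i + 1)))))"
    unfolding pdq_schur_tuple[OF assms(1)] by (simp add: schur_down_def)
  hence "pdq (pdq (\<lambda>x. schur_tuple x N l) i) j = (\<lambda>x. (1 / real (i + 1)) * (\<Sum>s<N. pdq (\<lambda>x. schur_tuple x N (l(s := l s - int (i + 1)))) j x))"
    by (simp only: pdq_cmult[OF qpoly_sum[OF schur_tuple_qpoly]] pdq_sum[OF schur_tuple_qpoly])
  thus ?thesis unfolding pdq_schur_tuple[OF assms(2)] sum_divide_distrib[symmetric] by simp
qed

text \<open>Up to the factor i + 1 this is the first-order coefficient of the generator in the
  direction q_i = p_{i+1}.\<close>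

definition drift :: "real \<Rightarrow> real \<Rightarrow> nat \<Rightarrow> (nat \<Rightarrow> real) \<Rightarrow> real" where
  "drift A B i x = - (real i + A) * psum x (i + 1) + B * psum x i + (\<Sum>a=1..<i. psum x a * psum x (i - a))"

definition gamma_coeff :: "nat \<Rightarrow> nat \<Rightarrow> (nat \<Rightarrow> real) \<Rightarrow> real" where
  "gamma_coeff i j x = real ((i + 1) * (j + 1)) * (x (i + j) - x i * x j)"

text \<open>The sums are cut off at $K$; only finitely many of the derivatives of a given polynomial are nonzero.\<close>

definition diff_gen :: "nat \<Rightarrow> real \<Rightarrow> real \<Rightarrow> ((nat \<Rightarrow> real) \<Rightarrow> real) \<Rightarrow> (nat \<Rightarrow> real) \<Rightarrow> real" where
  "diff_gen K A B F x = (\<Sum>i=1..K. \<Sum>j=1..K. gamma_coeff i j x * pdq (pdq F i) j x)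
     + (\<Sum>i=1..K. real (i + 1) * drift A B i x * pdq F i x)"

definition diff_gamma :: "nat \<Rightarrow> ((nat \<Rightarrow> real) \<Rightarrow> real) \<Rightarrow> ((nat \<Rightarrow> real) \<Rightarrow> real) \<Rightarrow> (nat \<Rightarrow> real) \<Rightarrow> real" where
  "diff_gamma K F G x = (\<Sum>i=1..K. \<Sum>j=1..K. gamma_coeff i j x * pdq F i x * pdq G j x)"

text \<open>Here $d_k$ and $D_{kl}$ stand for $k\partial_{p_k}s$ and $kl\,\partial_{p_k}\partial_{p_l}s$. As $p_1 = 1$ in the quotient, the
  derivatives in $p_1$ have no meaning there; they are eliminated by Euler's identity.\<close>

lemma generator_algebra:
  fixes p d :: "nat \<Rightarrow> real" and D2 :: "nat \<Rightarrow> nat \<Rightarrow> real" and m M :: nat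
  assumes p1: "p 1 = 1"
    and d0: "\<And>k. m < k \<Longrightarrow> d k = 0" and D0: "\<And>k k'. m < k + k' \<Longrightarrow> D2 k k' = 0"
    and sym: "\<And>k k'. D2 k k' = D2 k' k"
    and e1: "(\<Sum>j=1..M. p j * d j) = real m * S"
    and e2: "\<And>k. 1 \<le> k \<Longrightarrow> (\<Sum>j=1..M. p j * D2 k j) = (real m - real k) * d k"
    and M: "1 \<le> M" "m \<le> M"
    and l2: "(\<Sum>i=1..M. \<Sum>j=1..M. p i * p j * d (i + j + 1)) + (\<Sum>i=1..M. p i * (\<Sum>k=1..i. D2 k (i + 1 - k))) = L2"
    and l1: "(\<Sum>i=1..M. p i * d (i + 1)) = L1"
  shows "L2 + B * L1 + A * d 1 - real m * (real m - 1 + A) * S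
    = (\<Sum>i=1..M. \<Sum>j=1..M. (p (i + j + 1) - p (i + 1) * p (j + 1)) * D2 (i + 1) (j + 1))
      + (\<Sum>i=1..M. (- (real i + A) * p (i + 1) + B * p i + (\<Sum>a=1..<i. p a * p (i - a))) * d (i + 1))"
proof -
  \<comment> \<open>Splits off the index 1, which belongs to p_1; the value at M + 1 that the
    shifted sum adds is 0 by degree.\<close>
  have shift: "(\<Sum>j=1..M. f j) = f 1 + (\<Sum>i=1..M. f (i + 1))" if "f (M + 1) = 0" for f :: "nat \<Rightarrow> real"
  proof -
    have "(\<Sum>j=1..M. f j) = (\<Sum>j=1..M + 1. f j)" using that by simp
    also have "\<dots> = f 1 + (\<Sum>j=2..M + 1. f j)"
      using M by (subst sum.atLeast_Suc_atMost) (auto simp: numeral_2_eq_2)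
    also have "(\<Sum>j=2..M + 1. f j) = (\<Sum>i=1..M. f (i + 1))"
      by (rule sum.reindex_bij_witness[where i="\<lambda>i. i + 1" and j="\<lambda>j. j - 1"]) auto
    finally show ?thesis .
  qed
  have d1: "d 1 = real m * S - (\<Sum>i=1..M. p (i + 1) * d (i + 1))"
    using e1 shift[of "\<lambda>j. p j * d j"] d0[of "M + 1"] M p1 by simp
  have D1: "D2 1 k = (real m - real k) * d k - (\<Sum>j=1..M. p (j + 1) * D2 k (j + 1))" if "1 \<le> k" for k
    using e2[OF that] shift[of "\<lambda>j. p j * D2 k j"] D0[of k "M + 1"] M p1 sym[of k 1] by simp
  define T where "T = (\<Sum>i=1..M. p (i + 1) * D2 1 (i + 1))"
  have D11: "D2 1 1 = (real m - 1) * d 1 - T" using D1[of 1] by (simp add: T_def)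
  have T: "T = (\<Sum>i=1..M. p (i + 1) * ((real m - real (i + 1)) * d (i + 1))) - (\<Sum>i=1..M. \<Sum>j=1..M. p (i + 1) * p (j + 1) * D2 (i + 1) (j + 1))"
  proof -
    have "T = (\<Sum>i=1..M. p (i + 1) * ((real m - real (i + 1)) * d (i + 1) - (\<Sum>j=1..M. p (j + 1) * D2 (i + 1) (j + 1))))"
      unfolding T_def using D1 by (intro sum.cong refl arg_cong2[where f="(*)"]) auto
    thus ?thesis by (simp only: right_diff_distrib sum_subtractf sum_distrib_left mult.assoc)
  qed
  \<comment> \<open>The term i = 1 of the outer sum is the double derivative in p_1. In the other
    terms the two ends of the inner sum contain one derivative in p_1 and give \<open>T\<close>
    each.\<close>
  have sec: "(\<Sum>i=1..M. p i * (\<Sum>k=1..i. D2 k (i + 1 - k))) = D2 1 1 + 2 * T + (\<Sum>i=1..M. \<Sum>j=1..M. p (i + j + 1) * D2 (i + 1) (j + 1))"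
  proof -
    define f where "f i = p i * (\<Sum>k=1..i. D2 k (i + 1 - k))" for i
    have "f (M + 1) = 0"
    proof -
      have "(\<Sum>k=1..M+1. D2 k (M + 1 + 1 - k)) = 0" using M by (intro sum.neutral ballI D0) auto
      thus ?thesis by (simp only: f_def mult_zero_right)
    qed
    hence "(\<Sum>i=1..M. f i) = f 1 + (\<Sum>i=1..M. f (i + 1))" by (rule shift)
    also have "f 1 = D2 1 1" by (simp add: f_def p1[unfolded One_nat_def])
    also have "(\<Sum>i=1..M. f (i + 1)) = (\<Sum>i=1..M. p (i + 1) * D2 1 (i + 1) + p (i + 1) * D2 1 (i + 1) + p (i + 1) * (\<Sum>k=1..<i. D2 (k + 1) (i - k + 1)))"
    proof (rule sum.cong[OF refl])
      fix i assume i: "i \<in> {1..M}"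
      have "(\<Sum>k=1..i + 1. D2 k (i + 1 + 1 - k)) = D2 1 (i + 1) + (\<Sum>k=2..i. D2 k (i + 2 - k)) + D2 (i + 1) 1"
        using i by (simp add: sum.atLeast_Suc_atMost numeral_2_eq_2)
      also have "(\<Sum>k=2..i. D2 k (i + 2 - k)) = (\<Sum>k=1..<i. D2 (k + 1) (i - k + 1))"
        by (rule sum.reindex_bij_witness[where i="\<lambda>k. k + 1" and j="\<lambda>k. k - 1"]) (auto simp: Suc_diff_le)
      finally show "f (i + 1) = p (i + 1) * D2 1 (i + 1) + p (i + 1) * D2 1 (i + 1) + p (i + 1) * (\<Sum>k=1..<i. D2 (k + 1) (i - k + 1))"
        unfolding f_def using sym[of "i + 1" 1] by (simp only: distrib_left)
    qed
    also have "\<dots> = 2 * T + (\<Sum>i=1..M. p (i + 1) * (\<Sum>k=1..<i. D2 (k + 1) (i - k + 1)))"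
      by (simp only: sum.distrib T_def mult_2)
    also have "(\<Sum>i=1..M. p (i + 1) * (\<Sum>k=1..<i. D2 (k + 1) (i - k + 1))) = (\<Sum>i=1..M. \<Sum>j=1..M. p (i + j + 1) * D2 (i + 1) (j + 1))"
    proof -
      have "(\<Sum>i=1..M. p (i + 1) * (\<Sum>k=1..<i. D2 (k + 1) (i - k + 1))) = (\<Sum>(i,k)\<in>Sigma {1..M} (\<lambda>i. {1..<i}). p (i + 1) * D2 (k + 1) (i - k + 1))"
        unfolding sum_distrib_left by (rule sum.Sigma) auto
      also have "\<dots> = (\<Sum>(a,b)\<in>{x \<in> {1..M} \<times> {1..M}. fst x + snd x \<le> M}. p (a + b + 1) * D2 (a + 1) (b + 1))"
        by (rule sum.reindex_bij_witness[where i="\<lambda>(a,b). (a + b, a)" and j="\<lambda>(i,k). (k, i - k)"]) auto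
      also have "\<dots> = (\<Sum>(a,b)\<in>{1..M} \<times> {1..M}. p (a + b + 1) * D2 (a + 1) (b + 1))"
      proof (rule sum.mono_neutral_left)
        show "\<forall>x\<in>{1..M} \<times> {1..M} - {x \<in> {1..M} \<times> {1..M}. fst x + snd x \<le> M}. (case x of (a, b) \<Rightarrow> p (a + b + 1) * D2 (a + 1) (b + 1)) = 0"
          using M by (auto intro!: D0)
      qed auto
      also have "\<dots> = (\<Sum>i=1..M. \<Sum>j=1..M. p (i + j + 1) * D2 (i + 1) (j + 1))"
        by (rule sum.cartesian_product[symmetric])
      finally show ?thesis .
    qed
    finally show ?thesis unfolding f_def by simp
  qed
  have fst: "(\<Sum>i=1..M. \<Sum>j=1..M. p i * p j * d (i + j + 1)) = (\<Sum>i=1..M. (\<Sum>a=1..<i. p a * p (i - a)) * d (i + 1))"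
  proof -
    have "(\<Sum>i=1..M. (\<Sum>a=1..<i. p a * p (i - a)) * d (i + 1)) = (\<Sum>(i,k)\<in>Sigma {1..M} (\<lambda>i. {1..<i}). p k * p (i - k) * d (i + 1))"
      unfolding sum_distrib_right by (rule sum.Sigma) auto
    also have "\<dots> = (\<Sum>(a,b)\<in>{x \<in> {1..M} \<times> {1..M}. fst x + snd x \<le> M}. p a * p b * d (a + b + 1))"
      by (rule sum.reindex_bij_witness[where i="\<lambda>(a,b). (a + b, a)" and j="\<lambda>(i,k). (k, i - k)"]) auto
    also have "\<dots> = (\<Sum>(a,b)\<in>{1..M} \<times> {1..M}. p a * p b * d (a + b + 1))"
    proof (rule sum.mono_neutral_left)
      show "\<forall>x\<in>{1..M} \<times> {1..M} - {x \<in> {1..M} \<times> {1..M}. fst x + snd x \<le> M}. (case x of (a, b) \<Rightarrow> p a * p b * d (a + b + 1)) = 0"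
        using M by (auto intro!: d0)
    qed auto
    also have "\<dots> = (\<Sum>i=1..M. \<Sum>j=1..M. p i * p j * d (i + j + 1))"
      by (rule sum.cartesian_product[symmetric])
    finally show ?thesis by simp
  qed
  define U where "U = (\<Sum>i=1..M. p (i + 1) * d (i + 1))"
  define V where "V = (\<Sum>i=1..M. real i * (p (i + 1) * d (i + 1)))"
  define Q1 where "Q1 = (\<Sum>i=1..M. \<Sum>j=1..M. p (i + j + 1) * D2 (i + 1) (j + 1))"
  define Q2 where "Q2 = (\<Sum>i=1..M. \<Sum>j=1..M. p (i + 1) * p (j + 1) * D2 (i + 1) (j + 1))"
  define Q3 where "Q3 = (\<Sum>i=1..M. (\<Sum>a=1..<i. p a * p (i - a)) * d (i + 1))"
  have TT: "T = (real m - 1) * U - V - Q2"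
  proof -
    have "(\<Sum>i=1..M. p (i + 1) * ((real m - real (i + 1)) * d (i + 1))) = (\<Sum>i=1..M. (real m - 1) * (p (i + 1) * d (i + 1)) - real i * (p (i + 1) * d (i + 1)))"
      by (intro sum.cong refl) (simp add: algebra_simps)
    thus ?thesis unfolding T U_def V_def Q2_def by (simp only: sum_subtractf sum_distrib_left)
  qed
  have "L2 + B * L1 + A * d 1 - real m * (real m - 1 + A) * S = Q3 + (D2 1 1 + 2 * T + Q1) + B * L1 + A * d 1 - real m * (real m - 1 + A) * S"
    unfolding l2[symmetric] fst sec Q1_def Q3_def ..
  \<comment> \<open>After substitution all terms in S cancel, and so do those in (m-1) U; the
    diagonal term -m(m-1+A) is made for this.\<close>
  also have "\<dots> = Q3 + Q1 - Q2 - V - A * U + B * L1"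
    unfolding D11 d1 TT U_def[symmetric] by (simp add: algebra_simps)
  also have "\<dots> = (\<Sum>i=1..M. \<Sum>j=1..M. (p (i + j + 1) - p (i + 1) * p (j + 1)) * D2 (i + 1) (j + 1))
      + (\<Sum>i=1..M. (- (real i + A) * p (i + 1) + B * p i + (\<Sum>a=1..<i. p a * p (i - a))) * d (i + 1))"
  proof -
    have "(\<Sum>i=1..M. \<Sum>j=1..M. (p (i + j + 1) - p (i + 1) * p (j + 1)) * D2 (i + 1) (j + 1)) = Q1 - Q2"
      unfolding Q1_def Q2_def by (simp only: left_diff_distrib sum_subtractf)
    moreover have "(\<Sum>i=1..M. (- (real i + A) * p (i + 1) + B * p i + (\<Sum>a=1..<i. p a * p (i - a))) * d (i + 1)) = - V - A * U + B * L1 + Q3"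
    proof -
      have "(- (real i + A) * p (i + 1) + B * p i + (\<Sum>a=1..<i. p a * p (i - a))) * d (i + 1)
        = (- 1) * (real i * (p (i + 1) * d (i + 1))) + (- A) * (p (i + 1) * d (i + 1)) + B * (p i * d (i + 1)) + (\<Sum>a=1..<i. p a * p (i - a)) * d (i + 1)" for i
        by (simp add: algebra_simps)
      hence "(\<Sum>i=1..M. (- (real i + A) * p (i + 1) + B * p i + (\<Sum>a=1..<i. p a * p (i - a))) * d (i + 1))
        = (- 1) * V + (- A) * U + B * L1 + Q3"
        unfolding V_def U_def Q3_def l1[symmetric] by (simp only: sum.distrib sum_distrib_left)
      thus ?thesis by simp
    qed
    ultimately show ?thesis by simp
  qed
  finally show ?thesis .
qed

section \<open>Integration by parts\<close>

lemma schur_down_NP: "schur_down x N k l = NP.lower_sum x N (int k) l"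
  by (simp add: schur_down_def NP.lower_sum_def schur_tuple_def)

text \<open>A tuple of negative size has a negative entry or a collision, since nonnegative
  injective tuples encode partitions up to order.\<close>

lemma schur_tuple_eq_0_of_size_neg:
  assumes "tuple_size N l < 0" shows "schur_tuple x N l = 0"
proof (cases "nonneg N l")
  case True
  hence "\<not> inj_on l {..<N}" using tuple_size_nonneg[of l N] assms by auto
  thus ?thesis by (rule schur_tuple_not_inj)
next
  case False thus ?thesis by (auto simp: nonneg_def not_le intro: schur_tuple_neg)
qed

lemma schur_down_eq_0: "tuple_size N l < int k \<Longrightarrow> schur_down x N k l = 0"
  unfolding schur_down_def
proof (intro sum.neutral ballI)
  fix s assume "tuple_size N l < int k" "s \<in> {..<N}"
  thus "schur_tuple x N (l(s := l s - int k)) = 0" using tuple_size_upd[of s N l "- int k"] by (intro schur_tuple_eq_0_of_size_neg) simp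
qed

definition schur_down2 :: "(nat \<Rightarrow> real) \<Rightarrow> nat \<Rightarrow> nat \<Rightarrow> nat \<Rightarrow> (nat \<Rightarrow> int) \<Rightarrow> real" where
  "schur_down2 x N k k' l = (\<Sum>r<N. schur_down x N k' (l(r := l r - int k)))"

lemma schur_down2_commute: "schur_down2 x N k k' l = schur_down2 x N k' k l"
proof -
  have "(l(r := l r - int k))(s := (l(r := l r - int k)) s - int k') = (l(s := l s - int k'))(r := (l(s := l s - int k')) r - int k)" for r s
    by (auto simp: fun_eq_iff)
  thus ?thesis unfolding schur_down2_def schur_down_def by (subst sum.swap) (simp only:)
qed

lemma schur_down2_eq_0: "tuple_size N l < int (k + k') \<Longrightarrow> schur_down2 x N k k' l = 0"
  unfolding schur_down2_def
proof (intro sum.neutral ballI)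
  fix s assume "tuple_size N l < int (k + k')" "s \<in> {..<N}"
  thus "schur_down x N k' (l(s := l s - int k)) = 0" using tuple_size_upd[of s N l "- int k"] by (intro schur_down_eq_0) simp
qed

lemma euler_schur_down:
  assumes "\<And>s. s < N \<Longrightarrow> l s \<le> int M"
  shows "(\<Sum>j=1..M. psum x j * schur_down x N j l) = of_int (tuple_size N l) * schur_tuple x N l"
  unfolding schur_down_def by (rule schur_tuple_euler[OF assms])

text \<open>The content identities express the weights c and c^2 through derivatives, and
  \<open>generator_algebra\<close> removes those in p_1. Derivatives of total degree above m vanish,
  so a cut-off at K \<ge> m loses nothing.\<close>

lemma diff_gen_schur_tuple:
  assumes tuple_size: "tuple_size N l = int m" and K: "m \<le> K"
  shows "diff_gen K A B (\<lambda>x. schur_tuple x N l) x =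
    (\<Sum>s<N. content_weight A B (l s - int N) * schur_tuple x N (l(s := l s - 1))) - real m * (real m - 1 + A) * schur_tuple x N l"
proof -
  \<comment> \<open>M bounds all entries, as the Newton and Euler sums require, and is at least K,
    so that sums up to K can be extended by vanishing terms.\<close>
  define M where "M = K + nat (\<Sum>s<N. \<bar>l s\<bar>) + 1"
  have lM: "l s \<le> int M" if "s < N" for s
  proof -
    have "l s \<le> \<bar>l s\<bar>" by simp
    also have "\<dots> \<le> (\<Sum>s<N. \<bar>l s\<bar>)" using that by (intro member_le_sum) auto
    finally show ?thesis by (simp add: M_def)
  qed
  have lM': "(l(r := l r - int k)) s \<le> int M" if "s < N" for s r k using lM[OF that] by auto
  define L1 where "L1 = (\<Sum>s<N. of_int (l s - int N) * schur_tuple x N (l(s := l s - 1)))"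
  define L2 where "L2 = (\<Sum>s<N. (of_int (l s - int N))\<^sup>2 * schur_tuple x N (l(s := l s - 1)))"
  define E where "E = (\<Sum>i=1..M. \<Sum>j=1..M. (psum x (i + j + 1) - psum x (i + 1) * psum x (j + 1)) * schur_down2 x N (i + 1) (j + 1) l)
      + (\<Sum>i=1..M. (- (real i + A) * psum x (i + 1) + B * psum x i + (\<Sum>a=1..<i. psum x a * psum x (i - a))) * schur_down x N (i + 1) l)"
  have gen: "L2 + B * L1 + A * schur_down x N 1 l - real m * (real m - 1 + A) * schur_tuple x N l = E"
    unfolding E_def
  proof (rule generator_algebra)
    show "psum x 1 = 1" by (simp add: psum_def)
    show "schur_down x N k l = 0" if "m < k" for k using that tuple_size by (intro schur_down_eq_0) simp
    show "schur_down2 x N k k' l = 0" if "m < k + k'" for k k' using that tuple_size by (intro schur_down2_eq_0) simp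
    show "schur_down2 x N k k' l = schur_down2 x N k' k l" for k k' by (rule schur_down2_commute)
    show "(\<Sum>j=1..M. psum x j * schur_down x N j l) = real m * schur_tuple x N l" using euler_schur_down[where x=x, OF lM] tuple_size by simp
    show "(\<Sum>j=1..M. psum x j * schur_down2 x N k j l) = (real m - real k) * schur_down x N k l" for k
    proof -
      have "(\<Sum>j=1..M. psum x j * schur_down2 x N k j l) = (\<Sum>r<N. \<Sum>j=1..M. psum x j * schur_down x N j (l(r := l r - int k)))"
        unfolding schur_down2_def sum_distrib_left by (rule sum.swap)
      also have "\<dots> = (\<Sum>r<N. (real m - real k) * schur_tuple x N (l(r := l r - int k)))"
      proof (rule sum.cong[OF refl])
        fix r assume "r \<in> {..<N}"
        hence "tuple_size N (l(r := l r - int k)) = int m - int k" using tuple_size_upd[of r N l "- int k"] tuple_size by simp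
        moreover have "(\<Sum>j=1..M. psum x j * schur_down x N j (l(r := l r - int k))) = of_int (tuple_size N (l(r := l r - int k))) * schur_tuple x N (l(r := l r - int k))"
          by (rule euler_schur_down[OF lM'])
        ultimately show "(\<Sum>j=1..M. psum x j * schur_down x N j (l(r := l r - int k))) = (real m - real k) * schur_tuple x N (l(r := l r - int k))" by simp
      qed
      finally show ?thesis by (simp only: sum_distrib_left schur_down_def)
    qed
    show "1 \<le> M" "m \<le> M" using K by (auto simp: M_def)
    show "(\<Sum>i=1..M. \<Sum>j=1..M. psum x i * psum x j * schur_down x N (i + j + 1) l) + (\<Sum>i=1..M. psum x i * (\<Sum>k=1..i. schur_down2 x N k (i + 1 - k) l)) = L2"
    proof -
      have "(\<Sum>k=1..i. schur_down2 x N k (i + 1 - k) l) = (\<Sum>k=1..i. \<Sum>r<N. NP.lower_sum x N (int i + 1 - int k) (l(r := l r - int k)))" for i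
        unfolding schur_down2_def schur_down_NP by (intro sum.cong refl) (simp add: of_nat_diff add.commute)
      moreover have "schur_down x N (i + j + 1) l = NP.lower_sum x N (int i + int j + 1) l" for i j by (simp add: schur_down_NP add_ac)
      ultimately show ?thesis unfolding L2_def schur_tuple_def
        using NP.L2_contents[where x=x and N=N and l=l and M=M, OF lM] by (simp only:)
    qed
    show "(\<Sum>i=1..M. psum x i * schur_down x N (i + 1) l) = L1"
    proof -
      have "schur_down x N (i + 1) l = NP.lower_sum x N (int i + 1) l" for i by (simp add: schur_down_NP add_ac)
      thus ?thesis unfolding L1_def schur_tuple_def
        using NP.L1_contents[where x=x and N=N and l=l and M=M, OF lM] by (simp only:)
    qed
  qed
  have KM: "K \<le> M" by (simp add: M_def)
  have pd1: "pdq (\<lambda>x. schur_tuple x N l) i x = schur_down x N (i + 1) l / real (i + 1)" if "1 \<le> i" for i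
    unfolding pdq_schur_tuple[OF that] ..
  have pd2: "pdq (pdq (\<lambda>x. schur_tuple x N l) i) j x = schur_down2 x N (i + 1) (j + 1) l / (real (i + 1) * real (j + 1))" if "1 \<le> i" "1 \<le> j" for i j
    unfolding pdq_pdq_schur_tuple[OF that] schur_down2_def ..
  have ext: "(\<Sum>i=1..K. f i) = (\<Sum>i=1..M. f i)" if "\<And>i. K < i \<Longrightarrow> f i = 0" for f :: "nat \<Rightarrow> real"
    using KM that by (intro sum.mono_neutral_left) auto
  have "diff_gen K A B (\<lambda>x. schur_tuple x N l) x = (\<Sum>i=1..K. \<Sum>j=1..K. (psum x (i + j + 1) - psum x (i + 1) * psum x (j + 1)) * schur_down2 x N (i + 1) (j + 1) l)
      + (\<Sum>i=1..K. drift A B i x * schur_down x N (i + 1) l)"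
    unfolding diff_gen_def
  proof (intro arg_cong2[where f="(+)"] sum.cong refl)
    fix i j assume ij: "i \<in> {1..K}" "j \<in> {1..K}"
    show "gamma_coeff i j x * pdq (pdq (\<lambda>x. schur_tuple x N l) i) j x = (psum x (i + j + 1) - psum x (i + 1) * psum x (j + 1)) * schur_down2 x N (i + 1) (j + 1) l"
    proof -
      have cancel: "(a * b) * X * (Y / (a * b)) = X * Y" if "a \<noteq> 0" "b \<noteq> 0" for a b X Y :: real
        using that by simp
      have e: "psum x (i + j + 1) = x (i + j)" "psum x (i + 1) = x i" "psum x (j + 1) = x j"
        using ij by (auto simp: psum_def)
      have pd: "pdq (pdq (\<lambda>x. schur_tuple x N l) i) j x = schur_down2 x N (i + 1) (j + 1) l / (real (i + 1) * real (j + 1))"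
        using ij by (intro pd2) auto
      show ?thesis unfolding gamma_coeff_def pd e of_nat_mult by (rule cancel) auto
    qed
  next
    fix i assume "i \<in> {1..K}"
    thus "real (i + 1) * drift A B i x * pdq (\<lambda>x. schur_tuple x N l) i x = drift A B i x * schur_down x N (i + 1) l" by (simp add: pd1)
  qed
  also have "(\<Sum>i=1..K. drift A B i x * schur_down x N (i + 1) l) = (\<Sum>i=1..M. drift A B i x * schur_down x N (i + 1) l)"
    using K tuple_size by (intro ext) (simp add: schur_down_eq_0)
  also have "(\<Sum>i=1..K. \<Sum>j=1..K. (psum x (i + j + 1) - psum x (i + 1) * psum x (j + 1)) * schur_down2 x N (i + 1) (j + 1) l)
     = (\<Sum>i=1..K. \<Sum>j=1..M. (psum x (i + j + 1) - psum x (i + 1) * psum x (j + 1)) * schur_down2 x N (i + 1) (j + 1) l)"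
    using K tuple_size by (intro sum.cong refl ext) (simp add: schur_down2_eq_0)
  also have "\<dots> = (\<Sum>i=1..M. \<Sum>j=1..M. (psum x (i + j + 1) - psum x (i + 1) * psum x (j + 1)) * schur_down2 x N (i + 1) (j + 1) l)"
    using K tuple_size by (intro ext sum.neutral ballI) (simp add: schur_down2_eq_0)
  finally have "diff_gen K A B (\<lambda>x. schur_tuple x N l) x = E" unfolding E_def drift_def .
  also have "E = (\<Sum>s<N. content_weight A B (l s - int N) * schur_tuple x N (l(s := l s - 1))) - real m * (real m - 1 + A) * schur_tuple x N l"
  proof -
    have "schur_down x N 1 l = (\<Sum>s<N. schur_tuple x N (l(s := l s - 1)))" by (simp add: schur_down_def)
    hence "L2 + B * L1 + A * schur_down x N 1 l = (\<Sum>s<N. content_weight A B (l s - int N) * schur_tuple x N (l(s := l s - 1)))"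
      unfolding L1_def L2_def content_weight_def by (simp only: distrib_right sum.distrib sum_distrib_left mult.assoc)
    thus ?thesis using gen by simp
  qed
  finally show ?thesis .
qed

lemma diff_gen_schurq:
  assumes mu: "young mu" and K: "sum_list mu \<le> K"
  shows "diff_gen K A B (schurq mu) x = (\<Sum>ka\<in>downY mu. box_weight A B mu ka * schurq ka x)
     - real (sum_list mu) * (real (sum_list mu) - 1 + A) * schurq mu x"
proof -
  let ?N = "length mu"
  have s: "schurq mu = (\<lambda>x. schur_tuple x ?N (beta_tuple ?N mu))" by (rule ext) (rule schurq_eq_S)
  have "(\<Sum>ka\<in>downY mu. box_weight A B mu ka * schurq ka x) = (\<Sum>ka\<in>downY mu. box_weight A B mu ka * schur_tuple x ?N (beta_tuple ?N ka))"
    using length_downY[OF mu] by (intro sum.cong refl) (simp add: schurq_S)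
  also have "\<dots> = (\<Sum>s<?N. content_weight A B (beta_tuple ?N mu s - int ?N) * schur_tuple x ?N ((beta_tuple ?N mu)(s := beta_tuple ?N mu s - 1)))"
  proof (rule sum_downY[OF mu order.refl, where g="\<lambda>b. schur_tuple x ?N b" and H="content_weight A B"])
    show "schur_tuple x ?N b = 0" if "y < ?N" "z < ?N" "y \<noteq> z" "b y = b z" for b y z
      unfolding schur_tuple_def by (rule NP.S_collision[OF that])
    show "schur_tuple x ?N b = 0" if "y < ?N" "b y < 0" for b y by (rule schur_tuple_neg[of y]) (use that in auto)
    show "box_weight A B mu ka = content_weight A B (int (rowlen mu s) - 1 - int s)" if "rowlen ka = (rowlen mu)(s := rowlen mu s - 1)" "0 < rowlen mu s" for ka s
      unfolding box_weight_def by (rule boxes_downY_content[OF that])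
  qed
  finally show ?thesis unfolding s
    using diff_gen_schur_tuple[OF tuple_size_beta_tuple[OF order.refl] K, of A B x] by simp
qed

section \<open>The Schur functions span the polynomials in the moment coordinates\<close>

inductive_set schur_span :: "((nat \<Rightarrow> real) \<Rightarrow> real) set" where
  zero: "(\<lambda>x. 0) \<in> schur_span"
| step: "F \<in> schur_span \<Longrightarrow> young mu \<Longrightarrow> (\<lambda>x. c * schurq mu x + F x) \<in> schur_span"

lemma schur_span_qpoly: "F \<in> schur_span \<Longrightarrow> F \<in> qpoly"
proof (induction rule: schur_span.induct)
  case zero show ?case by (rule qpoly.const)
next
  case (step F mu c) thus ?case by (intro qpoly.add qpoly_cmult schurq_qpoly)
qed

lemma schur_span_add: "F \<in> schur_span \<Longrightarrow> G \<in> schur_span \<Longrightarrow> (\<lambda>x. F x + G x) \<in> schur_span"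
proof (induction rule: schur_span.induct)
  case (step F mu c)
  from schur_span.step[OF step.IH[OF step.prems] step.hyps(2), of c] show ?case by (simp add: add.assoc)
qed simp

lemma schur_span_cmult: "F \<in> schur_span \<Longrightarrow> (\<lambda>x. c * F x) \<in> schur_span"
proof (induction rule: schur_span.induct)
  case zero show ?case using schur_span.zero by simp
next
  case (step F mu d)
  from schur_span.step[OF step.IH step.hyps(2), of "c * d"] show ?case by (simp add: distrib_left mult.assoc)
qed

lemma schur_span_schurq: "young mu \<Longrightarrow> schurq mu \<in> schur_span"
  using schur_span.step[OF schur_span.zero, of mu 1] by simp

lemma schur_span_sum: "(\<And>i. i \<in> I \<Longrightarrow> F i \<in> schur_span) \<Longrightarrow> (\<lambda>x. \<Sum>i\<in>I. F i x) \<in> schur_span"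
proof (induction I rule: infinite_finite_induct)
  case (insert a I)
  have "(\<lambda>x. F a x + (\<Sum>i\<in>I. F i x)) \<in> schur_span" using insert by (intro schur_span_add) auto
  thus ?case using insert by simp
qed (auto intro: schur_span.zero)

lemma schur_span_schur_tuple: "(\<lambda>x. schur_tuple x N l) \<in> schur_span"
proof (cases "inj_on l {..<N} \<and> nonneg N l")
  case True
  then obtain \<pi> mu where mu: "\<pi> permutes {..<N}" "young mu" "length mu \<le> N" "\<And>i. i < N \<Longrightarrow> (l \<circ> \<pi>) i = beta_tuple N mu i"
    using sorted_partition[of l N] by metis
  have "schur_tuple x N l = of_int (sign \<pi>) * schurq mu x" for x
  proof -
    have "schurq mu x = schur_tuple x N (l \<circ> \<pi>)" unfolding schurq_S[OF mu(3)] by (rule schur_tuple_cong) (simp add: mu(4)[symmetric])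
    also have "\<dots> = of_int (sign \<pi>) * schur_tuple x N l" by (rule schur_tuple_permute[OF mu(1)])
    finally show ?thesis by (simp add: sign_def)
  qed
  thus ?thesis using schur_span_cmult[OF schur_span_schurq[OF mu(2)]] by simp
next
  case False
  hence "schur_tuple x N l = 0" for x by (auto simp: nonneg_def not_le intro: schur_tuple_neg schur_tuple_not_inj)
  thus ?thesis using schur_span.zero by simp
qed

text \<open>By the Murnaghan--Nakayama rule, multiplication by x_k = p_{k+1} raises one entry by k +
  1 in all ways. The tuple gets k + 1 empty rows beyond the length of \<mu>, as that rule
  demands.\<close>

lemma schur_span_var:
  assumes "F \<in> schur_span" "k \<ge> 1"
  shows "(\<lambda>x. x k * F x) \<in> schur_span"
  using assms(1)
proof (induction rule: schur_span.induct)
  case zero show ?case using schur_span.zero by simp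
next
  case (step F mu c)
  define N where "N = length mu + (k + 1)"
  let ?l = "beta_tuple N mu"
  have gamma_coeff: "int ` {..<k + 1} \<subseteq> ?l ` {..<N}"
  proof
    fix v assume "v \<in> int ` {..<k + 1}"
    then obtain q where q: "v = int q" "q < k + 1" by auto
    have "?l (N - 1 - q) = v" using q by (simp add: beta_tuple_def rowlen_def N_def of_nat_diff)
    moreover have "N - 1 - q < N" using q by (simp add: N_def)
    ultimately show "v \<in> ?l ` {..<N}" by (metis imageI lessThan_iff)
  qed
  have "x k * schurq mu x = (\<Sum>r<N. schur_tuple x N (?l(r := ?l r + int (k + 1))))" for x
  proof -
    have "NP.raise_sum x N (int (k + 1)) ?l = psum x (k + 1) * NP.S x N ?l"
      by (rule NP.murnaghan_nakayama[OF _ nonneg_beta_tuple gamma_coeff]) simp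
    moreover have "psum x (k + 1) = x k" using assms(2) by (simp add: psum_def)
    moreover have "schurq mu x = schur_tuple x N ?l" by (rule schurq_S) (simp add: N_def)
    ultimately show ?thesis by (simp add: NP.raise_sum_def schur_tuple_def)
  qed
  hence "(\<lambda>x. x k * schurq mu x) \<in> schur_span" using schur_span_sum[OF schur_span_schur_tuple] by simp
  from schur_span_add[OF schur_span_cmult[OF this, of c] step.IH] show ?case by (simp add: distrib_left mult.left_commute)
qed

text \<open>The induction shows that multiplication by \<open>G\<close> preserves the span; applied
  to 1, the Schur function of the empty diagram, this gives the claim.\<close>

lemma qpoly_schur_span:
  assumes "G \<in> qpoly" shows "G \<in> schur_span"
proof -
  have "F \<in> schur_span \<Longrightarrow> (\<lambda>x. G x * F x) \<in> schur_span" for F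
    using assms
  proof (induction arbitrary: F)
    case (const c) thus ?case by (intro schur_span_cmult)
  next
    case (var k) thus ?case by (intro schur_span_var)
  next
    case (add G H)
    from schur_span_add[OF add.IH(1)[OF add.prems] add.IH(2)[OF add.prems]] show ?case by (simp add: distrib_right)
  next
    case (mult G H)
    from mult.IH(1)[OF mult.IH(2)[OF mult.prems]] show ?case by (simp add: mult.assoc)
  qed
  moreover have "(\<lambda>x. 1) \<in> schur_span"
  proof -
    have "schurq [] = (\<lambda>x. 1)" by (auto simp: schurq_Nil)
    thus ?thesis using schur_span_schurq[of "[]"] by (simp add: young_def)
  qed
  ultimately have "(\<lambda>x. G x * 1) \<in> schur_span" by blast
  thus ?thesis by simp
qed

lemma gamma_coeff_qpoly: "1 \<le> i \<Longrightarrow> 1 \<le> j \<Longrightarrow> gamma_coeff i j \<in> qpoly"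
  unfolding gamma_coeff_def[abs_def] by (intro qpoly_cmult qpoly_diff qpoly.mult qpoly.var) auto

lemma drift_qpoly: "1 \<le> i \<Longrightarrow> drift A B i \<in> qpoly"
  unfolding drift_def[abs_def] by (intro qpoly_cmult qpoly.add qpoly_sum qpoly.mult psum_qpoly) auto

lemma diff_gen_qpoly: "F \<in> qpoly \<Longrightarrow> diff_gen K A B F \<in> qpoly"
  unfolding diff_gen_def[abs_def] by (intro qpoly_cmult qpoly.add qpoly_sum qpoly.mult gamma_coeff_qpoly drift_qpoly pdq_deriv qpoly.const) auto

lemma diff_gamma_qpoly: "F \<in> qpoly \<Longrightarrow> G \<in> qpoly \<Longrightarrow> diff_gamma K F G \<in> qpoly"
  unfolding diff_gamma_def[abs_def] by (intro qpoly_cmult qpoly.add qpoly_sum qpoly.mult gamma_coeff_qpoly pdq_deriv) auto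

lemma diff_gen_add:
  assumes "F \<in> qpoly" "G \<in> qpoly"
  shows "diff_gen K A B (\<lambda>x. F x + G x) x = diff_gen K A B F x + diff_gen K A B G x"
  unfolding diff_gen_def by (simp add: pdq_add assms pdq_deriv(2) distrib_left sum.distrib)

lemma diff_gen_cmult:
  assumes "F \<in> qpoly"
  shows "diff_gen K A B (\<lambda>x. c * F x) x = c * diff_gen K A B F x"
  unfolding diff_gen_def by (simp add: pdq_cmult assms pdq_deriv(2) distrib_left sum_distrib_left mult.left_commute)

lemma diff_gen_const: "diff_gen K A B (\<lambda>x. c) x = 0"
  unfolding diff_gen_def by (simp add: pdq_const)

lemma diff_gamma_commute: "diff_gamma K F G x = diff_gamma K G F x"
  unfolding diff_gamma_def
  by (subst sum.swap) (intro sum.cong refl, simp add: gamma_coeff_def add.commute mult_ac)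

lemma diff_gen_mult:
  assumes "F \<in> qpoly" "G \<in> qpoly"
  shows "diff_gen K A B (\<lambda>x. F x * G x) x = F x * diff_gen K A B G x + diff_gen K A B F x * G x + 2 * diff_gamma K F G x"
proof -
  have 2: "pdq (pdq (\<lambda>x. F x * G x) i) j x = F x * pdq (pdq G i) j x + pdq (pdq F i) j x * G x + (pdq F i x * pdq G j x + pdq G i x * pdq F j x)" for i j
    using assms by (simp add: pdq_mult pdq_add qpoly.mult pdq_deriv(2) algebra_simps)
  have 1: "pdq (\<lambda>x. F x * G x) i x = F x * pdq G i x + pdq F i x * G x" for i
    using assms by (simp add: pdq_mult algebra_simps)
  have "diff_gen K A B (\<lambda>x. F x * G x) x = F x * diff_gen K A B G x + diff_gen K A B F x * G x + (diff_gamma K F G x + diff_gamma K G F x)"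
    unfolding diff_gen_def diff_gamma_def 1 2
    by (simp only: distrib_left distrib_right sum.distrib sum_distrib_left sum_distrib_right mult_ac add_ac)
  thus ?thesis using diff_gamma_commute[of K G F x] by simp
qed

text \<open>\<open>J\<close> is kept abstract: linearity and symmetry on Schur functions are all
  that matters. As symmetry for a pair of Schur functions is available only when K is at least their
  sizes, it holds for \<open>F\<close> and \<open>G\<close> from some K on, and each further summand
  may raise this bound.\<close>

lemma integration_by_parts:
  fixes J :: "((nat \<Rightarrow> real) \<Rightarrow> real) \<Rightarrow> real"
  assumes Jadd: "\<And>F G. F \<in> qpoly \<Longrightarrow> G \<in> qpoly \<Longrightarrow> J (\<lambda>x. F x + G x) = J F + J G"
    and Jcmult: "\<And>F c. F \<in> qpoly \<Longrightarrow> J (\<lambda>x. c * F x) = c * J F"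
    and Jsym: "\<And>mu nu K. young mu \<Longrightarrow> young nu \<Longrightarrow> sum_list mu \<le> K \<Longrightarrow> sum_list nu \<le> K \<Longrightarrow>
       J (\<lambda>x. diff_gen K A B (schurq mu) x * schurq nu x) = J (\<lambda>x. schurq mu x * diff_gen K A B (schurq nu) x)"
    and FG: "F \<in> qpoly" "G \<in> qpoly"
  shows "\<exists>K0. \<forall>K\<ge>K0. - J (\<lambda>x. diff_gen K A B F x * G x) = J (diff_gamma K F G)"
proof -
  note q = qpoly.add qpoly.mult qpoly_cmult diff_gen_qpoly schurq_qpoly schur_span_qpoly
  have J0: "J (\<lambda>x. 0) = 0" using Jcmult[OF qpoly.const[of 0], of 0] by simp
  have lin: "J (\<lambda>x. diff_gen K A B (\<lambda>x. c * schurq mu x + F x) x * H x) = c * J (\<lambda>x. diff_gen K A B (schurq mu) x * H x) + J (\<lambda>x. diff_gen K A B F x * H x)"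
    if "F \<in> qpoly" "H \<in> qpoly" for c mu F H K
  proof -
    have "J (\<lambda>x. diff_gen K A B (\<lambda>x. c * schurq mu x + F x) x * H x) = J (\<lambda>x. c * (diff_gen K A B (schurq mu) x * H x) + diff_gen K A B F x * H x)"
      using that by (simp add: diff_gen_add diff_gen_cmult q distrib_right mult.assoc)
    also have "\<dots> = c * J (\<lambda>x. diff_gen K A B (schurq mu) x * H x) + J (\<lambda>x. diff_gen K A B F x * H x)"
      using that by (simp add: Jadd Jcmult q)
    finally show ?thesis .
  qed
  have lin2: "J (\<lambda>x. H x * (c * schurq mu x + F x)) = c * J (\<lambda>x. H x * schurq mu x) + J (\<lambda>x. H x * F x)"
    if "F \<in> qpoly" "H \<in> qpoly" for c mu F H
  proof -
    have "J (\<lambda>x. H x * (c * schurq mu x + F x)) = J (\<lambda>x. c * (H x * schurq mu x) + H x * F x)"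
      by (simp add: distrib_left mult.left_commute)
    also have "\<dots> = c * J (\<lambda>x. H x * schurq mu x) + J (\<lambda>x. H x * F x)"
      using that by (simp add: Jadd Jcmult q)
    finally show ?thesis .
  qed
  have sym1: "\<exists>K0. \<forall>K\<ge>K0. J (\<lambda>x. diff_gen K A B (schurq mu) x * G x) = J (\<lambda>x. schurq mu x * diff_gen K A B G x)"
    if mu: "young mu" and Gs: "G \<in> schur_span" for mu G
    using Gs
  proof (induction rule: schur_span.induct)
    case zero show ?case by (simp add: diff_gen_const)
  next
    case (step G nu c)
    then obtain K0 where K0: "\<forall>K\<ge>K0. J (\<lambda>x. diff_gen K A B (schurq mu) x * G x) = J (\<lambda>x. schurq mu x * diff_gen K A B G x)" by blast
    show ?case
    proof (intro exI[of _ "max K0 (max (sum_list mu) (sum_list nu))"] allI impI)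
      fix K assume K: "max K0 (max (sum_list mu) (sum_list nu)) \<le> K"
      have G: "G \<in> qpoly" by (rule schur_span_qpoly[OF step.hyps(1)])
      have "J (\<lambda>x. diff_gen K A B (schurq mu) x * (c * schurq nu x + G x)) = c * J (\<lambda>x. diff_gen K A B (schurq mu) x * schurq nu x) + J (\<lambda>x. diff_gen K A B (schurq mu) x * G x)"
        by (rule lin2[OF G]) (intro q)
      also have "\<dots> = c * J (\<lambda>x. diff_gen K A B (schurq nu) x * schurq mu x) + J (\<lambda>x. diff_gen K A B G x * schurq mu x)"
        using Jsym[OF mu step.hyps(2), of K] K0 K by (simp add: mult.commute)
      also have "\<dots> = J (\<lambda>x. diff_gen K A B (\<lambda>x. c * schurq nu x + G x) x * schurq mu x)"
        by (rule lin[OF G schurq_qpoly, symmetric])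
      finally show "J (\<lambda>x. diff_gen K A B (schurq mu) x * (c * schurq nu x + G x)) = J (\<lambda>x. schurq mu x * diff_gen K A B (\<lambda>x. c * schurq nu x + G x) x)"
        by (simp add: mult.commute)
    qed
  qed
  have sym: "\<exists>K0. \<forall>K\<ge>K0. J (\<lambda>x. diff_gen K A B F x * G x) = J (\<lambda>x. F x * diff_gen K A B G x)"
    if Fs: "F \<in> schur_span" and Gs: "G \<in> schur_span" for F G
    using Fs
  proof (induction rule: schur_span.induct)
    case zero show ?case by (simp add: diff_gen_const)
  next
    case (step F mu c)
    then obtain K0 where K0: "\<forall>K\<ge>K0. J (\<lambda>x. diff_gen K A B F x * G x) = J (\<lambda>x. F x * diff_gen K A B G x)" by blast
    obtain K1 where K1: "\<forall>K\<ge>K1. J (\<lambda>x. diff_gen K A B (schurq mu) x * G x) = J (\<lambda>x. schurq mu x * diff_gen K A B G x)"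
      using sym1[OF step.hyps(2) Gs] by blast
    have G: "G \<in> qpoly" by (rule schur_span_qpoly[OF Gs])
    have F: "F \<in> qpoly" by (rule schur_span_qpoly[OF step.hyps(1)])
    show ?case
    proof (intro exI[of _ "max K0 K1"] allI impI)
      fix K assume K: "max K0 K1 \<le> K"
      have "J (\<lambda>x. diff_gen K A B (\<lambda>x. c * schurq mu x + F x) x * G x) = c * J (\<lambda>x. diff_gen K A B G x * schurq mu x) + J (\<lambda>x. diff_gen K A B G x * F x)"
        unfolding lin[OF F G] using K0 K1 K by (simp add: mult.commute)
      also have "\<dots> = J (\<lambda>x. diff_gen K A B G x * (c * schurq mu x + F x))"
        by (rule lin2[OF F diff_gen_qpoly[OF G], symmetric])
      finally show "J (\<lambda>x. diff_gen K A B (\<lambda>x. c * schurq mu x + F x) x * G x) = J (\<lambda>x. (c * schurq mu x + F x) * diff_gen K A B G x)"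
        by (simp add: mult.commute)
    qed
  qed
  have one: "(\<lambda>x. 1) \<in> schur_span" by (rule qpoly_schur_span[OF qpoly.const])
  have FGs: "(\<lambda>x. F x * G x) \<in> schur_span" by (intro qpoly_schur_span qpoly.mult FG)
  obtain K0 where K0: "\<forall>K\<ge>K0. J (\<lambda>x. diff_gen K A B (\<lambda>x. F x * G x) x * 1) = J (\<lambda>x. (F x * G x) * diff_gen K A B (\<lambda>x. 1) x)"
    using sym[OF FGs one] by blast
  obtain K1 where K1: "\<forall>K\<ge>K1. J (\<lambda>x. diff_gen K A B F x * G x) = J (\<lambda>x. F x * diff_gen K A B G x)"
    using sym[OF qpoly_schur_span[OF FG(1)] qpoly_schur_span[OF FG(2)]] by blast
  show ?thesis
  proof (intro exI[of _ "max K0 K1"] allI impI)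
    fix K assume K: "max K0 K1 \<le> K"
    \<comment> \<open>Symmetry for the pair FG and 1, as the generator annihilates constants. Since
      J(F AG) = J(AF G), the product rule then gives twice the claim.\<close>
    have "0 = J (diff_gen K A B (\<lambda>x. F x * G x))" using K0 K by (simp add: diff_gen_const J0)
    also have "diff_gen K A B (\<lambda>x. F x * G x) = (\<lambda>x. (F x * diff_gen K A B G x + diff_gen K A B F x * G x) + 2 * diff_gamma K F G x)"
      by (rule ext) (rule diff_gen_mult[OF FG])
    also have "J \<dots> = J (\<lambda>x. F x * diff_gen K A B G x) + J (\<lambda>x. diff_gen K A B F x * G x) + 2 * J (diff_gamma K F G)"
      using FG diff_gamma_qpoly[OF FG] by (simp add: Jadd Jcmult q)
    finally show "- J (\<lambda>x. diff_gen K A B F x * G x) = J (diff_gamma K F G)" using K1 K by simp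
  qed
qed

section \<open>The boundary z-measure\<close>

text \<open>The first i + 1 terms of each sequence are at least as large as the last of them, and
  their sum is at most 1.\<close>

lemma Omega_coord_bound:
  assumes "\<omega> \<in> Omega"
  shows "0 \<le> fst \<omega> i" "fst \<omega> i \<le> 1 / real (i + 1)" "0 \<le> snd \<omega> i" "snd \<omega> i \<le> 1 / real (i + 1)"
proof -
  obtain a b where w: "\<omega> = (a, b)" by (cases \<omega>)
  have o: "\<And>i. 0 \<le> a i" "\<And>i. 0 \<le> b i" "antimono a" "antimono b" "\<And>N. (\<Sum>j<N. a j + b j) \<le> 1"
    using assms unfolding w Omega_def by auto
  have "real (i + 1) * a i = (\<Sum>j<i + 1. a i)" by simp
  also have "\<dots> \<le> (\<Sum>j<i + 1. a j + b j)"
    using o(1,2) antimonoD[OF o(3)] by (intro sum_mono) (auto intro!: add_increasing2)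
  also have "\<dots> \<le> 1" by (rule o(5))
  finally have a1: "real (i + 1) * a i \<le> 1" .
  have "real (i + 1) * b i = (\<Sum>j<i + 1. b i)" by simp
  also have "\<dots> \<le> (\<Sum>j<i + 1. a j + b j)"
    using o(1,2) antimonoD[OF o(4)] by (intro sum_mono) (auto intro!: add_increasing)
  also have "\<dots> \<le> 1" by (rule o(5))
  finally have b1: "real (i + 1) * b i \<le> 1" .
  show "0 \<le> fst \<omega> i" "fst \<omega> i \<le> 1 / real (i + 1)" "0 \<le> snd \<omega> i" "snd \<omega> i \<le> 1 / real (i + 1)"
    using o(1)[of i] o(2)[of i] a1 b1 by (simp_all add: w pos_le_divide_eq mult.commute)
qed

text \<open>The M-test applies with majorant 1/(i+1)^2 as soon as the exponent is at least 2, that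
  is k \<ge> 1; for exponent 1 the majorant 1/(i+1) would diverge.\<close>

lemma continuous_on_power_series_Omega:
  fixes f :: "thoma \<Rightarrow> nat \<Rightarrow> real"
  assumes c: "\<And>i. continuous_on Omega (\<lambda>\<omega>. f \<omega> i)"
    and b: "\<And>\<omega> i. \<omega> \<in> Omega \<Longrightarrow> 0 \<le> f \<omega> i \<and> f \<omega> i \<le> 1 / real (i + 1)" and k: "1 \<le> k"
  shows "continuous_on Omega (\<lambda>\<omega>. \<Sum>i. f \<omega> i ^ (k + 1))"
proof (rule uniform_limit_theorem[where F=sequentially and f="\<lambda>n \<omega>. \<Sum>i<n. f \<omega> i ^ (k + 1)"])
  show "\<forall>\<^sub>F n in sequentially. continuous_on Omega (\<lambda>\<omega>. \<Sum>i<n. f \<omega> i ^ (k + 1))"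
    by (intro always_eventually allI continuous_intros c)
  show "uniform_limit Omega (\<lambda>n \<omega>. \<Sum>i<n. f \<omega> i ^ (k + 1)) (\<lambda>\<omega>. \<Sum>i. f \<omega> i ^ (k + 1)) sequentially"
  proof (rule Weierstrass_m_test)
    fix i and \<omega> assume w: "\<omega> \<in> Omega"
    have "f \<omega> i ^ (k + 1) \<le> (1 / real (i + 1)) ^ (k + 1)" using b[OF w, of i] by (intro power_mono) auto
    also have "\<dots> \<le> (1 / real (i + 1)) ^ 2" using k by (intro power_decreasing) auto
    finally show "norm (f \<omega> i ^ (k + 1)) \<le> inverse (real (Suc i) ^ 2)"
      using b[OF w, of i] by (simp add: power_inverse divide_inverse)
  next
    have "summable (\<lambda>n. inverse (real n ^ 2))" by (rule inverse_power_summable) simp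
    thus "summable (\<lambda>i. inverse (real (Suc i) ^ 2))" by (subst summable_Suc_iff)
  qed
qed simp

lemma continuous_on_qmom:
  assumes "1 \<le> k"
  shows "continuous_on Omega (qmom k)"
proof -
  have "continuous_on Omega (\<lambda>\<omega>. fst \<omega> i)" "continuous_on Omega (\<lambda>\<omega>. snd \<omega> i)" for i
    by (rule continuous_on_product_then_coordinatewise, intro continuous_on_fst continuous_on_snd continuous_on_id)+
  hence "continuous_on Omega (\<lambda>\<omega>. (\<Sum>i. fst \<omega> i ^ (k + 1)) + (-1) ^ k * (\<Sum>i. snd \<omega> i ^ (k + 1)))"
    using assms Omega_coord_bound
    by (intro continuous_on_add continuous_on_mult continuous_on_const continuous_on_power_series_Omega) blast+
  thus ?thesis unfolding qmom_def[abs_def] .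
qed

lemma continuous_on_qpoly:
  assumes "F \<in> qpoly"
  shows "continuous_on Omega (\<lambda>\<omega>. F (qvec \<omega>))"
  using assms
proof induction
  case (var k)
  thus ?case using continuous_on_qmom[of k] by (simp add: qvec_def)
qed (auto intro: continuous_intros)

text \<open>Approximation with error O(1/n) on the diagrams with n boxes. The bound on
  \<open>X\<close> is included to make the notion stable under products.\<close>

definition near :: "(nat \<Rightarrow> nat list \<Rightarrow> real) \<Rightarrow> ((nat \<Rightarrow> real) \<Rightarrow> real) \<Rightarrow> bool" where
  "near X Y \<longleftrightarrow> (\<exists>C\<ge>0. \<exists>n0\<ge>1. \<forall>n\<ge>n0. \<forall>l\<in>YD n. \<bar>X n l - Y (qvec (iota n l))\<bar> \<le> C / real n \<and> \<bar>X n l\<bar> \<le> C)"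

lemma nearI:
  assumes "0 \<le> C" "\<And>n l. max n0 1 \<le> n \<Longrightarrow> l \<in> YD n \<Longrightarrow> \<bar>X n l - Y (qvec (iota n l))\<bar> \<le> C / real n"
    "\<And>n l. max n0 1 \<le> n \<Longrightarrow> l \<in> YD n \<Longrightarrow> \<bar>X n l\<bar> \<le> C"
  shows "near X Y"
  unfolding near_def using assms by (intro exI[of _ C] conjI exI[of _ "max n0 1"]) auto

lemma nearE:
  assumes "near X Y"
  obtains C n0 where "0 \<le> C" "\<And>n l. n0 \<le> n \<Longrightarrow> l \<in> YD n \<Longrightarrow> \<bar>X n l - Y (qvec (iota n l))\<bar> \<le> C / real n"
    "\<And>n l. n0 \<le> n \<Longrightarrow> l \<in> YD n \<Longrightarrow> \<bar>X n l\<bar> \<le> C"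
  using assms unfolding near_def by blast

lemma near_zero: "near (\<lambda>n l. 0) (\<lambda>x. 0)"
  by (rule nearI[of 0 0]) auto

lemma near_add:
  assumes "near X Y" "near X' Y'"
  shows "near (\<lambda>n l. X n l + X' n l) (\<lambda>x. Y x + Y' x)"
proof -
  obtain C n0 where 1: "0 \<le> C" "\<And>n l. n0 \<le> n \<Longrightarrow> l \<in> YD n \<Longrightarrow> \<bar>X n l - Y (qvec (iota n l))\<bar> \<le> C / real n"
    "\<And>n l. n0 \<le> n \<Longrightarrow> l \<in> YD n \<Longrightarrow> \<bar>X n l\<bar> \<le> C" using assms(1) by (rule nearE) blast
  obtain C' n0' where 2: "0 \<le> C'" "\<And>n l. n0' \<le> n \<Longrightarrow> l \<in> YD n \<Longrightarrow> \<bar>X' n l - Y' (qvec (iota n l))\<bar> \<le> C' / real n"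
    "\<And>n l. n0' \<le> n \<Longrightarrow> l \<in> YD n \<Longrightarrow> \<bar>X' n l\<bar> \<le> C'" using assms(2) by (rule nearE) blast
  show ?thesis
  proof (rule nearI[of "C + C'" "max n0 n0'"])
    fix n l assume n: "max (max n0 n0') 1 \<le> n" and l: "l \<in> YD n"
    show "\<bar>X n l + X' n l - (Y (qvec (iota n l)) + Y' (qvec (iota n l)))\<bar> \<le> (C + C') / real n"
      using 1(2)[of n l] 2(2)[of n l] n l unfolding add_divide_distrib by simp
    show "\<bar>X n l + X' n l\<bar> \<le> C + C'" using 1(3)[of n l] 2(3)[of n l] n l by simp
  qed (use 1 2 in simp)
qed

lemma near_mult:
  assumes "near X Y" "near X' Y'"
  shows "near (\<lambda>n l. X n l * X' n l) (\<lambda>x. Y x * Y' x)"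
proof -
  obtain C n0 where 1: "0 \<le> C" "\<And>n l. n0 \<le> n \<Longrightarrow> l \<in> YD n \<Longrightarrow> \<bar>X n l - Y (qvec (iota n l))\<bar> \<le> C / real n"
    "\<And>n l. n0 \<le> n \<Longrightarrow> l \<in> YD n \<Longrightarrow> \<bar>X n l\<bar> \<le> C" using assms(1) by (rule nearE) blast
  obtain C' n0' where 2: "0 \<le> C'" "\<And>n l. n0' \<le> n \<Longrightarrow> l \<in> YD n \<Longrightarrow> \<bar>X' n l - Y' (qvec (iota n l))\<bar> \<le> C' / real n"
    "\<And>n l. n0' \<le> n \<Longrightarrow> l \<in> YD n \<Longrightarrow> \<bar>X' n l\<bar> \<le> C'" using assms(2) by (rule nearE) blast
  show ?thesis
  proof (rule nearI[of "3 * C * C'" "max n0 n0'"])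
    fix n l assume n: "max (max n0 n0') 1 \<le> n" and l: "l \<in> YD n"
    define a b c d where "a = X n l" and "b = Y (qvec (iota n l))" and "c = X' n l" and "d = Y' (qvec (iota n l))"
    have ab: "\<bar>a - b\<bar> \<le> C / real n" "\<bar>a\<bar> \<le> C" and cd: "\<bar>c - d\<bar> \<le> C' / real n" "\<bar>c\<bar> \<le> C'"
      using 1(2,3)[of n l] 2(2,3)[of n l] n l unfolding a_def b_def c_def d_def by auto
    \<comment> \<open>Bounds the approximating function as well, by 2C'; this is where the constant
      3CC' = CC' + 2CC' comes from.\<close>
    have "C' / real n \<le> C'" using 2(1) n by (simp add: divide_le_eq mult_le_cancel_left1)
    hence d: "\<bar>d\<bar> \<le> 2 * C'" using cd by linarith
    have "a * c - b * d = a * (c - d) + (a - b) * d" by (simp add: algebra_simps)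
    hence "\<bar>a * c - b * d\<bar> \<le> \<bar>a\<bar> * \<bar>c - d\<bar> + \<bar>a - b\<bar> * \<bar>d\<bar>" by (simp add: abs_mult[symmetric] abs_triangle_ineq)
    also have "\<dots> \<le> C * (C' / real n) + (C / real n) * (2 * C')"
      using ab cd d 1(1) 2(1) by (intro add_mono mult_mono) auto
    also have "\<dots> = 3 * C * C' / real n" by (simp add: add_divide_distrib[symmetric])
    finally show "\<bar>X n l * X' n l - Y (qvec (iota n l)) * Y' (qvec (iota n l))\<bar> \<le> 3 * C * C' / real n"
      by (simp only: a_def b_def c_def d_def)
    have "\<bar>a * c\<bar> \<le> C * C'" unfolding abs_mult using ab cd 1(1) by (intro mult_mono) auto
    also have "\<dots> \<le> 3 * C * C'" using 1(1) 2(1) by simp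
    finally show "\<bar>X n l * X' n l\<bar> \<le> 3 * C * C'" by (simp only: a_def c_def)
  qed (use 1 2 in simp)
qed

lemma near_cmult:
  assumes "near X Y"
  shows "near (\<lambda>n l. c * X n l) (\<lambda>x. c * Y x)"
proof -
  have "near (\<lambda>n l. c) (\<lambda>x. c)" by (rule nearI[of "\<bar>c\<bar>" 0]) auto
  thus ?thesis by (rule near_mult[OF _ assms])
qed

lemma near_sum: "(\<And>i. i \<in> I \<Longrightarrow> near (X i) (Y i)) \<Longrightarrow> near (\<lambda>n l. \<Sum>i\<in>I. X i n l) (\<lambda>x. \<Sum>i\<in>I. Y i x)"
proof (induction I rule: infinite_finite_induct)
  case (insert a I)
  have "near (\<lambda>n l. X a n l + (\<Sum>i\<in>I. X i n l)) (\<lambda>x. Y a x + (\<Sum>i\<in>I. Y i x))"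
    using insert by (intro near_add) auto
  thus ?case using insert by simp
qed (auto intro: near_zero)

lemma near_diff:
  assumes "near X Y" "near X' Y'"
  shows "near (\<lambda>n l. X n l - X' n l) (\<lambda>x. Y x - Y' x)"
  using near_add[OF assms(1) near_cmult[OF assms(2), of "-1"]] by simp

lemma near_dim_ratio: "young mu \<Longrightarrow> near (\<lambda>n l. dim_ratio (Suc n) mu l) (schurq mu)"
proof -
  assume mu: "young mu"
  obtain C where C: "C \<ge> 0" "\<And>n N la. 1 \<le> n \<Longrightarrow> la \<in> YD n \<Longrightarrow> length la \<le> N \<Longrightarrow> length mu \<le> N \<Longrightarrow>
     \<bar>dim_ratio N mu la - schurq mu (qvec (iota n la))\<bar> \<le> C / real n \<and> \<bar>dim_ratio N mu la\<bar> \<le> 1"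
    using dim_ratio_asymptotic[OF mu] by blast
  show ?thesis
  proof (rule nearI[of "C + 1" "length mu"])
    fix n l assume n: "max (length mu) 1 \<le> n" and l: "l \<in> YD n"
    have "\<bar>dim_ratio (Suc n) mu l - schurq mu (qvec (iota n l))\<bar> \<le> C / real n \<and> \<bar>dim_ratio (Suc n) mu l\<bar> \<le> 1"
      using n l YD_young(3)[OF l] by (intro C(2)) auto
    moreover have "C / real n \<le> (C + 1) / real n" by (intro divide_right_mono) auto
    ultimately show "\<bar>dim_ratio (Suc n) mu l - schurq mu (qvec (iota n l))\<bar> \<le> (C + 1) / real n" "\<bar>dim_ratio (Suc n) mu l\<bar> \<le> C + 1"
      using C(1) by auto
  qed (use C in simp)
qed

text \<open>The generator before the limit and the one on Schur functions have the same
  coefficients, so the approximation of g by s passes to them term by term.\<close>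

lemma near_dim_ratio_gen:
  assumes mu: "young mu" and K: "sum_list mu \<le> K"
  shows "near (\<lambda>n l. dim_ratio_gen A B (Suc n) mu l) (diff_gen K A B (schurq mu))"
proof -
  have "diff_gen K A B (schurq mu) = (\<lambda>x. (\<Sum>ka\<in>downY mu. box_weight A B mu ka * schurq ka x)
     - real (sum_list mu) * (real (sum_list mu) - 1 + A) * schurq mu x)"
    by (rule ext) (rule diff_gen_schurq[OF mu K])
  moreover have "near (\<lambda>n l. dim_ratio_gen A B (Suc n) mu l) (\<lambda>x. (\<Sum>ka\<in>downY mu. box_weight A B mu ka * schurq ka x)
     - real (sum_list mu) * (real (sum_list mu) - 1 + A) * schurq mu x)"
    unfolding dim_ratio_gen_def by (intro near_diff near_sum near_cmult near_dim_ratio mu) (auto simp: downY_def)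
  ultimately show ?thesis by simp
qed

lemma diff_gen_sum:
  assumes "\<And>i. i \<in> I \<Longrightarrow> F i \<in> qpoly"
  shows "diff_gen K A B (\<lambda>x. \<Sum>i\<in>I. c i * F i x) x = (\<Sum>i\<in>I. c i * diff_gen K A B (F i) x)"
  using assms
proof (induction I rule: infinite_finite_induct)
  case (insert a I)
  have "diff_gen K A B (\<lambda>x. c a * F a x + (\<Sum>i\<in>I. c i * F i x)) x = diff_gen K A B (\<lambda>x. c a * F a x) x + diff_gen K A B (\<lambda>x. \<Sum>i\<in>I. c i * F i x) x"
    using insert.prems by (intro diff_gen_add qpoly_cmult qpoly_sum) auto
  thus ?case using insert by (simp add: diff_gen_cmult)
qed (auto simp: diff_gen_const)

lemma Aop_eq_diff_gen:
  assumes w: "\<And>c::int. (z + of_int c) * (z' + of_int c) = complex_of_real (content_weight (Re (z * z')) B c)"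
    and c: "finite {\<mu>. c \<mu> \<noteq> 0}" "\<And>\<mu>. c \<mu> \<noteq> 0 \<Longrightarrow> young \<mu>"
  shows "\<exists>K0. \<forall>K\<ge>K0. \<forall>x. Aop z z' c x = diff_gen K (Re (z * z')) B (fschur c) x"
\<comment> \<open>A cut-off beyond the total size of the diagrams in the support serves all of them
  at once.\<close>
proof (intro exI[of _ "\<Sum>\<mu> | c \<mu> \<noteq> 0. sum_list \<mu>"] allI impI)
  fix K x assume K: "(\<Sum>\<mu> | c \<mu> \<noteq> 0. sum_list \<mu>) \<le> K"
  have "A_schur z z' \<mu> x = diff_gen K (Re (z * z')) B (schurq \<mu>) x" if "c \<mu> \<noteq> 0" for \<mu>
  proof -
    have "sum_list \<mu> \<le> (\<Sum>\<mu> | c \<mu> \<noteq> 0. sum_list \<mu>)" using c(1) that by (intro member_le_sum) auto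
    thus ?thesis using K diff_gen_schurq[OF c(2)[OF that], of K "Re (z * z')" B x] by (simp only: A_schur_eq[OF w])
  qed
  hence "Aop z z' c x = (\<Sum>\<mu> | c \<mu> \<noteq> 0. c \<mu> * diff_gen K (Re (z * z')) B (schurq \<mu>) x)"
    unfolding Aop_def by (intro sum.cong) auto
  also have "\<dots> = diff_gen K (Re (z * z')) B (fschur c) x"
    unfolding fschur_def[abs_def] by (rule diff_gen_sum[symmetric]) (rule schurq_qpoly)
  finally show "Aop z z' c x = diff_gen K (Re (z * z')) B (fschur c) x" .
qed

text \<open>A polynomial involves finitely many variables, so the infinite sum has finite
  support.\<close>

lemma GammaQ_eq_diff_gamma:
  assumes "F \<in> qpoly" "G \<in> qpoly"
  shows "\<exists>K0. \<forall>K\<ge>K0. \<forall>\<omega>. GammaQ F G \<omega> = diff_gamma K F G (qvec \<omega>)"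
proof -
  obtain K1 K2 where K: "\<forall>i>K1. pdq F i = (\<lambda>x. 0)" "\<forall>i>K2. pdq G i = (\<lambda>x. 0)"
    using pdq_eventually_zero assms by meson
  show ?thesis
  proof (intro exI[of _ "max K1 K2"] allI impI)
    fix K \<omega> assume k: "max K1 K2 \<le> K"
    let ?f = "\<lambda>(i, j). gamma_coeff i j (qvec \<omega>) * pdq F i (qvec \<omega>) * pdq G j (qvec \<omega>)"
    have "GammaQ F G \<omega> = infsum ?f ({1..K} \<times> {1..K})"
      unfolding GammaQ_def
    proof (rule infsum_cong_neutral)
      fix x assume "x \<in> ({1..} \<times> {1..}) - ({1..K} \<times> {1..K})"
      thus "(case x of (i, j) \<Rightarrow> real ((i + 1) * (j + 1)) * (qmom (i + j) \<omega> - qmom i \<omega> * qmom j \<omega>) * pdq F i (qvec \<omega>) * pdq G j (qvec \<omega>)) = 0"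
        using K k by (cases x) auto
    qed (auto simp: gamma_coeff_def qvec_def)
    also have "\<dots> = (\<Sum>x\<in>{1..K} \<times> {1..K}. ?f x)" by (rule infsum_finite) simp
    also have "\<dots> = diff_gamma K F G (qvec \<omega>)" unfolding diff_gamma_def by (rule sum.cartesian_product[symmetric])
    finally show "GammaQ F G \<omega> = diff_gamma K F G (qvec \<omega>)" .
  qed
qed

theorem theorem7p4:
  fixes z z' :: complex and P :: "thoma measure"
    and c :: "nat list \<Rightarrow> real" and G :: "(nat \<Rightarrow> real) \<Rightarrow> real"
  assumes series: "(z \<notin> \<real> \<and> z' = cnj z) \<or>
      (\<exists>N::int. z \<in> \<real> \<and> z' \<in> \<real> \<and> of_int N < Re z \<and> Re z < of_int N + 1
                 \<and> of_int N < Re z' \<and> Re z' < of_int N + 1)"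
    and P_prob: "prob_space P" and P_borel: "sets P = sets borel"
    and P_Omega: "emeasure P Omega = 1"
    and P_limit: "\<And>F. continuous_on Omega F \<Longrightarrow>
        (\<lambda>n. \<Sum>l\<in>YD n. zmeas z z' n l * F (iota n l)) \<longlonglongrightarrow> (LINT \<omega>:Omega|P. F \<omega>)"
    and c_fin: "finite {\<mu>. c \<mu> \<noteq> 0}" and c_young: "\<And>\<mu>. c \<mu> \<noteq> 0 \<Longrightarrow> young \<mu>"
    and G_poly: "G \<in> qpoly"
  shows "- (LINT \<omega>:Omega|P. Aop z z' c (qvec \<omega>) * G (qvec \<omega>))
         = (LINT \<omega>:Omega|P. GammaQ (fschur c) G \<omega>)"
proof -
  define A where "A = Re (z * z')"
  define B where "B = Re (z + z')"
  have w: "(z + of_int c) * (z' + of_int c) = complex_of_real (content_weight A B c)" and wpos: "0 < content_weight A B c" for c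
    unfolding A_def B_def by (rule series_weights[OF series])+
  have A: "0 < A" using wpos[of 0] by (simp add: content_weight_def)
  define J where "J F = (LINT \<omega>:Omega|P. F (qvec \<omega>))" for F :: "(nat \<Rightarrow> real) \<Rightarrow> real"
  define En where "En n F = (\<Sum>l\<in>YD n. z_weight A B n l * F (qvec (iota n l)))" for n F
  have lim: "(\<lambda>n. En n F) \<longlonglongrightarrow> J F" if "F \<in> qpoly" for F
    using P_limit[OF continuous_on_qpoly[OF that]] unfolding J_def En_def zmeas_z_weight[OF w] .
  \<comment> \<open>Linearity of \<open>J\<close> is read off from the sums before the limit by
    uniqueness of limits, which avoids questions of integrability.\<close>
  have Jadd: "J (\<lambda>x. F x + G x) = J F + J G" if "F \<in> qpoly" "G \<in> qpoly" for F G
  proof (rule LIMSEQ_unique)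
    show "(\<lambda>n. En n (\<lambda>x. F x + G x)) \<longlonglongrightarrow> J (\<lambda>x. F x + G x)" using that by (intro lim qpoly.add)
    have "En n (\<lambda>x. F x + G x) = En n F + En n G" for n by (simp add: En_def distrib_left sum.distrib)
    thus "(\<lambda>n. En n (\<lambda>x. F x + G x)) \<longlonglongrightarrow> J F + J G" using that by (simp add: tendsto_add lim)
  qed
  have Jcmult: "J (\<lambda>x. c * F x) = c * J F" if "F \<in> qpoly" for F c
  proof (rule LIMSEQ_unique)
    show "(\<lambda>n. En n (\<lambda>x. c * F x)) \<longlonglongrightarrow> J (\<lambda>x. c * F x)" using that by (intro lim qpoly_cmult)
    have "En n (\<lambda>x. c * F x) = c * En n F" for n by (simp add: En_def sum_distrib_left mult.left_commute)
    thus "(\<lambda>n. En n (\<lambda>x. c * F x)) \<longlonglongrightarrow> c * J F" using that by (simp add: tendsto_mult_left lim)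
  qed
  have Jsym: "J (\<lambda>x. diff_gen K A B (schurq mu) x * schurq nu x) = J (\<lambda>x. schurq mu x * diff_gen K A B (schurq nu) x)"
    if mu: "young mu" "sum_list mu \<le> K" and nu: "young nu" "sum_list nu \<le> K" for mu nu K
  proof -
    define H where "H x = diff_gen K A B (schurq mu) x * schurq nu x - schurq mu x * diff_gen K A B (schurq nu) x" for x
    define D where "D n l = dim_ratio_gen A B (Suc n) mu l * dim_ratio (Suc n) nu l - dim_ratio (Suc n) mu l * dim_ratio_gen A B (Suc n) nu l" for n l
    have qm: "(\<lambda>x. diff_gen K A B (schurq mu) x * schurq nu x) \<in> qpoly" "(\<lambda>x. schurq mu x * diff_gen K A B (schurq nu) x) \<in> qpoly"
      by (intro qpoly.mult diff_gen_qpoly schurq_qpoly)+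
    have HJ: "J H = J (\<lambda>x. diff_gen K A B (schurq mu) x * schurq nu x) - J (\<lambda>x. schurq mu x * diff_gen K A B (schurq nu) x)"
      using Jadd[OF qm(1) qpoly_cmult[OF qm(2), of "-1"]] Jcmult[OF qm(2), of "-1"] unfolding H_def[abs_def] by simp
    have Hq: "H \<in> qpoly" unfolding H_def[abs_def] by (intro qpoly_diff qm)
    have "near D H" unfolding D_def[abs_def] H_def[abs_def]
      by (intro near_diff near_mult near_dim_ratio_gen near_dim_ratio mu nu)
    then obtain C n0 where C: "0 \<le> C" "\<And>n l. n0 \<le> n \<Longrightarrow> l \<in> YD n \<Longrightarrow> \<bar>D n l - H (qvec (iota n l))\<bar> \<le> C / real n"
      by (rule nearE) blast
    \<comment> \<open>By the exact symmetry at level n the weighted sum of \<open>D\<close>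
      vanishes, so only the error D - H remains.\<close>
    have bound: "\<bar>En n H\<bar> \<le> C / real n * En n (\<lambda>x. 1)" if n: "max n0 K \<le> n" for n
    proof -
      have z: "(\<Sum>l\<in>YD n. z_weight A B n l * D n l) = 0"
        unfolding D_def by (rule discrete_symmetry[OF A mu(1) _ nu(1)]) (use mu nu n in auto)
      have "En n H = - (\<Sum>l\<in>YD n. z_weight A B n l * (D n l - H (qvec (iota n l))))"
        using z by (simp add: En_def right_diff_distrib sum_subtractf)
      hence "\<bar>En n H\<bar> \<le> (\<Sum>l\<in>YD n. \<bar>z_weight A B n l * (D n l - H (qvec (iota n l)))\<bar>)" by (simp add: sum_abs)
      also have "\<dots> \<le> (\<Sum>l\<in>YD n. z_weight A B n l * (C / real n))"
        unfolding abs_mult using C(2) n z_weight_nonneg[OF wpos]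
        by (intro sum_mono mult_mono) auto
      also have "\<dots> = C / real n * En n (\<lambda>x. 1)" by (simp add: En_def sum_distrib_left mult.commute)
      finally show ?thesis .
    qed
    \<comment> \<open>By the limit hypothesis for a constant function the total masses converge, so
      the factor 1/n forces the product to 0.\<close>
    have "(\<lambda>n. C / real n * En n (\<lambda>x. 1)) \<longlonglongrightarrow> 0 * J (\<lambda>x. 1)"
      by (intro tendsto_mult lim_const_over_n lim qpoly.const)
    hence "(\<lambda>n. C / real n * En n (\<lambda>x. 1)) \<longlonglongrightarrow> 0" by simp
    moreover have "\<forall>\<^sub>F n in sequentially. norm (En n H) \<le> C / real n * En n (\<lambda>x. 1)"
      unfolding eventually_sequentially real_norm_def using bound by blast
    ultimately have "(\<lambda>n. En n H) \<longlonglongrightarrow> 0" by (rule Lim_null_comparison[rotated])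
    hence "J H = 0" using LIMSEQ_unique[OF lim[OF Hq]] by blast
    thus ?thesis using HJ by simp
  qed
  have Fq: "fschur c \<in> qpoly"
    unfolding fschur_def[abs_def] by (intro qpoly_sum qpoly_cmult schurq_qpoly)
  obtain K0 where K0: "\<forall>K\<ge>K0. - J (\<lambda>x. diff_gen K A B (fschur c) x * G x) = J (diff_gamma K (fschur c) G)"
    using integration_by_parts[of J A B, OF Jadd Jcmult Jsym Fq G_poly] by blast
  obtain K1 where K1: "\<forall>K\<ge>K1. \<forall>x. Aop z z' c x = diff_gen K A B (fschur c) x"
    using Aop_eq_diff_gen[OF w[unfolded A_def] c_fin c_young] unfolding A_def by blast
  obtain K2 where K2: "\<forall>K\<ge>K2. \<forall>\<omega>. GammaQ (fschur c) G \<omega> = diff_gamma K (fschur c) G (qvec \<omega>)"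
    using GammaQ_eq_diff_gamma[OF Fq G_poly] by blast
  define K where "K = max K0 (max K1 K2)"
  have "- J (\<lambda>x. diff_gen K A B (fschur c) x * G x) = J (diff_gamma K (fschur c) G)" using K0 by (simp add: K_def)
  moreover have "J (\<lambda>x. diff_gen K A B (fschur c) x * G x) = (LINT \<omega>:Omega|P. Aop z z' c (qvec \<omega>) * G (qvec \<omega>))"
  proof -
    have "Aop z z' c x = diff_gen K A B (fschur c) x" for x using K1 by (simp add: K_def)
    thus ?thesis unfolding J_def by (simp only:)
  qed
  moreover have "J (diff_gamma K (fschur c) G) = (LINT \<omega>:Omega|P. GammaQ (fschur c) G \<omega>)"
  proof -
    have "GammaQ (fschur c) G \<omega> = diff_gamma K (fschur c) G (qvec \<omega>)" for \<omega>
      using K2[rule_format, of K] by (simp add: K_def)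
    thus ?thesis unfolding J_def by (simp only:)
  qed
  ultimately show ?thesis by simp
qed

end
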